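(* Let $\Omega\subseteq\mathbb R^d$ be open, $u\in\mathcal G(\Omega)$ and $(x_0,\xi_0)\in\Omega\times\mathbf S$. Then $u$ is $\mathcal G^\infty$-microlocally regular at $(x_0,\xi_0)$ if and only if there exists $r\in\mathbb R_{>0}$ such that $u$ is $\widetilde{\mathcal G}^\infty$-microlocally regular at $(x,\xi)$ for each $x\in\widetilde{\mathbb R}^d$ with $|x-x_0|\le r$ and each $\xi\in\widetilde{\mathbf S}$ with $|\xi-\xi_0|\le r$ (all these $x$ being understood to lie in $\widetilde\Omega_c$).
   Context: Nets are indexed by $\varepsilon\in(0,1]$; "for small $\varepsilon$" means for all $\varepsilon\le\varepsilon_0$, for some $\varepsilon_0>0$. $\mathcal G(\Omega)$ is the special Colombeau algebra: nets $(u_\varepsilon)$ in $C^\infty(\Omega)$ (complex valued) that are moderate (for every compact $K\subset\Omega$ and $\alpha\in\mathbb N^d$ there is $N\in\mathbb N$ with $\sup_K|\partial^\alpha u_\varepsilon|=O(\varepsilon^{-N})$) modulo null nets (for all $K,\alpha,n$: $\sup_K|\partial^\alpha u_\varepsilon|=O(\varepsilon^n)$). $\widetilde{\mathbb R}$, $\widetilde{\mathbb C}$ are the rings of Colombeau generalized numbers (nets with $|x_\varepsilon|=O(\varepsilon^{-N})$ for some $N$, modulo nets with $|x_\varepsilon|=O(\varepsilon^n)$ for all $n$); $\widetilde{\mathbb R}^d=(\widetilde{\mathbb R})^d$. Classes are written $[\cdot_\varepsilon]$. For $x,y\in\widetilde{\mathbb R}$, $x\le y$ means that there are representatives with $x_\varepsilon\le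 y_\varepsilon$ for all $\varepsilon$. $\rho:=[\varepsilon]$, so $\rho^a=[\varepsilon^a]$. $\widetilde\Omega_c$ is the set of $[x_\varepsilon]\in\widetilde{\mathbb R}^d$ having a representative with values in a fixed compact subset of $\Omega$ for small $\varepsilon$. $u=[u_\varepsilon]\in\mathcal G(\Omega)$ has point values $u([x_\varepsilon])=[u_\varepsilon(x_\varepsilon)]$ for $[x_\varepsilon]\in\widetilde\Omega_c$. $\mathbf S=\{x\in\mathbb R^d:|x|=1\}$, $\widetilde{\mathbf S}=\{x\in\widetilde{\mathbb R}^d:|x|=1\}$; $\mathbb R^d\subseteq\widetilde{\mathbb R}^d$ via constant nets. $\mathcal G_c(\Omega)$ is the set of compactly supported elements of $\mathcal G(\Omega)$. $\mathcal G_{\mathscr S}(\mathbb R^d)=\mathcal E_{\mathscr S}/\mathcal N_{\mathscr S}$, where $\mathcal E_{\mathscr S}$ (resp. $\mathcal N_{\mathscr S}$) consists of nets in $\mathscr S(\mathbb R^d)$ such that for all $\alpha,\beta$, $\sup_x|x^\alpha\partial^\beta v_\varepsilon(x)|$ is $O(\varepsilon^{-N})$ for some $N$ (resp. $O(\varepsilon^n)$ for all $n$). $\mathcal G_c(\Omega)\subseteq\mathcal G_{\mathscr S}(\mathbb R^d)$ via representatives supported in a fixed compact set, extended by $0$. The Fourier transform is $\widehat v=[\widehat{v_\varepsilon}]\in\mathcal G_{\mathscr S}(\mathbb R^d)$, with point values $\widehat v([\xi_\varepsilon])=[\widehat{v_\varepsilon}(\xi_\varepsilon)]$ for $[\xi_\varepsilon]\in\widetilde{\mathbb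 R}^d$. $\widetilde{\mathbb R}^d_{fs}=\{x\in\widetilde{\mathbb R}^d:\exists a\in\mathbb R_{>0},\ |x|\ge\rho^{-a}\}$. $x\approx_{fast}y$ means $|x-y|\le\rho^a$ for some $a\in\mathbb R_{>0}$. For $\xi_0\in\widetilde{\mathbf S}$, $\Gamma_{fast}(\xi_0)=\{\xi\in\widetilde{\mathbb R}^d:|\xi|\text{ invertible},\ \xi/|\xi|\approx_{fast}\xi_0\}$. Definition. $u\in\mathcal G(\Omega)$ is $\widetilde{\mathcal G}^\infty$-microlocally regular at $(x_0,\xi_0)\in\widetilde\Omega_c\times\widetilde{\mathbf S}$ if there exists $v\in\mathcal G_c(\Omega)$ with $u(x)=v(x)$ for all $x\approx_{fast}x_0$ and $\widehat v(\xi)=0$ for all $\xi\in\widetilde{\mathbb R}^d_{fs}\cap\Gamma_{fast}(\xi_0)$. Definition. $u=[u_\varepsilon]\in\mathcal G(\Omega)$ is $\mathcal G^\infty$-microlocally regular at $(x_0,\xi_0)\in\Omega\times\mathbf S$ if there exist $\phi\in\mathcal D(\Omega)$ (smooth, compactly supported) with $\phi(x_0)=1$, a conic neighbourhood $\Gamma\subseteq\mathbb R^d$ of $\xi_0$ and $N\in\mathbb N$ such that for all $m\in\mathbb N$, $\sup_{\xi\in\Gamma}\langle\xi\rangle^m|\widehat{\phi u_\varepsilon}(\xi)|\le\varepsilon^{-N}$ for small $\varepsilon$. Here $\langle\xi\rangle=(1+|\xi|^2)^{1/2}$. *)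

theory Defs
  imports "HOL-Analysis.Analysis" "HOL-Library.Landau_Symbols"
begin

text \<open>
  Nets are functions of a real parameter of which only the restriction to
  \<open>{0<..1}\<close> matters: all the equivalence relations below ignore the values elsewhere.
  ``For small \<open>\<epsilon>\<close>'' is the filter \<^term>\<open>at_right (0::real)\<close>.
\<close>

section \<open>Generalized numbers and generalized points\<close>

definition gmoderate :: "(real \<Rightarrow> 'a::real_normed_vector) \<Rightarrow> bool" where
  "gmoderate x \<longleftrightarrow> (\<exists>N::nat. (\<lambda>\<epsilon>. norm (x \<epsilon>)) \<in> O[at_right 0](\<lambda>\<epsilon>. inverse \<epsilon> ^ N))"

definition gnegligible :: "(real \<Rightarrow> 'a::real_normed_vector) \<Rightarrow> bool" where
  "gnegligible x \<longleftrightarrow> (\<forall>n::nat. (\<lambda>\<epsilon>. norm (x \<epsilon>)) \<in> O[at_right 0](\<lambda>\<epsilon>. \<epsilon> ^ n))"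

definition gequiv :: "(real \<Rightarrow> 'a::real_normed_vector) \<Rightarrow> (real \<Rightarrow> 'a) \<Rightarrow> bool" where
  "gequiv x y \<longleftrightarrow> gmoderate x \<and> gmoderate y \<and> gnegligible (\<lambda>\<epsilon>. x \<epsilon> - y \<epsilon>)"

lemma inverse_power_bigo_mono:
  assumes "N \<le> M"
  shows "(\<lambda>\<epsilon>::real. inverse \<epsilon> ^ N) \<in> O[at_right 0](\<lambda>\<epsilon>. inverse \<epsilon> ^ M)"
proof (rule landau_o.big_mono)
  have "eventually (\<lambda>\<epsilon>::real. \<epsilon> \<in> {0<..<1}) (at_right 0)"
    by (rule eventually_at_right_real) simp
  then show "\<forall>\<^sub>F \<epsilon>::real in at_right 0. norm (inverse \<epsilon> ^ N) \<le> norm (inverse \<epsilon> ^ M)"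
    by eventually_elim (use assms in \<open>simp add: power_inverse power_decreasing\<close>)
qed

lemma gmoderate_const: "gmoderate (\<lambda>_. c)"
  unfolding gmoderate_def by (rule exI[of _ 0]) simp

lemma gmoderate_bound:
  assumes "gmoderate x" "gmoderate y"
    and "\<And>\<epsilon>. norm (z \<epsilon>) \<le> norm (x \<epsilon>) + norm (y \<epsilon>)"
  shows "gmoderate z"
proof -
  obtain N M where N: "(\<lambda>\<epsilon>. norm (x \<epsilon>)) \<in> O[at_right 0](\<lambda>\<epsilon>. inverse \<epsilon> ^ N)"
    and M: "(\<lambda>\<epsilon>. norm (y \<epsilon>)) \<in> O[at_right 0](\<lambda>\<epsilon>. inverse \<epsilon> ^ M)"
    using assms(1,2) by (auto simp: gmoderate_def)
  have "(\<lambda>\<epsilon>. norm (x \<epsilon>) + norm (y \<epsilon>)) \<in> O[at_right 0](\<lambda>\<epsilon>. inverse \<epsilon> ^ (N + M))"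
    by (intro sum_in_bigo landau_o.big_trans[OF N] landau_o.big_trans[OF M]
        inverse_power_bigo_mono) auto
  moreover have "(\<lambda>\<epsilon>. norm (z \<epsilon>)) \<in> O[at_right 0](\<lambda>\<epsilon>. norm (x \<epsilon>) + norm (y \<epsilon>))"
    by (rule landau_o.big_mono) (use assms(3) in \<open>auto intro!: always_eventually\<close>)
  ultimately show ?thesis
    unfolding gmoderate_def using landau_o.big_trans by blast
qed

lemma gnegligible_bound:
  assumes "gnegligible x" "gnegligible y"
    and "\<And>\<epsilon>. norm (z \<epsilon>) \<le> norm (x \<epsilon>) + norm (y \<epsilon>)"
  shows "gnegligible z"
  unfolding gnegligible_def
proof
  fix n
  have "(\<lambda>\<epsilon>. norm (x \<epsilon>) + norm (y \<epsilon>)) \<in> O[at_right 0](\<lambda>\<epsilon>. \<epsilon> ^ n)"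
    using assms(1,2) unfolding gnegligible_def by (intro sum_in_bigo) auto
  moreover have "(\<lambda>\<epsilon>. norm (z \<epsilon>)) \<in> O[at_right 0](\<lambda>\<epsilon>. norm (x \<epsilon>) + norm (y \<epsilon>))"
    by (rule landau_o.big_mono) (use assms(3) in \<open>auto intro!: always_eventually\<close>)
  ultimately show "(\<lambda>\<epsilon>. norm (z \<epsilon>)) \<in> O[at_right 0](\<lambda>\<epsilon>. \<epsilon> ^ n)"
    using landau_o.big_trans by blast
qed

lemma gmoderate_prod:
  assumes "gmoderate x" "gmoderate y"
    and "\<And>\<epsilon>. norm (z \<epsilon>) \<le> norm (x \<epsilon>) * norm (y \<epsilon>)"
  shows "gmoderate z"
proof -
  obtain N M where N: "(\<lambda>\<epsilon>. norm (x \<epsilon>)) \<in> O[at_right 0](\<lambda>\<epsilon>. inverse \<epsilon> ^ N)"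
    and M: "(\<lambda>\<epsilon>. norm (y \<epsilon>)) \<in> O[at_right 0](\<lambda>\<epsilon>. inverse \<epsilon> ^ M)"
    using assms(1,2) by (auto simp: gmoderate_def)
  have "(\<lambda>\<epsilon>. norm (x \<epsilon>) * norm (y \<epsilon>)) \<in> O[at_right 0](\<lambda>\<epsilon>. inverse \<epsilon> ^ (N + M))"
    unfolding power_add by (rule landau_o.big.mult[OF N M])
  moreover have "(\<lambda>\<epsilon>. norm (z \<epsilon>)) \<in> O[at_right 0](\<lambda>\<epsilon>. norm (x \<epsilon>) * norm (y \<epsilon>))"
    by (rule landau_o.big_mono) (use assms(3) in \<open>auto intro!: always_eventually\<close>)
  ultimately show ?thesis
    unfolding gmoderate_def using landau_o.big_trans by blast
qed

lemma gnegligible_prod: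
  assumes "gnegligible x" "gmoderate y"
    and "\<And>\<epsilon>. norm (z \<epsilon>) \<le> norm (x \<epsilon>) * norm (y \<epsilon>)"
  shows "gnegligible z"
  unfolding gnegligible_def
proof
  fix n
  obtain M where M: "(\<lambda>\<epsilon>. norm (y \<epsilon>)) \<in> O[at_right 0](\<lambda>\<epsilon>. inverse \<epsilon> ^ M)"
    using assms(2) by (auto simp: gmoderate_def)
  have "(\<lambda>\<epsilon>. norm (x \<epsilon>)) \<in> O[at_right 0](\<lambda>\<epsilon>. \<epsilon> ^ (n + M))"
    using assms(1) by (auto simp: gnegligible_def)
  then have "(\<lambda>\<epsilon>. norm (x \<epsilon>) * norm (y \<epsilon>)) \<in>
      O[at_right 0](\<lambda>\<epsilon>. \<epsilon> ^ (n + M) * inverse \<epsilon> ^ M)"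
    by (rule landau_o.big.mult[OF _ M])
  also have "(\<lambda>\<epsilon>::real. \<epsilon> ^ (n + M) * inverse \<epsilon> ^ M) \<in> \<Theta>[at_right 0](\<lambda>\<epsilon>. \<epsilon> ^ n)"
  proof (rule bigthetaI_cong)
    have "eventually (\<lambda>\<epsilon>::real. \<epsilon> \<in> {0<..<1}) (at_right 0)"
      by (rule eventually_at_right_real) simp
    then show "\<forall>\<^sub>F \<epsilon>::real in at_right 0. \<epsilon> ^ (n + M) * inverse \<epsilon> ^ M = \<epsilon> ^ n"
      by eventually_elim (simp add: power_add power_inverse)
  qed
  finally have "(\<lambda>\<epsilon>. norm (x \<epsilon>) * norm (y \<epsilon>)) \<in> O[at_right 0](\<lambda>\<epsilon>. \<epsilon> ^ n)" .
  moreover have "(\<lambda>\<epsilon>. norm (z \<epsilon>)) \<in> O[at_right 0](\<lambda>\<epsilon>. norm (x \<epsilon>) * norm (y \<epsilon>))"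
    by (rule landau_o.big_mono) (use assms(3) in \<open>auto intro!: always_eventually\<close>)
  ultimately show "(\<lambda>\<epsilon>. norm (z \<epsilon>)) \<in> O[at_right 0](\<lambda>\<epsilon>. \<epsilon> ^ n)"
    using landau_o.big_trans by blast
qed

lemma gnegligible_zero: "gnegligible (\<lambda>_. 0)"
  by (simp add: gnegligible_def)

lemma gnegligible_minus: "gnegligible (\<lambda>\<epsilon>. x \<epsilon> - y \<epsilon>) \<Longrightarrow> gnegligible (\<lambda>\<epsilon>. y \<epsilon> - x \<epsilon>)"
  by (simp add: gnegligible_def norm_minus_commute)

text \<open>
  \<open>real gen\<close> and \<open>complex gen\<close> are the rings of generalized real and complex numbers;
  \<open>(real^'n) gen\<close> is the \<open>CARD('n)\<close>-fold product of \<open>real gen\<close> with itself, since a net of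
  vectors is moderate (negligible) iff all its components are.
\<close>

quotient_type (overloaded) 'a gen = "real \<Rightarrow> 'a::real_normed_vector" / partial: gequiv
proof (rule part_equivpI)
  show "\<exists>x. gequiv x (x :: real \<Rightarrow> 'a)"
    by (rule exI[of _ "\<lambda>_. 0"]) (simp add: gequiv_def gmoderate_const gnegligible_zero)
  show "symp (gequiv :: (real \<Rightarrow> 'a) \<Rightarrow> _)"
    by (auto intro!: sympI simp: gequiv_def intro: gnegligible_minus)
  show "transp (gequiv :: (real \<Rightarrow> 'a) \<Rightarrow> _)"
  proof (rule transpI)
    fix x y z :: "real \<Rightarrow> 'a"
    assume a: "gequiv x y" "gequiv y z"
    have "norm (x \<epsilon> - z \<epsilon>) \<le> norm (x \<epsilon> - y \<epsilon>) + norm (y \<epsilon> - z \<epsilon>)" for \<epsilon>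
      by (metis norm_triangle_ineq diff_add_cancel add_diff_eq)
    then have "gnegligible (\<lambda>\<epsilon>. x \<epsilon> - z \<epsilon>)"
      using a unfolding gequiv_def
      by (blast intro: gnegligible_bound[of "\<lambda>\<epsilon>. x \<epsilon> - y \<epsilon>" "\<lambda>\<epsilon>. y \<epsilon> - z \<epsilon>"])
    with a show "gequiv x z" by (simp add: gequiv_def)
  qed
qed

definition reps :: "'a::real_normed_vector gen \<Rightarrow> (real \<Rightarrow> 'a) set" where
  "reps X = {x. gmoderate x \<and> abs_gen x = X}"

lift_definition gconst :: "'a \<Rightarrow> 'a::real_normed_vector gen" is "\<lambda>c _. c"
  by (simp add: gequiv_def gmoderate_const gnegligible_zero)

lift_definition gnorm :: "'a::real_normed_vector gen \<Rightarrow> real gen" is "\<lambda>x \<epsilon>. norm (x \<epsilon>)"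
proof -
  fix x y :: "real \<Rightarrow> 'a"
  assume a: "gequiv x y"
  have "gnegligible (\<lambda>\<epsilon>. norm (x \<epsilon>) - norm (y \<epsilon>))"
    by (rule gnegligible_bound[OF _ gnegligible_zero, of "\<lambda>\<epsilon>. x \<epsilon> - y \<epsilon>"])
       (use a in \<open>auto simp: gequiv_def norm_triangle_ineq3\<close>)
  with a show "gequiv (\<lambda>\<epsilon>. norm (x \<epsilon>)) (\<lambda>\<epsilon>. norm (y \<epsilon>))"
    by (simp add: gequiv_def gmoderate_def)
qed

lift_definition gscale :: "real gen \<Rightarrow> 'a::real_normed_vector gen \<Rightarrow> 'a gen"
  is "\<lambda>c x \<epsilon>. c \<epsilon> *\<^sub>R x \<epsilon>"
proof -
  fix c d :: "real \<Rightarrow> real" and x y :: "real \<Rightarrow> 'a"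
  assume a: "gequiv c d" "gequiv x y"
  have 1: "gnegligible (\<lambda>\<epsilon>. (c \<epsilon> - d \<epsilon>) *\<^sub>R x \<epsilon>)"
    by (rule gnegligible_prod[of "\<lambda>\<epsilon>. c \<epsilon> - d \<epsilon>" x]) (use a in \<open>auto simp: gequiv_def\<close>)
  have 2: "gnegligible (\<lambda>\<epsilon>. d \<epsilon> *\<^sub>R (x \<epsilon> - y \<epsilon>))"
    by (rule gnegligible_prod[of "\<lambda>\<epsilon>. x \<epsilon> - y \<epsilon>" d]) (use a in \<open>auto simp: gequiv_def\<close>)
  have "norm (c \<epsilon> *\<^sub>R x \<epsilon> - d \<epsilon> *\<^sub>R y \<epsilon>)
      \<le> norm ((c \<epsilon> - d \<epsilon>) *\<^sub>R x \<epsilon>) + norm (d \<epsilon> *\<^sub>R (x \<epsilon> - y \<epsilon>))" for \<epsilon>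
    using norm_triangle_ineq[of "(c \<epsilon> - d \<epsilon>) *\<^sub>R x \<epsilon>" "d \<epsilon> *\<^sub>R (x \<epsilon> - y \<epsilon>)"]
    by (simp add: algebra_simps)
  then have "gnegligible (\<lambda>\<epsilon>. c \<epsilon> *\<^sub>R x \<epsilon> - d \<epsilon> *\<^sub>R y \<epsilon>)"
    by (rule gnegligible_bound[OF 1 2])
  moreover have "gmoderate (\<lambda>\<epsilon>. c \<epsilon> *\<^sub>R x \<epsilon>)" "gmoderate (\<lambda>\<epsilon>. d \<epsilon> *\<^sub>R y \<epsilon>)"
    using a by (auto simp: gequiv_def intro: gmoderate_prod[of c x] gmoderate_prod[of d y])
  ultimately show "gequiv (\<lambda>\<epsilon>. c \<epsilon> *\<^sub>R x \<epsilon>) (\<lambda>\<epsilon>. d \<epsilon> *\<^sub>R y \<epsilon>)"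
    by (simp add: gequiv_def)
qed

instantiation gen :: (real_normed_vector) ab_group_add
begin

lift_definition zero_gen :: "'a gen" is "\<lambda>_. 0"
  by (simp add: gequiv_def gmoderate_const gnegligible_zero)

lift_definition plus_gen :: "'a gen \<Rightarrow> 'a gen \<Rightarrow> 'a gen" is "\<lambda>x y \<epsilon>. x \<epsilon> + y \<epsilon>"
proof -
  fix x y x' y' :: "real \<Rightarrow> 'a"
  assume a: "gequiv x y" "gequiv x' y'"
  have "norm (x \<epsilon> + x' \<epsilon> - (y \<epsilon> + y' \<epsilon>)) \<le> norm (x \<epsilon> - y \<epsilon>) + norm (x' \<epsilon> - y' \<epsilon>)" for \<epsilon>
    by (rule norm_diff_triangle_ineq)
  with a show "gequiv (\<lambda>\<epsilon>. x \<epsilon> + x' \<epsilon>) (\<lambda>\<epsilon>. y \<epsilon> + y' \<epsilon>)"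
    unfolding gequiv_def
    by (auto intro: gmoderate_bound[of x x'] gmoderate_bound[of y y'] norm_triangle_ineq
        gnegligible_bound[of "\<lambda>\<epsilon>. x \<epsilon> - y \<epsilon>" "\<lambda>\<epsilon>. x' \<epsilon> - y' \<epsilon>"])
qed

lift_definition uminus_gen :: "'a gen \<Rightarrow> 'a gen" is "\<lambda>x \<epsilon>. - x \<epsilon>"
  by (simp add: gequiv_def gmoderate_def gnegligible_def norm_minus_commute)

lift_definition minus_gen :: "'a gen \<Rightarrow> 'a gen \<Rightarrow> 'a gen" is "\<lambda>x y \<epsilon>. x \<epsilon> - y \<epsilon>"
proof -
  fix x y x' y' :: "real \<Rightarrow> 'a"
  assume a: "gequiv x y" "gequiv x' y'"
  have "norm (x \<epsilon> - x' \<epsilon> - (y \<epsilon> - y' \<epsilon>)) \<le> norm (x \<epsilon> - y \<epsilon>) + norm (x' \<epsilon> - y' \<epsilon>)" for \<epsilon>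
    using norm_triangle_ineq4[of "x \<epsilon> - y \<epsilon>" "x' \<epsilon> - y' \<epsilon>"] by (simp add: algebra_simps)
  with a show "gequiv (\<lambda>\<epsilon>. x \<epsilon> - x' \<epsilon>) (\<lambda>\<epsilon>. y \<epsilon> - y' \<epsilon>)"
    unfolding gequiv_def
    by (auto intro: gmoderate_bound[of x x'] gmoderate_bound[of y y'] norm_triangle_ineq4
        gnegligible_bound[of "\<lambda>\<epsilon>. x \<epsilon> - y \<epsilon>" "\<lambda>\<epsilon>. x' \<epsilon> - y' \<epsilon>"])
qed

instance
proof
  fix a b c :: "'a gen"
  have refl: "gequiv x x" if "gmoderate x" for x :: "real \<Rightarrow> 'a"
    using that by (simp add: gequiv_def gnegligible_zero)
  have add: "gmoderate (\<lambda>\<epsilon>. x \<epsilon> + y \<epsilon>)" if "gmoderate x" "gmoderate y" for x y :: "real \<Rightarrow> 'a"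
    using that by (rule gmoderate_bound) (rule norm_triangle_ineq)
  have diff: "gmoderate (\<lambda>\<epsilon>. x \<epsilon> - y \<epsilon>)" if "gmoderate x" "gmoderate y" for x y :: "real \<Rightarrow> 'a"
    using that by (rule gmoderate_bound) (rule norm_triangle_ineq4)
  have mod: "gmoderate x" if "gequiv x x" for x :: "real \<Rightarrow> 'a"
    using that by (simp add: gequiv_def)
  show "a + b + c = a + (b + c)"
    by transfer (auto simp: add.assoc intro!: refl add dest!: mod)
  show "a + b = b + a"
    by transfer (auto simp: add.commute intro!: refl add dest!: mod)
  show "0 + a = a"
    by transfer simp
  show "- a + a = 0"
    by transfer (auto intro!: refl gmoderate_const)
  show "a - b = a + - b"
    by transfer (auto intro!: refl diff dest!: mod)
qed

end

instantiation gen :: ("{real_normed_vector, ord}") ord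
begin

definition less_eq_gen :: "'a gen \<Rightarrow> 'a gen \<Rightarrow> bool" where
  "X \<le> Y \<longleftrightarrow> (\<exists>x\<in>reps X. \<exists>y\<in>reps Y. \<forall>\<epsilon>\<in>{0<..1}. x \<epsilon> \<le> y \<epsilon>)"

definition less_gen :: "'a gen \<Rightarrow> 'a gen \<Rightarrow> bool" where
  "X < Y \<longleftrightarrow> X \<le> Y \<and> \<not> Y \<le> (X :: 'a gen)"

instance ..

end

lift_definition rho_powr :: "real \<Rightarrow> real gen" is "\<lambda>a \<epsilon>. \<epsilon> powr a"
proof -
  fix a :: real
  obtain N :: nat where N: "- a \<le> real N"
    using real_arch_simple by blast
  have "(\<lambda>\<epsilon>. norm (\<epsilon> powr a)) \<in> O[at_right 0](\<lambda>\<epsilon>. inverse \<epsilon> ^ N)"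
  proof (rule landau_o.big_mono)
    have "eventually (\<lambda>\<epsilon>::real. \<epsilon> \<in> {0<..<1}) (at_right 0)"
      by (rule eventually_at_right_real) simp
    then show "\<forall>\<^sub>F \<epsilon>::real in at_right 0. norm (norm (\<epsilon> powr a)) \<le> norm (inverse \<epsilon> ^ N)"
    proof eventually_elim
      case (elim \<epsilon>)
      have "\<epsilon> powr a \<le> \<epsilon> powr (- real N)"
        using elim N by (intro powr_mono') auto
      also have "\<dots> = inverse \<epsilon> ^ N"
        using elim by (simp add: powr_minus powr_realpow power_inverse)
      finally show ?case
        using elim by simp
    qed
  qed
  then show "gequiv (\<lambda>\<epsilon>. \<epsilon> powr a) (\<lambda>\<epsilon>. \<epsilon> powr a)"
    by (auto simp: gequiv_def gmoderate_def gnegligible_zero)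
qed

definition gsphere :: "(real^'n) gen set" where
  "gsphere = {\<xi>. gnorm \<xi> = gconst 1}"

definition fast_near :: "'a::real_normed_vector gen \<Rightarrow> 'a gen \<Rightarrow> bool"  (infix "\<approx>\<^sub>f" 50) where
  "x \<approx>\<^sub>f y \<longleftrightarrow> (\<exists>a>0. gnorm (x - y) \<le> rho_powr a)"

definition fast_large :: "(real^'n) gen set" where
  "fast_large = {\<xi>. \<exists>a>0. rho_powr (- a) \<le> gnorm \<xi>}"

text \<open>Here \<open>c\<close> is the inverse of \<open>|\<xi>|\<close> in the ring of generalized real numbers, whose
  multiplication is \<^const>\<open>gscale\<close>.\<close>

definition fast_cone :: "(real^'n) gen \<Rightarrow> (real^'n) gen set" where
  "fast_cone \<xi>0 = {\<xi>. \<exists>c. gscale c (gnorm \<xi>) = gconst 1 \<and> gscale c \<xi> \<approx>\<^sub>f \<xi>0}"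

definition in_compact_reps :: "(real^'n) set \<Rightarrow> (real^'n) gen \<Rightarrow> (real \<Rightarrow> real^'n) set" where
  "in_compact_reps \<Omega> X =
    {x\<in>reps X. \<exists>K. compact K \<and> K \<subseteq> \<Omega> \<and> (\<forall>\<^sub>F \<epsilon> in at_right 0. x \<epsilon> \<in> K)}"

definition compact_points :: "(real^'n) set \<Rightarrow> (real^'n) gen set" where
  "compact_points \<Omega> = {X. in_compact_reps \<Omega> X \<noteq> {}}"


section \<open>Smooth functions\<close>

definition pderiv_at :: "'n \<Rightarrow> (real^'n \<Rightarrow> complex) \<Rightarrow> real^'n \<Rightarrow> complex" where
  "pderiv_at i f x = frechet_derivative f (at x) (axis i 1)"

text \<open>
  Iterated partial derivatives are indexed by words \<open>[i\<^sub>1, \<dots>, i\<^sub>k]\<close> of coordinate indices.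
  For smooth functions the order of differentiation does not matter, so that ranging over all
  words is the same as ranging over all multi-indices.
\<close>

fun pderivs :: "'n list \<Rightarrow> (real^'n \<Rightarrow> complex) \<Rightarrow> real^'n \<Rightarrow> complex" where
  "pderivs [] f = f"
| "pderivs (i # is) f = pderiv_at i (pderivs is f)"

text \<open>Used for open \<open>\<Omega>\<close> only. Differentiability of all iterated partial derivatives includes
  their continuity.\<close>

definition smooth_on :: "(real^'n) set \<Rightarrow> (real^'n \<Rightarrow> complex) \<Rightarrow> bool" where
  "smooth_on \<Omega> f \<longleftrightarrow> (\<forall>is. \<forall>x\<in>\<Omega>. pderivs is f differentiable (at x))"

definition test_function :: "(real^'n) set \<Rightarrow> (real^'n \<Rightarrow> complex) \<Rightarrow> bool" where
  "test_function \<Omega> \<phi> \<longleftrightarrow> smooth_on UNIV \<phi> \<and>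
    compact (closure {x. \<phi> x \<noteq> 0}) \<and> closure {x. \<phi> x \<noteq> 0} \<subseteq> \<Omega>"

definition schwartz :: "(real^'n \<Rightarrow> complex) \<Rightarrow> bool" where
  "schwartz f \<longleftrightarrow> smooth_on UNIV f \<and>
    (\<forall>(\<alpha>::'n \<Rightarrow> nat) is. bounded (range (\<lambda>x. (\<Prod>i\<in>UNIV. x $ i ^ \<alpha> i) *\<^sub>R pderivs is f x)))"

definition fourier :: "(real^'n \<Rightarrow> complex) \<Rightarrow> real^'n \<Rightarrow> complex" where
  "fourier f \<xi> = (LINT x|lborel. exp (- (\<i> * complex_of_real (x \<bullet> \<xi>))) * f x)"

text \<open>
  \<open>sup_bigo A f g\<close> says that the supremum of \<open>|f\<^sub>\<epsilon>|\<close> over \<open>A\<close> is \<open>O(g \<epsilon>)\<close> as \<open>\<epsilon> \<rightarrow> 0\<close>;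
  it is spelled out because \<^const>\<open>Sup\<close> on the reals is unspecified for empty and unbounded sets.
\<close>

definition sup_bigo :: "'a set \<Rightarrow> (real \<Rightarrow> 'a \<Rightarrow> complex) \<Rightarrow> (real \<Rightarrow> real) \<Rightarrow> bool" where
  "sup_bigo A f g \<longleftrightarrow> (\<exists>C. \<forall>\<^sub>F \<epsilon> in at_right 0. \<forall>x\<in>A. norm (f \<epsilon> x) \<le> C * g \<epsilon>)"


section \<open>The special Colombeau algebra\<close>

text \<open>Values of nets outside \<open>\<Omega>\<close> are arbitrary and are ignored by the equivalence relation.\<close>

definition moderate_nets :: "(real^'n) set \<Rightarrow> (real \<Rightarrow> real^'n \<Rightarrow> complex) set" where
  "moderate_nets \<Omega> = {u. (\<forall>\<epsilon>\<in>{0<..1}. smooth_on \<Omega> (u \<epsilon>)) \<and>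
    (\<forall>K is. compact K \<and> K \<subseteq> \<Omega> \<longrightarrow>
      (\<exists>N::nat. sup_bigo K (\<lambda>\<epsilon>. pderivs is (u \<epsilon>)) (\<lambda>\<epsilon>. inverse \<epsilon> ^ N)))}"

definition null_nets :: "(real^'n) set \<Rightarrow> (real \<Rightarrow> real^'n \<Rightarrow> complex) set" where
  "null_nets \<Omega> = {u. (\<forall>\<epsilon>\<in>{0<..1}. smooth_on \<Omega> (u \<epsilon>)) \<and>
    (\<forall>K is (n::nat). compact K \<and> K \<subseteq> \<Omega> \<longrightarrow>
      sup_bigo K (\<lambda>\<epsilon>. pderivs is (u \<epsilon>)) (\<lambda>\<epsilon>. \<epsilon> ^ n))}"

definition net_rel :: "(real^'n) set \<Rightarrow> (real \<Rightarrow> real^'n \<Rightarrow> complex) rel" where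
  "net_rel \<Omega> = {(u, v). u \<in> moderate_nets \<Omega> \<and> v \<in> moderate_nets \<Omega> \<and>
    (\<lambda>\<epsilon> x. u \<epsilon> x - v \<epsilon> x) \<in> null_nets \<Omega>}"

definition colombeau :: "(real^'n) set \<Rightarrow> (real \<Rightarrow> real^'n \<Rightarrow> complex) set set" where
  "colombeau \<Omega> = moderate_nets \<Omega> // net_rel \<Omega>"

text \<open>The class of \<open>u\<^sub>\<epsilon>(x\<^sub>\<epsilon>)\<close> does not depend on the representatives, so that the definite
  description is well defined for \<open>X \<in> compact_points \<Omega>\<close>.\<close>

definition point_value ::
  "(real^'n) set \<Rightarrow> (real \<Rightarrow> real^'n \<Rightarrow> complex) set \<Rightarrow> (real^'n) gen \<Rightarrow> complex gen" where
  "point_value \<Omega> U X =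
    (THE c. \<exists>u\<in>U. \<exists>x\<in>in_compact_reps \<Omega> X. c = abs_gen (\<lambda>\<epsilon>. u \<epsilon> (x \<epsilon>)))"

text \<open>The support is the complement in \<open>\<Omega>\<close> of the open sets to which \<open>U\<close> restricts as \<open>0\<close>.\<close>

definition colombeau_supp ::
  "(real^'n) set \<Rightarrow> (real \<Rightarrow> real^'n \<Rightarrow> complex) set \<Rightarrow> (real^'n) set" where
  "colombeau_supp \<Omega> U = \<Omega> - \<Union>{W. open W \<and> W \<subseteq> \<Omega> \<and> U \<subseteq> null_nets W}"

definition colombeau_c :: "(real^'n) set \<Rightarrow> (real \<Rightarrow> real^'n \<Rightarrow> complex) set set" where
  "colombeau_c \<Omega> = {V\<in>colombeau \<Omega>. compact (colombeau_supp \<Omega> V)}"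


section \<open>The Colombeau algebra based on Schwartz functions, and the Fourier transform\<close>

definition moderate_schwartz :: "(real \<Rightarrow> real^'n \<Rightarrow> complex) set" where
  "moderate_schwartz = {v. (\<forall>\<epsilon>\<in>{0<..1}. schwartz (v \<epsilon>)) \<and>
    (\<forall>(\<alpha>::'n \<Rightarrow> nat) is. \<exists>N::nat. sup_bigo UNIV
      (\<lambda>\<epsilon> x. (\<Prod>i\<in>UNIV. x $ i ^ \<alpha> i) *\<^sub>R pderivs is (v \<epsilon>) x) (\<lambda>\<epsilon>. inverse \<epsilon> ^ N))}"

definition null_schwartz :: "(real \<Rightarrow> real^'n \<Rightarrow> complex) set" where
  "null_schwartz = {v. (\<forall>\<epsilon>\<in>{0<..1}. schwartz (v \<epsilon>)) \<and>
    (\<forall>(\<alpha>::'n \<Rightarrow> nat) is (n::nat). sup_bigo UNIV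
      (\<lambda>\<epsilon> x. (\<Prod>i\<in>UNIV. x $ i ^ \<alpha> i) *\<^sub>R pderivs is (v \<epsilon>) x) (\<lambda>\<epsilon>. \<epsilon> ^ n))}"

definition schwartz_rel :: "(real \<Rightarrow> real^'n \<Rightarrow> complex) rel" where
  "schwartz_rel = {(u, v). u \<in> moderate_schwartz \<and> v \<in> moderate_schwartz \<and>
    (\<lambda>\<epsilon> x. u \<epsilon> x - v \<epsilon> x) \<in> null_schwartz}"

definition colombeau_schwartz :: "(real \<Rightarrow> real^'n \<Rightarrow> complex) set set" where
  "colombeau_schwartz = moderate_schwartz // schwartz_rel"

text \<open>
  The following two maps are defined by taking the image of (suitable) representatives under the
  target equivalence relation; all representatives are mapped to the same class.
\<close>

definition embed_schwartz ::
  "(real^'n) set \<Rightarrow> (real \<Rightarrow> real^'n \<Rightarrow> complex) set \<Rightarrow> (real \<Rightarrow> real^'n \<Rightarrow> complex) set" where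
  "embed_schwartz \<Omega> V = schwartz_rel ``
    {v\<in>V. \<exists>K. compact K \<and> K \<subseteq> \<Omega> \<and> (\<forall>\<epsilon>\<in>{0<..1}. \<forall>x. x \<notin> K \<longrightarrow> v \<epsilon> x = 0)}"

definition gfourier ::
  "(real \<Rightarrow> real^'n \<Rightarrow> complex) set \<Rightarrow> (real \<Rightarrow> real^'n \<Rightarrow> complex) set" where
  "gfourier V = schwartz_rel `` ((\<lambda>v \<epsilon>. fourier (v \<epsilon>)) ` V)"

definition schwartz_point_value ::
  "(real \<Rightarrow> real^'n \<Rightarrow> complex) set \<Rightarrow> (real^'n) gen \<Rightarrow> complex gen" where
  "schwartz_point_value V X = (THE c. \<exists>v\<in>V. \<exists>x\<in>reps X. c = abs_gen (\<lambda>\<epsilon>. v \<epsilon> (x \<epsilon>)))"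


section \<open>Microlocal regularity\<close>

text \<open>To be used for \<open>x0 \<in> compact_points \<Omega>\<close> and \<open>\<xi>0 \<in> gsphere\<close>; every \<open>x \<approx>\<^sub>f x0\<close> then
  belongs to \<open>compact_points \<Omega>\<close> as well.\<close>

definition gen_microlocally_regular ::
  "(real^'n) set \<Rightarrow> (real \<Rightarrow> real^'n \<Rightarrow> complex) set \<Rightarrow> (real^'n) gen \<Rightarrow> (real^'n) gen \<Rightarrow> bool" where
  "gen_microlocally_regular \<Omega> U x0 \<xi>0 \<longleftrightarrow>
    (\<exists>V\<in>colombeau_c \<Omega>.
      (\<forall>x. x \<approx>\<^sub>f x0 \<longrightarrow> point_value \<Omega> U x = point_value \<Omega> V x) \<and>
      (\<forall>\<xi>\<in>fast_large \<inter> fast_cone \<xi>0.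
        schwartz_point_value (gfourier (embed_schwartz \<Omega> V)) \<xi> = 0))"

text \<open>Unlike the library's \<^const>\<open>cone\<close>, a conic neighbourhood need not contain \<open>0\<close>.\<close>

definition conic_nbhd :: "(real^'n) set \<Rightarrow> real^'n \<Rightarrow> bool" where
  "conic_nbhd \<Gamma> \<xi>0 \<longleftrightarrow> \<xi>0 \<in> interior \<Gamma> \<and> (\<forall>\<xi>\<in>\<Gamma>. \<forall>t>0. t *\<^sub>R \<xi> \<in> \<Gamma>)"

text \<open>The property does not depend on the representative \<open>u\<close> of \<open>U\<close>, since a null net only
  changes the exponent \<open>N\<close>.\<close>

definition microlocally_regular ::
  "(real^'n) set \<Rightarrow> (real \<Rightarrow> real^'n \<Rightarrow> complex) set \<Rightarrow> real^'n \<Rightarrow> real^'n \<Rightarrow> bool" where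
  "microlocally_regular \<Omega> U x0 \<xi>0 \<longleftrightarrow>
    (\<exists>u\<in>U. \<exists>\<phi> \<Gamma>. \<exists>N::nat. test_function \<Omega> \<phi> \<and> \<phi> x0 = 1 \<and> conic_nbhd \<Gamma> \<xi>0 \<and>
      (\<forall>m::nat. \<forall>\<^sub>F \<epsilon> in at_right 0. \<forall>\<xi>\<in>\<Gamma>.
        sqrt (1 + (norm \<xi>)\<^sup>2) ^ m * norm (fourier (\<lambda>x. \<phi> x * u \<epsilon> x) \<xi>) \<le> inverse \<epsilon> ^ N))"

end

theory Submission
  imports Defs
begin

text \<open>
  Both implications rest on one estimate for the Fourier transform \<open>F\<close>. Multiplying \<open>g\<close> by a cutoff
  of width \<open>s\<close> averages \<open>F g\<close> against a rapidly decreasing kernel of width \<open>1/s\<close>; hence \<open>F\<close> of the product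
  at \<open>\<xi>\<close> is bounded, up to a constant factor, by the supremum of \<open>|F g|\<close> on the ball of radius \<open>R\<close> about \<open>\<xi>\<close> plus an error
  \<open>(s R)\<^sup>-\<^sup>k sup |F g|\<close> with \<open>k\<close> arbitrary (\<open>fourier_localization\<close>). If \<open>|\<xi>| \<ge> \<epsilon>\<^sup>-\<^sup>b\<close>, \<open>s = \<epsilon>\<^sup>p\<close> and
  \<open>R = \<epsilon>\<^sup>q |\<xi>|\<close> with \<open>p + q < b\<close>, the error is smaller than any power of \<open>\<epsilon>\<close>. So cutting off at
  the scale \<open>\<epsilon>\<^sup>p\<close> preserves negligibility of the transform if this is known for all frequencies whose
  direction is fast close to that of \<open>\<xi>\<close> (\<open>fourier_localization_negligible\<close>). The estimate needs
  an inequality of the type of Fourier inversion, which is derived from the multiplication formula and an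
  autocorrelation (\<open>fourier_inversion_bound\<close>).

  Suppose that \<open>u\<close> is regular at \<open>(x0, \<xi>0)\<close>, by means of \<open>\<phi>\<close>, \<open>\<Gamma>\<close> and \<open>N\<close>. For \<open>\<xi>\<close> in \<open>\<Gamma>\<close> with
  \<open>|\<xi>| \<ge> \<epsilon>\<^sup>-\<^sup>b\<close> the transform of \<open>\<phi> u\<close> is at most \<open>\<epsilon>\<^sup>b\<^sup>m\<^sup>-\<^sup>N\<close> for every \<open>m\<close>, hence negligible. Let \<open>\<chi>\<close> be a
  cutoff that equals \<open>1\<close> near \<open>x0\<close> and is supported where \<open>\<phi>\<close> does not vanish. Then \<open>\<chi> u\<close> is a
  smooth multiple of \<open>\<phi> u\<close>, so its transform is negligible at fast-scale frequencies in a smaller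
  cone, and \<open>\<chi> u\<close> is the required element for all points near \<open>x0\<close> and directions near \<open>\<xi>0\<close>
  (\<open>regular_imp_gen_regular\<close>).

  Conversely, the element \<open>v\<close> provided by regularity at a generalized point and direction depends on them and
  agrees with \<open>u\<close> only at distances \<open>\<epsilon>\<^sup>a\<close> with \<open>a > 0\<close>. One therefore looks at \<open>\<phi> u\<close> times a cutoff of width
  \<open>\<epsilon>\<^sup>b\<^sup>/\<^sup>4\<close>, for which \<open>u\<close> can be replaced by \<open>v\<close>; its transform is negligible at frequencies
  \<open>|\<xi>| \<ge> \<epsilon>\<^sup>-\<^sup>b\<close> (\<open>gen_regular_local_negligible\<close>). As this holds for all nets of positions of the cutoff and
  of frequencies, it holds uniformly over classical positions and frequencies: a net could pick the worst of
  them for each \<open>\<epsilon>\<close> (\<open>uniform_negligible\<close>). Averaging over the positions recovers the transform of \<open>\<phi> u\<close>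
  up to a power of \<open>\<epsilon>\<close> (\<open>fourier_average_bound\<close>), which is thus negligible for \<open>|\<xi>| \<ge> \<epsilon>\<^sup>-\<^sup>b\<close>, for each
  \<open>b > 0\<close>. Choosing \<open>b \<le> 1/m\<close> gives the weighted estimate of order \<open>m\<close> with an exponent that does not
  depend on \<open>m\<close> (\<open>uniform_exponent\<close>).

  Generalized functions, their point values and their Fourier transforms are equivalence classes and definite
  descriptions; \<open>point_value_eq\<close> and \<open>schwartz_point_value_gfourier\<close> reduce them to
  representatives, in the second case to one with compact support
  (\<open>colombeau_c_compact_representative\<close>).
\<close>


section \<open>Calculus of smooth functions on open sets\<close>

lemma has_derivative_cong_open:
  assumes "open S" "x \<in> S" "\<And>y. y \<in> S \<Longrightarrow> f y = g y"
  shows "(f has_derivative D) (at x) \<longleftrightarrow> (g has_derivative D) (at x)"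
proof
  assume "(f has_derivative D) (at x)"
  then show "(g has_derivative D) (at x)"
    by (rule has_derivative_transform_within_open[OF _ assms(1,2)]) (rule assms(3))
next
  assume "(g has_derivative D) (at x)"
  then show "(f has_derivative D) (at x)"
    by (rule has_derivative_transform_within_open[OF _ assms(1,2)]) (rule assms(3)[symmetric])
qed

lemma differentiable_cong_open:
  assumes "open S" "x \<in> S" "\<And>y. y \<in> S \<Longrightarrow> f y = g y"
  shows "f differentiable (at x) \<longleftrightarrow> g differentiable (at x)"
  unfolding differentiable_def using has_derivative_cong_open[OF assms] by simp

lemma pderiv_at_cong_open:
  assumes "open S" "x \<in> S" "\<And>y. y \<in> S \<Longrightarrow> f y = g y"
  shows "pderiv_at i f x = pderiv_at i g x"
  unfolding pderiv_at_def frechet_derivative_def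
  using has_derivative_cong_open[OF assms] by simp

text \<open>Iterated partial derivatives at a point of an open set only see the function on that
  set. This lets nets whose values outside \<open>\<Omega>\<close> are arbitrary be replaced
  freely.\<close>

lemma pderivs_cong_open:
  assumes "open S" "\<And>y. y \<in> S \<Longrightarrow> f y = g y" "x \<in> S"
  shows "pderivs is f x = pderivs is g x"
  using assms(3)
proof (induction "is" arbitrary: x)
  case Nil
  then show ?case using assms(2) by simp
next
  case (Cons i "is")
  have "pderiv_at i (pderivs is f) x = pderiv_at i (pderivs is g) x"
    by (rule pderiv_at_cong_open[OF assms(1) Cons.prems]) (rule Cons.IH)
  then show ?case by simp
qed

lemma pderivs_append: "pderivs (is @ js) f = pderivs is (pderivs js f)"
  by (induction "is") auto

lemma pderiv_at_eq: "(f has_derivative D) (at x) \<Longrightarrow> pderiv_at i f x = D (axis i 1)"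
  unfolding pderiv_at_def by (drule frechet_derivative_at) simp

lemma smooth_on_cong:
  assumes "open S" "\<And>y. y \<in> S \<Longrightarrow> f y = g y"
  shows "smooth_on S f \<longleftrightarrow> smooth_on S g"
proof -
  have "pderivs is f differentiable (at x) \<longleftrightarrow> pderivs is g differentiable (at x)" if "x \<in> S" for "is" x
    by (rule differentiable_cong_open[OF assms(1) that]) (rule pderivs_cong_open[OF assms])
  then show ?thesis by (simp add: smooth_on_def)
qed

lemma smooth_on_subset: "smooth_on S f \<Longrightarrow> T \<subseteq> S \<Longrightarrow> smooth_on T f"
  by (auto simp: smooth_on_def)

lemma smooth_on_UNIV: "smooth_on UNIV f \<Longrightarrow> smooth_on S f"
  by (rule smooth_on_subset) auto

lemma smooth_on_pderivs: "smooth_on S f \<Longrightarrow> smooth_on S (pderivs js f)"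
  unfolding smooth_on_def by (simp flip: pderivs_append)

lemma smooth_on_pderiv_at: "smooth_on S f \<Longrightarrow> smooth_on S (pderiv_at i f)"
  using smooth_on_pderivs[of S f "[i]"] by simp

lemma smooth_on_differentiable: "smooth_on S f \<Longrightarrow> x \<in> S \<Longrightarrow> f differentiable (at x)"
  using pderivs.simps(1) unfolding smooth_on_def by metis

lemma smooth_on_continuous_on: "smooth_on S f \<Longrightarrow> continuous_on S f"
  by (rule continuous_at_imp_continuous_on)
    (auto dest: smooth_on_differentiable intro: differentiable_imp_continuous_within)

lemma smooth_on_continuous_pderivs: "smooth_on S f \<Longrightarrow> continuous_on S (pderivs is f)"
  by (intro smooth_on_continuous_on smooth_on_pderivs)

lemma smooth_on_open_Union:
  "(\<And>x. x \<in> S \<Longrightarrow> \<exists>W. x \<in> W \<and> smooth_on W f) \<Longrightarrow> smooth_on S f"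
  unfolding smooth_on_def by blast

text \<open>Smoothness is the greatest class of differentiable functions closed under partial
  derivatives, so a function is smooth as soon as it lies in any such class. In this form no Leibniz
  or Faa di Bruno formula is ever needed.\<close>

lemma smooth_on_coinduct:
  assumes "open S" "P f"
    and diff: "\<And>f x. P f \<Longrightarrow> x \<in> S \<Longrightarrow> f differentiable (at x)"
    and closed: "\<And>f i. P f \<Longrightarrow> \<exists>g. P g \<and> (\<forall>x\<in>S. pderiv_at i f x = g x)"
  shows "smooth_on S f"
proof -
  have "\<forall>f x. P f \<longrightarrow> x \<in> S \<longrightarrow> pderivs is f differentiable (at x)" for "is"
  proof (induction "is" rule: rev_induct)
    case Nil
    then show ?case using diff by simp
  next
    case (snoc i "is")
    show ?case
    proof (intro allI impI)
      fix f x assume "P f" "x \<in> S"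
      then obtain g where g: "P g" "\<forall>x\<in>S. pderiv_at i f x = g x" using closed by blast
      have "pderivs is g differentiable (at x)" using snoc g(1) \<open>x \<in> S\<close> by blast
      moreover have "pderivs is (pderiv_at i f) y = pderivs is g y" if "y \<in> S" for y
        by (rule pderivs_cong_open[OF assms(1) _ that]) (use g(2) in blast)
      ultimately show "pderivs (is @ [i]) f differentiable (at x)"
        using differentiable_cong_open[OF assms(1) \<open>x \<in> S\<close>, of "pderivs is (pderiv_at i f)" "pderivs is g"]
        by (simp add: pderivs_append)
    qed
  qed
  then show ?thesis using assms(2) by (auto simp: smooth_on_def)
qed

section \<open>Smooth functions and cutoffs\<close>

text \<open>For \<open>k = 0\<close> the standard smooth function that is flat at \<open>0\<close>.
  The factors \<open>t\<^sup>-\<^sup>k\<close> make the family closed under differentiation up to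
  linear combinations.\<close>

definition exp_cut :: "nat \<Rightarrow> real \<Rightarrow> real" where
  "exp_cut k t = (if t > 0 then inverse t ^ k * exp (- inverse t) else 0)"

lemma power_le_fact_exp:
  fixes x :: real
  assumes "x \<ge> 0" shows "x ^ n \<le> fact n * exp x"
proof -
  have "(\<Sum>k\<in>{n}. x ^ k /\<^sub>R fact k) \<le> (\<Sum>k. x ^ k /\<^sub>R fact k)"
    by (rule sum_le_suminf) (use assms summable_exp_generic[of x] in auto)
  also have "\<dots> = exp x" by (simp add: exp_def)
  finally show ?thesis by (simp add: field_simps)
qed

text \<open>The quadratic bound is all that is needed to differentiate at the junction \<open>t =
  0\<close>.\<close>

lemma exp_cut_bound: "\<bar>exp_cut k t\<bar> \<le> fact (k + 2) * t\<^sup>2"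
proof (cases "t > 0")
  case True
  have "inverse t ^ k * exp (- inverse t) * inverse t ^ 2 = inverse t ^ (k + 2) * exp (- inverse t)"
    by (simp add: power_add power2_eq_square)
  also have "\<dots> \<le> (fact (k + 2) * exp (inverse t)) * exp (- inverse t)"
    by (intro mult_right_mono power_le_fact_exp) (use True in auto)
  also have "\<dots> = fact (k + 2)"
    by (simp add: exp_minus)
  finally have "inverse t ^ k * exp (- inverse t) * inverse t ^ 2 * t\<^sup>2 \<le> fact (k + 2) * t\<^sup>2"
    by (intro mult_right_mono) auto
  then show ?thesis using True by (simp add: exp_cut_def field_simps)
qed (simp add: exp_cut_def)

lemma DERIV_exp_cut:
  "(exp_cut k has_real_derivative exp_cut (k + 2) t - real k * exp_cut (k + 1) t) (at t)"
proof -
  consider "t > 0" | "t < 0" | "t = 0" by linarith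
  then show ?thesis
  proof cases
    case 1
    have "((\<lambda>t. inverse t ^ k * exp (- inverse t)) has_real_derivative
        real k * inverse t ^ (k - 1) * (- (inverse t * inverse t)) * exp (- inverse t) +
        inverse t ^ k * (exp (- inverse t) * (inverse t * inverse t))) (at t)"
      using 1 by (auto intro!: derivative_eq_intros simp: power2_eq_square)
    also have "real k * inverse t ^ (k - 1) * (- (inverse t * inverse t)) * exp (- inverse t) +
        inverse t ^ k * (exp (- inverse t) * (inverse t * inverse t)) =
        exp_cut (k + 2) t - real k * exp_cut (k + 1) t"
      using 1 by (cases k) (simp_all add: exp_cut_def algebra_simps)
    finally have "((\<lambda>t. inverse t ^ k * exp (- inverse t)) has_real_derivative
        exp_cut (k + 2) t - real k * exp_cut (k + 1) t) (at t)" .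
    moreover have "open {0::real<..}" "t \<in> {0<..}" using 1 by auto
    ultimately show ?thesis
      by (rule has_field_derivative_transform_within_open) (auto simp: exp_cut_def)
  next
    case 2
    have "((\<lambda>_. 0) has_real_derivative exp_cut (k + 2) t - real k * exp_cut (k + 1) t) (at t)"
      using 2 by (simp add: exp_cut_def)
    moreover have "open {..<0::real}" "t \<in> {..<0}" using 2 by auto
    ultimately show ?thesis
      by (rule has_field_derivative_transform_within_open) (auto simp: exp_cut_def)
  next
    case 3
    have "((\<lambda>h. exp_cut k h / h) \<longlongrightarrow> 0) (at 0)"
    proof (rule tendsto_rabs_zero_cancel, rule tendsto_sandwich[OF _ _ tendsto_const])
      have "((\<lambda>h::real. fact (k + 2) * \<bar>h\<bar>) \<longlongrightarrow> fact (k + 2) * \<bar>0\<bar>) (at 0)"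
        by (intro tendsto_intros)
      then show "((\<lambda>h::real. fact (k + 2) * \<bar>h\<bar>) \<longlongrightarrow> 0) (at 0)" by simp
      show "\<forall>\<^sub>F h in at 0. \<bar>exp_cut k h / h\<bar> \<le> fact (k + 2) * \<bar>h\<bar>"
      proof (intro always_eventually allI)
        fix h :: real
        show "\<bar>exp_cut k h / h\<bar> \<le> fact (k + 2) * \<bar>h\<bar>"
        proof (cases "h = 0")
          case False
          have "\<bar>exp_cut k h / h\<bar> \<le> fact (k + 2) * h\<^sup>2 / \<bar>h\<bar>"
            unfolding abs_divide by (intro divide_right_mono exp_cut_bound) simp
          also have "\<dots> = fact (k + 2) * (h\<^sup>2 / \<bar>h\<bar>)" by simp
          also have "h\<^sup>2 / \<bar>h\<bar> = \<bar>h\<bar>"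
            using False by (cases "h > 0") (auto simp: power2_eq_square)
          finally show ?thesis .
        qed simp
      qed
    qed auto
    then show ?thesis
      unfolding 3 by (simp add: DERIV_def exp_cut_def)
  qed
qed

text \<open>The closure of the smooth functions under the operations needed for cutoffs. Since the
  derivative of each operation is again expressed by these operations, the closure is stable under
  partial derivatives, and coinduction shows that it contains smooth functions only. Real functions
  are composed with \<^const>\<open>exp_cut\<close> as complex functions with vanishing imaginary
  part.\<close>

inductive_set smooth_alg :: "(real^'n) set \<Rightarrow> (real^'n \<Rightarrow> complex) set" for S where
  base: "smooth_on S f \<Longrightarrow> f \<in> smooth_alg S"
| add: "f \<in> smooth_alg S \<Longrightarrow> g \<in> smooth_alg S \<Longrightarrow> (\<lambda>x. f x + g x) \<in> smooth_alg S"
| mult: "f \<in> smooth_alg S \<Longrightarrow> g \<in> smooth_alg S \<Longrightarrow> (\<lambda>x. f x * g x) \<in> smooth_alg S"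
| inverse: "f \<in> smooth_alg S \<Longrightarrow> (\<And>x. x \<in> S \<Longrightarrow> f x \<noteq> 0) \<Longrightarrow> (\<lambda>x. inverse (f x)) \<in> smooth_alg S"
| exp_cut: "f \<in> smooth_alg S \<Longrightarrow> (\<And>x. x \<in> S \<Longrightarrow> Im (f x) = 0) \<Longrightarrow>
    (\<lambda>x. of_real (exp_cut k (Re (f x)))) \<in> smooth_alg S"

lemma has_derivative_pderiv_at:
  "f differentiable (at x) \<Longrightarrow> \<exists>D. (f has_derivative D) (at x) \<and> (\<forall>i. D (axis i 1) = pderiv_at i f x)"
  unfolding pderiv_at_def using frechet_derivative_works by blast

lemma pderiv_at_const: "pderiv_at i (\<lambda>_. c) x = 0"
  using pderiv_at_eq[OF has_derivative_const] .

lemma smooth_on_const: "smooth_on S (\<lambda>_. c)"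
proof (rule smooth_on_UNIV, rule smooth_on_coinduct[of _ "\<lambda>f. \<exists>c. f = (\<lambda>_. c)"])
  fix f :: "real^'n \<Rightarrow> complex" and i
  assume "\<exists>c. f = (\<lambda>_. c)"
  then have "\<forall>x. pderiv_at i f x = 0" by (auto simp: pderiv_at_const)
  then show "\<exists>g. (\<exists>c. g = (\<lambda>_. c)) \<and> (\<forall>x\<in>UNIV. pderiv_at i f x = g x)"
    by (intro exI[of _ "\<lambda>_. 0"] conjI) auto
qed auto

lemma pderiv_at_add:
  "f differentiable (at x) \<Longrightarrow> g differentiable (at x) \<Longrightarrow>
    pderiv_at i (\<lambda>x. f x + g x) x = pderiv_at i f x + pderiv_at i g x"
proof -
  assume "f differentiable (at x)" "g differentiable (at x)"
  then obtain D E where D: "(f has_derivative D) (at x)" "D (axis i 1) = pderiv_at i f x"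
    and E: "(g has_derivative E) (at x)" "E (axis i 1) = pderiv_at i g x"
    using has_derivative_pderiv_at by metis
  show ?thesis
    using pderiv_at_eq[OF has_derivative_add[OF D(1) E(1)], of i] D(2) E(2) by simp
qed

lemma pderiv_at_mult:
  "f differentiable (at x) \<Longrightarrow> g differentiable (at x) \<Longrightarrow>
    pderiv_at i (\<lambda>x. f x * g x) x = pderiv_at i f x * g x + f x * pderiv_at i g x"
proof -
  assume "f differentiable (at x)" "g differentiable (at x)"
  then obtain D E where D: "(f has_derivative D) (at x)" "D (axis i 1) = pderiv_at i f x"
    and E: "(g has_derivative E) (at x)" "E (axis i 1) = pderiv_at i g x"
    using has_derivative_pderiv_at by metis
  show ?thesis
    using pderiv_at_eq[OF has_derivative_mult[OF D(1) E(1)], of i] D(2) E(2) by simp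
qed

lemma pderiv_at_inverse:
  assumes "f differentiable (at x)" "f x \<noteq> 0"
  shows "pderiv_at i (\<lambda>x. inverse (f x)) x = - (inverse (f x) * pderiv_at i f x * inverse (f x))"
proof -
  obtain D where D: "(f has_derivative D) (at x)" "D (axis i 1) = pderiv_at i f x"
    using has_derivative_pderiv_at[OF assms(1)] by blast
  have "((\<lambda>x. inverse (f x)) has_derivative (\<lambda>h. - (inverse (f x) * D h * inverse (f x)))) (at x)"
    by (rule Deriv.has_derivative_inverse[OF assms(2) D(1)])
  from pderiv_at_eq[OF this, of i] D(2) show ?thesis by simp
qed

lemma has_derivative_exp_cut_comp:
  assumes "(f has_derivative D) (at x)"
  shows "((\<lambda>x. complex_of_real (exp_cut k (Re (f x)))) has_derivative
    (\<lambda>h. of_real ((exp_cut (k + 2) (Re (f x)) - real k * exp_cut (k + 1) (Re (f x))) * Re (D h)))) (at x)"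
proof -
  have 1: "((\<lambda>x. Re (f x)) has_derivative (\<lambda>h. Re (D h))) (at x)"
    using assms by (rule has_derivative_Re)
  have 2: "(exp_cut k has_derivative
      (*) (exp_cut (k + 2) (Re (f x)) - real k * exp_cut (k + 1) (Re (f x)))) (at (Re (f x)))"
    using DERIV_exp_cut[of k "Re (f x)"] unfolding has_field_derivative_def .
  show ?thesis
    by (rule has_derivative_of_real) (rule has_derivative_compose[OF 1 2])
qed

text \<open>A derivative of a real function is real; in the rule for \<^const>\<open>exp_cut\<close>
  this identifies \<open>Re (D h)\<close> with the complex derivative itself.\<close>

lemma pderiv_at_real:
  assumes "open S" "x \<in> S" "\<And>x. x \<in> S \<Longrightarrow> Im (f x) = 0" "(f has_derivative D) (at x)"
  shows "Im (D h) = 0"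
proof -
  have 1: "((\<lambda>x. Im (f x)) has_derivative (\<lambda>h. Im (D h))) (at x)"
    using assms(4) by (rule has_derivative_Im)
  have "((\<lambda>x. Im (f x)) has_derivative (\<lambda>h. 0)) (at x)"
    by (subst has_derivative_cong_open[OF assms(1,2), of _ "\<lambda>_. 0"]) (auto simp: assms(3))
  from has_derivative_unique[OF 1 this] show ?thesis by metis
qed

lemma smooth_alg_closed:
  assumes "open S" "f \<in> smooth_alg S"
  shows "(\<forall>x\<in>S. f differentiable (at x)) \<and> (\<forall>i. \<exists>g\<in>smooth_alg S. \<forall>x\<in>S. pderiv_at i f x = g x)"
  using assms(2)
proof (induction rule: smooth_alg.induct)
  case (base f)
  then show ?case
    using smooth_alg.base[OF smooth_on_pderiv_at[OF base]] smooth_on_differentiable[OF base] by blast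
next
  case (add f g)
  show ?case
  proof (intro conjI allI ballI)
    fix i
    have df: "\<And>x. x \<in> S \<Longrightarrow> f differentiable (at x)" and dg: "\<And>x. x \<in> S \<Longrightarrow> g differentiable (at x)"
      using add.IH by simp_all
    obtain f' where "f' \<in> smooth_alg S" "\<forall>x\<in>S. pderiv_at i f x = f' x"
      using conjunct2[OF add.IH(1), rule_format, of i] by (rule bexE)
    moreover obtain g' where "g' \<in> smooth_alg S" "\<forall>x\<in>S. pderiv_at i g x = g' x"
      using conjunct2[OF add.IH(2), rule_format, of i] by (rule bexE)
    ultimately show "\<exists>h\<in>smooth_alg S. \<forall>x\<in>S. pderiv_at i (\<lambda>x. f x + g x) x = h x"
      using df dg by (intro bexI[OF _ smooth_alg.add[of f' S g']]) (simp_all add: pderiv_at_add)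
  qed (use add.IH in \<open>blast intro: differentiable_add\<close>)
next
  case (mult f g)
  show ?case
  proof (intro conjI allI ballI)
    fix i
    have df: "\<And>x. x \<in> S \<Longrightarrow> f differentiable (at x)" and dg: "\<And>x. x \<in> S \<Longrightarrow> g differentiable (at x)"
      using mult.IH by simp_all
    obtain f' where "f' \<in> smooth_alg S" "\<forall>x\<in>S. pderiv_at i f x = f' x"
      using conjunct2[OF mult.IH(1), rule_format, of i] by (rule bexE)
    moreover obtain g' where "g' \<in> smooth_alg S" "\<forall>x\<in>S. pderiv_at i g x = g' x"
      using conjunct2[OF mult.IH(2), rule_format, of i] by (rule bexE)
    ultimately show "\<exists>h\<in>smooth_alg S. \<forall>x\<in>S. pderiv_at i (\<lambda>x. f x * g x) x = h x"
      using df dg mult.hyps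
      by (intro bexI[OF _ smooth_alg.add[OF smooth_alg.mult[of f' S g] smooth_alg.mult[of f S g']]])
        (simp_all add: pderiv_at_mult)
  qed (use mult.IH in \<open>blast intro: differentiable_mult\<close>)
next
  case (inverse f)
  show ?case
  proof (intro conjI allI ballI)
    fix i
    obtain f' where f': "f' \<in> smooth_alg S" "\<forall>x\<in>S. pderiv_at i f x = f' x"
      using conjunct2[OF inverse.IH, rule_format, of i] by (rule bexE)
    have m: "(\<lambda>x. - 1) \<in> smooth_alg S"
      by (rule smooth_alg.base, rule smooth_on_const)
    have h: "(\<lambda>x. - 1 * (inverse (f x) * f' x * inverse (f x))) \<in> smooth_alg S"
      by (intro smooth_alg.mult smooth_alg.inverse m f'(1) inverse.hyps)
    show "\<exists>h\<in>smooth_alg S. \<forall>x\<in>S. pderiv_at i (\<lambda>x. inverse (f x)) x = h x"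
      by (rule bexI[OF _ h]) (use inverse f'(2) in \<open>auto simp: pderiv_at_inverse\<close>)
  next
    fix x assume "x \<in> S"
    then show "(\<lambda>x. inverse (f x)) differentiable (at x)"
      using inverse.IH inverse.hyps(2) by (intro differentiable_inverse) auto
  qed
next
  case (exp_cut f k)
  have d: "(\<lambda>x. complex_of_real (exp_cut k (Re (f x)))) differentiable (at x)" if "x \<in> S" for x
  proof -
    obtain D where "(f has_derivative D) (at x)"
      using exp_cut.IH \<open>x \<in> S\<close> unfolding differentiable_def by auto
    then show ?thesis by (rule differentiableI[OF has_derivative_exp_cut_comp])
  qed
  show ?case
  proof (intro conjI allI ballI)
    fix i
    obtain f' where f': "f' \<in> smooth_alg S" "\<forall>x\<in>S. pderiv_at i f x = f' x"
      using conjunct2[OF exp_cut.IH, rule_format, of i] by (rule bexE)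
    have m: "(\<lambda>x. - of_nat k) \<in> smooth_alg S"
      by (rule smooth_alg.base, rule smooth_on_const)
    define E where "E j x = complex_of_real (exp_cut j (Re (f x)))" for j x
    have E: "E j \<in> smooth_alg S" for j
      unfolding E_def by (rule smooth_alg.exp_cut) (use exp_cut in auto)
    have "pderiv_at i (\<lambda>x. of_real (exp_cut k (Re (f x)))) x = (E (k + 2) x + (- of_nat k) * E (k + 1) x) * f' x"
      if "x \<in> S" for x
    proof -
      obtain D where D: "(f has_derivative D) (at x)" "D (axis i 1) = pderiv_at i f x"
        using has_derivative_pderiv_at[of f x] exp_cut.IH \<open>x \<in> S\<close> by auto
      have "Im (D (axis i 1)) = 0"
        by (rule pderiv_at_real[OF assms(1) that exp_cut.hyps(2) D(1)])
      then have "complex_of_real (Re (D (axis i 1))) = f' x"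
        using f'(2) that D(2) by (simp add: complex_eq_iff)
      then show ?thesis
        using pderiv_at_eq[OF has_derivative_exp_cut_comp[OF D(1)], of i k]
        by (simp add: E_def)
    qed
    then show "\<exists>h\<in>smooth_alg S. \<forall>x\<in>S. pderiv_at i (\<lambda>x. of_real (exp_cut k (Re (f x)))) x = h x"
      by (intro bexI[OF _ smooth_alg.mult[OF smooth_alg.add[OF E smooth_alg.mult[OF m E]] f'(1)]]) blast
  qed (use d in blast)
qed

lemma smooth_alg_smooth_on:
  assumes "open S" "f \<in> smooth_alg S" shows "smooth_on S f"
  using assms
proof (rule smooth_on_coinduct)
  fix g i assume "g \<in> smooth_alg S"
  then show "\<exists>h. h \<in> smooth_alg S \<and> (\<forall>x\<in>S. pderiv_at i g x = h x)"
    using smooth_alg_closed[OF assms(1)] by blast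
qed (use smooth_alg_closed[OF assms(1)] in blast)

lemma smooth_on_coord: "smooth_on S (\<lambda>x::real^'n. of_real (x $ i))"
proof (rule smooth_on_UNIV, rule smooth_on_coinduct[of _ "\<lambda>f. f = (\<lambda>x. of_real (x $ i)) \<or> (\<exists>c. f = (\<lambda>_. c))"])
  have D: "((\<lambda>x::real^'n. complex_of_real (x $ i)) has_derivative (\<lambda>h. of_real (h $ i))) (at x)" for x
    by (intro has_derivative_of_real bounded_linear_imp_has_derivative bounded_linear_vec_nth)
  fix f :: "real^'n \<Rightarrow> complex" and x j
  assume f: "f = (\<lambda>x. of_real (x $ i)) \<or> (\<exists>c. f = (\<lambda>_. c))"
  then show "f differentiable (at x)"
    using differentiableI[OF D] by (elim disjE exE) simp_all
  show "\<exists>g. (g = (\<lambda>x. of_real (x $ i)) \<or> (\<exists>c. g = (\<lambda>_. c))) \<and> (\<forall>x\<in>UNIV. pderiv_at j f x = g x)"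
    using f
  proof
    assume "f = (\<lambda>x. of_real (x $ i))"
    then show ?thesis
      by (intro exI[of _ "\<lambda>_. of_real (axis j 1 $ i)"]) (auto simp: pderiv_at_eq[OF D])
  next
    assume "\<exists>c. f = (\<lambda>_. c)"
    then show ?thesis
      by (intro exI[of _ "\<lambda>_. 0"]) (auto simp: pderiv_at_const)
  qed
qed auto

lemma smooth_on_add: "open S \<Longrightarrow> smooth_on S f \<Longrightarrow> smooth_on S g \<Longrightarrow> smooth_on S (\<lambda>x. f x + g x)"
  by (rule smooth_alg_smooth_on, assumption, rule smooth_alg.add; rule smooth_alg.base)

lemma smooth_on_mult: "open S \<Longrightarrow> smooth_on S f \<Longrightarrow> smooth_on S g \<Longrightarrow> smooth_on S (\<lambda>x. f x * g x)"
  by (rule smooth_alg_smooth_on, assumption, rule smooth_alg.mult; rule smooth_alg.base)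

lemma smooth_on_inverse:
  "open S \<Longrightarrow> smooth_on S f \<Longrightarrow> (\<And>x. x \<in> S \<Longrightarrow> f x \<noteq> 0) \<Longrightarrow> smooth_on S (\<lambda>x. inverse (f x))"
  by (rule smooth_alg_smooth_on, assumption, rule smooth_alg.inverse; (rule smooth_alg.base)?; assumption?; blast?)

lemma smooth_on_exp_cut:
  "open S \<Longrightarrow> smooth_on S f \<Longrightarrow> (\<And>x. x \<in> S \<Longrightarrow> Im (f x) = 0) \<Longrightarrow>
    smooth_on S (\<lambda>x. of_real (exp_cut k (Re (f x))))"
  by (rule smooth_alg_smooth_on, assumption, rule smooth_alg.exp_cut; (rule smooth_alg.base)?; assumption?; blast?)

lemma smooth_on_diff:
  assumes "open S" "smooth_on S f" "smooth_on S g" shows "smooth_on S (\<lambda>x. f x - g x)"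
  using smooth_on_add[OF assms(1,2) smooth_on_mult[OF assms(1) smooth_on_const assms(3)], of "- 1"] by simp

lemma smooth_on_sum:
  "open S \<Longrightarrow> (\<And>i. i \<in> I \<Longrightarrow> smooth_on S (f i)) \<Longrightarrow> smooth_on S (\<lambda>x. \<Sum>i\<in>I. f i x)"
  by (induction I rule: infinite_finite_induct) (auto intro!: smooth_on_const smooth_on_add)

lemma smooth_on_prod:
  "open S \<Longrightarrow> (\<And>i. i \<in> I \<Longrightarrow> smooth_on S (f i)) \<Longrightarrow> smooth_on S (\<lambda>x. \<Prod>i\<in>I. f i x)"
  by (induction I rule: infinite_finite_induct) (auto intro!: smooth_on_const smooth_on_mult)

lemma smooth_on_dist_power2: "smooth_on S (\<lambda>x::real^'n. of_real ((dist x c)\<^sup>2))"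
proof -
  have "of_real ((dist x c)\<^sup>2) =
      (\<Sum>i\<in>UNIV. (complex_of_real (x $ i) - of_real (c $ i)) * (of_real (x $ i) - of_real (c $ i)))" for x :: "real^'n"
    by (simp add: dist_norm norm_vec_def L2_set_def sum_nonneg power2_eq_square)
  moreover have "smooth_on UNIV (\<lambda>x::real^'n. \<Sum>i\<in>UNIV. (complex_of_real (x $ i) - of_real (c $ i)) * (of_real (x $ i) - of_real (c $ i)))"
    by (intro smooth_on_sum smooth_on_mult smooth_on_diff smooth_on_const smooth_on_coord) auto
  ultimately have "smooth_on UNIV (\<lambda>x::real^'n. complex_of_real ((dist x c)\<^sup>2))" by (simp only:)
  then show ?thesis by (rule smooth_on_UNIV)
qed

text \<open>For \<open>0 < r < R\<close> equal to \<open>1\<close> on the ball of radius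
  \<open>r\<close> about \<open>c\<close> and to \<open>0\<close> off that of radius
  \<open>R\<close>.\<close>

definition bump :: "real^'n \<Rightarrow> real \<Rightarrow> real \<Rightarrow> real^'n \<Rightarrow> complex" where
  "bump c r R x = of_real (exp_cut 0 (R\<^sup>2 - (dist x c)\<^sup>2) /
    (exp_cut 0 (R\<^sup>2 - (dist x c)\<^sup>2) + exp_cut 0 ((dist x c)\<^sup>2 - r\<^sup>2)))"

lemma exp_cut_0: "exp_cut 0 t \<ge> 0" "t > 0 \<Longrightarrow> exp_cut 0 t > 0" "t \<le> 0 \<Longrightarrow> exp_cut 0 t = 0"
  by (auto simp: exp_cut_def)

lemma bump_denominator:
  assumes "0 < r" "r < R"
  shows "exp_cut 0 (R\<^sup>2 - t\<^sup>2) + exp_cut 0 (t\<^sup>2 - r\<^sup>2) > 0"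
proof (cases "R\<^sup>2 - t\<^sup>2 > 0")
  case True
  then show ?thesis using exp_cut_0 by (simp add: add_pos_nonneg)
next
  case False
  have "r\<^sup>2 < R\<^sup>2" using assms by (simp add: power_strict_mono)
  with False have "t\<^sup>2 - r\<^sup>2 > 0" by simp
  then show ?thesis using exp_cut_0 by (simp add: add_nonneg_pos)
qed

lemma smooth_on_bump:
  assumes "0 < r" "r < R" shows "smooth_on S (bump c r R)"
proof -
  let ?q = "\<lambda>x. complex_of_real ((dist x c)\<^sup>2)"
  have s: "smooth_on UNIV (\<lambda>x. complex_of_real (exp_cut 0 (R\<^sup>2 - (dist x c)\<^sup>2)))"
    "smooth_on UNIV (\<lambda>x. complex_of_real (exp_cut 0 ((dist x c)\<^sup>2 - r\<^sup>2)))"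
    using smooth_on_exp_cut[OF open_UNIV smooth_on_diff[OF open_UNIV smooth_on_const smooth_on_dist_power2], of "of_real (R\<^sup>2)" c 0]
      smooth_on_exp_cut[OF open_UNIV smooth_on_diff[OF open_UNIV smooth_on_dist_power2 smooth_on_const], of c "of_real (r\<^sup>2)" 0]
    by simp_all
  have "smooth_on UNIV (\<lambda>x. complex_of_real (exp_cut 0 (R\<^sup>2 - (dist x c)\<^sup>2)) *
      inverse (complex_of_real (exp_cut 0 (R\<^sup>2 - (dist x c)\<^sup>2)) + complex_of_real (exp_cut 0 ((dist x c)\<^sup>2 - r\<^sup>2))))"
    by (intro smooth_on_mult smooth_on_inverse smooth_on_add s)
      (use bump_denominator[OF assms] in \<open>auto simp flip: of_real_add simp: less_le\<close>)
  then have "smooth_on UNIV (bump c r R)"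
    by (simp add: bump_def[abs_def] divide_inverse)
  then show ?thesis by (rule smooth_on_UNIV)
qed

lemma bump_nonneg: "bump c r R x = of_real (norm (bump c r R x))"
  unfolding bump_def norm_of_real using exp_cut_0(1) by (simp add: abs_of_nonneg)

lemma bump_eq_1:
  assumes "0 < r" "r < R" "dist x c \<le> r" shows "bump c r R x = 1"
proof -
  have "(dist x c)\<^sup>2 \<le> r\<^sup>2" using assms by (simp add: power_mono)
  then have "exp_cut 0 ((dist x c)\<^sup>2 - r\<^sup>2) = 0" by (simp add: exp_cut_0)
  then show ?thesis using bump_denominator[OF assms(1,2), of "dist x c"] by (simp add: bump_def)
qed

lemma bump_eq_0: "0 < R \<Longrightarrow> R \<le> dist x c \<Longrightarrow> bump c r R x = 0"
  by (simp add: bump_def exp_cut_0 power_mono)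

lemma test_functionI:
  assumes "smooth_on UNIV f" "compact K" "K \<subseteq> S" "\<And>x. x \<notin> K \<Longrightarrow> f x = 0"
  shows "test_function S f"
proof -
  have "{x. f x \<noteq> 0} \<subseteq> K" using assms(4) by auto
  then have "closure {x. f x \<noteq> 0} \<subseteq> K"
    by (simp add: closure_minimal compact_imp_closed assms(2))
  with assms show ?thesis
    unfolding test_function_def
    by (metis bounded_subset closed_closure compact_eq_bounded_closed subset_trans)
qed

lemma test_function_smooth: "test_function S f \<Longrightarrow> smooth_on T f"
  by (auto simp: test_function_def intro: smooth_on_UNIV)

lemma test_functionE:
  assumes "test_function S f"
  obtains K where "compact K" "K \<subseteq> S" "\<And>x. x \<notin> K \<Longrightarrow> f x = 0"
  using assms closure_subset[of "{x. f x \<noteq> 0}"] unfolding test_function_def by blast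

lemma test_function_bump:
  assumes "0 < r" "r < R" "cball c R \<subseteq> S" shows "test_function S (bump c r R)"
  by (rule test_functionI[OF smooth_on_bump[OF assms(1,2)] compact_cball assms(3)])
    (use assms in \<open>auto simp: dist_commute intro: bump_eq_0\<close>)

text \<open>Near a point outside the support of \<open>f\<close> the product vanishes, whatever
  \<open>g\<close> does there; hence \<open>g\<close> only has to be smooth on
  \<open>S\<close>.\<close>

lemma test_function_mult_smooth:
  assumes "open S" "test_function S f" "smooth_on S g"
  shows "test_function S (\<lambda>x. f x * g x)"
proof -
  obtain K where K: "compact K" "K \<subseteq> S" "\<And>x. x \<notin> K \<Longrightarrow> f x = 0"
    using assms(2) by (rule test_functionE) blast
  have "smooth_on UNIV (\<lambda>x. f x * g x)"
  proof (rule smooth_on_open_Union)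
    fix x
    show "\<exists>W. x \<in> W \<and> smooth_on W (\<lambda>x. f x * g x)"
    proof (cases "x \<in> K")
      case True
      then show ?thesis
        using assms K(2) smooth_on_mult[OF assms(1) test_function_smooth[OF assms(2)] assms(3)] by blast
    next
      case False
      have "open (- K)" using K(1) by (simp add: compact_imp_closed open_Compl)
      then have "smooth_on (- K) (\<lambda>x. f x * g x)"
        by (subst smooth_on_cong[of _ _ "\<lambda>_. 0"]) (auto simp: K(3) smooth_on_const)
      then show ?thesis using False by blast
    qed
  qed
  then show ?thesis by (rule test_functionI[OF _ K(1,2)]) (simp add: K(3))
qed

text \<open>The set is covered by finitely many balls on each of which a bump equals
  \<open>1\<close>; one minus the product of the complementary bumps equals \<open>1\<close> as soon
  as one of them does.\<close>

lemma exists_cutoff: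
  fixes K :: "(real^'n) set"
  assumes "compact K" "open S" "K \<subseteq> S"
  obtains cut W where "test_function S cut" "open W" "K \<subseteq> W" "\<And>x. x \<in> W \<Longrightarrow> cut x = 1"
proof -
  have "\<exists>e>0. cball x e \<subseteq> S" if "x \<in> K" for x
    using assms that open_contains_cball by blast
  then obtain e where e: "\<And>x. x \<in> K \<Longrightarrow> e x > 0" "\<And>x. x \<in> K \<Longrightarrow> cball x (e x) \<subseteq> S" by metis
  have "K \<subseteq> (\<Union>x\<in>K. ball x (e x / 2))" using e(1) by force
  then obtain D where D: "D \<subseteq> K" "finite D" "K \<subseteq> (\<Union>x\<in>D. ball x (e x / 2))"
    using compactE_image[OF assms(1), of K "\<lambda>x. ball x (e x / 2)"] by blast
  define b where "b c = bump c (e c / 2) (e c)" for c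
  define cut where "cut x = 1 - (\<Prod>c\<in>D. 1 - b c x)" for x
  have b: "smooth_on UNIV (b c)" if "c \<in> D" for c
    unfolding b_def using e(1)[of c] that D(1) by (intro smooth_on_bump) auto
  have "smooth_on UNIV cut"
    unfolding cut_def by (intro smooth_on_diff smooth_on_const smooth_on_prod b) auto
  moreover have "compact (\<Union>c\<in>D. cball c (e c))" using D(2) by (intro compact_UN) auto
  moreover have "(\<Union>c\<in>D. cball c (e c)) \<subseteq> S" using e(2) D(1) by blast
  moreover have "cut x = 0" if "x \<notin> (\<Union>c\<in>D. cball c (e c))" for x
  proof -
    have "b c x = 0" if "c \<in> D" for c
      unfolding b_def using \<open>x \<notin> _\<close> that e(1)[of c] D(1) by (intro bump_eq_0) (auto simp: dist_commute)
    then show ?thesis by (simp add: cut_def)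
  qed
  ultimately have t: "test_function S cut" by (rule test_functionI)
  have "cut x = 1" if "x \<in> (\<Union>c\<in>D. ball c (e c / 2))" for x
  proof -
    from that obtain c where c: "c \<in> D" "dist x c < e c / 2" by (auto simp: dist_commute)
    have "b c x = 1" unfolding b_def using c D(1) e(1)[of c] by (intro bump_eq_1) auto
    then have "(\<Prod>c\<in>D. 1 - b c x) = 0" using c(1) D(2) by (intro prod_zero) auto
    then show ?thesis by (simp add: cut_def)
  qed
  then show ?thesis using that[OF t _ D(3)] by blast
qed

section \<open>The Fourier transform of compactly supported functions\<close>

lemma has_derivative_partials:
  fixes f :: "real^'n \<Rightarrow> complex"
  assumes "f differentiable (at x)"
  shows "(f has_derivative (\<lambda>h. \<Sum>i\<in>UNIV. h $ i *\<^sub>R pderiv_at i f x)) (at x)"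
proof -
  obtain D where D: "(f has_derivative D) (at x)" "\<forall>i. D (axis i 1) = pderiv_at i f x"
    using has_derivative_pderiv_at[OF assms] by (elim exE conjE)
  have lin: "linear D" using D(1) by (rule has_derivative_linear)
  have "D h = (\<Sum>i\<in>UNIV. h $ i *\<^sub>R pderiv_at i f x)" for h
  proof -
    have "D h = D (\<Sum>i\<in>UNIV. h $ i *\<^sub>R axis i 1)"
      by (simp add: basis_expansion[of h] flip: scalar_mult_eq_scaleR)
    then show ?thesis using D(2) lin by (simp add: linear_sum linear_scale)
  qed
  then have "D = (\<lambda>h. \<Sum>i\<in>UNIV. h $ i *\<^sub>R pderiv_at i f x)" by (rule ext)
  with D(1) show ?thesis by (simp only:)
qed

text \<open>The mean value inequality in terms of the partial derivatives, which are the quantities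
  controlled for Colombeau nets.\<close>

lemma partials_lipschitz:
  fixes f :: "real^'n \<Rightarrow> complex"
  assumes "convex S" "\<And>z. z \<in> S \<Longrightarrow> f differentiable (at z)"
    and "\<And>z i. z \<in> S \<Longrightarrow> norm (pderiv_at i f z) \<le> B"
    and "x \<in> S" "y \<in> S"
  shows "norm (f x - f y) \<le> (real CARD('n) * B) * norm (x - y)"
proof (rule differentiable_bound[OF assms(1) _ _ assms(4,5)])
  fix z assume z: "z \<in> S"
  show "(f has_derivative (\<lambda>h. \<Sum>i\<in>UNIV. h $ i *\<^sub>R pderiv_at i f z)) (at z within S)"
    using has_derivative_partials[OF assms(2)[OF z]] by (rule has_derivative_at_withinI)
  have "norm (\<Sum>i\<in>UNIV. h $ i *\<^sub>R pderiv_at i f z) \<le> real CARD('n) * B * norm h" for h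
  proof -
    have "norm (\<Sum>i\<in>UNIV. h $ i *\<^sub>R pderiv_at i f z) \<le> (\<Sum>i\<in>(UNIV::'n set). norm h * B)"
    proof (rule order_trans[OF norm_sum], rule sum_mono)
      fix i
      have "\<bar>h $ i\<bar> * norm (pderiv_at i f z) \<le> norm h * B"
        using component_le_norm_cart[of h i] assms(3)[OF z, of i] by (intro mult_mono) auto
      then show "norm (h $ i *\<^sub>R pderiv_at i f z) \<le> norm h * B" by simp
    qed
    then show ?thesis by (simp add: algebra_simps)
  qed
  then show "onorm (\<lambda>h. \<Sum>i\<in>UNIV. h $ i *\<^sub>R pderiv_at i f z) \<le> real CARD('n) * B"
    by (rule onorm_le)
qed

lemma integrable_continuous_compact:
  fixes f :: "'a::euclidean_space \<Rightarrow> 'b::{banach, second_countable_topology}"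
  assumes "continuous_on UNIV f" "compact K" "\<And>x. x \<notin> K \<Longrightarrow> f x = 0"
  shows "integrable lborel f"
proof -
  have "integrable lborel (\<lambda>x. indicator K x *\<^sub>R f x)"
    using assms(2) by (rule borel_integrable_compact) (rule continuous_on_subset[OF assms(1) subset_UNIV])
  moreover have "(\<lambda>x. indicator K x *\<^sub>R f x) = f"
    using assms(3) by (auto simp: indicator_def)
  ultimately show ?thesis by simp
qed

lemma integrable_indicator_compact:
  "compact (K :: 'a::euclidean_space set) \<Longrightarrow> integrable lborel (indicator K :: _ \<Rightarrow> real)"
  using borel_integrable_compact[of K "\<lambda>_. 1::real"] by simp

lemma norm_integral_le_compact:
  fixes f :: "'a::euclidean_space \<Rightarrow> 'b::{banach, second_countable_topology}"
  assumes "compact K" "\<And>x. x \<notin> K \<Longrightarrow> f x = 0" "\<And>x. x \<in> K \<Longrightarrow> norm (f x) \<le> B"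
  shows "norm (LINT x|lborel. f x) \<le> B * measure lborel K"
proof -
  have "norm (LINT x|lborel. f x) \<le> (LINT x|lborel. norm (f x))" by (rule integral_norm_bound)
  also have "\<dots> \<le> (LINT x|lborel. B * indicator K x)"
  proof (rule integral_mono')
    show "integrable lborel (\<lambda>x. B * indicator K x)"
      using integrable_indicator_compact[OF assms(1)] by simp
    show "norm (f x) \<le> B * indicator K x" for x
      using assms(2,3) by (cases "x \<in> K") auto
    show "0 \<le> B * indicator K x" for x
      using order_trans[OF norm_ge_zero assms(3)[of x]] by (cases "x \<in> K") simp_all
  qed
  also have "\<dots> = B * measure lborel K"
    using assms(1) by (simp add: compact_imp_closed)
  finally show ?thesis .
qed

lemma integral_scale_lborel:
  fixes f :: "'a::euclidean_space \<Rightarrow> 'b::{banach, second_countable_topology}"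
  assumes "c \<noteq> 0" "f \<in> borel_measurable borel"
  shows "(LINT x|lborel. f x) = \<bar>c\<bar> ^ DIM('a) *\<^sub>R (LINT x|lborel. f (t + c *\<^sub>R x))" (is ?E)
    and "integrable lborel f \<longleftrightarrow> integrable lborel (\<lambda>x. f (t + c *\<^sub>R x))" (is ?I)
proof -
  have m: "(\<lambda>x::'a. t + c *\<^sub>R x) \<in> lborel \<rightarrow>\<^sub>M borel" by simp
  have m': "f \<in> borel_measurable (distr lborel borel (\<lambda>x. t + c *\<^sub>R x))" using assms(2) by simp
  have eq: "lborel = density (distr lborel borel (\<lambda>x::'a. t + c *\<^sub>R x)) (\<lambda>_. ennreal (\<bar>c\<bar> ^ DIM('a)))"
    by (rule lborel_affine[OF assms(1)])
  have "(LINT x|lborel. f x) =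
      (LINT x|density (distr lborel borel (\<lambda>x::'a. t + c *\<^sub>R x)) (\<lambda>_. ennreal (\<bar>c\<bar> ^ DIM('a))). f x)"
    using eq by simp
  also have "\<dots> = (LINT x|distr lborel borel (\<lambda>x::'a. t + c *\<^sub>R x). \<bar>c\<bar> ^ DIM('a) *\<^sub>R f x)"
    by (rule integral_density[OF m']) auto
  also have "\<dots> = (LINT x|lborel. \<bar>c\<bar> ^ DIM('a) *\<^sub>R f (t + c *\<^sub>R x))"
    by (rule integral_distr[OF m]) (use assms(2) in simp)
  finally show ?E by simp
  have "integrable lborel f \<longleftrightarrow>
      integrable (density (distr lborel borel (\<lambda>x::'a. t + c *\<^sub>R x)) (\<lambda>_. ennreal (\<bar>c\<bar> ^ DIM('a)))) f"
    using eq by simp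
  also have "\<dots> \<longleftrightarrow> integrable (distr lborel borel (\<lambda>x::'a. t + c *\<^sub>R x)) (\<lambda>x. \<bar>c\<bar> ^ DIM('a) *\<^sub>R f x)"
    by (rule integrable_density[OF m']) auto
  also have "\<dots> \<longleftrightarrow> integrable lborel (\<lambda>x. \<bar>c\<bar> ^ DIM('a) *\<^sub>R f (t + c *\<^sub>R x))"
    by (rule integrable_distr_eq[OF m]) (use assms(2) in simp)
  also have "\<dots> \<longleftrightarrow> integrable lborel (\<lambda>x. f (t + c *\<^sub>R x))"
  proof
    assume "integrable lborel (\<lambda>x. \<bar>c\<bar> ^ DIM('a) *\<^sub>R f (t + c *\<^sub>R x))"
    then have "integrable lborel (\<lambda>x. inverse (\<bar>c\<bar> ^ DIM('a)) *\<^sub>R (\<bar>c\<bar> ^ DIM('a) *\<^sub>R f (t + c *\<^sub>R x)))"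
      by (rule integrable_scaleR_right)
    then show "integrable lborel (\<lambda>x. f (t + c *\<^sub>R x))" using assms(1) by simp
  qed (rule integrable_scaleR_right)
  finally show ?I .
qed

text \<open>The integral of a difference quotient vanishes by translation invariance of Lebesgue
  measure; dominated convergence passes to the derivative. This avoids iterated integrals in
  coordinates.\<close>

lemma integral_pderiv_at_eq_0:
  fixes f :: "real^'n \<Rightarrow> complex"
  assumes diff: "\<And>x. f differentiable (at x)"
    and cont: "\<And>i. continuous_on UNIV (pderiv_at i f)"
    and K: "compact K" "\<And>x. x \<notin> K \<Longrightarrow> f x = 0"
  shows "(LINT x|lborel. pderiv_at i f x) = 0"
proof -
  obtain R where "\<forall>x\<in>K. norm x \<le> R" using compact_imp_bounded[OF K(1)] unfolding bounded_iff ..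
  then have R: "K \<subseteq> cball 0 R" by auto
  have "\<exists>B. \<forall>z\<in>cball 0 (R + 2). norm (pderiv_at j f z) \<le> B" for j
  proof -
    have "compact (pderiv_at j f ` cball 0 (R + 2))"
      by (intro compact_continuous_image continuous_on_subset[OF cont]) auto
    then have "bounded (pderiv_at j f ` cball 0 (R + 2))" by (rule compact_imp_bounded)
    then show ?thesis unfolding bounded_iff by blast
  qed
  then obtain b where b: "\<And>j z. z \<in> cball 0 (R + 2) \<Longrightarrow> norm (pderiv_at j f z) \<le> b j" by metis
  define B where "B = Max (range b)"
  have B: "norm (pderiv_at j f z) \<le> B" if "z \<in> cball 0 (R + 2)" for j z
  proof -
    have "b j \<le> B" unfolding B_def by simp
    then show ?thesis using b[OF that, of j] by linarith
  qed
  define h where "h n = 1 / real (Suc n)" for n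
  have h: "0 < h n" "h n \<le> 1" for n by (auto simp: h_def)
  have h0: "h \<longlonglongrightarrow> 0" unfolding h_def by (rule LIMSEQ_Suc) (rule lim_1_over_n)
  define e :: "real^'n" where "e = axis i 1"
  have e: "norm e = 1" by (simp add: e_def)
  \<comment> \<open>The difference quotients in direction \<open>e\<close> all vanish off the ball
    of radius \<open>R + 1\<close>, on which \<open>B\<close> controls them.\<close>
  define s where "s n x = inverse (h n) *\<^sub>R (f (x + h n *\<^sub>R e) - f x)" for n x
  have fc: "continuous_on UNIV f" using diff by (simp add: continuous_at_imp_continuous_on differentiable_imp_continuous_within)
  then have [measurable]: "f \<in> borel_measurable borel" by (rule borel_measurable_continuous_onI)
  have [measurable]: "pderiv_at i f \<in> borel_measurable borel" using cont by (rule borel_measurable_continuous_onI)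
  have fi: "integrable lborel f" by (rule integrable_continuous_compact[OF fc K])
  have "(\<lambda>n. LINT x|lborel. s n x) \<longlonglongrightarrow> (LINT x|lborel. pderiv_at i f x)"
  proof (rule integral_dominated_convergence[where w = "\<lambda>x. (real CARD('n) * B) * indicator (cball 0 (R + 1)) x"])
    show "s n \<in> borel_measurable lborel" for n unfolding s_def[abs_def] by measurable
    show "integrable lborel (\<lambda>x::real^'n. (real CARD('n) * B) * indicator (cball 0 (R + 1)) x)"
      using integrable_indicator_compact[of "cball (0::real^'n) (R + 1)"] by simp
    show "AE x in lborel. (\<lambda>n. s n x) \<longlonglongrightarrow> pderiv_at i f x"
    proof (intro always_eventually allI)
      fix x
      have "(f has_derivative (\<lambda>h. \<Sum>i\<in>UNIV. h $ i *\<^sub>R pderiv_at i f x)) (at x)"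
        by (rule has_derivative_partials[OF diff])
      then have 1: "(f has_derivative (\<lambda>h. \<Sum>i\<in>UNIV. h $ i *\<^sub>R pderiv_at i f x)) (at (x + 0 *\<^sub>R e))"
        by simp
      have 2: "((\<lambda>t. x + t *\<^sub>R e) has_derivative (\<lambda>t. t *\<^sub>R e)) (at 0)"
        by (auto intro!: derivative_eq_intros)
      have "((\<lambda>t. f (x + t *\<^sub>R e)) has_derivative (\<lambda>t. \<Sum>i\<in>UNIV. (t *\<^sub>R e) $ i *\<^sub>R pderiv_at i f x)) (at 0)"
        by (rule has_derivative_compose[OF 2 1])
      also have "(\<lambda>t. \<Sum>i\<in>UNIV. (t *\<^sub>R e) $ i *\<^sub>R pderiv_at i f x) = (\<lambda>t. t *\<^sub>R pderiv_at i f x)"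
      proof
        fix t
        have "(t *\<^sub>R e) $ j *\<^sub>R pderiv_at j f x = (if j = i then t *\<^sub>R pderiv_at i f x else 0)" for j
          by (simp add: e_def axis_def)
        then show "(\<Sum>i\<in>UNIV. (t *\<^sub>R e) $ i *\<^sub>R pderiv_at i f x) = t *\<^sub>R pderiv_at i f x" by simp
      qed
      finally have "((\<lambda>t. f (x + t *\<^sub>R e)) has_vector_derivative pderiv_at i f x) (at 0)"
        by (simp add: has_vector_derivative_def)
      then have "((\<lambda>t. norm (f (x + t *\<^sub>R e) - f x - t *\<^sub>R pderiv_at i f x) / norm t) \<longlongrightarrow> 0) (at 0)"
        unfolding has_vector_derivative_def has_derivative_at by simp
      also have "?this \<longleftrightarrow> ((\<lambda>t. norm (inverse t *\<^sub>R (f (x + t *\<^sub>R e) - f x) - pderiv_at i f x)) \<longlongrightarrow> 0) (at 0)"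
      proof (rule tendsto_cong)
        have "norm (f (x + t *\<^sub>R e) - f x - t *\<^sub>R pderiv_at i f x) / norm t =
            norm (inverse t *\<^sub>R (f (x + t *\<^sub>R e) - f x) - pderiv_at i f x)" if "t \<noteq> 0" for t
        proof -
          have "inverse t *\<^sub>R (f (x + t *\<^sub>R e) - f x) - pderiv_at i f x =
              inverse t *\<^sub>R (f (x + t *\<^sub>R e) - f x - t *\<^sub>R pderiv_at i f x)"
            using that by (simp add: scaleR_diff_right)
          then show ?thesis by (simp only: norm_scaleR) (simp add: divide_inverse)
        qed
        then show "\<forall>\<^sub>F t in at 0. norm (f (x + t *\<^sub>R e) - f x - t *\<^sub>R pderiv_at i f x) / norm t =
            norm (inverse t *\<^sub>R (f (x + t *\<^sub>R e) - f x) - pderiv_at i f x)"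
          by (auto simp: eventually_at_filter)
      qed
      finally have lim: "((\<lambda>t. inverse t *\<^sub>R (f (x + t *\<^sub>R e) - f x)) \<longlongrightarrow> pderiv_at i f x) (at 0)"
        by (simp add: tendsto_norm_zero_iff flip: Lim_null)
      have "filterlim h (at 0) sequentially"
        unfolding filterlim_at using h0 h(1) by (auto intro!: always_eventually simp: less_imp_neq[symmetric])
      then show "(\<lambda>n. s n x) \<longlonglongrightarrow> pderiv_at i f x"
        unfolding s_def by (rule filterlim_compose[OF lim])
    qed
    show "AE x in lborel. norm (s n x) \<le> (real CARD('n) * B) * indicator (cball 0 (R + 1)) x" for n
    proof (intro always_eventually allI)
      fix x :: "real^'n"
      have n1: "norm (x + h n *\<^sub>R e) \<le> norm x + h n" "norm x \<le> norm (x + h n *\<^sub>R e) + h n"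
        using norm_triangle_ineq[of x "h n *\<^sub>R e"] norm_triangle_ineq4[of "x + h n *\<^sub>R e" "h n *\<^sub>R e"] h(1)[of n] e by auto
      show "norm (s n x) \<le> (real CARD('n) * B) * indicator (cball 0 (R + 1)) x"
      proof (cases "x \<in> cball 0 (R + 1)")
        case True
        have "norm (f (x + h n *\<^sub>R e) - f x) \<le> (real CARD('n) * B) * norm (x + h n *\<^sub>R e - x)"
          by (rule partials_lipschitz[of "cball 0 (R + 2)"]) (use diff B True n1 h(2)[of n] in auto)
        then have "norm (f (x + h n *\<^sub>R e) - f x) \<le> (real CARD('n) * B) * h n" using h(1)[of n] e by simp
        then have "inverse (h n) * norm (f (x + h n *\<^sub>R e) - f x) \<le> inverse (h n) * ((real CARD('n) * B) * h n)"
          using h(1)[of n] by (intro mult_left_mono) auto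
        moreover have "norm (s n x) = inverse (h n) * norm (f (x + h n *\<^sub>R e) - f x)"
          unfolding s_def norm_scaleR using h(1)[of n] by simp
        moreover have "inverse (h n) * ((real CARD('n) * B) * h n) = real CARD('n) * B"
          using h(1)[of n] by simp
        ultimately show ?thesis using True by simp
      next
        case False
        then have "x \<notin> K" "x + h n *\<^sub>R e \<notin> K" using R n1 h(2)[of n] by auto
        then show ?thesis using False K(2) by (simp add: s_def)
      qed
    qed
  qed simp
  moreover have "(LINT x|lborel. s n x) = 0" for n
  proof -
    have "integrable lborel (\<lambda>x. f (h n *\<^sub>R e + 1 *\<^sub>R x))"
      using integral_scale_lborel(2)[of 1 f "h n *\<^sub>R e"] fi by simp
    moreover have "(LINT x|lborel. f (h n *\<^sub>R e + 1 *\<^sub>R x)) = (LINT x|lborel. f x)"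
      using integral_scale_lborel(1)[of 1 f "h n *\<^sub>R e"] by simp
    ultimately show ?thesis unfolding s_def using fi by (simp add: add.commute)
  qed
  ultimately have "(\<lambda>n::nat. 0) \<longlonglongrightarrow> (LINT x|lborel. pderiv_at i f x)" by (simp only:)
  then show ?thesis by (rule LIMSEQ_unique[OF _ tendsto_const])
qed


text \<open>The character that is the kernel of \<^const>\<open>fourier\<close>.\<close>

definition wave :: "real^'n \<Rightarrow> real^'n \<Rightarrow> complex" where
  "wave x \<xi> = exp (- (\<i> * complex_of_real (x \<bullet> \<xi>)))"

lemma fourier_wave: "fourier f \<xi> = (LINT x|lborel. wave x \<xi> * f x)"
  by (simp add: fourier_def wave_def)

lemma norm_wave [simp]: "norm (wave x \<xi>) = 1"
  by (simp add: wave_def)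

lemma wave_add_right: "wave x (\<xi> + \<eta>) = wave x \<xi> * wave x \<eta>"
  by (simp add: wave_def inner_add_right ring_distribs flip: exp_add)

lemma wave_add_left: "wave (x + y) \<xi> = wave x \<xi> * wave y \<xi>"
  by (simp add: wave_def inner_add_left ring_distribs flip: exp_add)

lemma wave_0 [simp]: "wave x 0 = 1" "wave 0 \<xi> = 1"
  by (simp_all add: wave_def)

lemma wave_minus: "wave x (- \<xi>) = cnj (wave x \<xi>)" "wave (- x) \<xi> = cnj (wave x \<xi>)"
  by (simp_all add: wave_def exp_cnj)

lemma wave_commute: "wave x \<xi> = wave \<xi> x"
  by (simp add: wave_def inner_commute)

lemma wave_scaleR: "wave (s *\<^sub>R x) \<xi> = wave x (s *\<^sub>R \<xi>)"
  by (simp add: wave_def)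

lemma continuous_on_wave [continuous_intros]:
  "continuous_on S f \<Longrightarrow> continuous_on S g \<Longrightarrow> continuous_on S (\<lambda>x. wave (f x) (g x))"
  unfolding wave_def by (intro continuous_intros)

lemma measurable_wave [measurable (raw)]:
  "f \<in> borel_measurable M \<Longrightarrow> g \<in> borel_measurable M \<Longrightarrow> (\<lambda>x. wave (f x) (g x)) \<in> borel_measurable M"
  unfolding wave_def by measurable

lemma wave_lipschitz: "norm (wave x \<xi> - wave x \<eta>) \<le> norm x * norm (\<xi> - \<eta>)"
proof -
  have "norm (wave x d - 1) \<le> norm x * norm d" for d
  proof -
    have "norm (wave x d - 1) = 2 * \<bar>sin ((x \<bullet> (- d)) / 2)\<bar>"
      using dist_exp_i_1[of "x \<bullet> (- d)"] by (simp add: wave_def)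
    also have "\<dots> \<le> \<bar>x \<bullet> (- d)\<bar>" using abs_sin_x_le_abs_x[of "(x \<bullet> (- d)) / 2"] by simp
    also have "\<dots> \<le> norm x * norm d" using Cauchy_Schwarz_ineq2[of x "- d"] by simp
    finally show ?thesis .
  qed
  then have "norm (wave x (\<xi> - \<eta>) - 1) \<le> norm x * norm (\<xi> - \<eta>)" .
  moreover have "wave x \<xi> - wave x \<eta> = wave x \<eta> * (wave x (\<xi> - \<eta>) - 1)"
    using wave_add_right[of x "\<xi> - \<eta>" \<eta>] by (simp add: algebra_simps)
  ultimately show ?thesis by (simp add: norm_mult)
qed

lemma integrable_wave:
  fixes f :: "real^'n \<Rightarrow> complex"
  assumes "integrable lborel f" shows "integrable lborel (\<lambda>x. wave x \<xi> * f x)"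
proof (rule Bochner_Integration.integrable_bound[OF assms])
  have [measurable]: "f \<in> borel_measurable borel" using assms by simp
  show "(\<lambda>x. wave x \<xi> * f x) \<in> borel_measurable lborel" by measurable
qed (simp add: norm_mult)

lemma norm_fourier_le:
  "norm (fourier f \<xi>) \<le> (LINT x|lborel. norm (f x))"
  unfolding fourier_wave using integral_norm_bound[of lborel "\<lambda>x. wave x \<xi> * f x"] by (simp add: norm_mult)

lemma fourier_diff:
  assumes "integrable lborel f" "integrable lborel g"
  shows "fourier (\<lambda>x. f x - g x) \<xi> = fourier f \<xi> - fourier g \<xi>"
  unfolding fourier_wave right_diff_distrib
  by (intro Bochner_Integration.integral_diff integrable_wave assms)

lemma norm_fourier_le_compact:
  assumes "compact K" "\<And>x. x \<notin> K \<Longrightarrow> f x = 0" "\<And>x. x \<in> K \<Longrightarrow> norm (f x) \<le> B"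
  shows "norm (fourier f \<xi>) \<le> B * measure lborel K"
  unfolding fourier_wave
  by (rule norm_integral_le_compact[OF assms(1)]) (simp_all add: assms norm_mult)

lemma fourier_lipschitz:
  fixes f :: "real^'n \<Rightarrow> complex"
  assumes "integrable lborel f" "compact K" "\<And>x. x \<notin> K \<Longrightarrow> f x = 0"
    "\<And>x. x \<in> K \<Longrightarrow> norm (f x) \<le> B" "\<And>x. x \<in> K \<Longrightarrow> norm x \<le> R"
  shows "norm (fourier f \<xi> - fourier f \<eta>) \<le> R * norm (\<xi> - \<eta>) * B * measure lborel K"
proof -
  have "fourier f \<xi> - fourier f \<eta> = (LINT x|lborel. (wave x \<xi> - wave x \<eta>) * f x)"
    unfolding fourier_wave left_diff_distrib
    by (intro Bochner_Integration.integral_diff[symmetric] integrable_wave assms(1))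
  moreover have "norm (LINT x|lborel. (wave x \<xi> - wave x \<eta>) * f x) \<le> R * norm (\<xi> - \<eta>) * B * measure lborel K"
  proof (rule norm_integral_le_compact[OF assms(2)])
    fix x assume x: "x \<in> K"
    have "norm (wave x \<xi> - wave x \<eta>) \<le> R * norm (\<xi> - \<eta>)"
      by (rule order_trans[OF wave_lipschitz]) (intro mult_right_mono assms(5)[OF x] norm_ge_zero)
    then show "norm ((wave x \<xi> - wave x \<eta>) * f x) \<le> R * norm (\<xi> - \<eta>) * B"
      unfolding norm_mult using assms(4)[OF x]
      by (intro mult_mono) (auto intro: order_trans[OF norm_ge_zero])
  qed (simp add: assms(3))
  ultimately show ?thesis by simp
qed

lemma compact_norm_bound:
  fixes K :: "'a::real_normed_vector set" and f :: "'a \<Rightarrow> 'b::real_normed_vector"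
  assumes "compact K" "continuous_on K f"
  obtains B where "B \<ge> 0" "\<And>x. x \<in> K \<Longrightarrow> norm (f x) \<le> B"
proof -
  have "bounded (f ` K)" using compact_continuous_image[OF assms(2,1)] by (rule compact_imp_bounded)
  then obtain B where "\<forall>y\<in>f ` K. norm y \<le> B" unfolding bounded_iff ..
  then have "norm (f x) \<le> max B 0" if "x \<in> K" for x using that by fastforce
  then show ?thesis using that[of "max B 0"] by simp
qed

lemma continuous_on_fourier:
  fixes f :: "real^'n \<Rightarrow> complex"
  assumes "continuous_on UNIV f" "compact K" "\<And>x. x \<notin> K \<Longrightarrow> f x = 0"
  shows "continuous_on UNIV (fourier f)"
proof -
  obtain B where B: "B \<ge> 0" "\<And>x. x \<in> K \<Longrightarrow> norm (f x) \<le> B"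
    using compact_norm_bound[OF assms(2) continuous_on_subset[OF assms(1) subset_UNIV]] by blast
  obtain R where R: "R \<ge> 0" "\<And>x. x \<in> K \<Longrightarrow> norm x \<le> R"
    using compact_norm_bound[OF assms(2) continuous_on_id] by blast
  have "dist (fourier f \<xi>) (fourier f \<eta>) \<le> (R * B * measure lborel K) * dist \<xi> \<eta>" for \<xi> \<eta>
    using fourier_lipschitz[OF integrable_continuous_compact[OF assms] assms(2,3) B(2) R(2), of \<xi> \<eta>]
    by (simp add: dist_norm algebra_simps)
  then have "(R * B * measure lborel K)-lipschitz_on UNIV (fourier f)"
    using R(1) B(1) by (intro lipschitz_onI) auto
  then show ?thesis by (rule lipschitz_on_continuous_on)
qed

lemma has_derivative_wave:
  "((\<lambda>x. wave x \<xi>) has_derivative (\<lambda>h. - (\<i> * of_real (h \<bullet> \<xi>)) * wave x \<xi>)) (at x)"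
proof -
  have 1: "((\<lambda>x. - (\<i> * complex_of_real (x \<bullet> \<xi>))) has_derivative (\<lambda>h. - (\<i> * of_real (h \<bullet> \<xi>)))) (at x)"
    by (intro has_derivative_minus has_derivative_mult_right has_derivative_of_real
        bounded_linear_imp_has_derivative bounded_linear_inner_left)
  have 2: "(exp has_derivative (*) (wave x \<xi>)) (at (- (\<i> * complex_of_real (x \<bullet> \<xi>))))"
    using DERIV_exp[of "- (\<i> * complex_of_real (x \<bullet> \<xi>))"] unfolding has_field_derivative_def wave_def .
  show ?thesis
    using has_derivative_compose[OF 1 2] unfolding wave_def[abs_def] by (simp add: mult.commute)
qed

lemma pderiv_at_wave: "pderiv_at i (\<lambda>x. wave x \<xi>) x = - (\<i> * of_real (\<xi> $ i)) * wave x \<xi>"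
  using pderiv_at_eq[OF has_derivative_wave] by (simp add: inner_axis')

lemma differentiable_wave: "(\<lambda>x. wave x \<xi>) differentiable (at x)"
  using has_derivative_wave by (rule differentiableI)

lemma pderivs_eq_0_outside:
  fixes f :: "real^'n \<Rightarrow> complex"
  assumes "compact K" "\<And>x. x \<notin> K \<Longrightarrow> f x = 0" "x \<notin> K" shows "pderivs is f x = 0"
proof -
  have "open (- K)" using assms(1) by (simp add: compact_imp_closed open_Compl)
  then have "pderivs is f x = pderivs is (\<lambda>_. 0) x"
    by (rule pderivs_cong_open) (use assms in auto)
  also have "pderivs is (\<lambda>_. 0) = (\<lambda>_::real^'n. 0::complex)" for "is" :: "'n list"
    by (induction "is") (auto simp: pderiv_at_const)
  finally show ?thesis by simp
qed

text \<open>Integration by parts: the derivative of \<open>f\<close> times the character has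
  integral zero.\<close>

lemma fourier_pderiv_at:
  fixes f :: "real^'n \<Rightarrow> complex"
  assumes f: "smooth_on UNIV f" and K: "compact K" "\<And>x. x \<notin> K \<Longrightarrow> f x = 0"
  shows "fourier (pderiv_at i f) \<xi> = \<i> * of_real (\<xi> $ i) * fourier f \<xi>"
proof -
  note df = smooth_on_differentiable[OF f UNIV_I]
  have eq: "pderiv_at j (\<lambda>x. wave x \<xi> * f x) x =
      - (\<i> * of_real (\<xi> $ j)) * (wave x \<xi> * f x) + wave x \<xi> * pderiv_at j f x" for j x
    by (simp add: pderiv_at_mult[OF differentiable_wave df] pderiv_at_wave)
  have cf: "continuous_on UNIV f" and cpf: "\<And>j. continuous_on UNIV (pderiv_at j f)"
    using smooth_on_continuous_on f smooth_on_pderiv_at by blast+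
  have i1: "integrable lborel f" by (rule integrable_continuous_compact[OF cf K])
  have "pderivs [i] f x = 0" if "x \<notin> K" for x
    using K that by (rule pderivs_eq_0_outside)
  then have "pderiv_at i f x = 0" if "x \<notin> K" for x
    using that by simp
  then have i2: "integrable lborel (pderiv_at i f)"
    by (rule integrable_continuous_compact[OF cpf K(1)])
  have "(LINT x|lborel. pderiv_at i (\<lambda>x. wave x \<xi> * f x) x) = 0"
  proof (rule integral_pderiv_at_eq_0[OF _ _ K(1)])
    show "(\<lambda>x. wave x \<xi> * f x) differentiable (at x)" for x
      by (intro differentiable_mult differentiable_wave df)
    show "continuous_on UNIV (pderiv_at j (\<lambda>x. wave x \<xi> * f x))" for j
      unfolding eq[abs_def] by (intro continuous_intros cf cpf)
  qed (simp add: K(2))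
  also have "(LINT x|lborel. pderiv_at i (\<lambda>x. wave x \<xi> * f x) x) =
      - (\<i> * of_real (\<xi> $ i)) * fourier f \<xi> + fourier (pderiv_at i f) \<xi>"
    unfolding eq fourier_wave using integrable_wave[OF i1, of \<xi>] integrable_wave[OF i2, of \<xi>]
    by (subst Bochner_Integration.integral_add) auto
  finally show ?thesis by (simp add: algebra_simps)
qed

lemma fourier_pderivs:
  fixes f :: "real^'n \<Rightarrow> complex"
  assumes f: "smooth_on UNIV f" and K: "compact K" "\<And>x. x \<notin> K \<Longrightarrow> f x = 0"
  shows "fourier (pderivs is f) \<xi> = (\<Prod>i\<leftarrow>is. \<i> * of_real (\<xi> $ i)) * fourier f \<xi>"
proof (induction "is")
  case (Cons i "is")
  have "fourier (pderivs (i # is) f) \<xi> = \<i> * of_real (\<xi> $ i) * fourier (pderivs is f) \<xi>"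
    using fourier_pderiv_at[OF smooth_on_pderivs[OF f] K(1) pderivs_eq_0_outside[OF K]] by simp
  then show ?case using Cons by simp
qed simp

section \<open>Decay of the Fourier transform\<close>

text \<open>Powers of the norm are bounded by powers of single coordinates, so that only iterated
  derivatives in one direction have to be estimated.\<close>

lemma weight_le_coordinates:
  fixes x :: "real^'n"
  shows "(1 + norm x) ^ m \<le> (1 + real CARD('n)) ^ m * (1 + (\<Sum>i\<in>UNIV. \<bar>x $ i\<bar> ^ m))"
proof -
  define M where "M = Max (range (\<lambda>i. \<bar>x $ i\<bar>))"
  have le: "\<bar>x $ i\<bar> \<le> M" for i unfolding M_def by simp
  have "M \<in> range (\<lambda>i. \<bar>x $ i\<bar>)" unfolding M_def by (rule Max_in) auto
  then obtain j where j: "M = \<bar>x $ j\<bar>" by blast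
  have M0: "0 \<le> M" using j by simp
  have "norm x \<le> (\<Sum>i\<in>UNIV. \<bar>x $ i\<bar>)" by (rule norm_le_l1_cart)
  also have "\<dots> \<le> (\<Sum>i\<in>(UNIV::'n set). M)" by (intro sum_mono le)
  finally have "norm x \<le> real CARD('n) * M" by simp
  also have "\<dots> \<le> real CARD('n) * max 1 M" by (intro mult_left_mono) auto
  finally have "1 + norm x \<le> (1 + real CARD('n)) * max 1 M" by (simp add: distrib_right)
  then have "(1 + norm x) ^ m \<le> ((1 + real CARD('n)) * max 1 M) ^ m" by (intro power_mono) auto
  also have "\<dots> = (1 + real CARD('n)) ^ m * max 1 M ^ m" by (rule power_mult_distrib)
  also have "max 1 M ^ m \<le> 1 + M ^ m" using M0 by (auto simp: max_def)
  also have "M ^ m \<le> (\<Sum>i\<in>UNIV. \<bar>x $ i\<bar> ^ m)"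
    unfolding j by (rule member_le_sum) auto
  finally show ?thesis by (simp add: mult_left_mono)
qed

lemma fourier_decay:
  fixes f :: "real^'n \<Rightarrow> complex"
  assumes f: "smooth_on UNIV f" and K: "compact K" "\<And>x. x \<notin> K \<Longrightarrow> f x = 0"
    and B: "\<And>x. x \<in> K \<Longrightarrow> norm (f x) \<le> B"
      "\<And>x i. x \<in> K \<Longrightarrow> norm (pderivs (replicate m i) f x) \<le> B"
  shows "(1 + norm \<xi>) ^ m * norm (fourier f \<xi>) \<le>
    (1 + real CARD('n)) ^ m * ((1 + real CARD('n)) * (B * measure lborel K))"
proof -
  have 1: "norm (fourier f \<xi>) \<le> B * measure lborel K"
    by (rule norm_fourier_le_compact[OF K B(1)])
  have 2: "\<bar>\<xi> $ i\<bar> ^ m * norm (fourier f \<xi>) \<le> B * measure lborel K" for i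
  proof -
    have "norm (fourier (pderivs (replicate m i) f) \<xi>) \<le> B * measure lborel K"
      by (rule norm_fourier_le_compact[OF K(1) pderivs_eq_0_outside[OF K] B(2)])
    moreover have "norm (fourier (pderivs (replicate m i) f) \<xi>) = \<bar>\<xi> $ i\<bar> ^ m * norm (fourier f \<xi>)"
      by (simp add: fourier_pderivs[OF f K] norm_mult norm_power)
    ultimately show ?thesis by simp
  qed
  have "(1 + norm \<xi>) ^ m * norm (fourier f \<xi>) \<le>
      ((1 + real CARD('n)) ^ m * (1 + (\<Sum>i\<in>UNIV. \<bar>\<xi> $ i\<bar> ^ m))) * norm (fourier f \<xi>)"
    by (intro mult_right_mono weight_le_coordinates norm_ge_zero)
  also have "\<dots> = (1 + real CARD('n)) ^ m *
      (norm (fourier f \<xi>) + (\<Sum>i\<in>UNIV. \<bar>\<xi> $ i\<bar> ^ m * norm (fourier f \<xi>)))"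
    by (simp add: algebra_simps sum_distrib_left sum_distrib_right)
  also have "\<dots> \<le> (1 + real CARD('n)) ^ m *
      (B * measure lborel K + (\<Sum>i\<in>(UNIV::'n set). B * measure lborel K))"
    by (intro mult_left_mono add_mono sum_mono 1 2) auto
  finally show ?thesis by (simp add: algebra_simps)
qed

lemma fourier_rapidly_decreasing:
  fixes f :: "real^'n \<Rightarrow> complex"
  assumes f: "smooth_on UNIV f" and K: "compact K" "\<And>x. x \<notin> K \<Longrightarrow> f x = 0"
  obtains C where "\<And>\<xi>. (1 + norm \<xi>) ^ m * norm (fourier f \<xi>) \<le> C"
proof -
  have "\<exists>B. \<forall>x\<in>K. norm (pderivs js f x) \<le> B" for js
    using compact_norm_bound[OF K(1) smooth_on_continuous_pderivs[OF smooth_on_UNIV[OF f]]] by metis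
  then obtain b where b: "\<And>js x. x \<in> K \<Longrightarrow> norm (pderivs js f x) \<le> b js" by metis
  define S where "S = insert [] (range (replicate m :: 'n \<Rightarrow> 'n list))"
  have le: "norm (pderivs js f x) \<le> Max (b ` S)" if "x \<in> K" "js \<in> S" for js x
  proof -
    have "b js \<le> Max (b ` S)" using that by (intro Max_ge) (auto simp: S_def)
    then show ?thesis using b[OF that(1), of js] by linarith
  qed
  have "norm (f x) \<le> Max (b ` S)" if "x \<in> K" for x
    using le[OF that, of "[]"] by (simp add: S_def)
  moreover have "norm (pderivs (replicate m i) f x) \<le> Max (b ` S)" if "x \<in> K" for x i
    by (rule le[OF that]) (auto simp: S_def)
  ultimately show ?thesis using fourier_decay[OF f K] that by blast
qed

text \<open>The level sets of the norm are compared with balls: on \<open>n \<le> |x| < n +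
  1\<close> the integrand is at most \<open>(n + 1)\<^sup>-\<^sup>d\<^sup>-\<^sup>2\<close>, while
  the ball of radius \<open>n + 1\<close> has volume proportional to \<open>(n +
  1)\<^sup>d\<close>.\<close>

lemma integrable_weight:
  "integrable lborel (\<lambda>x::'a::euclidean_space. inverse ((1 + norm x) ^ (DIM('a) + 2)))"
proof (rule integrableI_bounded)
  show "(\<lambda>x::'a. inverse ((1 + norm x) ^ (DIM('a) + 2))) \<in> borel_measurable lborel" by measurable
  let ?a = "\<lambda>n::nat. inverse (real (Suc n) ^ (DIM('a) + 2))"
  define V where "V = unit_ball_vol (real DIM('a))"
  have V: "V \<ge> 0" by (simp add: V_def)
  have "(\<integral>\<^sup>+ x. ennreal (norm (inverse ((1 + norm (x::'a)) ^ (DIM('a) + 2)))) \<partial>lborel) \<le>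
      (\<integral>\<^sup>+ x. (\<Sum>n. ennreal (?a n) * indicator (cball (0::'a) (real (Suc n))) x) \<partial>lborel)"
  proof (rule nn_integral_mono)
    fix x :: 'a
    define n where "n = nat \<lfloor>norm x\<rfloor>"
    have "real n = of_int \<lfloor>norm x\<rfloor>" by (simp add: n_def)
    then have n: "real n \<le> norm x" "norm x \<le> real (Suc n)" by linarith+
    have "inverse ((1 + norm x) ^ (DIM('a) + 2)) \<le> ?a n"
      using n(1) by (intro le_imp_inverse_le power_mono) auto
    then have "ennreal (norm (inverse ((1 + norm x) ^ (DIM('a) + 2)))) \<le>
        ennreal (?a n) * indicator (cball 0 (real (Suc n))) x"
      using n(2) by (simp add: ennreal_leI)
    also have "\<dots> \<le> (\<Sum>n. ennreal (?a n) * indicator (cball 0 (real (Suc n))) x)"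
    proof -
      have "(\<Sum>i\<in>{n}. t i) \<le> (\<Sum>i. t i)" for t :: "nat \<Rightarrow> ennreal" by (rule sum_le_suminf) auto
      then have "t n \<le> (\<Sum>i. t i)" for t :: "nat \<Rightarrow> ennreal" by simp
      then show ?thesis .
    qed
    finally show "ennreal (norm (inverse ((1 + norm x) ^ (DIM('a) + 2)))) \<le>
      (\<Sum>n. ennreal (?a n) * indicator (cball 0 (real (Suc n))) x)" .
  qed
  also have "\<dots> = (\<Sum>n. \<integral>\<^sup>+ x. ennreal (?a n) * indicator (cball (0::'a) (real (Suc n))) x \<partial>lborel)"
  proof (rule nn_integral_suminf)
    have [measurable]: "Measurable.pred borel (\<lambda>x::'a. x \<in> cball 0 r)" for r by (simp add: pred_def)
    show "(\<lambda>x::'a. ennreal (?a n) * indicator (cball 0 (real (Suc n))) x) \<in> borel_measurable lborel" for n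
      by measurable
  qed
  also have "\<dots> = (\<Sum>n. ennreal (V * inverse (real (Suc n) ^ 2)))"
  proof (rule suminf_cong)
    fix n
    have "(\<integral>\<^sup>+ x. ennreal (?a n) * indicator (cball (0::'a) (real (Suc n))) x \<partial>lborel) =
        ennreal (?a n) * ennreal (V * real (Suc n) ^ DIM('a))"
      unfolding V_def by (subst nn_integral_cmult_indicator) (simp_all add: emeasure_cball del: of_nat_Suc)
    also have "\<dots> = ennreal (?a n * (V * real (Suc n) ^ DIM('a)))"
      using V by (intro ennreal_mult[symmetric]) auto
    also have "?a n * (V * real (Suc n) ^ DIM('a)) = V * inverse (real (Suc n) ^ 2)"
    proof -
      have "inverse (N ^ (DIM('a) + 2)) * (V * N ^ DIM('a)) = V * inverse (N ^ 2)" if "N \<noteq> 0" for N :: real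
        using that by (simp add: power_add field_simps power2_eq_square)
      then show ?thesis by (simp del: of_nat_Suc)
    qed
    finally show "(\<integral>\<^sup>+ x. ennreal (?a n) * indicator (cball (0::'a) (real (Suc n))) x \<partial>lborel) =
        ennreal (V * inverse (real (Suc n) ^ 2))" .
  qed
  also have "\<dots> < \<infinity>"
  proof -
    have "summable (\<lambda>n. inverse (real n ^ 2))" by (rule inverse_power_summable) simp
    then have "summable (\<lambda>n. inverse (real (Suc n) ^ 2))" by (subst summable_Suc_iff)
    then have "summable (\<lambda>n. V * inverse (real (Suc n) ^ 2))" by (rule summable_mult)
    then have "(\<Sum>n. ennreal (V * inverse (real (Suc n) ^ 2))) \<noteq> top"
      by (rule ennreal_suminf_neq_top) (use V in auto)
    then show ?thesis by (simp add: top.not_eq_extremum)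
  qed
  finally show "(\<integral>\<^sup>+ x. ennreal (norm (inverse ((1 + norm (x::'a)) ^ (DIM('a) + 2)))) \<partial>lborel) < \<infinity>" .
qed

lemma integrable_weight_bound:
  fixes f :: "real^'n \<Rightarrow> 'b::{banach, second_countable_topology}"
  assumes "f \<in> borel_measurable borel" "\<And>x. (1 + norm x) ^ (CARD('n) + 2) * norm (f x) \<le> C"
  shows "integrable lborel f"
    and "(LINT x|lborel. norm (f x)) \<le> C * (LINT x|lborel. inverse ((1 + norm (x::real^'n)) ^ (CARD('n) + 2)))"
proof -
  have le: "norm (f x) \<le> C * inverse ((1 + norm x) ^ (CARD('n) + 2))" for x
  proof -
    have "0 < 1 + norm x" by (simp add: add_pos_nonneg)
    then have W: "(1 + norm x) ^ (CARD('n) + 2) \<noteq> 0" by simp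
    have cancel: "t = inverse W * (W * t)" if "W \<noteq> 0" for W t :: real using that by simp
    have "norm (f x) = inverse ((1 + norm x) ^ (CARD('n) + 2)) * ((1 + norm x) ^ (CARD('n) + 2) * norm (f x))"
      by (rule cancel[OF W])
    also have "\<dots> \<le> inverse ((1 + norm x) ^ (CARD('n) + 2)) * C"
      by (intro mult_left_mono assms(2)) simp
    finally show ?thesis by (simp add: mult.commute)
  qed
  have C: "0 \<le> C" using order_trans[OF norm_ge_zero[of "f 0"]] assms(2)[of 0] by simp
  have i: "integrable lborel (\<lambda>x::real^'n. C * inverse ((1 + norm x) ^ (CARD('n) + 2)))"
    using integrable_weight[where 'a = "real^'n"] by simp
  show int: "integrable lborel f"
    by (rule Bochner_Integration.integrable_bound[OF i])
      (use assms(1) le in \<open>auto intro: order_trans[OF _ abs_ge_self]\<close>)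
  have "(LINT x|lborel. norm (f x)) \<le> (LINT x|lborel. C * inverse ((1 + norm (x::real^'n)) ^ (CARD('n) + 2)))"
    by (rule integral_mono) (use int i le in auto)
  then show "(LINT x|lborel. norm (f x)) \<le> C * (LINT x|lborel. inverse ((1 + norm (x::real^'n)) ^ (CARD('n) + 2)))"
    by simp
qed

lemma integrable_weight_fourier:
  fixes f :: "real^'n \<Rightarrow> complex"
  assumes f: "smooth_on UNIV f" and K: "compact K" "\<And>x. x \<notin> K \<Longrightarrow> f x = 0"
  shows "integrable lborel (\<lambda>\<xi>. (1 + norm \<xi>) ^ m * norm (fourier f \<xi>))"
proof -
  obtain C where C: "\<And>\<xi>. (1 + norm \<xi>) ^ (CARD('n) + 2 + m) * norm (fourier f \<xi>) \<le> C"
    using fourier_rapidly_decreasing[OF f K] by metis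
  have [measurable]: "fourier f \<in> borel_measurable borel"
    using continuous_on_fourier[OF smooth_on_continuous_on[OF f] K] by (rule borel_measurable_continuous_onI)
  show ?thesis
    by (rule integrable_weight_bound(1)[of _ C]) (use C in \<open>auto simp: power_add mult.assoc abs_mult\<close>)
qed

lemma integrable_fourier:
  fixes f :: "real^'n \<Rightarrow> complex"
  assumes f: "smooth_on UNIV f" and K: "compact K" "\<And>x. x \<notin> K \<Longrightarrow> f x = 0"
  shows "integrable lborel (fourier f)"
proof -
  have [measurable]: "fourier f \<in> borel_measurable borel"
    using continuous_on_fourier[OF smooth_on_continuous_on[OF f] K] by (rule borel_measurable_continuous_onI)
  show ?thesis
    using integrable_weight_fourier[OF assms, of 0] by (subst integrable_norm_iff[symmetric]) auto
qed

section \<open>Frequency localization of products\<close>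

text \<open>Both sides are the double integral of \<open>f(x) g(y)\<close> against the
  character.\<close>

lemma fourier_multiplication_formula:
  fixes f g :: "real^'n \<Rightarrow> complex"
  assumes "integrable lborel f" "integrable lborel g"
  shows "(LINT x|lborel. f x * fourier g x) = (LINT y|lborel. fourier f y * g y)"
proof -
  have [measurable]: "f \<in> borel_measurable borel" "g \<in> borel_measurable borel" using assms by simp_all
  have int: "integrable (lborel \<Otimes>\<^sub>M lborel) (\<lambda>(x, y). f x * g y * wave x y)"
  proof (rule lborel_pair.Fubini_integrable)
    show "(\<lambda>(x, y). f x * g y * wave x y) \<in> borel_measurable (lborel \<Otimes>\<^sub>M lborel)" by measurable
    have "integrable lborel (\<lambda>x. norm (f x) * (LINT y|lborel. norm (g y)))" using assms(1) by simp
    then show "integrable lborel (\<lambda>x. LINT y|lborel. norm (case (x, y) of (x, y) \<Rightarrow> f x * g y * wave x y))"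
      by (simp add: norm_mult)
    show "AE x in lborel. integrable lborel (\<lambda>y. case (x, y) of (x, y) \<Rightarrow> f x * g y * wave x y)"
    proof (intro always_eventually allI)
      fix x
      have "integrable lborel (\<lambda>y. f x * (wave y x * g y))"
        by (intro integrable_mult_right integrable_wave assms(2))
      then show "integrable lborel (\<lambda>y. case (x, y) of (x, y) \<Rightarrow> f x * g y * wave x y)"
        by (simp add: mult_ac wave_commute[of x])
    qed
  qed
  have "(LINT x|lborel. f x * fourier g x) = (LINT x|lborel. LINT y|lborel. f x * g y * wave x y)"
  proof (rule Bochner_Integration.integral_cong[OF refl])
    fix x
    have "f x * fourier g x = (LINT y|lborel. f x * (wave y x * g y))" by (simp add: fourier_wave)
    then show "f x * fourier g x = (LINT y|lborel. f x * g y * wave x y)"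
      by (simp add: mult_ac wave_commute[of x])
  qed
  also have "\<dots> = (LINT y|lborel. LINT x|lborel. f x * g y * wave x y)"
    by (rule lborel_pair.Fubini_integral[OF int, symmetric])
  also have "\<dots> = (LINT y|lborel. fourier f y * g y)"
  proof (rule Bochner_Integration.integral_cong[OF refl])
    fix y
    have "fourier f y * g y = (LINT x|lborel. (wave x y * f x) * g y)" by (simp add: fourier_wave)
    then show "(LINT x|lborel. f x * g y * wave x y) = fourier f y * g y" by (simp add: mult_ac)
  qed
  finally show ?thesis .
qed

text \<open>Cross-correlation. It is used instead of convolution because its Fourier transform at
  \<open>\<eta>\<close> involves \<open>g\<close> at \<open>- \<eta>\<close>, so that
  \<open>correlation k k\<close> has a nonnegative transform for real \<open>k\<close>.\<close>

definition correlation :: "(real^'n \<Rightarrow> complex) \<Rightarrow> (real^'n \<Rightarrow> complex) \<Rightarrow> real^'n \<Rightarrow> complex" where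
  "correlation f g w = (LINT x|lborel. f x * g (x - w))"

lemma correlation_eq_0:
  fixes f g :: "real^'n \<Rightarrow> complex"
  assumes "\<And>x. x \<notin> K \<Longrightarrow> f x = 0" "\<And>x. x \<notin> L \<Longrightarrow> g x = 0" "w \<notin> {x - y |x y. x \<in> K \<and> y \<in> L}"
  shows "correlation f g w = 0"
proof -
  have "f x * g (x - w) = 0" for x
  proof (rule ccontr)
    assume "f x * g (x - w) \<noteq> 0"
    then have "x \<in> K" "x - w \<in> L" using assms(1,2) by auto
    then have "\<exists>x y. w = x - y \<and> x \<in> K \<and> y \<in> L" by (intro exI[of _ x] exI[of _ "x - w"]) simp
    with assms(3) show False by blast
  qed
  then have "correlation f g w = (LINT x|(lborel :: (real^'n) measure). 0)" unfolding correlation_def by (simp only:)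
  then show ?thesis by simp
qed

lemma continuous_compact_bounded:
  fixes f :: "'a::real_normed_vector \<Rightarrow> 'b::real_normed_vector"
  assumes "continuous_on UNIV f" "compact K" "\<And>x. x \<notin> K \<Longrightarrow> f x = 0"
  obtains B where "B \<ge> 0" "\<And>x. norm (f x) \<le> B"
proof -
  obtain B where B: "B \<ge> 0" "\<And>x. x \<in> K \<Longrightarrow> norm (f x) \<le> B"
    using compact_norm_bound[OF assms(2) continuous_on_subset[OF assms(1) subset_UNIV]] by blast
  have "norm (f x) \<le> B" for x by (cases "x \<in> K") (simp_all add: B assms(3))
  with B(1) show ?thesis by (rule that)
qed

lemma continuous_on_correlation:
  fixes f g :: "real^'n \<Rightarrow> complex"
  assumes f: "continuous_on UNIV f" "compact K" "\<And>x. x \<notin> K \<Longrightarrow> f x = 0"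
    and g: "continuous_on UNIV g" "compact L" "\<And>x. x \<notin> L \<Longrightarrow> g x = 0"
  shows "continuous_on UNIV (correlation f g)"
proof (rule continuous_at_imp_continuous_on, rule ballI)
  fix w
  obtain B where B: "\<And>x. norm (g x) \<le> B" using continuous_compact_bounded[OF g] by metis
  have [measurable]: "f \<in> borel_measurable borel" "g \<in> borel_measurable borel"
    using f(1) g(1) by (auto intro: borel_measurable_continuous_onI)
  have fi: "integrable lborel f" by (rule integrable_continuous_compact[OF f])
  show "isCont (correlation f g) w"
    unfolding continuous_at_sequentially
  proof (intro allI impI)
    fix X assume X: "X \<longlonglongrightarrow> w"
    have "(\<lambda>n. LINT x|lborel. f x * g (x - X n)) \<longlonglongrightarrow> (LINT x|lborel. f x * g (x - w))"
    proof (rule integral_dominated_convergence[where w = "\<lambda>x. B * norm (f x)"])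
      show "integrable lborel (\<lambda>x. B * norm (f x))" using fi by simp
      have "(\<lambda>n. f x * g (x - X n)) \<longlonglongrightarrow> f x * g (x - w)" for x
      proof -
        have "(\<lambda>n. x - X n) \<longlonglongrightarrow> x - w" by (intro tendsto_intros X)
        moreover have "isCont g (x - w)" using g(1) by (simp add: continuous_on_eq_continuous_at)
        ultimately have "(\<lambda>n. g (x - X n)) \<longlonglongrightarrow> g (x - w)" by (rule isCont_tendsto_compose[rotated])
        then show ?thesis by (intro tendsto_mult tendsto_const)
      qed
      then show "AE x in lborel. (\<lambda>n. f x * g (x - X n)) \<longlonglongrightarrow> f x * g (x - w)" by simp
      have "norm (f x * g (x - X n)) \<le> B * norm (f x)" for x n
        unfolding norm_mult using mult_right_mono[OF B norm_ge_zero] by (simp add: mult.commute)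
      then show "AE x in lborel. norm (f x * g (x - X n)) \<le> B * norm (f x)" for n by simp
    qed simp_all
    then show "(correlation f g \<circ> X) \<longlonglongrightarrow> correlation f g w" by (simp add: correlation_def comp_def)
  qed
qed

lemma fourier_correlation:
  fixes f g :: "real^'n \<Rightarrow> complex"
  assumes f: "continuous_on UNIV f" "compact K" "\<And>x. x \<notin> K \<Longrightarrow> f x = 0"
    and g: "continuous_on UNIV g" "compact L" "\<And>x. x \<notin> L \<Longrightarrow> g x = 0"
  shows "fourier (correlation f g) \<eta> = fourier f \<eta> * fourier g (- \<eta>)"
proof -
  let ?h = "\<lambda>w x. wave w \<eta> * (f x * g (x - w))"
  let ?M = "{x - y |x y. x \<in> K \<and> y \<in> L}"
  have fc: "continuous_on S (\<lambda>x. f (a x))" if "continuous_on S a" for S :: "'a::topological_space set" and a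
    by (rule continuous_on_compose2[OF f(1) that]) simp
  have gc: "continuous_on S (\<lambda>x. g (a x))" if "continuous_on S a" for S :: "'a::topological_space set" and a
    by (rule continuous_on_compose2[OF g(1) that]) simp
  have [measurable]: "f \<in> borel_measurable borel" "g \<in> borel_measurable borel"
    using f(1) g(1) by (auto intro: borel_measurable_continuous_onI)
  have "integrable lborel (\<lambda>p. ?h (fst p) (snd p))"
  proof (rule integrable_continuous_compact)
    show "continuous_on UNIV (\<lambda>p. ?h (fst p) (snd p))" by (intro continuous_intros fc gc)
    show "compact (?M \<times> K)" by (intro compact_Times compact_differences f(2) g(2))
    fix p assume p: "p \<notin> ?M \<times> K"
    show "?h (fst p) (snd p) = 0"
    proof (rule ccontr)
      assume "?h (fst p) (snd p) \<noteq> 0"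
      then have s: "snd p \<in> K" "snd p - fst p \<in> L" using f(3) g(3) by auto
      then have "fst p \<in> ?M" by (intro CollectI exI[of _ "snd p"] exI[of _ "snd p - fst p"]) simp
      with s p show False by (auto simp: mem_Times_iff)
    qed
  qed
  then have int: "integrable (lborel \<Otimes>\<^sub>M lborel) (\<lambda>(w, x). ?h w x)"
    by (simp add: lborel_prod case_prod_unfold)
  have "fourier (correlation f g) \<eta> = (LINT w|lborel. LINT x|lborel. ?h w x)"
    by (simp add: fourier_wave correlation_def)
  also have "\<dots> = (LINT x|lborel. LINT w|lborel. ?h w x)"
    by (rule lborel_pair.Fubini_integral[OF int, symmetric])
  also have "\<dots> = (LINT x|lborel. wave x \<eta> * f x * fourier g (- \<eta>))"
  proof (rule Bochner_Integration.integral_cong[OF refl])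
    fix x
    have "(LINT w|lborel. ?h w x) = (LINT y|lborel. ?h (x + (- 1) *\<^sub>R y) x)"
      using integral_scale_lborel(1)[of "- 1" "\<lambda>w. ?h w x" x] by simp
    also have "\<dots> = (LINT y|lborel. (wave x \<eta> * f x) * (wave y (- \<eta>) * g y))"
      by (simp add: wave_add_left[of x "- y" for y, simplified] wave_minus mult_ac)
    finally show "(LINT w|lborel. ?h w x) = wave x \<eta> * f x * fourier g (- \<eta>)"
      by (simp add: fourier_wave)
  qed
  also have "\<dots> = fourier f \<eta> * fourier g (- \<eta>)"
    by (simp add: fourier_wave)
  finally show ?thesis .
qed


lemma fourier_real_minus:
  fixes k :: "real^'n \<Rightarrow> complex"
  assumes "\<And>x. cnj (k x) = k x"
  shows "fourier k (- \<eta>) = cnj (fourier k \<eta>)"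
  unfolding fourier_wave
proof -
  have "cnj (LINT x|lborel. wave x \<eta> * k x) = (LINT x|lborel. cnj (wave x \<eta> * k x))"
    by (rule Bochner_Integration.integral_cnj[symmetric])
  then show "(LINT x|lborel. wave x (- \<eta>) * k x) = cnj (LINT x|lborel. wave x \<eta> * k x)"
    by (simp add: wave_minus assms)
qed

lemma fourier_scale:
  fixes f :: "real^'n \<Rightarrow> complex"
  assumes "f \<in> borel_measurable borel" "s > 0"
  shows "fourier (\<lambda>x. f (inverse s *\<^sub>R (x - c))) \<eta> = of_real (s ^ CARD('n)) * (wave c \<eta> * fourier f (s *\<^sub>R \<eta>))"
proof -
  have [measurable]: "f \<in> borel_measurable borel" by fact
  have "fourier (\<lambda>x. f (inverse s *\<^sub>R (x - c))) \<eta> =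
      s ^ CARD('n) *\<^sub>R (LINT x|lborel. wave (c + s *\<^sub>R x) \<eta> * f (inverse s *\<^sub>R (c + s *\<^sub>R x - c)))"
    unfolding fourier_wave using assms(2)
    by (subst integral_scale_lborel(1)[of s _ c]) simp_all
  also have "\<dots> = of_real (s ^ CARD('n)) * (wave c \<eta> * fourier f (s *\<^sub>R \<eta>))"
  proof -
    have "inverse s *\<^sub>R (c + s *\<^sub>R x - c) = x" for x using assms(2) by simp
    then have "(LINT x|lborel. wave (c + s *\<^sub>R x) \<eta> * f (inverse s *\<^sub>R (c + s *\<^sub>R x - c))) =
        (LINT x|lborel. wave c \<eta> * (wave x (s *\<^sub>R \<eta>) * f x))"
      by (simp only: wave_add_left wave_scaleR mult.assoc)
    then show ?thesis by (simp add: fourier_wave scaleR_conv_of_real)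
  qed
  finally show ?thesis .
qed

lemma fourier_bump_0_neq_0:
  assumes "0 < r" "r < R" shows "fourier (bump (0::real^'n) r R) 0 \<noteq> 0"
proof -
  let ?k = "bump (0::real^'n) r R"
  have "fourier ?k 0 = (LINT x|lborel. complex_of_real (norm (?k x)))"
    unfolding fourier_wave by (simp add: bump_nonneg[symmetric])
  also have "\<dots> = of_real (LINT x|lborel. norm (?k x))" by (rule integral_complex_of_real)
  finally have eq: "fourier ?k 0 = of_real (LINT x|lborel. norm (?k x))" .
  have "integrable lborel ?k"
    by (rule integrable_continuous_compact[OF smooth_on_continuous_on[OF smooth_on_bump[OF assms]] compact_cball[of 0 R]])
      (use assms in \<open>auto intro: bump_eq_0 simp: dist_commute\<close>)
  then have ki: "integrable lborel (\<lambda>x. norm (?k x))" by simp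
  have "0 < measure lborel (cball (0::real^'n) r)" using assms by (simp add: content_cball)
  also have "measure lborel (cball (0::real^'n) r) = (LINT x|lborel. indicator (cball (0::real^'n) r) x)" by simp
  also have "\<dots> \<le> (LINT x|lborel. norm (?k x))"
  proof (rule integral_mono[OF _ ki])
    show "integrable lborel (indicator (cball (0::real^'n) r) :: _ \<Rightarrow> real)"
      by (rule integrable_indicator_compact) simp
    show "indicator (cball 0 r) x \<le> norm (?k x)" for x
      using assms by (cases "x \<in> cball 0 r") (auto simp: bump_eq_1 dist_commute)
  qed
  finally show ?thesis by (simp add: eq)
qed

text \<open>An inequality in place of the inversion formula, for which no Fourier transform has to
  be computed. Take a real bump \<open>k\<close>. Its autocorrelation \<open>\<gamma>\<close> is
  bounded and has the transform \<open>P = |fourier k|\<^sup>2\<close>, which is nonnegative,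
  integrable and not zero. By the multiplication formula the integral of \<open>A P\<close> is that
  of \<open>fourier A\<close> times \<open>\<gamma>\<close>, hence at most \<open>sup
  |\<gamma>|\<close> times the \<open>L\<^sup>1\<close> norm of \<open>fourier A\<close>. That norm
  does not change when \<open>A\<close> is dilated to \<open>z \<mapsto> A (d z)\<close>, and as
  \<open>d \<rightarrow> 0\<close> the left-hand side tends to \<open>A 0\<close> times the integral
  of \<open>P\<close>.\<close>

lemma fourier_inversion_bound:
  obtains C where "C \<ge> 0" and
    "\<And>(A :: real^'n \<Rightarrow> complex) K. continuous_on UNIV A \<Longrightarrow> compact K \<Longrightarrow> (\<And>x. x \<notin> K \<Longrightarrow> A x = 0) \<Longrightarrow>
      integrable lborel (fourier A) \<Longrightarrow> norm (A 0) \<le> C * (LINT \<eta>|lborel. norm (fourier A \<eta>))"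
proof -
  define k :: "real^'n \<Rightarrow> complex" where "k = bump 0 1 2"
  have k: "smooth_on UNIV k" unfolding k_def by (rule smooth_on_bump) auto
  have kK: "compact (cball (0::real^'n) 2)" "k x = 0" if "x \<notin> cball 0 2" for x
    unfolding k_def using that by (auto intro!: bump_eq_0 simp: dist_commute)
  note kc = smooth_on_continuous_on[OF k]
  have kK': "\<And>x. x \<notin> cball 0 2 \<Longrightarrow> k x = 0" using kK(2) .
  have kKc: "compact (cball (0::real^'n) 2)" by (rule compact_cball)
  have creal: "cnj (k x) = k x" for x
    unfolding k_def by (subst (1 2) bump_nonneg) simp
  \<comment> \<open>The transform of the autocorrelation of \<open>k\<close>.\<close>
  define P where "P \<eta> = (norm (fourier k \<eta>))\<^sup>2" for \<eta>
  have Pc: "continuous_on UNIV P"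
    unfolding P_def by (intro continuous_intros continuous_on_fourier[OF kc kKc kK'])
  then have [measurable]: "P \<in> borel_measurable borel" by (rule borel_measurable_continuous_onI)
  obtain C0 where C0: "\<And>\<xi>. (1 + norm \<xi>) ^ 0 * norm (fourier k \<xi>) \<le> C0"
    using fourier_rapidly_decreasing[OF k kKc kK'] by metis
  have Pi: "integrable lborel P"
  proof (rule Bochner_Integration.integrable_bound)
    show "integrable lborel (\<lambda>\<eta>. C0 * norm (fourier k \<eta>))"
      using integrable_fourier[OF k kKc kK'] by simp
    have "P \<eta> \<le> C0 * norm (fourier k \<eta>)" for \<eta>
      unfolding P_def power2_eq_square using C0[of \<eta>] by (intro mult_right_mono) auto
    moreover have "0 \<le> P \<eta>" for \<eta> by (simp add: P_def)
    ultimately show "AE x in lborel. norm (P x) \<le> norm (C0 * norm (fourier k x))"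
      by (intro always_eventually allI) (smt (verit) real_norm_def)
  qed simp
  define c0 where "c0 = (LINT \<eta>|lborel. P \<eta>)"
  have c0: "c0 > 0"
  proof -
    have "fourier k 0 \<noteq> 0" unfolding k_def by (rule fourier_bump_0_neq_0) auto
    then have P0: "P 0 > 0" by (simp add: P_def)
    have "isCont P 0" using Pc by (simp add: continuous_on_eq_continuous_at)
    then obtain d where d: "d > 0" "\<And>x. dist x 0 < d \<Longrightarrow> dist (P x) (P 0) < P 0 / 2"
      using P0 unfolding continuous_at_eps_delta by (metis half_gt_zero)
    have "0 < P 0 / 2 * measure lborel (ball (0::real^'n) d)"
      using P0 d(1) by (simp add: content_ball)
    also have "\<dots> = (LINT x|lborel. P 0 / 2 * indicator (ball (0::real^'n) d) x)" by simp
    also have "\<dots> \<le> c0" unfolding c0_def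
    proof (rule integral_mono)
      have "emeasure lborel (ball (0::real^'n) d) < \<infinity>"
        using d(1) by (simp add: emeasure_ball)
      then show "integrable lborel (\<lambda>x::real^'n. P 0 / 2 * indicator (ball 0 d) x)"
        by (intro integrable_mult_right) (simp add: integrable_indicator_iff)
      show "P 0 / 2 * indicator (ball 0 d) x \<le> P x" for x
      proof (cases "x \<in> ball 0 d")
        case True
        then have "\<bar>P x - P 0\<bar> < P 0 / 2" using d(2)[of x] by (simp add: dist_real_def dist_norm)
        then have "P 0 / 2 \<le> P x" by linarith
        then show ?thesis using True by simp
      qed (simp add: P_def)
    qed (rule Pi)
    finally show ?thesis .
  qed
  define \<gamma> where "\<gamma> = correlation k k"
  let ?D = "{x - y |x y. x \<in> cball (0::real^'n) 2 \<and> y \<in> cball 0 2}"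
  have \<gamma>c: "continuous_on UNIV \<gamma>"
    unfolding \<gamma>_def by (rule continuous_on_correlation[OF kc kKc kK' kc kKc kK'])
  have \<gamma>K: "compact ?D" "\<And>x. x \<notin> ?D \<Longrightarrow> \<gamma> x = 0"
    unfolding \<gamma>_def by (intro compact_differences kKc) (rule correlation_eq_0[OF kK' kK'])
  have \<gamma>i: "integrable lborel \<gamma>" by (rule integrable_continuous_compact[OF \<gamma>c \<gamma>K])
  have F\<gamma>: "fourier \<gamma> \<eta> = of_real (P \<eta>)" for \<eta>
  proof -
    have "fourier \<gamma> \<eta> = fourier k \<eta> * fourier k (- \<eta>)"
      unfolding \<gamma>_def using kc kKc kK' kc kKc kK' by (rule fourier_correlation)
    also have "fourier k (- \<eta>) = cnj (fourier k \<eta>)" by (rule fourier_real_minus[OF creal])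
    finally show ?thesis by (simp only: P_def complex_norm_square)
  qed
  obtain G where G: "G \<ge> 0" "\<And>x. norm (\<gamma> x) \<le> G"
    using continuous_compact_bounded[OF \<gamma>c \<gamma>K] by blast
  have step: "norm (LINT z|lborel. A z * of_real (P z)) \<le> G * (LINT \<eta>|lborel. norm (fourier A \<eta>))"
    if A: "integrable lborel A" "integrable lborel (fourier A)" for A
  proof -
    have "(LINT z|lborel. A z * of_real (P z)) = (LINT z|lborel. fourier A z * \<gamma> z)"
      using fourier_multiplication_formula[OF A(1) \<gamma>i] by (simp add: F\<gamma>)
    also have "norm \<dots> \<le> (LINT z|lborel. norm (fourier A z * \<gamma> z))" by (rule integral_norm_bound)
    also have "\<dots> \<le> (LINT z|lborel. G * norm (fourier A z))"
      by (rule integral_mono')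
        (use A(2) G in \<open>auto simp: norm_mult mult.commute intro: mult_right_mono\<close>)
    finally show ?thesis by simp
  qed
  show ?thesis
  proof (rule that[of "G / c0"])
    show "G / c0 \<ge> 0" using G(1) c0 by simp
    fix A :: "real^'n \<Rightarrow> complex" and K
    assume A: "continuous_on UNIV A" "compact K" "\<And>x. x \<notin> K \<Longrightarrow> A x = 0" and FA: "integrable lborel (fourier A)"
    obtain B where B: "\<And>x. norm (A x) \<le> B" using continuous_compact_bounded[OF A] by metis
    have [measurable]: "A \<in> borel_measurable borel" using A(1) by (rule borel_measurable_continuous_onI)
    have [measurable]: "fourier A \<in> borel_measurable borel" using FA by simp
    \<comment> \<open>The \<open>L\<^sup>1\<close> norm of the transform is invariant under dilation
      of \<open>A\<close>.\<close>
    have bound: "norm (LINT z|lborel. A (d *\<^sub>R z) * of_real (P z)) \<le> G * (LINT \<eta>|lborel. norm (fourier A \<eta>))"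
      if d: "d > 0" for d
    proof -
      have eq: "fourier (\<lambda>z. A (d *\<^sub>R z)) \<eta> = of_real (inverse d ^ CARD('n)) * fourier A (inverse d *\<^sub>R \<eta>)" for \<eta>
        using fourier_scale[of A "inverse d" 0 \<eta>] d by simp
      have "integrable lborel (\<lambda>\<eta>. fourier A (inverse d *\<^sub>R \<eta>))"
        using integral_scale_lborel(2)[of "inverse d" "fourier A" 0] d FA by simp
      then have "integrable lborel (fourier (\<lambda>z. A (d *\<^sub>R z)))" unfolding eq[abs_def] by simp
      moreover have "integrable lborel (\<lambda>z. A (d *\<^sub>R z))"
        using integral_scale_lborel(2)[of d A 0] d integrable_continuous_compact[OF A] by simp
      moreover have "(LINT \<eta>|lborel. norm (fourier (\<lambda>z. A (d *\<^sub>R z)) \<eta>)) = (LINT \<eta>|lborel. norm (fourier A \<eta>))"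
        using integral_scale_lborel(1)[of "inverse d" "\<lambda>\<eta>. norm (fourier A \<eta>)" 0] d
        by (simp add: eq norm_mult norm_power norm_inverse)
      ultimately show ?thesis using step[of "\<lambda>z. A (d *\<^sub>R z)"] by simp
    qed
    define h where "h n = 1 / real (Suc n)" for n
    have h: "h n > 0" for n by (simp add: h_def)
    have h0: "h \<longlonglongrightarrow> 0" unfolding h_def by (rule LIMSEQ_Suc) (rule lim_1_over_n)
    have "(\<lambda>n. LINT z|lborel. A (h n *\<^sub>R z) * of_real (P z)) \<longlonglongrightarrow> (LINT z|lborel. A 0 * of_real (P z))"
    proof (rule integral_dominated_convergence[where w = "\<lambda>z. B * P z"])
      show "integrable lborel (\<lambda>z. B * P z)" using Pi by simp
      have "(\<lambda>n. A (h n *\<^sub>R z) * of_real (P z)) \<longlonglongrightarrow> A 0 * of_real (P z)" for z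
      proof -
        have "(\<lambda>n. h n *\<^sub>R z) \<longlonglongrightarrow> 0 *\<^sub>R z" by (intro tendsto_intros h0)
        then have "(\<lambda>n. h n *\<^sub>R z) \<longlonglongrightarrow> 0" by simp
        moreover have "isCont A 0" using A(1) by (simp add: continuous_on_eq_continuous_at)
        ultimately have "(\<lambda>n. A (h n *\<^sub>R z)) \<longlonglongrightarrow> A 0" by (rule isCont_tendsto_compose[rotated])
        then show ?thesis by (intro tendsto_mult tendsto_const)
      qed
      then show "AE z in lborel. (\<lambda>n. A (h n *\<^sub>R z) * of_real (P z)) \<longlonglongrightarrow> A 0 * of_real (P z)" by simp
      have "norm (A (h n *\<^sub>R z) * of_real (P z)) \<le> B * P z" for z n
        unfolding norm_mult norm_of_real using B[of "h n *\<^sub>R z"] by (simp add: P_def mult_right_mono)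
      then show "AE z in lborel. norm (A (h n *\<^sub>R z) * of_real (P z)) \<le> B * P z" for n by simp
    qed simp_all
    then have "(\<lambda>n. norm (LINT z|lborel. A (h n *\<^sub>R z) * of_real (P z))) \<longlonglongrightarrow> norm (LINT z|lborel. A 0 * of_real (P z))"
      by (rule tendsto_norm)
    then have "norm (LINT z|lborel. A 0 * of_real (P z)) \<le> G * (LINT \<eta>|lborel. norm (fourier A \<eta>))"
      by (rule LIMSEQ_le_const2) (use bound[OF h] in blast)
    moreover have "(LINT z|lborel. A 0 * complex_of_real (P z)) = A 0 * of_real c0"
      by (simp add: c0_def)
    ultimately have "norm (A 0 * of_real c0) \<le> G * (LINT \<eta>|lborel. norm (fourier A \<eta>))"
      by (simp only:)
    then have "norm (A 0) * c0 \<le> G * (LINT \<eta>|lborel. norm (fourier A \<eta>))"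
      using c0 by (simp add: norm_mult)
    then show "norm (A 0) \<le> G / c0 * (LINT \<eta>|lborel. norm (fourier A \<eta>))"
      using c0 by (simp add: field_simps)
  qed
qed

text \<open>The value \<open>fourier (h g) \<xi>\<close> is the value at \<open>0\<close> of the
  correlation of \<open>h\<close> with the modulated function \<open>g\<close>, whose transform at
  \<open>\<eta>\<close> is \<open>fourier h \<eta>\<close> times \<open>fourier g (\<xi> -
  \<eta>)\<close>; the inversion bound applies to it.\<close>

lemma fourier_mult_bound:
  obtains C where "C \<ge> 0" and
    "\<And>(h :: real^'n \<Rightarrow> complex) g K L \<xi>. continuous_on UNIV h \<Longrightarrow> compact K \<Longrightarrow> (\<And>x. x \<notin> K \<Longrightarrow> h x = 0) \<Longrightarrow>
      continuous_on UNIV g \<Longrightarrow> compact L \<Longrightarrow> (\<And>x. x \<notin> L \<Longrightarrow> g x = 0) \<Longrightarrow> integrable lborel (fourier h) \<Longrightarrow>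
      norm (fourier (\<lambda>x. h x * g x) \<xi>) \<le> C * (LINT \<eta>|lborel. norm (fourier h \<eta>) * norm (fourier g (\<xi> - \<eta>)))"
proof -
  obtain C where C: "C \<ge> 0" and bound:
    "\<And>(A :: real^'n \<Rightarrow> complex) K. continuous_on UNIV A \<Longrightarrow> compact K \<Longrightarrow> (\<And>x. x \<notin> K \<Longrightarrow> A x = 0) \<Longrightarrow>
      integrable lborel (fourier A) \<Longrightarrow> norm (A 0) \<le> C * (LINT \<eta>|lborel. norm (fourier A \<eta>))"
    by (rule fourier_inversion_bound, rule that, assumption) blast
  show ?thesis
  proof (rule that[OF C])
    fix h g :: "real^'n \<Rightarrow> complex" and K L \<xi>
    assume h: "continuous_on UNIV h" "compact K" "\<And>x. x \<notin> K \<Longrightarrow> h x = 0"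
      and g: "continuous_on UNIV g" "compact L" "\<And>x. x \<notin> L \<Longrightarrow> g x = 0"
      and Fh: "integrable lborel (fourier h)"
    \<comment> \<open>Modulation moves the frequency \<open>\<xi>\<close> to
      \<open>0\<close>.\<close>
    define g' where "g' y = wave y \<xi> * g y" for y
    have g': "continuous_on UNIV g'" "\<And>x. x \<notin> L \<Longrightarrow> g' x = 0"
      unfolding g'_def by (intro continuous_intros g(1)) (simp add: g(3))
    have Fg': "fourier g' (- \<eta>) = fourier g (\<xi> - \<eta>)" for \<eta>
      unfolding fourier_wave g'_def using wave_add_right[of _ "- \<eta>" \<xi>] by (simp add: mult.assoc[symmetric])
    define A where "A = correlation h g'"
    have FA: "fourier A \<eta> = fourier h \<eta> * fourier g (\<xi> - \<eta>)" for \<eta>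
    proof -
      have "fourier A \<eta> = fourier h \<eta> * fourier g' (- \<eta>)"
        unfolding A_def using h g'(1) g(2) g'(2) by (rule fourier_correlation)
      then show ?thesis by (simp only: Fg')
    qed
    have "continuous_on UNIV A" unfolding A_def by (rule continuous_on_correlation[OF h g'(1) g(2) g'(2)])
    moreover have "compact {x - y |x y. x \<in> K \<and> y \<in> L}" by (intro compact_differences h(2) g(2))
    moreover have "\<And>x. x \<notin> {x - y |x y. x \<in> K \<and> y \<in> L} \<Longrightarrow> A x = 0"
      unfolding A_def by (rule correlation_eq_0[OF h(3) g'(2)])
    moreover have "integrable lborel (fourier A)"
    proof (rule Bochner_Integration.integrable_bound)
      let ?N = "LINT x|lborel. norm (g x)"
      show "integrable lborel (\<lambda>\<eta>. of_real ?N * fourier h \<eta>)" using Fh by simp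
      have [measurable]: "fourier h \<in> borel_measurable borel" using Fh by simp
      have [measurable]: "fourier g \<in> borel_measurable borel"
        using continuous_on_fourier[OF g] by (rule borel_measurable_continuous_onI)
      show "fourier A \<in> borel_measurable lborel" unfolding FA[abs_def] by measurable
      have "norm (fourier A \<eta>) \<le> norm (of_real ?N * fourier h \<eta>)" for \<eta>
        unfolding FA norm_mult norm_of_real using norm_fourier_le[of g "\<xi> - \<eta>"]
        by (subst mult.commute) (intro mult_right_mono; simp)
      then show "AE \<eta> in lborel. norm (fourier A \<eta>) \<le> norm (of_real ?N * fourier h \<eta>)" by simp
    qed
    ultimately have "norm (A 0) \<le> C * (LINT \<eta>|lborel. norm (fourier A \<eta>))" by (rule bound)
    moreover have "A 0 = fourier (\<lambda>x. h x * g x) \<xi>"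
      by (simp add: A_def correlation_def g'_def fourier_wave mult_ac)
    ultimately show "norm (fourier (\<lambda>x. h x * g x) \<xi>) \<le>
        C * (LINT \<eta>|lborel. norm (fourier h \<eta>) * norm (fourier g (\<xi> - \<eta>)))"
      by (simp add: FA norm_mult)
  qed
qed

text \<open>Cutting off at spatial scale \<open>s\<close> mixes frequencies at distance about
  \<open>1/s\<close> only: \<open>fourier g\<close> is averaged against a rapidly decreasing kernel
  of that width. The values within distance \<open>R\<close> of \<open>\<xi>\<close> contribute
  \<open>B1\<close>, all others are suppressed by \<open>(s R)\<^sup>-\<^sup>k\<close>. The constant
  depends on \<open>\<theta>\<close> and \<open>k\<close> only.\<close>

lemma fourier_localization:
  fixes \<theta> :: "real^'n \<Rightarrow> complex"
  assumes \<theta>: "smooth_on UNIV \<theta>" and K: "compact K" "\<And>x. x \<notin> K \<Longrightarrow> \<theta> x = 0"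
  obtains T where "T \<ge> 0" and
    "\<And>s c g L \<xi> R B1 B2. s > 0 \<Longrightarrow> R > 0 \<Longrightarrow> continuous_on UNIV g \<Longrightarrow> compact L \<Longrightarrow> (\<And>x. x \<notin> L \<Longrightarrow> g x = 0) \<Longrightarrow>
      (\<And>\<eta>. norm (\<eta> - \<xi>) \<le> R \<Longrightarrow> norm (fourier g \<eta>) \<le> B1) \<Longrightarrow> (\<And>\<eta>. norm (fourier g \<eta>) \<le> B2) \<Longrightarrow>
      norm (fourier (\<lambda>x. \<theta> (inverse s *\<^sub>R (x - c)) * g x) \<xi>) \<le> T * (B1 + B2 / (s * R) ^ k)"
proof -
  obtain C where C: "C \<ge> 0" and bound: "\<And>(h :: real^'n \<Rightarrow> complex) g K L \<xi>.
      continuous_on UNIV h \<Longrightarrow> compact K \<Longrightarrow> (\<And>x. x \<notin> K \<Longrightarrow> h x = 0) \<Longrightarrow>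
      continuous_on UNIV g \<Longrightarrow> compact L \<Longrightarrow> (\<And>x. x \<notin> L \<Longrightarrow> g x = 0) \<Longrightarrow> integrable lborel (fourier h) \<Longrightarrow>
      norm (fourier (\<lambda>x. h x * g x) \<xi>) \<le> C * (LINT \<eta>|lborel. norm (fourier h \<eta>) * norm (fourier g (\<xi> - \<eta>)))"
    using fourier_mult_bound by blast
  note \<theta>c = smooth_on_continuous_on[OF \<theta>]
  have [measurable]: "\<theta> \<in> borel_measurable borel" using \<theta>c by (rule borel_measurable_continuous_onI)
  have [measurable]: "fourier \<theta> \<in> borel_measurable borel"
    using continuous_on_fourier[OF \<theta>c K] by (rule borel_measurable_continuous_onI)
  define I where "I = (LINT \<zeta>|lborel. (1 + norm \<zeta>) ^ k * norm (fourier \<theta> \<zeta>))"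
  have I: "I \<ge> 0" unfolding I_def by (rule Bochner_Integration.integral_nonneg) simp
  show ?thesis
  proof (rule that[of "C * I"])
    show "C * I \<ge> 0" using C I by simp
    fix s R B1 B2 :: real and c \<xi> :: "real^'n" and g L
    assume s: "s > 0" and R: "R > 0" and g: "continuous_on UNIV g" "compact L" "\<And>x. x \<notin> L \<Longrightarrow> g x = 0"
      and B1: "\<And>\<eta>. norm (\<eta> - \<xi>) \<le> R \<Longrightarrow> norm (fourier g \<eta>) \<le> B1" and B2: "\<And>\<eta>. norm (fourier g \<eta>) \<le> B2"
    have B10: "B1 \<ge> 0" using order_trans[OF norm_ge_zero B1[of \<xi>]] R by simp
    have B20: "B2 \<ge> 0" using B2[of \<xi>] norm_ge_zero[of "fourier g \<xi>"] by linarith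
    define h where "h x = \<theta> (inverse s *\<^sub>R (x - c))" for x
    have Fh: "fourier h \<eta> = of_real (s ^ CARD('n)) * (wave c \<eta> * fourier \<theta> (s *\<^sub>R \<eta>))" for \<eta>
      unfolding h_def[abs_def] by (rule fourier_scale[OF _ s]) simp
    have hc: "continuous_on UNIV h"
      unfolding h_def by (rule continuous_on_compose2[OF \<theta>c]) (auto intro!: continuous_intros)
    have hK: "compact ((\<lambda>x. c + s *\<^sub>R x) ` K)"
      by (intro compact_continuous_image K(1) continuous_intros)
    have hK0: "h x = 0" if "x \<notin> (\<lambda>x. c + s *\<^sub>R x) ` K" for x
    proof -
      have "x = c + s *\<^sub>R (inverse s *\<^sub>R (x - c))" using s by simp
      then have "inverse s *\<^sub>R (x - c) \<notin> K" using that by (metis imageI)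
      then show ?thesis by (simp add: h_def K(2))
    qed
    have i\<theta>: "integrable lborel (\<lambda>\<eta>. fourier \<theta> (s *\<^sub>R \<eta>))"
      using integral_scale_lborel(2)[of s "fourier \<theta>" 0] s integrable_fourier[OF \<theta> K] by simp
    have iw: "integrable lborel (\<lambda>\<eta>. wave c \<eta> * fourier \<theta> (s *\<^sub>R \<eta>))"
      using integrable_wave[OF i\<theta>, of c] by (simp add: wave_commute[of c])
    then have ih: "integrable lborel (fourier h)" unfolding Fh[abs_def] by simp
    define a where "a = B1 + B2 / (s * R) ^ k"
    have a0: "a \<ge> 0" unfolding a_def using B10 B20 s R by simp
    \<comment> \<open>One bound for both ranges of \<open>\<eta>\<close>: the weight is at least
      \<open>1\<close>, and at least \<open>(s R)\<^sup>k\<close> outside the ball of radius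
      \<open>R\<close>.\<close>
    have pw: "norm (fourier g (\<xi> - \<eta>)) \<le> a * (1 + norm (s *\<^sub>R \<eta>)) ^ k" for \<eta>
    proof (cases "norm \<eta> \<le> R")
      case True
      have "norm (fourier g (\<xi> - \<eta>)) \<le> B1" using B1[of "\<xi> - \<eta>"] True by simp
      also have "B1 \<le> a" unfolding a_def using B20 s R by simp
      also have "\<dots> \<le> a * (1 + norm (s *\<^sub>R \<eta>)) ^ k" using a0 by (simp add: mult_left_le one_le_power mult_le_cancel_left1)
      finally show ?thesis .
    next
      case False
      have "norm (fourier g (\<xi> - \<eta>)) \<le> B2 / (s * R) ^ k * (s * R) ^ k" using B2 s R by simp
      also have "\<dots> \<le> a * (1 + norm (s *\<^sub>R \<eta>)) ^ k"
      proof (intro mult_mono power_mono)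
        have "s * R \<le> s * norm \<eta>" using False s by simp
        moreover have "norm (s *\<^sub>R \<eta>) = s * norm \<eta>" using s by simp
        ultimately show "s * R \<le> 1 + norm (s *\<^sub>R \<eta>)" by linarith
      qed (use a0 B10 s R in \<open>auto simp: a_def\<close>)
      finally show ?thesis .
    qed
    have iF: "integrable lborel (\<lambda>\<zeta>. (1 + norm \<zeta>) ^ k * norm (fourier \<theta> \<zeta>))"
      by (rule integrable_weight_fourier[OF \<theta> K])
    have iF': "integrable lborel (\<lambda>\<eta>. (1 + norm (s *\<^sub>R \<eta>)) ^ k * norm (fourier \<theta> (s *\<^sub>R \<eta>)))"
      using integral_scale_lborel(2)[of s "\<lambda>\<zeta>. (1 + norm \<zeta>) ^ k * norm (fourier \<theta> \<zeta>)" 0] s iF by simp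
    have "norm (fourier (\<lambda>x. h x * g x) \<xi>) \<le> C * (LINT \<eta>|lborel. norm (fourier h \<eta>) * norm (fourier g (\<xi> - \<eta>)))"
      by (rule bound[OF hc hK hK0 g ih])
    also have "\<dots> \<le> C * (a * I)"
    proof (rule mult_left_mono[OF _ C])
      have "(LINT \<eta>|lborel. norm (fourier h \<eta>) * norm (fourier g (\<xi> - \<eta>))) \<le>
          (LINT \<eta>|lborel. (a * s ^ CARD('n)) * ((1 + norm (s *\<^sub>R \<eta>)) ^ k * norm (fourier \<theta> (s *\<^sub>R \<eta>))))"
      proof (rule integral_mono')
        show "integrable lborel (\<lambda>\<eta>. (a * s ^ CARD('n)) * ((1 + norm (s *\<^sub>R \<eta>)) ^ k * norm (fourier \<theta> (s *\<^sub>R \<eta>))))"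
          using iF' by simp
        fix \<eta> :: "real^'n"
        have n: "norm (fourier h \<eta>) = s ^ CARD('n) * norm (fourier \<theta> (s *\<^sub>R \<eta>))"
          using s by (simp add: Fh norm_mult norm_power)
        have "norm (fourier h \<eta>) * norm (fourier g (\<xi> - \<eta>)) \<le>
            (s ^ CARD('n) * norm (fourier \<theta> (s *\<^sub>R \<eta>))) * (a * (1 + norm (s *\<^sub>R \<eta>)) ^ k)"
          unfolding n by (rule mult_left_mono[OF pw]) (use s in simp)
        then show "norm (fourier h \<eta>) * norm (fourier g (\<xi> - \<eta>)) \<le>
            (a * s ^ CARD('n)) * ((1 + norm (s *\<^sub>R \<eta>)) ^ k * norm (fourier \<theta> (s *\<^sub>R \<eta>)))"
          by (simp only: mult_ac)
        show "0 \<le> (a * s ^ CARD('n)) * ((1 + norm (s *\<^sub>R \<eta>)) ^ k * norm (fourier \<theta> (s *\<^sub>R \<eta>)))"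
          using a0 s by simp
      qed
      also have "\<dots> = a * I"
        using integral_scale_lborel(1)[of s "\<lambda>\<zeta>. (1 + norm \<zeta>) ^ k * norm (fourier \<theta> \<zeta>)" 0] s
        by (simp add: I_def)
      finally show "(LINT \<eta>|lborel. norm (fourier h \<eta>) * norm (fourier g (\<xi> - \<eta>))) \<le> a * I" .
    qed
    finally show "norm (fourier (\<lambda>x. \<theta> (inverse s *\<^sub>R (x - c)) * g x) \<xi>) \<le> C * I * (B1 + B2 / (s * R) ^ k)"
      by (simp add: h_def a_def algebra_simps)
  qed
qed

section \<open>Moderate and null nets of smooth functions\<close>

lemma pderivs_add:
  fixes f g :: "real^'n \<Rightarrow> complex"
  assumes "open S" "smooth_on S f" "smooth_on S g" "x \<in> S"
  shows "pderivs is (\<lambda>x. f x + g x) x = pderivs is f x + pderivs is g x"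
  using assms(4)
proof (induction "is" arbitrary: x)
  case (Cons i "is")
  have d: "pderivs is f differentiable (at x)" "pderivs is g differentiable (at x)"
    using assms(2,3) Cons.prems by (auto simp: smooth_on_def)
  have "pderiv_at i (pderivs is (\<lambda>x. f x + g x)) x =
      pderiv_at i (\<lambda>x. pderivs is f x + pderivs is g x) x"
    by (rule pderiv_at_cong_open[OF assms(1) Cons.prems]) (rule Cons.IH)
  also have "\<dots> = pderiv_at i (pderivs is f) x + pderiv_at i (pderivs is g) x"
    using d by (rule pderiv_at_add)
  finally show ?case by simp
qed simp

lemma eventually_small: "c > 0 \<Longrightarrow> \<forall>\<^sub>F \<epsilon> in at_right (0::real). 0 < \<epsilon> \<and> \<epsilon> < c"
  using eventually_at_right_real[of 0 c] by (auto elim: eventually_mono)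

text \<open>Moderateness and negligibility of the uniform norm on \<open>K\<close>, the conditions
  occurring in \<^const>\<open>moderate_nets\<close> and \<^const>\<open>null_nets\<close> for one
  \<open>K\<close> and one derivative.\<close>

definition moderate_on :: "'a set \<Rightarrow> (real \<Rightarrow> 'a \<Rightarrow> complex) \<Rightarrow> bool" where
  "moderate_on K f \<longleftrightarrow> (\<exists>N::nat. sup_bigo K f (\<lambda>\<epsilon>. inverse \<epsilon> ^ N))"

definition null_on :: "'a set \<Rightarrow> (real \<Rightarrow> 'a \<Rightarrow> complex) \<Rightarrow> bool" where
  "null_on K f \<longleftrightarrow> (\<forall>n::nat. sup_bigo K f (\<lambda>\<epsilon>. \<epsilon> ^ n))"

lemma sup_bigoI: "\<forall>\<^sub>F \<epsilon> in at_right 0. \<forall>x\<in>A. norm (f \<epsilon> x) \<le> C * g \<epsilon> \<Longrightarrow> sup_bigo A f g"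
  unfolding sup_bigo_def by blast

lemma absorb_const_inverse:
  fixes C :: real
  shows "\<forall>\<^sub>F \<epsilon> in at_right 0. C * inverse \<epsilon> ^ N \<le> inverse \<epsilon> ^ Suc N"
proof -
  have "0 < 1 / (\<bar>C\<bar> + 1)" by simp
  from eventually_small[OF this] show ?thesis
  proof eventually_elim
    case (elim \<epsilon>)
    have "\<epsilon> * (\<bar>C\<bar> + 1) < 1" using elim by (simp add: field_simps)
    then have "\<bar>C\<bar> + 1 \<le> inverse \<epsilon>" using elim by (simp add: field_simps)
    then have "C \<le> inverse \<epsilon>" by linarith
    then show ?case using elim by (simp add: mult_right_mono)
  qed
qed

lemma absorb_const_power:
  fixes C :: real
  shows "\<forall>\<^sub>F \<epsilon> in at_right 0. C * \<epsilon> ^ Suc n \<le> \<epsilon> ^ n"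
proof -
  have "0 < 1 / (\<bar>C\<bar> + 1)" by simp
  from eventually_small[OF this] show ?thesis
  proof eventually_elim
    case (elim \<epsilon>)
    have "\<epsilon> * (\<bar>C\<bar> + 1) < 1" using elim by (simp add: field_simps)
    moreover have "C * \<epsilon> \<le> \<epsilon> * (\<bar>C\<bar> + 1)"
      using elim by (subst mult.commute) (intro mult_left_mono; linarith)
    ultimately have "C * \<epsilon> \<le> 1" by linarith
    then have "(C * \<epsilon>) * \<epsilon> ^ n \<le> 1 * \<epsilon> ^ n" using elim by (intro mult_right_mono) auto
    then show ?case by (simp add: mult.assoc)
  qed
qed

text \<open>Constants are absorbed by one more power of \<open>1/\<epsilon>\<close> (or
  \<open>\<epsilon>\<close>), so they can be dropped from the definitions. All later estimates use
  these forms.\<close>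

lemma moderate_on_iff: "moderate_on K f \<longleftrightarrow> (\<exists>N::nat. \<forall>\<^sub>F \<epsilon> in at_right 0. \<forall>x\<in>K. norm (f \<epsilon> x) \<le> inverse \<epsilon> ^ N)"
proof
  assume "moderate_on K f"
  then obtain N C where "\<forall>\<^sub>F \<epsilon> in at_right 0. \<forall>x\<in>K. norm (f \<epsilon> x) \<le> C * inverse \<epsilon> ^ N"
    unfolding moderate_on_def sup_bigo_def by blast
  with absorb_const_inverse[of C N]
  have "\<forall>\<^sub>F \<epsilon> in at_right 0. \<forall>x\<in>K. norm (f \<epsilon> x) \<le> inverse \<epsilon> ^ Suc N"
    by eventually_elim (blast intro: order_trans)
  then show "\<exists>N::nat. \<forall>\<^sub>F \<epsilon> in at_right 0. \<forall>x\<in>K. norm (f \<epsilon> x) \<le> inverse \<epsilon> ^ N" by blast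
next
  assume "\<exists>N::nat. \<forall>\<^sub>F \<epsilon> in at_right 0. \<forall>x\<in>K. norm (f \<epsilon> x) \<le> inverse \<epsilon> ^ N"
  then obtain N where "\<forall>\<^sub>F \<epsilon> in at_right 0. \<forall>x\<in>K. norm (f \<epsilon> x) \<le> 1 * inverse \<epsilon> ^ N" by auto
  then show "moderate_on K f" unfolding moderate_on_def by (intro exI sup_bigoI)
qed

lemma null_on_iff: "null_on K f \<longleftrightarrow> (\<forall>n::nat. \<forall>\<^sub>F \<epsilon> in at_right 0. \<forall>x\<in>K. norm (f \<epsilon> x) \<le> \<epsilon> ^ n)"
proof
  assume a: "null_on K f"
  show "\<forall>n::nat. \<forall>\<^sub>F \<epsilon> in at_right 0. \<forall>x\<in>K. norm (f \<epsilon> x) \<le> \<epsilon> ^ n"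
  proof
    fix n
    obtain C where "\<forall>\<^sub>F \<epsilon> in at_right 0. \<forall>x\<in>K. norm (f \<epsilon> x) \<le> C * \<epsilon> ^ Suc n"
      using a unfolding null_on_def sup_bigo_def by blast
    with absorb_const_power[of C n]
    show "\<forall>\<^sub>F \<epsilon> in at_right 0. \<forall>x\<in>K. norm (f \<epsilon> x) \<le> \<epsilon> ^ n"
      by eventually_elim (blast intro: order_trans)
  qed
next
  assume a: "\<forall>n::nat. \<forall>\<^sub>F \<epsilon> in at_right 0. \<forall>x\<in>K. norm (f \<epsilon> x) \<le> \<epsilon> ^ n"
  show "null_on K f" unfolding null_on_def
  proof
    fix n :: nat
    have "\<forall>\<^sub>F \<epsilon> in at_right 0. \<forall>x\<in>K. norm (f \<epsilon> x) \<le> 1 * \<epsilon> ^ n" using a by simp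
    then show "sup_bigo K f (\<lambda>\<epsilon>. \<epsilon> ^ n)" by (rule sup_bigoI)
  qed
qed

lemma bigo_real_iff:
  fixes x :: "real \<Rightarrow> 'a::real_normed_vector"
  assumes "\<forall>\<^sub>F \<epsilon> in at_right 0. g \<epsilon> \<ge> (0::real)"
  shows "(\<lambda>\<epsilon>. norm (x \<epsilon>)) \<in> O[at_right 0](g) \<longleftrightarrow> (\<exists>C. \<forall>\<^sub>F \<epsilon> in at_right 0. norm (x \<epsilon>) \<le> C * g \<epsilon>)"
proof
  assume "(\<lambda>\<epsilon>. norm (x \<epsilon>)) \<in> O[at_right 0](g)"
  then obtain C where "\<forall>\<^sub>F \<epsilon> in at_right 0. norm (norm (x \<epsilon>)) \<le> C * norm (g \<epsilon>)"
    by (rule landau_o.bigE)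
  with assms have "\<forall>\<^sub>F \<epsilon> in at_right 0. norm (x \<epsilon>) \<le> C * g \<epsilon>"
    by eventually_elim simp
  then show "\<exists>C. \<forall>\<^sub>F \<epsilon> in at_right 0. norm (x \<epsilon>) \<le> C * g \<epsilon>" ..
next
  assume "\<exists>C. \<forall>\<^sub>F \<epsilon> in at_right 0. norm (x \<epsilon>) \<le> C * g \<epsilon>"
  then obtain C where "\<forall>\<^sub>F \<epsilon> in at_right 0. norm (x \<epsilon>) \<le> C * g \<epsilon>" ..
  with assms have "\<forall>\<^sub>F \<epsilon> in at_right 0. norm (norm (x \<epsilon>)) \<le> C * norm (g \<epsilon>)"
    by eventually_elim simp
  then show "(\<lambda>\<epsilon>. norm (x \<epsilon>)) \<in> O[at_right 0](g)" by (rule bigoI)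
qed

lemma eventually_pos: "\<forall>\<^sub>F \<epsilon> in at_right (0::real). 0 < \<epsilon>"
  using eventually_small[of 1] by (auto elim: eventually_mono)

lemma gmoderate_iff:
  fixes x :: "real \<Rightarrow> 'a::real_normed_vector"
  shows "gmoderate x \<longleftrightarrow> (\<exists>N::nat. \<forall>\<^sub>F \<epsilon> in at_right 0. norm (x \<epsilon>) \<le> inverse \<epsilon> ^ N)"
proof -
  have pos: "\<forall>\<^sub>F \<epsilon> in at_right 0. inverse \<epsilon> ^ N \<ge> (0::real)" for N
    using eventually_pos by eventually_elim simp
  have "gmoderate x \<longleftrightarrow> moderate_on UNIV (\<lambda>\<epsilon> (_::unit). of_real (norm (x \<epsilon>)))"
    unfolding gmoderate_def moderate_on_def sup_bigo_def by (simp add: bigo_real_iff[OF pos])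
  then show ?thesis unfolding moderate_on_iff by simp
qed

lemma gnegligible_iff:
  fixes x :: "real \<Rightarrow> 'a::real_normed_vector"
  shows "gnegligible x \<longleftrightarrow> (\<forall>n::nat. \<forall>\<^sub>F \<epsilon> in at_right 0. norm (x \<epsilon>) \<le> \<epsilon> ^ n)"
proof -
  have pos: "\<forall>\<^sub>F \<epsilon> in at_right 0. \<epsilon> ^ N \<ge> (0::real)" for N
    using eventually_pos by eventually_elim simp
  have "gnegligible x \<longleftrightarrow> null_on UNIV (\<lambda>\<epsilon> (_::unit). of_real (norm (x \<epsilon>)))"
    unfolding gnegligible_def null_on_def sup_bigo_def by (simp add: bigo_real_iff[OF pos])
  then show ?thesis unfolding null_on_iff by simp
qed

lemma moderate_on_mult:
  assumes "moderate_on K f" "moderate_on K g" shows "moderate_on K (\<lambda>\<epsilon> x. f \<epsilon> x * g \<epsilon> x)"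
proof -
  obtain N M where N: "\<forall>\<^sub>F \<epsilon> in at_right 0. \<forall>x\<in>K. norm (f \<epsilon> x) \<le> inverse \<epsilon> ^ N"
    and M: "\<forall>\<^sub>F \<epsilon> in at_right 0. \<forall>x\<in>K. norm (g \<epsilon> x) \<le> inverse \<epsilon> ^ M"
    using assms unfolding moderate_on_iff by blast
  have "\<forall>\<^sub>F \<epsilon> in at_right 0. \<forall>x\<in>K. norm (f \<epsilon> x * g \<epsilon> x) \<le> inverse \<epsilon> ^ (N + M)"
    using N M eventually_pos
    by eventually_elim (auto simp: norm_mult power_add intro!: mult_mono)
  then show ?thesis unfolding moderate_on_iff by blast
qed

lemma moderate_on_add:
  assumes "moderate_on K f" "moderate_on K g" shows "moderate_on K (\<lambda>\<epsilon> x. f \<epsilon> x + g \<epsilon> x)"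
proof -
  obtain N M where N: "\<forall>\<^sub>F \<epsilon> in at_right 0. \<forall>x\<in>K. norm (f \<epsilon> x) \<le> inverse \<epsilon> ^ N"
    and M: "\<forall>\<^sub>F \<epsilon> in at_right 0. \<forall>x\<in>K. norm (g \<epsilon> x) \<le> inverse \<epsilon> ^ M"
    using assms unfolding moderate_on_iff by blast
  have "\<forall>\<^sub>F \<epsilon> in at_right 0. \<forall>x\<in>K. norm (f \<epsilon> x + g \<epsilon> x) \<le> 2 * inverse \<epsilon> ^ max N M"
    using N M eventually_small[OF zero_less_one]
  proof eventually_elim
    case (elim \<epsilon>)
    have "1 \<le> inverse \<epsilon>" using elim(3) by (simp add: one_le_inverse)
    then have "inverse \<epsilon> ^ N \<le> inverse \<epsilon> ^ max N M" "inverse \<epsilon> ^ M \<le> inverse \<epsilon> ^ max N M"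
      by (auto intro!: power_increasing)
    then show ?case
      using elim(1,2) norm_triangle_ineq[of "f \<epsilon> x" "g \<epsilon> x" for x] by (smt (verit) norm_triangle_ineq)
  qed
  then show ?thesis unfolding moderate_on_def by (intro exI sup_bigoI)
qed

lemma null_on_add:
  assumes "null_on K f" "null_on K g" shows "null_on K (\<lambda>\<epsilon> x. f \<epsilon> x + g \<epsilon> x)"
  unfolding null_on_def
proof
  fix n
  have "\<forall>\<^sub>F \<epsilon> in at_right 0. \<forall>x\<in>K. norm (f \<epsilon> x) \<le> \<epsilon> ^ n"
    "\<forall>\<^sub>F \<epsilon> in at_right 0. \<forall>x\<in>K. norm (g \<epsilon> x) \<le> \<epsilon> ^ n"
    using assms unfolding null_on_iff by blast+
  then have "\<forall>\<^sub>F \<epsilon> in at_right 0. \<forall>x\<in>K. norm (f \<epsilon> x + g \<epsilon> x) \<le> 2 * \<epsilon> ^ n"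
    by eventually_elim (smt (verit) norm_triangle_ineq)
  then show "sup_bigo K (\<lambda>\<epsilon> x. f \<epsilon> x + g \<epsilon> x) (\<lambda>\<epsilon>. \<epsilon> ^ n)" by (rule sup_bigoI)
qed

lemma null_on_mult:
  assumes "null_on K f" "moderate_on K g" shows "null_on K (\<lambda>\<epsilon> x. f \<epsilon> x * g \<epsilon> x)"
  unfolding null_on_iff
proof
  fix n
  obtain M where M: "\<forall>\<^sub>F \<epsilon> in at_right 0. \<forall>x\<in>K. norm (g \<epsilon> x) \<le> inverse \<epsilon> ^ M"
    using assms(2) unfolding moderate_on_iff by blast
  have N: "\<forall>\<^sub>F \<epsilon> in at_right 0. \<forall>x\<in>K. norm (f \<epsilon> x) \<le> \<epsilon> ^ (n + M)"
    using assms(1) unfolding null_on_iff by blast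
  show "\<forall>\<^sub>F \<epsilon> in at_right 0. \<forall>x\<in>K. norm (f \<epsilon> x * g \<epsilon> x) \<le> \<epsilon> ^ n"
    using N M eventually_pos
  proof eventually_elim
    case (elim \<epsilon>)
    have "\<epsilon> ^ (n + M) * inverse \<epsilon> ^ M = \<epsilon> ^ n" using elim(3) by (simp add: power_add power_inverse)
    moreover have "norm (f \<epsilon> x * g \<epsilon> x) \<le> \<epsilon> ^ (n + M) * inverse \<epsilon> ^ M" if "x \<in> K" for x
      unfolding norm_mult using elim that by (intro mult_mono) auto
    ultimately show ?case by simp
  qed
qed

lemma eventually_unit: "\<forall>\<^sub>F \<epsilon> in at_right (0::real). \<epsilon> \<in> {0<..1}"
  using eventually_small[of 1] by (auto elim: eventually_mono)

lemma moderate_on_cong: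
  assumes "\<And>\<epsilon> x. \<epsilon> \<in> {0<..1} \<Longrightarrow> x \<in> K \<Longrightarrow> f \<epsilon> x = g \<epsilon> x" "moderate_on K f"
  shows "moderate_on K g"
proof -
  obtain N where "\<forall>\<^sub>F \<epsilon> in at_right 0. \<forall>x\<in>K. norm (f \<epsilon> x) \<le> inverse \<epsilon> ^ N"
    using assms(2) unfolding moderate_on_iff by blast
  with eventually_unit have "\<forall>\<^sub>F \<epsilon> in at_right 0. \<forall>x\<in>K. norm (g \<epsilon> x) \<le> inverse \<epsilon> ^ N"
    by eventually_elim (simp add: assms(1))
  then show ?thesis unfolding moderate_on_iff by blast
qed

lemma null_on_cong:
  assumes "\<And>\<epsilon> x. \<epsilon> \<in> {0<..1} \<Longrightarrow> x \<in> K \<Longrightarrow> f \<epsilon> x = g \<epsilon> x" "null_on K f"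
  shows "null_on K g"
  unfolding null_on_iff
proof
  fix n
  have "\<forall>\<^sub>F \<epsilon> in at_right 0. \<forall>x\<in>K. norm (f \<epsilon> x) \<le> \<epsilon> ^ n"
    using assms(2) unfolding null_on_iff by blast
  with eventually_unit show "\<forall>\<^sub>F \<epsilon> in at_right 0. \<forall>x\<in>K. norm (g \<epsilon> x) \<le> \<epsilon> ^ n"
    by eventually_elim (simp add: assms(1))
qed

lemma moderate_on_bounded:
  assumes "\<And>x. x \<in> K \<Longrightarrow> norm (f x) \<le> C" shows "moderate_on K (\<lambda>_. f)"
  unfolding moderate_on_def by (rule exI[of _ 0], rule sup_bigoI[of _ _ C]) (use assms in simp)

lemma null_on_zero: "null_on K (\<lambda>_ _. 0)"
  unfolding null_on_def by (intro allI sup_bigoI[of _ _ 0]) simp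

lemma null_on_UN:
  assumes "finite D" "\<And>i. i \<in> D \<Longrightarrow> null_on (L i) f" "K \<subseteq> (\<Union>i\<in>D. L i)"
  shows "null_on K f"
  unfolding null_on_iff
proof
  fix n
  have "\<forall>\<^sub>F \<epsilon> in at_right 0. \<forall>i\<in>D. \<forall>x\<in>L i. norm (f \<epsilon> x) \<le> \<epsilon> ^ n"
    using assms(2) unfolding null_on_iff by (intro eventually_ball_finite assms(1)) blast
  then show "\<forall>\<^sub>F \<epsilon> in at_right 0. \<forall>x\<in>K. norm (f \<epsilon> x) \<le> \<epsilon> ^ n"
    by eventually_elim (use assms(3) in blast)
qed

text \<open>The Leibniz rule without its formula. If some class of nets contains all derivatives of
  \<open>u\<close>, another one all those of \<open>v\<close>, and products land in a third class
  closed under sums, then that class contains all derivatives of \<open>u v\<close>: peel off the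
  innermost derivative, which replaces \<open>u v\<close> by \<open>u' v + u v'\<close>.\<close>

lemma pderivs_mult_predicates:
  fixes u v :: "real \<Rightarrow> real^'n \<Rightarrow> complex"
  assumes "open \<Omega>"
    and mult: "\<And>f g. P f \<Longrightarrow> Q g \<Longrightarrow> R (\<lambda>\<epsilon> x. f \<epsilon> x * g \<epsilon> x)"
    and add: "\<And>f g. R f \<Longrightarrow> R g \<Longrightarrow> R (\<lambda>\<epsilon> x. f \<epsilon> x + g \<epsilon> x)"
    and cong: "\<And>f g. (\<And>\<epsilon> x. \<epsilon> \<in> {0<..1::real} \<Longrightarrow> x \<in> \<Omega> \<Longrightarrow> f \<epsilon> x = g \<epsilon> x) \<Longrightarrow> R f \<Longrightarrow> R g"
    and "\<And>\<epsilon>. \<epsilon> \<in> {0<..1} \<Longrightarrow> smooth_on \<Omega> (u \<epsilon>)" "\<And>\<epsilon>. \<epsilon> \<in> {0<..1} \<Longrightarrow> smooth_on \<Omega> (v \<epsilon>)"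
    and "\<And>js. P (\<lambda>\<epsilon>. pderivs js (u \<epsilon>))" "\<And>js. Q (\<lambda>\<epsilon>. pderivs js (v \<epsilon>))"
  shows "R (\<lambda>\<epsilon>. pderivs is (\<lambda>x. u \<epsilon> x * v \<epsilon> x))"
  using assms(5-8)
proof (induction "is" arbitrary: u v rule: rev_induct)
  case Nil
  show ?case using mult[OF Nil(3)[of "[]"] Nil(4)[of "[]"]] by (simp only: pderivs.simps)
next
  case (snoc i "is")
  let ?u = "\<lambda>\<epsilon>. pderiv_at i (u \<epsilon>)" and ?v = "\<lambda>\<epsilon>. pderiv_at i (v \<epsilon>)"
  have su: "\<And>\<epsilon>. \<epsilon> \<in> {0<..1} \<Longrightarrow> smooth_on \<Omega> (?u \<epsilon>)" and sv: "\<And>\<epsilon>. \<epsilon> \<in> {0<..1} \<Longrightarrow> smooth_on \<Omega> (?v \<epsilon>)"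
    using snoc.prems(1,2) by (auto intro: smooth_on_pderiv_at)
  have pu: "P (\<lambda>\<epsilon>. pderivs js (?u \<epsilon>))" and pv: "Q (\<lambda>\<epsilon>. pderivs js (?v \<epsilon>))" for js
    using snoc.prems(3)[of "js @ [i]"] snoc.prems(4)[of "js @ [i]"] by (simp_all add: pderivs_append)
  have 1: "R (\<lambda>\<epsilon>. pderivs is (\<lambda>x. ?u \<epsilon> x * v \<epsilon> x))"
    by (rule snoc.IH[OF su snoc.prems(2) pu snoc.prems(4)])
  have 2: "R (\<lambda>\<epsilon>. pderivs is (\<lambda>x. u \<epsilon> x * ?v \<epsilon> x))"
    by (rule snoc.IH[OF snoc.prems(1) sv snoc.prems(3) pv])
  show ?case
  proof (rule cong[OF _ add[OF 1 2]])
    fix \<epsilon> :: real and x assume e: "\<epsilon> \<in> {0<..1}" and x: "x \<in> \<Omega>"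
    have "pderivs is (pderiv_at i (\<lambda>x. u \<epsilon> x * v \<epsilon> x)) x =
        pderivs is (\<lambda>x. ?u \<epsilon> x * v \<epsilon> x + u \<epsilon> x * ?v \<epsilon> x) x"
      by (rule pderivs_cong_open[OF assms(1) _ x])
        (use snoc.prems(1,2)[OF e] in \<open>auto intro!: pderiv_at_mult dest: smooth_on_differentiable\<close>)
    also have "\<dots> = pderivs is (\<lambda>x. ?u \<epsilon> x * v \<epsilon> x) x + pderivs is (\<lambda>x. u \<epsilon> x * ?v \<epsilon> x) x"
      using e su sv snoc.prems(1,2) by (intro pderivs_add[OF assms(1) _ _ x] smooth_on_mult[OF assms(1)]) auto
    finally show "pderivs is (\<lambda>x. ?u \<epsilon> x * v \<epsilon> x) x + pderivs is (\<lambda>x. u \<epsilon> x * ?v \<epsilon> x) x =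
        pderivs (is @ [i]) (\<lambda>x. u \<epsilon> x * v \<epsilon> x) x"
      by (simp add: pderivs_append)
  qed
qed

lemma moderate_nets_iff:
  "u \<in> moderate_nets \<Omega> \<longleftrightarrow> (\<forall>\<epsilon>\<in>{0<..1}. smooth_on \<Omega> (u \<epsilon>)) \<and>
    (\<forall>K is. compact K \<longrightarrow> K \<subseteq> \<Omega> \<longrightarrow> moderate_on K (\<lambda>\<epsilon>. pderivs is (u \<epsilon>)))"
  unfolding moderate_nets_def moderate_on_def by blast

lemma null_nets_iff:
  "u \<in> null_nets \<Omega> \<longleftrightarrow> (\<forall>\<epsilon>\<in>{0<..1}. smooth_on \<Omega> (u \<epsilon>)) \<and>
    (\<forall>K is. compact K \<longrightarrow> K \<subseteq> \<Omega> \<longrightarrow> null_on K (\<lambda>\<epsilon>. pderivs is (u \<epsilon>)))"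
  unfolding null_nets_def null_on_def by blast

lemma moderate_nets_moderate_on:
  "u \<in> moderate_nets \<Omega> \<Longrightarrow> compact K \<Longrightarrow> K \<subseteq> \<Omega> \<Longrightarrow> moderate_on K (\<lambda>\<epsilon>. pderivs is (u \<epsilon>))"
  by (simp add: moderate_nets_iff)

lemma null_nets_null_on:
  "u \<in> null_nets \<Omega> \<Longrightarrow> compact K \<Longrightarrow> K \<subseteq> \<Omega> \<Longrightarrow> null_on K (\<lambda>\<epsilon>. pderivs is (u \<epsilon>))"
  by (simp add: null_nets_iff)

lemma moderate_nets_smooth_on:
  "u \<in> moderate_nets \<Omega> \<Longrightarrow> \<epsilon> \<in> {0<..1} \<Longrightarrow> smooth_on \<Omega> (u \<epsilon>)"
  by (simp add: moderate_nets_iff)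

lemma null_nets_smooth_on:
  "u \<in> null_nets \<Omega> \<Longrightarrow> \<epsilon> \<in> {0<..1} \<Longrightarrow> smooth_on \<Omega> (u \<epsilon>)"
  by (simp add: null_nets_iff)

lemma moderate_nets_mult:
  assumes "open \<Omega>" "u \<in> moderate_nets \<Omega>" "v \<in> moderate_nets \<Omega>"
  shows "(\<lambda>\<epsilon> x. u \<epsilon> x * v \<epsilon> x) \<in> moderate_nets \<Omega>"
  unfolding moderate_nets_iff
proof (intro conjI allI impI ballI)
  fix K "is" assume K: "compact K" "K \<subseteq> \<Omega>"
  show "moderate_on K (\<lambda>\<epsilon>. pderivs is (\<lambda>x. u \<epsilon> x * v \<epsilon> x))"
  proof (rule pderivs_mult_predicates[OF assms(1)])
    show "moderate_on K (\<lambda>\<epsilon> x. f \<epsilon> x * g \<epsilon> x)" if "moderate_on K f" "moderate_on K g" for f g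
      using that by (rule moderate_on_mult)
    show "moderate_on K (\<lambda>\<epsilon> x. f \<epsilon> x + g \<epsilon> x)" if "moderate_on K f" "moderate_on K g" for f g
      using that by (rule moderate_on_add)
    show "moderate_on K g" if "\<And>\<epsilon> x. \<epsilon> \<in> {0<..1} \<Longrightarrow> x \<in> \<Omega> \<Longrightarrow> f \<epsilon> x = g \<epsilon> x" "moderate_on K f" for f g
      using K(2) by (intro moderate_on_cong[OF _ that(2)] that(1)) auto
    show "moderate_on K (\<lambda>\<epsilon>. pderivs js (u \<epsilon>))" "moderate_on K (\<lambda>\<epsilon>. pderivs js (v \<epsilon>))" for js
      using assms(2,3) K unfolding moderate_nets_iff null_nets_iff by blast+
  qed (use assms(2,3) in \<open>auto simp: moderate_nets_iff null_nets_iff\<close>)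
qed (use assms in \<open>auto simp: moderate_nets_iff intro: smooth_on_mult\<close>)

lemma null_nets_mult:
  assumes "open \<Omega>" "u \<in> null_nets \<Omega>" "v \<in> moderate_nets \<Omega>"
  shows "(\<lambda>\<epsilon> x. u \<epsilon> x * v \<epsilon> x) \<in> null_nets \<Omega>"
  unfolding null_nets_iff
proof (intro conjI allI impI ballI)
  fix K "is" assume K: "compact K" "K \<subseteq> \<Omega>"
  show "null_on K (\<lambda>\<epsilon>. pderivs is (\<lambda>x. u \<epsilon> x * v \<epsilon> x))"
  proof (rule pderivs_mult_predicates[OF assms(1)])
    show "null_on K (\<lambda>\<epsilon> x. f \<epsilon> x * g \<epsilon> x)" if "null_on K f" "moderate_on K g" for f g
      using that by (rule null_on_mult)
    show "null_on K (\<lambda>\<epsilon> x. f \<epsilon> x + g \<epsilon> x)" if "null_on K f" "null_on K g" for f g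
      using that by (rule null_on_add)
    show "null_on K g" if "\<And>\<epsilon> x. \<epsilon> \<in> {0<..1} \<Longrightarrow> x \<in> \<Omega> \<Longrightarrow> f \<epsilon> x = g \<epsilon> x" "null_on K f" for f g
      using K(2) by (intro null_on_cong[OF _ that(2)] that(1)) auto
    show "null_on K (\<lambda>\<epsilon>. pderivs js (u \<epsilon>))" "moderate_on K (\<lambda>\<epsilon>. pderivs js (v \<epsilon>))" for js
      using assms(2,3) K unfolding moderate_nets_iff null_nets_iff by blast+
  qed (use assms(2,3) in \<open>auto simp: moderate_nets_iff null_nets_iff\<close>)
qed (use assms in \<open>auto simp: null_nets_iff moderate_nets_iff intro: smooth_on_mult\<close>)

lemma moderate_nets_const:
  assumes "smooth_on \<Omega> f" shows "(\<lambda>_. f) \<in> moderate_nets \<Omega>"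
  unfolding moderate_nets_iff
proof (intro conjI allI impI ballI)
  fix K "is" assume K: "compact K" "K \<subseteq> \<Omega>"
  obtain C where "\<And>x. x \<in> K \<Longrightarrow> norm (pderivs is f x) \<le> C"
    using compact_norm_bound[OF K(1) continuous_on_subset[OF smooth_on_continuous_pderivs[OF assms] K(2)]] by blast
  then show "moderate_on K (\<lambda>_. pderivs is f)" by (rule moderate_on_bounded)
qed (rule assms)

lemma null_nets_add:
  assumes "open \<Omega>" "u \<in> null_nets \<Omega>" "v \<in> null_nets \<Omega>"
  shows "(\<lambda>\<epsilon> x. u \<epsilon> x + v \<epsilon> x) \<in> null_nets \<Omega>"
  unfolding null_nets_iff
proof (intro conjI allI impI ballI)
  fix K "is" assume K: "compact K" "K \<subseteq> \<Omega>"
  have "null_on K (\<lambda>\<epsilon> x. pderivs is (u \<epsilon>) x + pderivs is (v \<epsilon>) x)"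
    using assms(2,3) K by (intro null_on_add) (auto simp: null_nets_iff)
  then show "null_on K (\<lambda>\<epsilon>. pderivs is (\<lambda>x. u \<epsilon> x + v \<epsilon> x))"
    by (rule null_on_cong[rotated])
      (use assms(2,3) K in \<open>auto simp: null_nets_iff intro!: pderivs_add[OF assms(1), symmetric]\<close>)
qed (use assms in \<open>auto simp: null_nets_iff intro: smooth_on_add\<close>)

lemma null_nets_uminus:
  assumes "open \<Omega>" "u \<in> null_nets \<Omega>" shows "(\<lambda>\<epsilon> x. - u \<epsilon> x) \<in> null_nets \<Omega>"
  using null_nets_mult[OF assms moderate_nets_const[OF smooth_on_const], of "- 1"] by simp

lemma moderate_nets_subset: "u \<in> moderate_nets \<Omega> \<Longrightarrow> W \<subseteq> \<Omega> \<Longrightarrow> u \<in> moderate_nets W"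
  by (auto simp: moderate_nets_iff intro: smooth_on_subset)

lemma null_nets_subset: "u \<in> null_nets \<Omega> \<Longrightarrow> W \<subseteq> \<Omega> \<Longrightarrow> u \<in> null_nets W"
  by (auto simp: null_nets_iff intro: smooth_on_subset)

lemma null_nets_eq_0:
  assumes "open \<Omega>" "\<And>\<epsilon> x. \<epsilon> \<in> {0<..1} \<Longrightarrow> x \<in> \<Omega> \<Longrightarrow> u \<epsilon> x = 0"
  shows "u \<in> null_nets \<Omega>"
proof -
  have z: "pderivs is (\<lambda>_::real^'n. 0::complex) x = 0" for "is" x
    using pderivs_eq_0_outside[of "{}" "\<lambda>_. 0" x "is"] by simp
  have s: "smooth_on \<Omega> (u \<epsilon>)" if "\<epsilon> \<in> {0<..1}" for \<epsilon>
    using smooth_on_cong[OF assms(1), of "u \<epsilon>" "\<lambda>_. 0"] assms(2)[OF that] smooth_on_const by simp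
  have "null_on K (\<lambda>\<epsilon>. pderivs is (u \<epsilon>))" if "K \<subseteq> \<Omega>" for K "is"
  proof (rule null_on_cong[OF _ null_on_zero])
    fix \<epsilon> x assume "\<epsilon> \<in> {0<..1::real}" "x \<in> K"
    then have "pderivs is (u \<epsilon>) x = pderivs is (\<lambda>_. 0) x"
      using that by (intro pderivs_cong_open[OF assms(1)] assms(2)) auto
    then show "0 = pderivs is (u \<epsilon>) x" by (simp add: z)
  qed
  with s show ?thesis by (auto simp: null_nets_iff)
qed

text \<open>Being a null net is a local property, since a compact set is covered by finitely many
  closed balls inside members of the cover.\<close>

lemma null_nets_open_cover:
  assumes "\<And>x. x \<in> \<Omega> \<Longrightarrow> \<exists>W. open W \<and> x \<in> W \<and> u \<in> null_nets W"
  shows "u \<in> null_nets \<Omega>"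
  unfolding null_nets_iff
proof (intro conjI allI impI ballI)
  fix \<epsilon> assume "\<epsilon> \<in> {0<..1::real}"
  then show "smooth_on \<Omega> (u \<epsilon>)"
    using assms by (intro smooth_on_open_Union) (meson null_nets_smooth_on)
next
  fix K "is" assume K: "compact K" "K \<subseteq> \<Omega>"
  have "\<exists>e>0. \<exists>W. cball x e \<subseteq> W \<and> u \<in> null_nets W" if "x \<in> K" for x
  proof -
    have "x \<in> \<Omega>" using that K(2) by auto
    from assms[OF this] obtain W where W: "open W" "x \<in> W" "u \<in> null_nets W" by (elim exE conjE)
    then obtain e where "e > 0" "cball x e \<subseteq> W" using open_contains_cball by blast
    with W(3) show ?thesis by blast
  qed
  then obtain e where e: "\<And>x. x \<in> K \<Longrightarrow> e x > 0" "\<And>x. x \<in> K \<Longrightarrow> \<exists>W. cball x (e x) \<subseteq> W \<and> u \<in> null_nets W"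
    by metis
  have "K \<subseteq> (\<Union>x\<in>K. ball x (e x))" using e(1) by force
  then obtain D where D: "D \<subseteq> K" "finite D" "K \<subseteq> (\<Union>x\<in>D. ball x (e x))"
    by (rule compactE_image[OF K(1) open_ball])
  show "null_on K (\<lambda>\<epsilon>. pderivs is (u \<epsilon>))"
  proof (rule null_on_UN[OF D(2)])
    fix x assume "x \<in> D"
    then have "x \<in> K" using D(1) by (rule subsetD[rotated])
    from e(2)[OF this] obtain W where W: "cball x (e x) \<subseteq> W" "u \<in> null_nets W" by (elim exE conjE)
    show "null_on (cball x (e x)) (\<lambda>\<epsilon>. pderivs is (u \<epsilon>))"
      by (rule null_nets_null_on[OF W(2) compact_cball W(1)])
  next
    show "K \<subseteq> (\<Union>x\<in>D. cball x (e x))" using D(3) ball_subset_cball by blast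
  qed
qed

lemma net_rel_iff:
  "(u, v) \<in> net_rel \<Omega> \<longleftrightarrow> u \<in> moderate_nets \<Omega> \<and> v \<in> moderate_nets \<Omega> \<and> (\<lambda>\<epsilon> x. u \<epsilon> x - v \<epsilon> x) \<in> null_nets \<Omega>"
  by (simp add: net_rel_def)

lemma null_nets_diff_commute:
  assumes "open \<Omega>" "(\<lambda>\<epsilon> x. u \<epsilon> x - v \<epsilon> x) \<in> null_nets \<Omega>"
  shows "(\<lambda>\<epsilon> x. v \<epsilon> x - u \<epsilon> x) \<in> null_nets \<Omega>"
  using null_nets_uminus[OF assms] by simp

lemma null_nets_diff_trans:
  assumes "open \<Omega>" "(\<lambda>\<epsilon> x. u \<epsilon> x - v \<epsilon> x) \<in> null_nets \<Omega>" "(\<lambda>\<epsilon> x. v \<epsilon> x - w \<epsilon> x) \<in> null_nets \<Omega>"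
  shows "(\<lambda>\<epsilon> x. u \<epsilon> x - w \<epsilon> x) \<in> null_nets \<Omega>"
  using null_nets_add[OF assms] by simp

lemma equiv_net_rel:
  assumes "open \<Omega>" shows "equiv (moderate_nets \<Omega>) (net_rel \<Omega>)"
proof (rule equivI)
  show "net_rel \<Omega> \<subseteq> moderate_nets \<Omega> \<times> moderate_nets \<Omega>" by (auto simp: net_rel_iff)
  show "refl_on (moderate_nets \<Omega>) (net_rel \<Omega>)"
    unfolding refl_on_def net_rel_iff by (simp add: null_nets_eq_0[OF assms])
  show "sym (net_rel \<Omega>)"
    by (rule symI) (simp add: net_rel_iff null_nets_diff_commute[OF assms])
  show "trans (net_rel \<Omega>)"
    by (rule transI, unfold net_rel_iff) (elim conjE, intro conjI; (rule null_nets_diff_trans[OF assms])?; assumption)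
qed

text \<open>Every representative may serve as the base point of its class.\<close>

lemma colombeau_elim:
  assumes "open \<Omega>" "U \<in> colombeau \<Omega>" "u \<in> U"
  shows "u \<in> moderate_nets \<Omega>" "v \<in> U \<longleftrightarrow> (u, v) \<in> net_rel \<Omega>"
proof -
  note eq = equiv_net_rel[OF assms(1)]
  obtain u0 where u0: "U = net_rel \<Omega> `` {u0}" using assms(2) by (auto simp: colombeau_def quotient_def)
  show "u \<in> moderate_nets \<Omega>" using assms(3) by (auto simp: u0 net_rel_iff)
  have "U = net_rel \<Omega> `` {u}" using assms(3) unfolding u0 by (intro equiv_class_eq[OF eq]) simp
  then show "v \<in> U \<longleftrightarrow> (u, v) \<in> net_rel \<Omega>" by auto
qed

lemma colombeau_nonempty: "open \<Omega> \<Longrightarrow> U \<in> colombeau \<Omega> \<Longrightarrow> \<exists>u. u \<in> U"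
  using in_quotient_imp_non_empty[OF equiv_net_rel] unfolding colombeau_def by blast

section \<open>Generalized numbers and point values\<close>

lemma gequiv_refl: "gmoderate x \<Longrightarrow> gequiv x x"
  by (simp add: gequiv_def gnegligible_zero)

text \<open>The quotient is partial, so equality of classes is only meaningful for moderate
  nets.\<close>

lemma abs_gen_eq_iff:
  assumes "gmoderate x" "gmoderate y"
  shows "abs_gen x = abs_gen y \<longleftrightarrow> gnegligible (\<lambda>\<epsilon>. x \<epsilon> - y \<epsilon>)"
proof -
  have "gequiv x y \<longleftrightarrow> gequiv x x \<and> gequiv y y \<and> abs_gen x = abs_gen y"
    using Quotient3_rel[OF Quotient3_gen] by metis
  then show ?thesis using assms by (simp add: gequiv_def gnegligible_zero)
qed

lemma gen_cases: obtains x where "gmoderate x" "X = abs_gen x"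
proof
  show "X = abs_gen (rep_gen X)" using Quotient3_abs_rep[OF Quotient3_gen] by metis
  show "gmoderate (rep_gen X)" using Quotient3_rep_reflp[OF Quotient3_gen, of X] by (simp add: gequiv_def)
qed

lemma reps_abs_gen:
  "gmoderate x \<Longrightarrow> y \<in> reps (abs_gen x) \<longleftrightarrow> gmoderate y \<and> gnegligible (\<lambda>\<epsilon>. y \<epsilon> - x \<epsilon>)"
  by (auto simp: reps_def abs_gen_eq_iff)

lemma gnegligible_imp_gmoderate: "gnegligible x \<Longrightarrow> gmoderate x"
  unfolding gnegligible_iff gmoderate_iff by (rule exI[of _ 0]) (drule spec[of _ 0], simp)

lemma gmoderate_add: "gmoderate x \<Longrightarrow> gmoderate y \<Longrightarrow> gmoderate (\<lambda>\<epsilon>. x \<epsilon> + y \<epsilon>)"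
  by (rule gmoderate_bound[of x y]) (auto intro: norm_triangle_ineq)

lemma gmoderate_diff: "gmoderate x \<Longrightarrow> gmoderate y \<Longrightarrow> gmoderate (\<lambda>\<epsilon>. x \<epsilon> - y \<epsilon>)"
  by (rule gmoderate_bound[of x y]) (auto intro: norm_triangle_ineq4)

lemma gmoderate_norm: "gmoderate x \<Longrightarrow> gmoderate (\<lambda>\<epsilon>. norm (x \<epsilon>))"
  by (simp add: gmoderate_iff)

lemma gnegligible_add: "gnegligible x \<Longrightarrow> gnegligible y \<Longrightarrow> gnegligible (\<lambda>\<epsilon>. x \<epsilon> + y \<epsilon>)"
  by (rule gnegligible_bound[of x y]) (auto intro: norm_triangle_ineq)

lemma gnegligible_trans:
  "gnegligible (\<lambda>\<epsilon>. x \<epsilon> - y \<epsilon>) \<Longrightarrow> gnegligible (\<lambda>\<epsilon>. y \<epsilon> - z \<epsilon>) \<Longrightarrow> gnegligible (\<lambda>\<epsilon>. x \<epsilon> - z \<epsilon>)"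
  using gnegligible_add[of "\<lambda>\<epsilon>. x \<epsilon> - y \<epsilon>" "\<lambda>\<epsilon>. y \<epsilon> - z \<epsilon>"] by simp

lemma gmoderate_near: "gmoderate y \<Longrightarrow> gnegligible (\<lambda>\<epsilon>. x \<epsilon> - y \<epsilon>) \<Longrightarrow> gmoderate x"
  using gmoderate_add[of "\<lambda>\<epsilon>. x \<epsilon> - y \<epsilon>" y] gnegligible_imp_gmoderate[of "\<lambda>\<epsilon>. x \<epsilon> - y \<epsilon>"] by simp

lemma gmoderate_eventually_bound:
  fixes x :: "real \<Rightarrow> 'a::real_normed_vector"
  assumes "\<forall>\<^sub>F \<epsilon> in at_right 0. norm (x \<epsilon>) \<le> C * inverse \<epsilon> ^ N" shows "gmoderate x"
proof -
  have "\<forall>\<^sub>F \<epsilon> in at_right 0. norm (x \<epsilon>) \<le> inverse \<epsilon> ^ Suc N"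
    using assms absorb_const_inverse[of C N] by eventually_elim (rule order_trans)
  then show ?thesis unfolding gmoderate_iff by blast
qed

lemma gnegligible_eventually_bound:
  fixes x :: "real \<Rightarrow> 'a::real_normed_vector"
  assumes "\<And>n::nat. \<exists>C. \<forall>\<^sub>F \<epsilon> in at_right 0. norm (x \<epsilon>) \<le> C * \<epsilon> ^ n" shows "gnegligible x"
  unfolding gnegligible_iff
proof
  fix n
  obtain C where "\<forall>\<^sub>F \<epsilon> in at_right 0. norm (x \<epsilon>) \<le> C * \<epsilon> ^ Suc n" using assms by blast
  then show "\<forall>\<^sub>F \<epsilon> in at_right 0. norm (x \<epsilon>) \<le> \<epsilon> ^ n"
    using absorb_const_power[of C n] by eventually_elim (rule order_trans)
qed

text \<open>The order is defined by well chosen representatives; for arbitrary representatives it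
  holds up to any power of \<open>\<epsilon>\<close>.\<close>

lemma gen_leD:
  assumes "abs_gen x \<le> abs_gen y" "gmoderate x" "gmoderate y"
  shows "\<forall>\<^sub>F \<epsilon> in at_right 0. x \<epsilon> \<le> y \<epsilon> + (\<epsilon>::real) ^ n"
proof -
  obtain x' y' where x': "x' \<in> reps (abs_gen x)" and y': "y' \<in> reps (abs_gen y)"
    and le: "\<forall>\<epsilon>\<in>{0<..1}. x' \<epsilon> \<le> y' \<epsilon>"
    using assms(1) unfolding less_eq_gen_def by blast
  have "\<forall>\<^sub>F \<epsilon> in at_right 0. norm (x' \<epsilon> - x \<epsilon>) \<le> \<epsilon> ^ Suc n"
    "\<forall>\<^sub>F \<epsilon> in at_right 0. norm (y' \<epsilon> - y \<epsilon>) \<le> \<epsilon> ^ Suc n"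
    using x' y' assms(2,3) by (auto simp: reps_abs_gen gnegligible_iff simp del: power_Suc)
  with eventually_unit absorb_const_power[of 2 n] show ?thesis
  proof eventually_elim
    case (elim \<epsilon>)
    have "x' \<epsilon> \<le> y' \<epsilon>" using le elim(1) by blast
    then show ?case using elim(2-4) unfolding real_norm_def abs_le_iff by linarith
  qed
qed

text \<open>If the inequality holds for small \<open>\<epsilon>\<close> only, replacing
  \<open>y\<close> by \<open>max x y\<close> changes a representative on large
  \<open>\<epsilon>\<close> alone.\<close>

lemma gen_leI:
  assumes "gmoderate x" "gmoderate y" "\<forall>\<^sub>F \<epsilon> in at_right 0. x \<epsilon> \<le> (y \<epsilon> :: real)"
  shows "abs_gen x \<le> abs_gen y"
proof -
  define y' where "y' \<epsilon> = max (x \<epsilon>) (y \<epsilon>)" for \<epsilon>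
  have n: "gnegligible (\<lambda>\<epsilon>. y' \<epsilon> - y \<epsilon>)"
    unfolding gnegligible_iff
  proof
    fix n
    show "\<forall>\<^sub>F \<epsilon> in at_right 0. norm (y' \<epsilon> - y \<epsilon>) \<le> \<epsilon> ^ n"
      using assms(3) eventually_pos by eventually_elim (simp add: y'_def max_def)
  qed
  then have "gmoderate y'" using gmoderate_near[OF assms(2)] by blast
  with n have "y' \<in> reps (abs_gen y)" by (simp add: reps_abs_gen assms(2))
  moreover have "x \<in> reps (abs_gen x)" using assms(1) by (simp add: reps_def)
  ultimately show ?thesis unfolding less_eq_gen_def by (intro bexI[of _ x] bexI[of _ y']) (simp_all add: y'_def)
qed

lemma gmoderate_powr: "gmoderate (\<lambda>\<epsilon>. \<epsilon> powr a)"
  using rho_powr.rsp[unfolded rel_fun_def eq_onp_def] by (simp add: gequiv_def)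

lemma gnorm_abs_gen: "gmoderate x \<Longrightarrow> gnorm (abs_gen x) = abs_gen (\<lambda>\<epsilon>. norm (x \<epsilon>))"
  by (simp add: gnorm.abs_eq gequiv_refl)

lemma gscale_abs_gen: "gmoderate c \<Longrightarrow> gmoderate x \<Longrightarrow> gscale (abs_gen c) (abs_gen x) = abs_gen (\<lambda>\<epsilon>. c \<epsilon> *\<^sub>R x \<epsilon>)"
  by (simp add: gscale.abs_eq gequiv_refl)

lemma minus_abs_gen: "gmoderate x \<Longrightarrow> gmoderate y \<Longrightarrow> abs_gen x - abs_gen y = abs_gen (\<lambda>\<epsilon>. x \<epsilon> - y \<epsilon>)"
  by (simp add: minus_gen.abs_eq gequiv_refl)

lemma gconst_abs_gen: "gconst c = abs_gen (\<lambda>_. c)"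
  by (rule gconst.abs_eq)

lemma rho_powr_abs_gen: "rho_powr a = abs_gen (\<lambda>\<epsilon>. \<epsilon> powr a)"
  by (rule rho_powr.abs_eq)

lemma gnorm_diff_abs_gen:
  "gmoderate x \<Longrightarrow> gmoderate y \<Longrightarrow> gnorm (abs_gen x - abs_gen y) = abs_gen (\<lambda>\<epsilon>. norm (x \<epsilon> - y \<epsilon>))"
  by (simp add: minus_abs_gen gnorm_abs_gen gmoderate_diff)

lemma gscale_moderate: "gmoderate c \<Longrightarrow> gmoderate x \<Longrightarrow> gmoderate (\<lambda>\<epsilon>. c \<epsilon> *\<^sub>R x \<epsilon>)"
  by (rule gmoderate_prod[of c x]) auto

lemma powr_le_powr_small: "0 < \<epsilon> \<Longrightarrow> \<epsilon> < 1 \<Longrightarrow> a \<le> b \<Longrightarrow> \<epsilon> powr b \<le> (\<epsilon>::real) powr a"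
  by (intro powr_mono') auto

text \<open>Halving an exponent (or lowering it by any amount) absorbs constants; this is why the
  fast relations below can be read off from arbitrary representatives.\<close>

lemma absorb_const_powr:
  fixes C :: real
  assumes "a > 0" shows "\<forall>\<^sub>F \<epsilon> in at_right 0. C * \<epsilon> powr (b + a) \<le> \<epsilon> powr b"
proof -
  have "((\<lambda>\<epsilon>::real. C * \<epsilon> powr a) \<longlongrightarrow> C * 0) (at_right 0)"
  proof (rule tendsto_mult_left)
    show "((\<lambda>\<epsilon>::real. \<epsilon> powr a) \<longlongrightarrow> 0) (at_right 0)"
      using tendsto_powr'[of "\<lambda>x::real. x" 0 "at_right 0" "\<lambda>_. a" a] assms eventually_pos
      by (simp add: tendsto_ident_at eventually_mono[OF eventually_pos])
  qed
  then have "\<forall>\<^sub>F \<epsilon> in at_right 0. C * \<epsilon> powr a < 1" by (rule order_tendstoD) simp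
  with eventually_pos show ?thesis
  proof eventually_elim
    case (elim \<epsilon>)
    have "C * \<epsilon> powr (b + a) = (C * \<epsilon> powr a) * \<epsilon> powr b" by (simp add: powr_add)
    also have "\<dots> \<le> 1 * \<epsilon> powr b" using elim by (intro mult_right_mono) auto
    finally show ?case by simp
  qed
qed

lemma fast_near_iff:
  fixes x y :: "real \<Rightarrow> 'a::real_normed_vector"
  assumes "gmoderate x" "gmoderate y"
  shows "abs_gen x \<approx>\<^sub>f abs_gen y \<longleftrightarrow> (\<exists>a>0. \<forall>\<^sub>F \<epsilon> in at_right 0. norm (x \<epsilon> - y \<epsilon>) \<le> \<epsilon> powr a)"
proof
  assume "abs_gen x \<approx>\<^sub>f abs_gen y"
  then obtain a where a: "a > 0" "abs_gen (\<lambda>\<epsilon>. norm (x \<epsilon> - y \<epsilon>)) \<le> abs_gen (\<lambda>\<epsilon>. \<epsilon> powr a)"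
    unfolding fast_near_def by (auto simp: gnorm_diff_abs_gen assms rho_powr_abs_gen)
  obtain n :: nat where n: "a \<le> real n" using real_arch_simple by blast
  have e: "\<forall>\<^sub>F \<epsilon> in at_right 0. norm (x \<epsilon> - y \<epsilon>) \<le> \<epsilon> powr a + \<epsilon> ^ n"
    by (rule gen_leD[OF a(2)]) (intro gmoderate_norm gmoderate_diff assms gmoderate_powr)+
  have "\<forall>\<^sub>F \<epsilon> in at_right 0. 2 * \<epsilon> powr (a / 2 + a / 2) \<le> \<epsilon> powr (a / 2)"
    using a(1) by (intro absorb_const_powr) simp
  with e eventually_small[OF zero_less_one]
  have "\<forall>\<^sub>F \<epsilon> in at_right 0. norm (x \<epsilon> - y \<epsilon>) \<le> \<epsilon> powr (a / 2)"
  proof eventually_elim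
    case (elim \<epsilon>)
    have "\<epsilon> ^ n = \<epsilon> powr real n" using elim(2) by (simp add: powr_realpow)
    also have "\<dots> \<le> \<epsilon> powr a" using elim(2) n by (intro powr_le_powr_small) auto
    finally show ?case using elim by simp
  qed
  then show "\<exists>a>0. \<forall>\<^sub>F \<epsilon> in at_right 0. norm (x \<epsilon> - y \<epsilon>) \<le> \<epsilon> powr a" using a(1) half_gt_zero by blast
next
  assume "\<exists>a>0. \<forall>\<^sub>F \<epsilon> in at_right 0. norm (x \<epsilon> - y \<epsilon>) \<le> \<epsilon> powr a"
  then obtain a where a: "a > 0" "\<forall>\<^sub>F \<epsilon> in at_right 0. norm (x \<epsilon> - y \<epsilon>) \<le> \<epsilon> powr a" by blast
  have "abs_gen (\<lambda>\<epsilon>. norm (x \<epsilon> - y \<epsilon>)) \<le> abs_gen (\<lambda>\<epsilon>. \<epsilon> powr a)"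
    by (intro gen_leI gmoderate_norm gmoderate_diff assms gmoderate_powr a(2))
  then show "abs_gen x \<approx>\<^sub>f abs_gen y"
    unfolding fast_near_def using a(1) by (auto simp: gnorm_diff_abs_gen assms rho_powr_abs_gen)
qed

lemma fast_large_iff:
  fixes x :: "real \<Rightarrow> real^'n"
  assumes "gmoderate x"
  shows "abs_gen x \<in> fast_large \<longleftrightarrow> (\<exists>a>0. \<forall>\<^sub>F \<epsilon> in at_right 0. \<epsilon> powr (- a) \<le> norm (x \<epsilon>))"
proof
  assume "abs_gen x \<in> fast_large"
  then obtain a where a: "a > 0" "abs_gen (\<lambda>\<epsilon>. \<epsilon> powr (- a)) \<le> abs_gen (\<lambda>\<epsilon>. norm (x \<epsilon>))"
    unfolding fast_large_def by (auto simp: gnorm_abs_gen assms rho_powr_abs_gen)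
  have e: "\<forall>\<^sub>F \<epsilon> in at_right 0. \<epsilon> powr (- a) \<le> norm (x \<epsilon>) + \<epsilon> ^ 0"
    by (rule gen_leD[OF a(2)]) (intro gmoderate_norm assms gmoderate_powr)+
  have "\<forall>\<^sub>F \<epsilon> in at_right 0. 2 * \<epsilon> powr (- a + a / 2) \<le> \<epsilon> powr (- a)"
    using a(1) by (intro absorb_const_powr) simp
  with e eventually_small[OF zero_less_one]
  have "\<forall>\<^sub>F \<epsilon> in at_right 0. \<epsilon> powr (- (a / 2)) \<le> norm (x \<epsilon>)"
  proof eventually_elim
    case (elim \<epsilon>)
    have "\<epsilon> powr 0 \<le> \<epsilon> powr (- (a / 2))" using elim(2) a(1) by (intro powr_le_powr_small) auto
    then show ?case using elim by simp
  qed
  then show "\<exists>a>0. \<forall>\<^sub>F \<epsilon> in at_right 0. \<epsilon> powr (- a) \<le> norm (x \<epsilon>)" using a(1) half_gt_zero by blast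
next
  assume "\<exists>a>0. \<forall>\<^sub>F \<epsilon> in at_right 0. \<epsilon> powr (- a) \<le> norm (x \<epsilon>)"
  then obtain a where a: "a > 0" "\<forall>\<^sub>F \<epsilon> in at_right 0. \<epsilon> powr (- a) \<le> norm (x \<epsilon>)" by blast
  have "abs_gen (\<lambda>\<epsilon>. \<epsilon> powr (- a)) \<le> abs_gen (\<lambda>\<epsilon>. norm (x \<epsilon>))"
    by (intro gen_leI gmoderate_norm assms gmoderate_powr a(2))
  then show "abs_gen x \<in> fast_large"
    unfolding fast_large_def using a(1) by (auto simp: gnorm_abs_gen assms rho_powr_abs_gen)
qed

lemma gsphere_iff:
  "gmoderate \<xi> \<Longrightarrow> abs_gen \<xi> \<in> gsphere \<longleftrightarrow> gnegligible (\<lambda>\<epsilon>. norm (\<xi> \<epsilon>) - 1)"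
  by (simp add: gsphere_def gnorm_abs_gen gconst_abs_gen abs_gen_eq_iff gmoderate_norm gmoderate_const)

lemma gball_le_iff:
  fixes x :: "real \<Rightarrow> 'a::real_normed_vector"
  assumes "gmoderate x"
  shows "gnorm (abs_gen x - gconst c) \<le> gconst r \<longleftrightarrow> abs_gen (\<lambda>\<epsilon>. norm (x \<epsilon> - c)) \<le> abs_gen (\<lambda>_. r)"
  by (simp add: gconst_abs_gen gnorm_diff_abs_gen assms gmoderate_const)

lemma gballD:
  fixes x :: "real \<Rightarrow> 'a::real_normed_vector"
  assumes "gnorm (abs_gen x - gconst c) \<le> gconst r" "gmoderate x" "r < R"
  shows "\<forall>\<^sub>F \<epsilon> in at_right 0. norm (x \<epsilon> - c) \<le> R"
proof -
  have "\<forall>\<^sub>F \<epsilon> in at_right 0. norm (x \<epsilon> - c) \<le> r + \<epsilon> ^ 1"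
    using assms(1) unfolding gball_le_iff[OF assms(2)]
    by (rule gen_leD) (intro gmoderate_norm gmoderate_diff gmoderate_const assms(2))+
  moreover have "\<forall>\<^sub>F \<epsilon> in at_right 0. 0 < \<epsilon> \<and> \<epsilon> < R - r" using assms(3) by (intro eventually_small) simp
  ultimately show ?thesis by eventually_elim simp
qed

lemma gballI:
  fixes x :: "real \<Rightarrow> 'a::real_normed_vector"
  assumes "gmoderate x" "\<forall>\<^sub>F \<epsilon> in at_right 0. norm (x \<epsilon> - c) \<le> r"
  shows "gnorm (abs_gen x - gconst c) \<le> gconst r"
  unfolding gball_le_iff[OF assms(1)]
  by (intro gen_leI gmoderate_norm gmoderate_diff gmoderate_const assms)

text \<open>The inverse of \<open>|\<eta>|\<close> in the definition is a generalized number; up to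
  a negligible error it is the pointwise inverse, so that \<open>\<eta>\<close> vanishes for no
  small \<open>\<epsilon>\<close>.\<close>

lemma fast_coneD:
  fixes \<eta> \<xi> :: "real \<Rightarrow> real^'n"
  assumes "abs_gen \<eta> \<in> fast_cone (abs_gen \<xi>)" "gmoderate \<eta>" "gmoderate \<xi>"
  obtains a where "a > 0" "\<forall>\<^sub>F \<epsilon> in at_right 0. \<eta> \<epsilon> \<noteq> 0 \<and> norm (inverse (norm (\<eta> \<epsilon>)) *\<^sub>R \<eta> \<epsilon> - \<xi> \<epsilon>) \<le> \<epsilon> powr a"
proof -
  obtain C where C: "gscale C (gnorm (abs_gen \<eta>)) = gconst 1" "gscale C (abs_gen \<eta>) \<approx>\<^sub>f abs_gen \<xi>"
    using assms(1) unfolding fast_cone_def by blast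
  obtain c where c: "gmoderate c" "C = abs_gen c" by (rule gen_cases)
  have "gnegligible (\<lambda>\<epsilon>. c \<epsilon> * norm (\<eta> \<epsilon>) - 1)"
    using C(1) unfolding c(2) gnorm_abs_gen[OF assms(2)] gconst_abs_gen
      gscale_abs_gen[OF c(1) gmoderate_norm[OF assms(2)]]
    by (subst (asm) abs_gen_eq_iff) (use gscale_moderate[OF c(1) gmoderate_norm[OF assms(2)]] in \<open>auto simp: gmoderate_const\<close>)
  then have n: "\<forall>\<^sub>F \<epsilon> in at_right 0. norm (c \<epsilon> * norm (\<eta> \<epsilon>) - 1) \<le> \<epsilon> ^ n" for n
    by (simp add: gnegligible_iff)
  obtain a where a: "a > 0" "\<forall>\<^sub>F \<epsilon> in at_right 0. norm (c \<epsilon> *\<^sub>R \<eta> \<epsilon> - \<xi> \<epsilon>) \<le> \<epsilon> powr a"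
    using C(2) unfolding c(2) gscale_abs_gen[OF c(1) assms(2)]
      fast_near_iff[OF gscale_moderate[OF c(1) assms(2)] assms(3)] by blast
  obtain k :: nat where k: "a \<le> real k" "k \<ge> 1" using real_arch_simple[of "max a 1"] by auto
  have "\<forall>\<^sub>F \<epsilon> in at_right 0. 2 * \<epsilon> powr (a / 2 + a / 2) \<le> \<epsilon> powr (a / 2)"
    using a(1) by (intro absorb_const_powr) simp
  with n[of k] a(2) eventually_small[OF zero_less_one]
  have "\<forall>\<^sub>F \<epsilon> in at_right 0. \<eta> \<epsilon> \<noteq> 0 \<and> norm (inverse (norm (\<eta> \<epsilon>)) *\<^sub>R \<eta> \<epsilon> - \<xi> \<epsilon>) \<le> \<epsilon> powr (a / 2)"
  proof eventually_elim
    case (elim \<epsilon>)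
    have e1: "\<epsilon> ^ k < 1" using elim(3) k(2) by (simp add: power_less_one_iff)
    have nz: "\<eta> \<epsilon> \<noteq> 0" using elim(1) e1 by auto
    have "inverse (norm (\<eta> \<epsilon>)) *\<^sub>R \<eta> \<epsilon> - c \<epsilon> *\<^sub>R \<eta> \<epsilon> = (inverse (norm (\<eta> \<epsilon>)) - c \<epsilon>) *\<^sub>R \<eta> \<epsilon>"
      by (simp add: scaleR_left_diff_distrib)
    then have "norm (inverse (norm (\<eta> \<epsilon>)) *\<^sub>R \<eta> \<epsilon> - c \<epsilon> *\<^sub>R \<eta> \<epsilon>) = \<bar>inverse (norm (\<eta> \<epsilon>)) - c \<epsilon>\<bar> * \<bar>norm (\<eta> \<epsilon>)\<bar>" by simp
    also have "\<dots> = \<bar>(inverse (norm (\<eta> \<epsilon>)) - c \<epsilon>) * norm (\<eta> \<epsilon>)\<bar>" by (simp only: abs_mult)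
    also have "\<dots> = \<bar>1 - c \<epsilon> * norm (\<eta> \<epsilon>)\<bar>"
      using nz by (simp add: left_diff_distrib)
    also have "\<dots> \<le> \<epsilon> ^ k" using elim(1) by (simp add: abs_minus_commute)
    also have "\<epsilon> ^ k = \<epsilon> powr real k" using elim(3) by (simp add: powr_realpow)
    also have "\<dots> \<le> \<epsilon> powr a" using elim(3) k(1) by (intro powr_le_powr_small) auto
    finally have "norm (inverse (norm (\<eta> \<epsilon>)) *\<^sub>R \<eta> \<epsilon> - c \<epsilon> *\<^sub>R \<eta> \<epsilon>) \<le> \<epsilon> powr a" .
    moreover have "norm (inverse (norm (\<eta> \<epsilon>)) *\<^sub>R \<eta> \<epsilon> - \<xi> \<epsilon>) \<le>
        norm (inverse (norm (\<eta> \<epsilon>)) *\<^sub>R \<eta> \<epsilon> - c \<epsilon> *\<^sub>R \<eta> \<epsilon>) + norm (c \<epsilon> *\<^sub>R \<eta> \<epsilon> - \<xi> \<epsilon>)"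
      by (rule norm_diff_triangle_le[OF order_refl order_refl])
    ultimately show ?case using nz elim by simp
  qed
  then show ?thesis using that[of "a / 2"] a(1) by simp
qed

lemma fast_coneI:
  fixes \<eta> \<xi> :: "real \<Rightarrow> real^'n"
  assumes "gmoderate \<eta>" "gmoderate \<xi>" "a > 0"
    "\<forall>\<^sub>F \<epsilon> in at_right 0. norm (\<eta> \<epsilon>) \<ge> 1"
    "\<forall>\<^sub>F \<epsilon> in at_right 0. norm (inverse (norm (\<eta> \<epsilon>)) *\<^sub>R \<eta> \<epsilon> - \<xi> \<epsilon>) \<le> \<epsilon> powr a"
  shows "abs_gen \<eta> \<in> fast_cone (abs_gen \<xi>)"
proof -
  define c where "c \<epsilon> = inverse (norm (\<eta> \<epsilon>))" for \<epsilon>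
  have c: "gmoderate c"
  proof (rule gmoderate_eventually_bound)
    show "\<forall>\<^sub>F \<epsilon> in at_right 0. norm (c \<epsilon>) \<le> 1 * inverse \<epsilon> ^ 0"
      using assms(4) by eventually_elim (simp add: c_def inverse_le_1_iff)
  qed
  have "gnegligible (\<lambda>\<epsilon>. c \<epsilon> * norm (\<eta> \<epsilon>) - 1)"
    unfolding gnegligible_iff
  proof
    fix n
    show "\<forall>\<^sub>F \<epsilon> in at_right 0. norm (c \<epsilon> * norm (\<eta> \<epsilon>) - 1) \<le> \<epsilon> ^ n"
      using assms(4) eventually_pos
    proof eventually_elim
      case (elim \<epsilon>)
      then have "c \<epsilon> * norm (\<eta> \<epsilon>) = 1" unfolding c_def by (intro left_inverse) auto
      then show ?case using elim(2) by simp
    qed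
  qed
  then have "abs_gen (\<lambda>\<epsilon>. c \<epsilon> *\<^sub>R norm (\<eta> \<epsilon>)) = gconst 1"
    unfolding gconst_abs_gen
    by (subst abs_gen_eq_iff[OF gscale_moderate[OF c gmoderate_norm[OF assms(1)]] gmoderate_const]) simp
  then have "gscale (abs_gen c) (gnorm (abs_gen \<eta>)) = gconst 1"
    by (simp add: gnorm_abs_gen assms(1) gscale_abs_gen c gmoderate_norm)
  moreover have "gscale (abs_gen c) (abs_gen \<eta>) \<approx>\<^sub>f abs_gen \<xi>"
    unfolding gscale_abs_gen[OF c assms(1)] fast_near_iff[OF gscale_moderate[OF c assms(1)] assms(2)]
    using assms(3,5) unfolding c_def by blast
  ultimately show ?thesis unfolding fast_cone_def by blast
qed

text \<open>Negligibility along all nets is automatically uniform: let the net pick a parameter that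
  violates the bound whenever there is one. This is what turns statements about all generalized
  points and directions into uniform classical estimates.\<close>

lemma uniform_negligible:
  fixes f :: "real \<Rightarrow> 'a \<Rightarrow> 'b::real_normed_vector"
  assumes "\<And>\<epsilon>. A \<epsilon> \<noteq> {}" and "\<And>y. (\<And>\<epsilon>. y \<epsilon> \<in> A \<epsilon>) \<Longrightarrow> gnegligible (\<lambda>\<epsilon>. f \<epsilon> (y \<epsilon>))"
  shows "\<forall>\<^sub>F \<epsilon> in at_right 0. \<forall>y\<in>A \<epsilon>. norm (f \<epsilon> y) \<le> \<epsilon> ^ n"
proof -
  define B where "B \<epsilon> = {y\<in>A \<epsilon>. \<not> norm (f \<epsilon> y) \<le> \<epsilon> ^ n}" for \<epsilon>
  \<comment> \<open>\<open>B \<epsilon>\<close> is the set of violating parameters.\<close>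
  define y where "y \<epsilon> = (if B \<epsilon> = {} then SOME y. y \<in> A \<epsilon> else SOME y. y \<in> B \<epsilon>)" for \<epsilon>
  have yB: "y \<epsilon> \<in> B \<epsilon>" if "B \<epsilon> \<noteq> {}" for \<epsilon>
    using that some_in_eq[of "B \<epsilon>"] by (simp add: y_def)
  have "y \<epsilon> \<in> A \<epsilon>" for \<epsilon>
  proof (cases "B \<epsilon> = {}")
    case True
    then show ?thesis using assms(1)[of \<epsilon>] some_in_eq[of "A \<epsilon>"] by (simp add: y_def)
  next
    case False
    then show ?thesis using yB[of \<epsilon>] by (simp add: B_def)
  qed
  then have "gnegligible (\<lambda>\<epsilon>. f \<epsilon> (y \<epsilon>))" by (rule assms(2))
  then have "\<forall>\<^sub>F \<epsilon> in at_right 0. norm (f \<epsilon> (y \<epsilon>)) \<le> \<epsilon> ^ n" by (simp add: gnegligible_iff)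
  then show ?thesis
  proof eventually_elim
    case (elim \<epsilon>)
    then have "B \<epsilon> = {}" using yB[of \<epsilon>] by (auto simp: B_def)
    then show ?case by (auto simp: B_def)
  qed
qed

lemma compact_thicken:
  fixes K :: "(real^'n) set"
  assumes "compact K" "open \<Omega>" "K \<subseteq> \<Omega>"
  obtains L e where "e > 0" "compact L" "L \<subseteq> \<Omega>" "\<forall>x\<in>K. cball x e \<subseteq> L"
proof -
  obtain e where e: "e > 0" "(\<Union>x\<in>K. cball x e) \<subseteq> \<Omega>"
    using compact_subset_open_imp_cball_epsilon_subset[OF assms] by blast
  let ?L = "{x + y |x y. x \<in> K \<and> y \<in> cball 0 e}"
  have "compact ?L" by (intro compact_sums assms(1) compact_cball)
  moreover have "?L \<subseteq> (\<Union>x\<in>K. cball x e)" by (auto simp: dist_norm)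
  moreover have "cball x e \<subseteq> ?L" if "x \<in> K" for x
  proof
    fix y assume "y \<in> cball x e"
    then have "y = x + (y - x)" "y - x \<in> cball 0 e" by (auto simp: dist_norm norm_minus_commute)
    with that show "y \<in> ?L" by blast
  qed
  ultimately show ?thesis using e(2) by (intro that[OF e(1), of ?L]) auto
qed

lemma moderate_nets_value:
  assumes "u \<in> moderate_nets \<Omega>" "compact K" "K \<subseteq> \<Omega>" "\<forall>\<^sub>F \<epsilon> in at_right 0. x \<epsilon> \<in> K"
  shows "gmoderate (\<lambda>\<epsilon>. u \<epsilon> (x \<epsilon>))"
proof -
  obtain N where "\<forall>\<^sub>F \<epsilon> in at_right 0. \<forall>x\<in>K. norm (u \<epsilon> x) \<le> inverse \<epsilon> ^ N"
    using moderate_nets_moderate_on[OF assms(1-3), of "[]"] unfolding moderate_on_iff by auto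
  with assms(4) have "\<forall>\<^sub>F \<epsilon> in at_right 0. norm (u \<epsilon> (x \<epsilon>)) \<le> inverse \<epsilon> ^ N" by eventually_elim blast
  then show ?thesis unfolding gmoderate_iff by blast
qed

lemma null_nets_value:
  assumes "u \<in> null_nets \<Omega>" "compact K" "K \<subseteq> \<Omega>" "\<forall>\<^sub>F \<epsilon> in at_right 0. x \<epsilon> \<in> K"
  shows "gnegligible (\<lambda>\<epsilon>. u \<epsilon> (x \<epsilon>))"
  unfolding gnegligible_iff
proof
  fix n
  have "\<forall>\<^sub>F \<epsilon> in at_right 0. \<forall>x\<in>K. norm (u \<epsilon> x) \<le> \<epsilon> ^ n"
    using null_nets_null_on[OF assms(1-3), of "[]"] unfolding null_on_iff by auto
  with assms(4) show "\<forall>\<^sub>F \<epsilon> in at_right 0. norm (u \<epsilon> (x \<epsilon>)) \<le> \<epsilon> ^ n" by eventually_elim blast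
qed

text \<open>The mean value inequality on a ball about \<open>x \<epsilon>\<close>, which stays in a
  compact subset of \<open>\<Omega>\<close> because \<open>K\<close> can be thickened inside
  \<open>\<Omega>\<close>.\<close>

lemma moderate_nets_value_diff:
  fixes x y :: "real \<Rightarrow> real^'n"
  assumes "open \<Omega>" "u \<in> moderate_nets \<Omega>" "compact K" "K \<subseteq> \<Omega>" "\<forall>\<^sub>F \<epsilon> in at_right 0. x \<epsilon> \<in> K"
    "gnegligible (\<lambda>\<epsilon>. y \<epsilon> - x \<epsilon>)"
  shows "gnegligible (\<lambda>\<epsilon>. u \<epsilon> (y \<epsilon>) - u \<epsilon> (x \<epsilon>))"
proof (rule gnegligible_eventually_bound)
  fix n :: nat
  obtain L e where L: "e > 0" "compact L" "L \<subseteq> \<Omega>" "\<forall>x\<in>K. cball x e \<subseteq> L"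
    by (rule compact_thicken[OF assms(3,1,4)])
  have "\<exists>N. \<forall>\<^sub>F \<epsilon> in at_right 0. \<forall>z\<in>L. norm (pderiv_at i (u \<epsilon>) z) \<le> inverse \<epsilon> ^ N" for i
    using moderate_nets_moderate_on[OF assms(2) L(2,3), of "[i]"] unfolding moderate_on_iff by simp
  then have "\<exists>N. \<forall>i. \<forall>\<^sub>F \<epsilon> in at_right 0. \<forall>z\<in>L. norm (pderiv_at i (u \<epsilon>) z) \<le> inverse \<epsilon> ^ N i"
    by (intro choice allI)
  then obtain N where N: "\<forall>i. \<forall>\<^sub>F \<epsilon> in at_right 0. \<forall>z\<in>L. norm (pderiv_at i (u \<epsilon>) z) \<le> inverse \<epsilon> ^ N i" ..
  define M where "M = Max (range N)"
  have M: "N i \<le> M" for i unfolding M_def by simp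
  have "\<forall>\<^sub>F \<epsilon> in at_right 0. \<forall>i\<in>UNIV. \<forall>z\<in>L. norm (pderiv_at i (u \<epsilon>) z) \<le> inverse \<epsilon> ^ N i"
    by (rule eventually_ball_finite) (use N in simp_all)
  moreover have "\<forall>\<^sub>F \<epsilon> in at_right 0. norm (y \<epsilon> - x \<epsilon>) \<le> \<epsilon> ^ (n + M + 1)"
    using assms(6) unfolding gnegligible_iff ..
  moreover have "0 < min 1 e" using L(1) by simp
  note eventually_small[OF this]
  ultimately have "\<forall>\<^sub>F \<epsilon> in at_right 0. norm (u \<epsilon> (y \<epsilon>) - u \<epsilon> (x \<epsilon>)) \<le> real CARD('n) * \<epsilon> ^ n"
    using assms(5)
  proof eventually_elim
    case (elim \<epsilon>)
    have e: "\<epsilon> \<in> {0<..1}" "0 < \<epsilon>" "\<epsilon> \<le> 1" "\<epsilon> \<le> e" using elim(3) by auto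
    have "\<epsilon> ^ (n + M + 1) \<le> \<epsilon> ^ 1" using e by (intro power_decreasing) auto
    then have "norm (y \<epsilon> - x \<epsilon>) \<le> e" using elim(2) e unfolding power_one_right by linarith
    then have y: "y \<epsilon> \<in> cball (x \<epsilon>) e" by (simp add: dist_norm norm_minus_commute)
    have sub: "cball (x \<epsilon>) e \<subseteq> L" using L(4) elim(4) by blast
    have "norm (u \<epsilon> (y \<epsilon>) - u \<epsilon> (x \<epsilon>)) \<le> (real CARD('n) * inverse \<epsilon> ^ M) * norm (y \<epsilon> - x \<epsilon>)"
    proof (rule partials_lipschitz[of "cball (x \<epsilon>) e"])
      show "u \<epsilon> differentiable (at z)" if "z \<in> cball (x \<epsilon>) e" for z
        using smooth_on_differentiable[OF moderate_nets_smooth_on[OF assms(2) e(1)]] that sub L(3) by blast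
      show "norm (pderiv_at i (u \<epsilon>) z) \<le> inverse \<epsilon> ^ M" if "z \<in> cball (x \<epsilon>) e" for z i
      proof -
        have "inverse \<epsilon> ^ N i \<le> inverse \<epsilon> ^ M" using e by (intro power_increasing M) (simp add: one_le_inverse)
        then show ?thesis using bspec[OF bspec[OF elim(1) UNIV_I] subsetD[OF sub that], of i] by simp
      qed
    qed (use y L(1) in auto)
    also have "\<dots> \<le> (real CARD('n) * inverse \<epsilon> ^ M) * \<epsilon> ^ (n + M + 1)"
      using elim(2) e by (intro mult_left_mono) auto
    also have "\<dots> = real CARD('n) * (inverse \<epsilon> ^ M * \<epsilon> ^ M) * \<epsilon> ^ (n + 1)"
      by (simp add: power_add)
    also have "inverse \<epsilon> ^ M * \<epsilon> ^ M = 1" using e by (simp flip: power_mult_distrib)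
    also have "real CARD('n) * 1 * \<epsilon> ^ (n + 1) \<le> real CARD('n) * 1 * \<epsilon> ^ n"
      using e by (intro mult_left_mono power_decreasing) auto
    finally show ?case by simp
  qed
  then show "\<exists>C. \<forall>\<^sub>F \<epsilon> in at_right 0. norm (u \<epsilon> (y \<epsilon>) - u \<epsilon> (x \<epsilon>)) \<le> C * \<epsilon> ^ n" ..
qed

text \<open>The definite description is resolved once and for all: any representative of the
  function and of the point may be used.\<close>

lemma point_value_eq:
  assumes "open \<Omega>" "U \<in> colombeau \<Omega>" "u \<in> U" "x \<in> in_compact_reps \<Omega> X"
  shows "point_value \<Omega> U X = abs_gen (\<lambda>\<epsilon>. u \<epsilon> (x \<epsilon>))"
  unfolding point_value_def
proof (rule the_equality)
  show "\<exists>v\<in>U. \<exists>y\<in>in_compact_reps \<Omega> X. abs_gen (\<lambda>\<epsilon>. u \<epsilon> (x \<epsilon>)) = abs_gen (\<lambda>\<epsilon>. v \<epsilon> (y \<epsilon>))"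
    using assms(3,4) by blast
next
  fix c assume "\<exists>u\<in>U. \<exists>x\<in>in_compact_reps \<Omega> X. c = abs_gen (\<lambda>\<epsilon>. u \<epsilon> (x \<epsilon>))"
  then obtain v y where v: "v \<in> U" and y: "y \<in> in_compact_reps \<Omega> X" and c: "c = abs_gen (\<lambda>\<epsilon>. v \<epsilon> (y \<epsilon>))" by blast
  obtain K where K: "compact K" "K \<subseteq> \<Omega>" "\<forall>\<^sub>F \<epsilon> in at_right 0. x \<epsilon> \<in> K" and x: "gmoderate x" "abs_gen x = X"
    using assms(4) by (auto simp: in_compact_reps_def reps_def)
  obtain L where L: "compact L" "L \<subseteq> \<Omega>" "\<forall>\<^sub>F \<epsilon> in at_right 0. y \<epsilon> \<in> L" and y': "gmoderate y" "abs_gen y = X"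
    using y by (auto simp: in_compact_reps_def reps_def)
  have yx: "gnegligible (\<lambda>\<epsilon>. y \<epsilon> - x \<epsilon>)" using x y' abs_gen_eq_iff by metis
  have um: "u \<in> moderate_nets \<Omega>" and vm: "v \<in> moderate_nets \<Omega>"
    using colombeau_elim(1)[OF assms(1,2)] assms(3) v by blast+
  have "(u, v) \<in> net_rel \<Omega>" using colombeau_elim(2)[OF assms(1-3)] v by blast
  then have "(\<lambda>\<epsilon> x. v \<epsilon> x - u \<epsilon> x) \<in> null_nets \<Omega>"
    by (auto simp: net_rel_iff intro: null_nets_diff_commute[OF assms(1)])
  then have "gnegligible (\<lambda>\<epsilon>. v \<epsilon> (y \<epsilon>) - u \<epsilon> (y \<epsilon>))"
    by (rule null_nets_value[OF _ L])
  moreover have "gnegligible (\<lambda>\<epsilon>. u \<epsilon> (y \<epsilon>) - u \<epsilon> (x \<epsilon>))"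
    by (rule moderate_nets_value_diff[OF assms(1) um K yx])
  ultimately have "gnegligible (\<lambda>\<epsilon>. v \<epsilon> (y \<epsilon>) - u \<epsilon> (x \<epsilon>))" by (rule gnegligible_trans)
  then show "c = abs_gen (\<lambda>\<epsilon>. u \<epsilon> (x \<epsilon>))"
    unfolding c by (subst abs_gen_eq_iff[OF moderate_nets_value[OF vm L] moderate_nets_value[OF um K]])
qed

lemma point_value_eq_iff:
  assumes "open \<Omega>" "U \<in> colombeau \<Omega>" "u \<in> U" "V \<in> colombeau \<Omega>" "v \<in> V" "x \<in> in_compact_reps \<Omega> X"
  shows "point_value \<Omega> U X = point_value \<Omega> V X \<longleftrightarrow> gnegligible (\<lambda>\<epsilon>. u \<epsilon> (x \<epsilon>) - v \<epsilon> (x \<epsilon>))"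
proof -
  obtain K where K: "compact K" "K \<subseteq> \<Omega>" "\<forall>\<^sub>F \<epsilon> in at_right 0. x \<epsilon> \<in> K"
    using assms(6) by (auto simp: in_compact_reps_def)
  show ?thesis
    unfolding point_value_eq[OF assms(1-3,6)] point_value_eq[OF assms(1,4,5,6)]
    by (rule abs_gen_eq_iff; rule moderate_nets_value[OF colombeau_elim(1)[OF assms(1)] K]) (use assms in auto)
qed

section \<open>Compactly supported nets and their Fourier transforms\<close>

text \<open>Differentiation under the integral, by the second order Taylor estimate of the character
  on the compact support.\<close>

lemma fourier_has_derivative:
  fixes f :: "real^'n \<Rightarrow> complex"
  assumes f: "continuous_on UNIV f" "compact K" "\<And>x. x \<notin> K \<Longrightarrow> f x = 0"
  shows "(fourier f has_derivative (\<lambda>h. \<Sum>i\<in>UNIV. h $ i *\<^sub>R fourier (\<lambda>x. - (\<i> * of_real (x $ i)) * f x) \<xi>)) (at \<xi>)"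
    (is "(_ has_derivative ?D) _")
proof -
  have fi: "integrable lborel f" by (rule integrable_continuous_compact[OF f])
  have gi: "integrable lborel (\<lambda>x. - (\<i> * of_real (x $ i)) * f x)" for i
    by (rule integrable_continuous_compact[OF _ f(2)]) (auto intro!: continuous_intros f(1) simp: f(3))
  obtain B where B: "B \<ge> 0" "\<And>x. x \<in> K \<Longrightarrow> norm (f x) \<le> B"
    using compact_norm_bound[OF f(2) continuous_on_subset[OF f(1) subset_UNIV]] by blast
  obtain R where R: "R \<ge> 0" "\<And>x. x \<in> K \<Longrightarrow> norm x \<le> R"
    using compact_norm_bound[OF f(2) continuous_on_id] by blast
  have coord: "complex_of_real (x \<bullet> h) = (\<Sum>i\<in>UNIV. of_real (h $ i) * of_real (x $ i))" for x h :: "real^'n"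
    by (simp add: inner_vec_def mult.commute)
  have D: "?D h = (LINT x|lborel. wave x \<xi> * (- (\<i> * of_real (x \<bullet> h)) * f x))" for h
  proof -
    have "(LINT x|lborel. wave x \<xi> * (- (\<i> * of_real (x \<bullet> h)) * f x)) =
        (LINT x|lborel. (\<Sum>i\<in>UNIV. of_real (h $ i) * (wave x \<xi> * (- (\<i> * of_real (x $ i)) * f x))))"
      by (intro Bochner_Integration.integral_cong refl)
        (simp add: coord sum_distrib_left sum_distrib_right sum_negf mult_ac)
    also have "\<dots> = (\<Sum>i\<in>UNIV. of_real (h $ i) * (LINT x|lborel. wave x \<xi> * (- (\<i> * of_real (x $ i)) * f x)))"
      using integrable_wave[OF gi] by (subst Bochner_Integration.integral_sum) auto
    finally show ?thesis by (simp add: fourier_wave scaleR_conv_of_real)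
  qed
  have Di: "integrable lborel (\<lambda>x. wave x \<xi> * (- (\<i> * of_real (x \<bullet> h)) * f x))" for h
    by (rule integrable_wave, rule integrable_continuous_compact[OF _ f(2)])
      (auto intro!: continuous_intros f(1) simp: f(3))
  have wave_taylor: "norm (wave x h - 1 + \<i> * of_real (x \<bullet> h)) \<le> (norm x * norm h)\<^sup>2" for x h :: "real^'n"
  proof -
    have "norm (exp (- (\<i> * complex_of_real (x \<bullet> h))) - (\<Sum>k\<le>1. (- (\<i> * complex_of_real (x \<bullet> h))) ^ k / fact k)) \<le>
        exp \<bar>Re (- (\<i> * complex_of_real (x \<bullet> h)))\<bar> * norm (- (\<i> * complex_of_real (x \<bullet> h))) ^ Suc 1 / fact 1"
      by (rule Taylor_exp)
    then have "norm (wave x h - 1 + \<i> * of_real (x \<bullet> h)) \<le> \<bar>x \<bullet> h\<bar>\<^sup>2"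
      by (simp add: wave_def norm_mult power2_eq_square algebra_simps)
    also have "\<dots> \<le> (norm x * norm h)\<^sup>2" by (intro power_mono Cauchy_Schwarz_ineq2) auto
    finally show ?thesis .
  qed
  define M where "M = R\<^sup>2 * B * measure lborel K"
  have est: "norm (fourier f (\<xi> + h) - fourier f \<xi> - ?D h) \<le> M * (norm h)\<^sup>2" for h
  proof -
    have "fourier f (\<xi> + h) - fourier f \<xi> - ?D h =
        (LINT x|lborel. wave x (\<xi> + h) * f x - wave x \<xi> * f x - wave x \<xi> * (- (\<i> * of_real (x \<bullet> h)) * f x))"
    proof -
      note ia = integrable_wave[OF fi, of "\<xi> + h"] and ib = integrable_wave[OF fi, of \<xi>]
      show ?thesis
        by (subst D)
          (simp only: fourier_wave Bochner_Integration.integral_diff[OF Bochner_Integration.integrable_diff[OF ia ib] Di]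
            Bochner_Integration.integral_diff[OF ia ib])
    qed
    also have "\<dots> = (LINT x|lborel. wave x \<xi> * f x * (wave x h - 1 + \<i> * of_real (x \<bullet> h)))"
      by (simp add: wave_add_right algebra_simps)
    also have "norm \<dots> \<le> (B * (R * norm h)\<^sup>2) * measure lborel K"
    proof (rule norm_integral_le_compact[OF f(2)])
      fix x assume x: "x \<in> K"
      have "(norm x * norm h)\<^sup>2 \<le> (R * norm h)\<^sup>2"
        by (intro power_mono mult_right_mono R(2)[OF x]) auto
      then have "norm (wave x h - 1 + \<i> * of_real (x \<bullet> h)) \<le> (R * norm h)\<^sup>2"
        using wave_taylor[of x h] by linarith
      then show "norm (wave x \<xi> * f x * (wave x h - 1 + \<i> * of_real (x \<bullet> h))) \<le> B * (R * norm h)\<^sup>2"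
        unfolding norm_mult norm_wave mult_1 using B x by (intro mult_mono) auto
    qed (simp add: f(3))
    finally show ?thesis by (simp add: M_def power_mult_distrib algebra_simps)
  qed
  have "bounded_linear ?D"
    by (intro bounded_linear_sum bounded_linear_scaleR_const bounded_linear_vec_nth)
  moreover have "((\<lambda>h. norm (fourier f (\<xi> + h) - fourier f \<xi> - ?D h) / norm h) \<longlongrightarrow> 0) (at 0)"
  proof (rule tendsto_sandwich[OF _ _ tendsto_const])
    show "\<forall>\<^sub>F h in at 0. norm (fourier f (\<xi> + h) - fourier f \<xi> - ?D h) / norm h \<le> M * norm h"
    proof (intro always_eventually allI)
      fix h :: "real^'n"
      have "norm (fourier f (\<xi> + h) - fourier f \<xi> - ?D h) / norm h \<le> M * (norm h)\<^sup>2 / norm h"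
        by (rule divide_right_mono[OF est]) simp
      then show "norm (fourier f (\<xi> + h) - fourier f \<xi> - ?D h) / norm h \<le> M * norm h"
        by (cases "h = 0") (simp_all add: power2_eq_square)
    qed
    have "((\<lambda>h::real^'n. M * norm h) \<longlongrightarrow> M * norm (0::real^'n)) (at 0)" by (intro tendsto_intros)
    then show "((\<lambda>h::real^'n. M * norm h) \<longlongrightarrow> 0) (at 0)" by simp
  qed simp
  ultimately show ?thesis by (simp add: has_derivative_at)
qed

text \<open>The factor that iterated differentiation of a Fourier transform produces under the
  integral.\<close>

definition freq_monomial :: "'n list \<Rightarrow> real^'n \<Rightarrow> complex" where
  "freq_monomial is x = (\<Prod>i\<leftarrow>is. - (\<i> * of_real (x $ i)))"

lemma smooth_on_freq_monomial: "smooth_on S (freq_monomial is)"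
proof -
  have "smooth_on UNIV (\<lambda>x::real^'n. - \<i> * of_real (x $ i))" for i
    by (intro smooth_on_mult smooth_on_const smooth_on_coord open_UNIV)
  then have *: "smooth_on UNIV (\<lambda>x::real^'n. - (\<i> * of_real (x $ i)))" for i by simp
  have "smooth_on UNIV (freq_monomial is)"
    unfolding freq_monomial_def[abs_def]
  proof (induction "is")
    case (Cons i "is")
    show ?case using smooth_on_mult[OF open_UNIV *[of i] Cons] by (simp only: list.map prod_list.Cons)
  qed (simp add: smooth_on_const)
  then show ?thesis by (rule smooth_on_UNIV)
qed

lemma continuous_on_freq_monomial: "continuous_on S (freq_monomial is)"
  by (intro smooth_on_continuous_on smooth_on_freq_monomial)

lemma pderivs_fourier:
  fixes f :: "real^'n \<Rightarrow> complex"
  assumes f: "continuous_on UNIV f" "compact K" "\<And>x. x \<notin> K \<Longrightarrow> f x = 0"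
  shows "pderivs is (fourier f) = fourier (\<lambda>x. freq_monomial is x * f x)"
    and "pderivs is (fourier f) differentiable (at \<xi>)"
proof -
  have *: "pderivs is (fourier f) = fourier (\<lambda>x. freq_monomial is x * f x)" for "is"
  proof (induction "is")
    case Nil
    then show ?case by (simp add: freq_monomial_def)
  next
    case (Cons i "is")
    let ?g = "\<lambda>x. freq_monomial is x * f x"
    have g: "continuous_on UNIV ?g" "\<And>x. x \<notin> K \<Longrightarrow> ?g x = 0"
      by (auto intro!: continuous_intros continuous_on_freq_monomial f(1) simp: f(3))
    have "pderiv_at i (fourier ?g) \<xi> = fourier (\<lambda>x. freq_monomial (i # is) x * f x) \<xi>" for \<xi>
    proof -
      have "pderiv_at i (fourier ?g) \<xi> =
          (\<Sum>j\<in>UNIV. axis i 1 $ j *\<^sub>R fourier (\<lambda>x. - (\<i> * of_real (x $ j)) * ?g x) \<xi>)"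
        using g(1) f(2) g(2) by (intro pderiv_at_eq fourier_has_derivative)
      also have "\<dots> = (\<Sum>j\<in>UNIV. if j = i then fourier (\<lambda>x. - (\<i> * of_real (x $ i)) * ?g x) \<xi> else 0)"
        by (intro sum.cong refl) (simp add: axis_def)
      finally show ?thesis by (simp add: freq_monomial_def mult.assoc)
    qed
    then show ?case by (simp add: Cons)
  qed
  let ?g = "\<lambda>x. freq_monomial is x * f x"
  have g: "continuous_on UNIV ?g" "\<And>x. x \<notin> K \<Longrightarrow> ?g x = 0"
    by (auto intro!: continuous_intros continuous_on_freq_monomial f(1) simp: f(3))
  show "pderivs is (fourier f) = fourier ?g" by (rule *)
  show "pderivs is (fourier f) differentiable (at \<xi>)"
    unfolding * using g(1) f(2) g(2) by (rule differentiableI[OF fourier_has_derivative])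
qed

lemma norm_monomial_le:
  fixes x :: "real^'n"
  shows "\<bar>\<Prod>i\<in>UNIV. x $ i ^ \<alpha> i\<bar> \<le> (1 + norm x) ^ (\<Sum>i\<in>UNIV. \<alpha> i)"
proof -
  have "\<bar>\<Prod>i\<in>UNIV. x $ i ^ \<alpha> i\<bar> = (\<Prod>i\<in>UNIV. \<bar>x $ i\<bar> ^ \<alpha> i)" by (simp add: abs_prod power_abs)
  also have "\<dots> \<le> (\<Prod>i\<in>UNIV. (1 + norm x) ^ \<alpha> i)"
    by (intro prod_mono conjI power_mono) (auto intro: order_trans[OF component_le_norm_cart])
  finally show ?thesis by (simp add: power_sum)
qed

text \<open>Nets with a common compact support, the representatives to which the Fourier transform
  is applied. They are smooth on the whole space.\<close>

definition compact_net :: "(real^'n) set \<Rightarrow> (real \<Rightarrow> real^'n \<Rightarrow> complex) \<Rightarrow> bool" where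
  "compact_net K v \<longleftrightarrow> compact K \<and> v \<in> moderate_nets UNIV \<and> (\<forall>\<epsilon>\<in>{0<..1}. \<forall>x. x \<notin> K \<longrightarrow> v \<epsilon> x = 0)"

lemma compact_netD:
  assumes "compact_net K v"
  shows "compact K" "v \<in> moderate_nets UNIV" "\<epsilon> \<in> {0<..1} \<Longrightarrow> x \<notin> K \<Longrightarrow> v \<epsilon> x = 0"
    "\<epsilon> \<in> {0<..1} \<Longrightarrow> smooth_on UNIV (v \<epsilon>)" "moderate_on K (\<lambda>\<epsilon>. pderivs is (v \<epsilon>))"
    "\<epsilon> \<in> {0<..1} \<Longrightarrow> continuous_on UNIV (v \<epsilon>)"
proof -
  show K: "compact K" and v: "v \<in> moderate_nets UNIV" using assms by (simp_all add: compact_net_def)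
  show "v \<epsilon> x = 0" if "\<epsilon> \<in> {0<..1}" "x \<notin> K" using assms that by (simp add: compact_net_def)
  show "smooth_on UNIV (v \<epsilon>)" if "\<epsilon> \<in> {0<..1}" by (rule moderate_nets_smooth_on[OF v that])
  then show "continuous_on UNIV (v \<epsilon>)" if "\<epsilon> \<in> {0<..1}" by (rule smooth_on_continuous_on[OF _]) (rule that)
  show "moderate_on K (\<lambda>\<epsilon>. pderivs is (v \<epsilon>))" by (rule moderate_nets_moderate_on[OF v K]) simp
qed

lemma compact_net_integrable: "compact_net K v \<Longrightarrow> \<epsilon> \<in> {0<..1} \<Longrightarrow> integrable lborel (v \<epsilon>)"
  by (rule integrable_continuous_compact) (auto intro: compact_netD)

lemma moderate_on_eq_0_outside:
  assumes "moderate_on K f" "\<And>\<epsilon> x. \<epsilon> \<in> {0<..1} \<Longrightarrow> x \<notin> K \<Longrightarrow> f \<epsilon> x = 0"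
  shows "moderate_on L f"
proof -
  obtain N where "\<forall>\<^sub>F \<epsilon> in at_right 0. \<forall>x\<in>K. norm (f \<epsilon> x) \<le> inverse \<epsilon> ^ N"
    using assms(1) unfolding moderate_on_iff by blast
  with eventually_unit have "\<forall>\<^sub>F \<epsilon> in at_right 0. \<forall>x\<in>L. norm (f \<epsilon> x) \<le> inverse \<epsilon> ^ N"
  proof eventually_elim
    case (elim \<epsilon>)
    have "norm (f \<epsilon> x) \<le> inverse \<epsilon> ^ N" for x
      using elim assms(2)[of \<epsilon> x] by (cases "x \<in> K") auto
    then show ?case by blast
  qed
  then show ?thesis unfolding moderate_on_iff by blast
qed

lemma compact_net_cutoff:
  assumes "open \<Omega>" "test_function \<Omega> \<phi>" "u \<in> moderate_nets \<Omega>"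
    "compact K" "K \<subseteq> \<Omega>" "\<And>x. x \<notin> K \<Longrightarrow> \<phi> x = 0"
  shows "compact_net K (\<lambda>\<epsilon> x. \<phi> x * u \<epsilon> x)"
proof -
  have m: "(\<lambda>\<epsilon> x. \<phi> x * u \<epsilon> x) \<in> moderate_nets \<Omega>"
    by (intro moderate_nets_mult moderate_nets_const test_function_smooth[OF assms(2)] assms(1,3))
  have "(\<lambda>\<epsilon> x. \<phi> x * u \<epsilon> x) \<in> moderate_nets UNIV"
    unfolding moderate_nets_iff
  proof (intro conjI allI impI ballI)
    fix \<epsilon> assume "\<epsilon> \<in> {0<..1::real}"
    then have "test_function \<Omega> (\<lambda>x. \<phi> x * u \<epsilon> x)"
      by (intro test_function_mult_smooth moderate_nets_smooth_on[OF assms(3)] assms(1,2))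
    then show "smooth_on UNIV (\<lambda>x. \<phi> x * u \<epsilon> x)" by (rule test_function_smooth)
  next
    fix L "is"
    show "moderate_on L (\<lambda>\<epsilon>. pderivs is (\<lambda>x. \<phi> x * u \<epsilon> x))"
    proof (rule moderate_on_eq_0_outside[OF moderate_nets_moderate_on[OF m assms(4,5)]])
      fix \<epsilon> x assume "x \<notin> K"
      then show "pderivs is (\<lambda>x. \<phi> x * u \<epsilon> x) x = 0"
        by (intro pderivs_eq_0_outside[OF assms(4)]) (simp_all add: assms(6))
    qed
  qed
  then show ?thesis using assms(4,6) by (simp add: compact_net_def)
qed

lemma compact_net_mult:
  assumes "compact_net K v" "smooth_on UNIV f" shows "compact_net K (\<lambda>\<epsilon> x. f x * v \<epsilon> x)"
  using assms(1) moderate_nets_mult[OF open_UNIV moderate_nets_const[OF assms(2)], of v]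
  unfolding compact_net_def by auto

text \<open>A common exponent for finitely many derivatives.\<close>

lemma moderate_on_finite:
  assumes "finite S" "\<And>j. j \<in> S \<Longrightarrow> moderate_on K (f j)"
  shows "\<exists>N. \<forall>\<^sub>F \<epsilon> in at_right 0. \<forall>j\<in>S. \<forall>x\<in>K. norm (f j \<epsilon> x) \<le> inverse \<epsilon> ^ N"
  using assms
proof (induction S rule: finite_induct)
  case (insert j S)
  obtain N where N: "\<forall>\<^sub>F \<epsilon> in at_right 0. \<forall>j\<in>S. \<forall>x\<in>K. norm (f j \<epsilon> x) \<le> inverse \<epsilon> ^ N"
    using insert.IH insert.prems by auto
  obtain M where M: "\<forall>\<^sub>F \<epsilon> in at_right 0. \<forall>x\<in>K. norm (f j \<epsilon> x) \<le> inverse \<epsilon> ^ M"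
    using insert.prems[of j] unfolding moderate_on_iff by auto
  have "\<forall>\<^sub>F \<epsilon> in at_right 0. \<forall>k\<in>insert j S. \<forall>x\<in>K. norm (f k \<epsilon> x) \<le> inverse \<epsilon> ^ max N M"
    using N M eventually_small[OF zero_less_one]
  proof eventually_elim
    case (elim \<epsilon>)
    have "1 \<le> inverse \<epsilon>" using elim(3) by (simp add: one_le_inverse)
    then have "inverse \<epsilon> ^ N \<le> inverse \<epsilon> ^ max N M" "inverse \<epsilon> ^ M \<le> inverse \<epsilon> ^ max N M"
      by (auto intro!: power_increasing)
    then show ?case using elim(1,2) by (metis (no_types, lifting) insert_iff order_trans)
  qed
  then show ?case by blast
qed (auto intro!: exI[of _ 0])

text \<open>Integration by parts bounds each weight by finitely many derivatives, which are
  moderate.\<close>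

lemma compact_net_fourier_decay:
  fixes v :: "real \<Rightarrow> real^'n \<Rightarrow> complex"
  assumes "compact_net K v"
  shows "\<exists>N. \<forall>\<^sub>F \<epsilon> in at_right 0. \<forall>\<xi>. (1 + norm \<xi>) ^ m * norm (fourier (v \<epsilon>) \<xi>) \<le> inverse \<epsilon> ^ N"
proof -
  define S where "S = insert [] (range (replicate m :: 'n \<Rightarrow> 'n list))"
  have "\<exists>N. \<forall>\<^sub>F \<epsilon> in at_right 0. \<forall>j\<in>S. \<forall>x\<in>K. norm (pderivs j (v \<epsilon>) x) \<le> inverse \<epsilon> ^ N"
    by (rule moderate_on_finite) (auto simp: S_def intro: compact_netD(5)[OF assms])
  then obtain N where N: "\<forall>\<^sub>F \<epsilon> in at_right 0. \<forall>j\<in>S. \<forall>x\<in>K. norm (pderivs j (v \<epsilon>) x) \<le> inverse \<epsilon> ^ N" ..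
  define C where "C = (1 + real CARD('n)) ^ m * ((1 + real CARD('n)) * measure lborel K)"
  from N absorb_const_inverse[of C N] eventually_unit
  have "\<forall>\<^sub>F \<epsilon> in at_right 0. \<forall>\<xi>. (1 + norm \<xi>) ^ m * norm (fourier (v \<epsilon>) \<xi>) \<le> inverse \<epsilon> ^ Suc N"
  proof eventually_elim
    case (elim \<epsilon>)
    have b1: "norm (v \<epsilon> x) \<le> inverse \<epsilon> ^ N" if "x \<in> K" for x
      using bspec[OF bspec[OF elim(1), of "[]"] that] by (simp add: S_def)
    have b2: "norm (pderivs (replicate m i) (v \<epsilon>) x) \<le> inverse \<epsilon> ^ N" if "x \<in> K" for x i
      using bspec[OF bspec[OF elim(1), of "replicate m i"] that] by (auto simp: S_def)
    show ?case
    proof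
      fix \<xi>
      have "(1 + norm \<xi>) ^ m * norm (fourier (v \<epsilon>) \<xi>) \<le>
          (1 + real CARD('n)) ^ m * ((1 + real CARD('n)) * (inverse \<epsilon> ^ N * measure lborel K))"
        using compact_netD(4)[OF assms elim(3)] compact_netD(1)[OF assms] compact_netD(3)[OF assms elim(3)] b1 b2
        by (rule fourier_decay)
      also have "\<dots> = C * inverse \<epsilon> ^ N" by (simp add: C_def)
      also have "\<dots> \<le> inverse \<epsilon> ^ Suc N" by (rule elim(2))
      finally show "(1 + norm \<xi>) ^ m * norm (fourier (v \<epsilon>) \<xi>) \<le> inverse \<epsilon> ^ Suc N" .
    qed
  qed
  then show ?thesis by (rule exI)
qed

lemma null_fourier:
  assumes "compact K" "\<And>\<epsilon> x. \<epsilon> \<in> {0<..1} \<Longrightarrow> x \<notin> K \<Longrightarrow> v \<epsilon> x = 0" "null_on K v"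
  shows "\<forall>\<^sub>F \<epsilon> in at_right 0. \<forall>\<xi>. norm (fourier (v \<epsilon>) \<xi>) \<le> \<epsilon> ^ n"
proof -
  have "\<forall>\<^sub>F \<epsilon> in at_right 0. \<forall>x\<in>K. norm (v \<epsilon> x) \<le> \<epsilon> ^ Suc n"
    using assms(3) unfolding null_on_iff ..
  with eventually_unit absorb_const_power[of "measure lborel K" n] show ?thesis
  proof eventually_elim
    case (elim \<epsilon>)
    have "norm (fourier (v \<epsilon>) \<xi>) \<le> \<epsilon> ^ Suc n * measure lborel K" for \<xi>
      using assms(1) assms(2)[OF elim(1)] bspec[OF elim(3)] by (rule norm_fourier_le_compact)
    then show ?case using elim(2) by (simp add: mult.commute[of "measure lborel K"]) (meson order_trans)
  qed
qed

lemma schwartz_compact_support: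
  fixes f :: "real^'n \<Rightarrow> complex"
  assumes f: "smooth_on UNIV f" and K: "compact K" "\<And>x. x \<notin> K \<Longrightarrow> f x = 0"
  shows "schwartz f"
  unfolding schwartz_def
proof (intro conjI allI f)
  fix \<alpha> :: "'n \<Rightarrow> nat" and "is"
  let ?h = "\<lambda>x. (\<Prod>i\<in>UNIV. x $ i ^ \<alpha> i) *\<^sub>R pderivs is f x"
  have z: "?h x = 0" if "x \<notin> K" for x using pderivs_eq_0_outside[OF K that] by simp
  have c: "continuous_on UNIV ?h"
    by (intro continuous_intros smooth_on_continuous_pderivs f)
  show "bounded (range ?h)"
  proof (rule continuous_compact_bounded[OF c K(1)])
    show "?h x = 0" if "x \<notin> K" for x by (rule z[OF that])
    fix B assume "\<And>x. norm (?h x) \<le> B"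
    then show "bounded (range ?h)" by (intro boundedI[of _ B]) auto
  qed
qed

lemma compact_net_moderate_schwartz:
  fixes v :: "real \<Rightarrow> real^'n \<Rightarrow> complex"
  assumes "compact_net K v" shows "v \<in> moderate_schwartz"
  unfolding moderate_schwartz_def
proof (intro CollectI conjI ballI allI)
  fix \<epsilon> :: real assume "\<epsilon> \<in> {0<..1}"
  then show "schwartz (v \<epsilon>)" using compact_netD[OF assms] by (intro schwartz_compact_support[of _ K]) auto
next
  fix \<alpha> :: "'n \<Rightarrow> nat" and "is"
  have c: "continuous_on K (\<lambda>x. complex_of_real (\<Prod>i\<in>UNIV. x $ i ^ \<alpha> i))" by (intro continuous_intros)
  obtain B where B: "\<And>x. x \<in> K \<Longrightarrow> norm (complex_of_real (\<Prod>i\<in>UNIV. x $ i ^ \<alpha> i)) \<le> B"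
    using compact_norm_bound[OF compact_netD(1)[OF assms] c] by blast
  have "moderate_on K (\<lambda>\<epsilon> x. complex_of_real (\<Prod>i\<in>UNIV. x $ i ^ \<alpha> i) * pderivs is (v \<epsilon>) x)"
    by (intro moderate_on_mult moderate_on_bounded[OF B] compact_netD(5)[OF assms])
  then have "moderate_on UNIV (\<lambda>\<epsilon> x. complex_of_real (\<Prod>i\<in>UNIV. x $ i ^ \<alpha> i) * pderivs is (v \<epsilon>) x)"
  proof (rule moderate_on_eq_0_outside)
    fix \<epsilon> :: real and x assume "\<epsilon> \<in> {0<..1}" "x \<notin> K"
    then have "pderivs is (v \<epsilon>) x = 0"
      by (intro pderivs_eq_0_outside[of K]) (auto intro: compact_netD[OF assms])
    then show "complex_of_real (\<Prod>i\<in>UNIV. x $ i ^ \<alpha> i) * pderivs is (v \<epsilon>) x = 0" by simp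
  qed
  then show "\<exists>N::nat. sup_bigo UNIV (\<lambda>\<epsilon> x. (\<Prod>i\<in>UNIV. x $ i ^ \<alpha> i) *\<^sub>R pderivs is (v \<epsilon>) x) (\<lambda>\<epsilon>. inverse \<epsilon> ^ N)"
    by (simp add: moderate_on_def scaleR_conv_of_real)
qed

lemma compact_net_fourier_moderate_schwartz:
  fixes v :: "real \<Rightarrow> real^'n \<Rightarrow> complex"
  assumes "compact_net K v" shows "(\<lambda>\<epsilon>. fourier (v \<epsilon>)) \<in> moderate_schwartz"
proof -
  have pd: "pderivs is (fourier (v \<epsilon>)) = fourier (\<lambda>x. freq_monomial is x * v \<epsilon> x)" if "\<epsilon> \<in> {0<..1}" for "is" \<epsilon>
    using compact_netD(6)[OF assms that] compact_netD(1)[OF assms] compact_netD(3)[OF assms that] by (rule pderivs_fourier(1))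
  have c: "compact_net K (\<lambda>\<epsilon> x. freq_monomial is x * v \<epsilon> x)" for "is"
    by (rule compact_net_mult[OF assms smooth_on_freq_monomial])
  have le: "norm ((\<Prod>i\<in>UNIV. \<xi> $ i ^ \<alpha> i) *\<^sub>R pderivs is (fourier (v \<epsilon>)) \<xi>) \<le>
      (1 + norm \<xi>) ^ (\<Sum>i\<in>UNIV. \<alpha> i) * norm (fourier (\<lambda>x. freq_monomial is x * v \<epsilon> x) \<xi>)"
    if "\<epsilon> \<in> {0<..1}" for \<alpha> "is" \<epsilon> \<xi>
    unfolding pd[OF that] norm_scaleR by (intro mult_right_mono norm_monomial_le norm_ge_zero)
  show ?thesis
    unfolding moderate_schwartz_def
  proof (intro CollectI conjI ballI allI)
    fix \<epsilon> :: real assume e: "\<epsilon> \<in> {0<..1}"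
    show "schwartz (fourier (v \<epsilon>))"
      unfolding schwartz_def smooth_on_def
    proof (intro conjI allI ballI)
      show "pderivs is (fourier (v \<epsilon>)) differentiable (at \<xi>)" for "is" \<xi>
        using compact_netD(6)[OF assms e] compact_netD(1)[OF assms] compact_netD(3)[OF assms e] by (rule pderivs_fourier(2))
      fix \<alpha> :: "'n \<Rightarrow> nat" and "is"
      show "bounded (range (\<lambda>\<xi>. (\<Prod>i\<in>UNIV. \<xi> $ i ^ \<alpha> i) *\<^sub>R pderivs is (fourier (v \<epsilon>)) \<xi>))"
      proof (rule fourier_rapidly_decreasing[OF compact_netD(4)[OF c e] compact_netD(1)[OF assms]])
        show "freq_monomial is x * v \<epsilon> x = 0" if "x \<notin> K" for x by (rule compact_netD(3)[OF c e that])
        fix C assume C: "\<And>\<xi>. (1 + norm \<xi>) ^ (\<Sum>i\<in>UNIV. \<alpha> i) *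
          norm (fourier (\<lambda>x. freq_monomial is x * v \<epsilon> x) \<xi>) \<le> C"
        show ?thesis
          by (rule boundedI[of _ C]) (auto intro: order_trans[OF le[OF e] C])
      qed
    qed
  next
    fix \<alpha> :: "'n \<Rightarrow> nat" and "is"
    obtain N where N: "\<forall>\<^sub>F \<epsilon> in at_right 0. \<forall>\<xi>. (1 + norm \<xi>) ^ (\<Sum>i\<in>UNIV. \<alpha> i) *
        norm (fourier (\<lambda>x. freq_monomial is x * v \<epsilon> x) \<xi>) \<le> inverse \<epsilon> ^ N"
      using compact_net_fourier_decay[OF c] by blast
    have "\<forall>\<^sub>F \<epsilon> in at_right 0. \<forall>\<xi>\<in>UNIV. norm ((\<Prod>i\<in>UNIV. \<xi> $ i ^ \<alpha> i) *\<^sub>R pderivs is (fourier (v \<epsilon>)) \<xi>) \<le> 1 * inverse \<epsilon> ^ N"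
      using N eventually_unit
    proof eventually_elim
      case (elim \<epsilon>)
      show ?case
        using order_trans[OF le[OF elim(2)] spec[OF elim(1)]] by simp
    qed
    then show "\<exists>N::nat. sup_bigo UNIV (\<lambda>\<epsilon> x. (\<Prod>i\<in>UNIV. x $ i ^ \<alpha> i) *\<^sub>R pderivs is (fourier (v \<epsilon>)) x) (\<lambda>\<epsilon>. inverse \<epsilon> ^ N)"
      by (intro exI sup_bigoI)
  qed
qed


lemma weighted_le_monomials:
  fixes f :: "real^'n \<Rightarrow> complex"
  assumes "norm (f x) \<le> b" "\<And>i. \<bar>x $ i\<bar> ^ m * norm (f x) \<le> b"
  shows "(1 + norm x) ^ m * norm (f x) \<le> (1 + real CARD('n)) ^ Suc m * b"
proof -
  have "(1 + norm x) ^ m * norm (f x) \<le>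
      ((1 + real CARD('n)) ^ m * (1 + (\<Sum>i\<in>UNIV. \<bar>x $ i\<bar> ^ m))) * norm (f x)"
    by (intro mult_right_mono weight_le_coordinates norm_ge_zero)
  also have "\<dots> = (1 + real CARD('n)) ^ m * (norm (f x) + (\<Sum>i\<in>UNIV. \<bar>x $ i\<bar> ^ m * norm (f x)))"
    by (simp add: algebra_simps sum_distrib_left sum_distrib_right)
  also have "\<dots> \<le> (1 + real CARD('n)) ^ m * (b + (\<Sum>i\<in>(UNIV::'n set). b))"
    by (intro mult_left_mono add_mono sum_mono assms) auto
  finally show ?thesis by (simp add: algebra_simps)
qed

lemma single_monomial:
  fixes x :: "real^'n"
  shows "(\<Prod>j\<in>UNIV. x $ j ^ (if j = i then m else 0)) = x $ i ^ m"
proof -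
  have "(\<Prod>j\<in>UNIV. x $ j ^ (if j = i then m else 0)) = (\<Prod>j\<in>UNIV. if j = i then x $ i ^ m else 1)"
    by (intro prod.cong refl) simp
  then show ?thesis by simp
qed

lemma schwartz_integrable:
  fixes f :: "real^'n \<Rightarrow> complex"
  assumes "schwartz f" shows "integrable lborel f"
proof -
  obtain m where m: "m = CARD('n) + 2" by simp
  have bdd: "\<exists>B. \<forall>x. norm ((\<Prod>i\<in>UNIV. x $ i ^ \<alpha> i) *\<^sub>R f x) \<le> B" for \<alpha> :: "'n \<Rightarrow> nat"
  proof -
    have "bounded (range (\<lambda>x. (\<Prod>i\<in>UNIV. x $ i ^ \<alpha> i) *\<^sub>R pderivs [] f x))"
      using assms unfolding schwartz_def by blast
    then show ?thesis by (simp add: bounded_iff)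
  qed
  obtain B0 where B0: "\<forall>x. norm (f x) \<le> B0" using bdd[of "\<lambda>_. 0"] by auto
  have "\<exists>B. \<forall>x. \<bar>x $ i\<bar> ^ m * norm (f x) \<le> B" for i
    using bdd[of "\<lambda>j. if j = i then m else 0"] by (simp add: single_monomial power_abs)
  then have "\<exists>b. \<forall>i. \<forall>x. \<bar>x $ i\<bar> ^ m * norm (f x) \<le> b i" by (intro choice allI)
  then obtain b where b: "\<forall>i. \<forall>x. \<bar>x $ i\<bar> ^ m * norm (f x) \<le> b i" ..
  define B where "B = max B0 (Max (range b))"
  have "b i \<le> Max (range b)" for i by simp
  then have bB: "b i \<le> B" for i unfolding B_def by (meson le_max_iff_disj)
  have B1: "norm (f x) \<le> B" for x using B0 unfolding B_def by (meson le_max_iff_disj)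
  have B2: "\<bar>x $ i\<bar> ^ m * norm (f x) \<le> B" for x i
    using b bB[of i] order_trans by blast
  have "continuous_on UNIV f" using assms unfolding schwartz_def by (intro smooth_on_continuous_on) blast
  then have "f \<in> borel_measurable borel" by (rule borel_measurable_continuous_onI)
  then show ?thesis
    by (rule integrable_weight_bound(1)) (rule weighted_le_monomials[OF B1 B2, unfolded m])
qed

lemma null_schwartz_null_on:
  fixes z :: "real \<Rightarrow> real^'n \<Rightarrow> complex" and \<alpha> :: "'n \<Rightarrow> nat"
  assumes "z \<in> null_schwartz"
  shows "null_on UNIV (\<lambda>\<epsilon> x. (\<Prod>i\<in>UNIV. x $ i ^ \<alpha> i) *\<^sub>R z \<epsilon> x)"
  unfolding null_on_def
proof
  fix k
  have "sup_bigo UNIV (\<lambda>\<epsilon> x. (\<Prod>i\<in>UNIV. x $ i ^ \<alpha> i) *\<^sub>R pderivs [] (z \<epsilon>) x) (\<lambda>\<epsilon>. \<epsilon> ^ k)"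
    using assms unfolding null_schwartz_def by blast
  then show "sup_bigo UNIV (\<lambda>\<epsilon> x. (\<Prod>i\<in>UNIV. x $ i ^ \<alpha> i) *\<^sub>R z \<epsilon> x) (\<lambda>\<epsilon>. \<epsilon> ^ k)" by simp
qed

text \<open>A null net of Schwartz functions is negligible in \<open>L\<^sup>1\<close>, by the
  integrable weight.\<close>

lemma null_schwartz_fourier:
  fixes z :: "real \<Rightarrow> real^'n \<Rightarrow> complex"
  assumes "z \<in> null_schwartz"
  shows "\<forall>\<^sub>F \<epsilon> in at_right 0. \<forall>\<xi>. norm (fourier (z \<epsilon>) \<xi>) \<le> \<epsilon> ^ n"
proof -
  let ?m = "CARD('n) + 2"
  note nul = null_schwartz_null_on[OF assms]
  have 1: "\<forall>\<^sub>F \<epsilon> in at_right 0. \<forall>x. norm (z \<epsilon> x) \<le> \<epsilon> ^ Suc n"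
    using nul[of "\<lambda>_. 0"] unfolding null_on_iff by (simp del: power_Suc)
  have "\<forall>\<^sub>F \<epsilon> in at_right 0. \<forall>x. \<bar>x $ i\<bar> ^ ?m * norm (z \<epsilon> x) \<le> \<epsilon> ^ Suc n" for i
    using nul[of "\<lambda>j. if j = i then ?m else 0"] unfolding null_on_iff single_monomial
    by (auto simp: power_abs simp del: power_Suc power_add_numeral dest: spec[of _ "Suc n"])
  then have 2: "\<forall>\<^sub>F \<epsilon> in at_right 0. \<forall>i\<in>UNIV. \<forall>x. \<bar>x $ i\<bar> ^ ?m * norm (z \<epsilon> x) \<le> \<epsilon> ^ Suc n"
    by (intro eventually_ball_finite) simp_all
  define W where "W = (LINT x|lborel. inverse ((1 + norm (x::real^'n)) ^ ?m))"
  define C where "C = (1 + real CARD('n)) ^ Suc ?m * W"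
  from 1 2 eventually_unit absorb_const_power[of C n] show ?thesis
  proof eventually_elim
    case (elim \<epsilon>)
    have "schwartz (z \<epsilon>)" using assms elim(3) unfolding null_schwartz_def by blast
    then have "continuous_on UNIV (z \<epsilon>)" unfolding schwartz_def by (intro smooth_on_continuous_on) blast
    then have meas: "z \<epsilon> \<in> borel_measurable borel" by (rule borel_measurable_continuous_onI)
    have "(1 + norm x) ^ ?m * norm (z \<epsilon> x) \<le> (1 + real CARD('n)) ^ Suc ?m * \<epsilon> ^ Suc n" for x
      by (rule weighted_le_monomials) (use elim(1,2) in blast)+
    then have "(LINT x|lborel. norm (z \<epsilon> x)) \<le> ((1 + real CARD('n)) ^ Suc ?m * \<epsilon> ^ Suc n) * W"
      unfolding W_def by (rule integrable_weight_bound(2)[OF meas])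
    also have "\<dots> = C * \<epsilon> ^ Suc n" by (simp add: C_def)
    also have "\<dots> \<le> \<epsilon> ^ n" by (rule elim(4))
    finally show ?case using norm_fourier_le[of "z \<epsilon>"] by (meson order_trans)
  qed
qed

lemma compact_net_fourier_bounded:
  assumes "compact_net K v"
  shows "\<exists>N. \<forall>\<^sub>F \<epsilon> in at_right 0. \<forall>\<xi>. norm (fourier (v \<epsilon>) \<xi>) \<le> inverse \<epsilon> ^ N"
  using compact_net_fourier_decay[OF assms, of 0] by simp

lemma compact_net_fourier_value:
  assumes "compact_net K v" shows "gmoderate (\<lambda>\<epsilon>. fourier (v \<epsilon>) (\<xi> \<epsilon>))"
proof -
  obtain N where "\<forall>\<^sub>F \<epsilon> in at_right 0. \<forall>\<xi>. norm (fourier (v \<epsilon>) \<xi>) \<le> inverse \<epsilon> ^ N"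
    using compact_net_fourier_bounded[OF assms] ..
  then have "\<forall>\<^sub>F \<epsilon> in at_right 0. norm (fourier (v \<epsilon>) (\<xi> \<epsilon>)) \<le> inverse \<epsilon> ^ N" by eventually_elim simp
  then show ?thesis unfolding gmoderate_iff by (rule exI)
qed

lemma compact_net_fourier_value_diff:
  assumes "compact_net K v" "gnegligible (\<lambda>\<epsilon>. \<xi> \<epsilon> - \<eta> \<epsilon>)"
  shows "gnegligible (\<lambda>\<epsilon>. fourier (v \<epsilon>) (\<xi> \<epsilon>) - fourier (v \<epsilon>) (\<eta> \<epsilon>))"
proof (rule gnegligible_eventually_bound)
  fix n :: nat
  obtain R where R: "R \<ge> 0" "\<And>x. x \<in> K \<Longrightarrow> norm x \<le> R"
    using compact_norm_bound[OF compact_netD(1)[OF assms(1)] continuous_on_id] by blast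
  obtain N where N: "\<forall>\<^sub>F \<epsilon> in at_right 0. \<forall>x\<in>K. norm (v \<epsilon> x) \<le> inverse \<epsilon> ^ N"
    using compact_netD(5)[OF assms(1), of "[]"] unfolding moderate_on_iff by auto
  have "\<forall>\<^sub>F \<epsilon> in at_right 0. norm (\<xi> \<epsilon> - \<eta> \<epsilon>) \<le> \<epsilon> ^ (n + N)"
    using assms(2) unfolding gnegligible_iff ..
  with N eventually_unit have "\<forall>\<^sub>F \<epsilon> in at_right 0.
      norm (fourier (v \<epsilon>) (\<xi> \<epsilon>) - fourier (v \<epsilon>) (\<eta> \<epsilon>)) \<le> (R * measure lborel K) * \<epsilon> ^ n"
  proof eventually_elim
    case (elim \<epsilon>)
    have "norm (fourier (v \<epsilon>) (\<xi> \<epsilon>) - fourier (v \<epsilon>) (\<eta> \<epsilon>)) \<le>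
        R * norm (\<xi> \<epsilon> - \<eta> \<epsilon>) * inverse \<epsilon> ^ N * measure lborel K"
      using compact_net_integrable[OF assms(1) elim(2)] compact_netD(1)[OF assms(1)] compact_netD(3)[OF assms(1) elim(2)]
        bspec[OF elim(1)] R(2) by (rule fourier_lipschitz)
    also have "\<dots> \<le> R * \<epsilon> ^ (n + N) * inverse \<epsilon> ^ N * measure lborel K"
      using elim(2,3) R(1) by (intro mult_right_mono mult_left_mono) auto
    also have "\<dots> = (R * measure lborel K) * \<epsilon> ^ n"
      using elim(2) by (simp add: power_add power_inverse)
    finally show ?case .
  qed
  then show "\<exists>C. \<forall>\<^sub>F \<epsilon> in at_right 0. norm (fourier (v \<epsilon>) (\<xi> \<epsilon>) - fourier (v \<epsilon>) (\<eta> \<epsilon>)) \<le> C * \<epsilon> ^ n" ..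
qed

lemma null_schwartz_zero: "(\<lambda>\<epsilon> x. 0) \<in> null_schwartz"
proof -
  have z: "pderivs is (\<lambda>_::real^'n. 0::complex) x = 0" for "is" x
    using pderivs_eq_0_outside[of "{}" "\<lambda>_. 0" x "is"] by simp
  have "schwartz (\<lambda>_::real^'n. 0)" by (rule schwartz_compact_support[of _ "{}"]) (auto intro: smooth_on_const)
  then show ?thesis unfolding null_schwartz_def by (auto simp: z intro!: sup_bigoI[of _ _ 0])
qed

lemma schwartz_rel_refl: "v \<in> moderate_schwartz \<Longrightarrow> (v, v) \<in> schwartz_rel"
  by (simp add: schwartz_rel_def null_schwartz_zero)

lemma fourier_value_null_diff:
  fixes v w :: "real \<Rightarrow> real^'n \<Rightarrow> complex" and \<xi> :: "real \<Rightarrow> real^'n"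
  assumes "\<And>n. \<forall>\<^sub>F \<epsilon> in at_right 0. \<forall>\<xi>. norm (fourier (\<lambda>x. v \<epsilon> x - w \<epsilon> x) \<xi>) \<le> \<epsilon> ^ n"
    and "\<And>\<epsilon>. \<epsilon> \<in> {0<..1} \<Longrightarrow> integrable lborel (v \<epsilon>)" "\<And>\<epsilon>. \<epsilon> \<in> {0<..1} \<Longrightarrow> integrable lborel (w \<epsilon>)"
  shows "gnegligible (\<lambda>\<epsilon>. fourier (v \<epsilon>) (\<xi> \<epsilon>) - fourier (w \<epsilon>) (\<xi> \<epsilon>))"
  unfolding gnegligible_iff
proof
  fix n
  from assms(1)[of n] eventually_unit
  show "\<forall>\<^sub>F \<epsilon> in at_right 0. norm (fourier (v \<epsilon>) (\<xi> \<epsilon>) - fourier (w \<epsilon>) (\<xi> \<epsilon>)) \<le> \<epsilon> ^ n"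
  proof eventually_elim
    case (elim \<epsilon>)
    show ?case
      using spec[OF elim(1), of "\<xi> \<epsilon>"] fourier_diff[OF assms(2)[OF elim(2)] assms(3)[OF elim(2)], of "\<xi> \<epsilon>"]
      by simp
  qed
qed

text \<open>Values of the generalized Fourier transform may be computed from any compactly supported
  representative \<open>v\<close>. Another choice passes from \<open>v\<close> to another compactly
  supported \<open>v'\<close>, then to an equivalent net \<open>w\<close> of Schwartz functions,
  from \<open>fourier w\<close> to an equivalent \<open>f\<close>, and from \<open>\<xi>\<close> to
  an equivalent \<open>\<eta>\<close>; each of these steps changes the value by a negligible
  amount.\<close>

lemma schwartz_point_value_gfourier:
  assumes "open \<Omega>" "V \<in> colombeau \<Omega>" "v \<in> V" "compact_net K v" "K \<subseteq> \<Omega>" "gmoderate \<xi>"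
  shows "schwartz_point_value (gfourier (embed_schwartz \<Omega> V)) (abs_gen \<xi>) = abs_gen (\<lambda>\<epsilon>. fourier (v \<epsilon>) (\<xi> \<epsilon>))"
  unfolding schwartz_point_value_def
proof (rule the_equality)
  have "v \<in> embed_schwartz \<Omega> V"
    unfolding embed_schwartz_def
  proof (rule ImageI[OF schwartz_rel_refl[OF compact_net_moderate_schwartz[OF assms(4)]]], intro CollectI conjI exI)
    show "\<forall>\<epsilon>\<in>{0<..1}. \<forall>x. x \<notin> K \<longrightarrow> v \<epsilon> x = 0" using assms(4) by (simp add: compact_net_def)
  qed (use assms compact_netD(1) in auto)
  then have "(\<lambda>\<epsilon>. fourier (v \<epsilon>)) \<in> gfourier (embed_schwartz \<Omega> V)"
    unfolding gfourier_def
    by (intro ImageI[OF schwartz_rel_refl[OF compact_net_fourier_moderate_schwartz[OF assms(4)]]] imageI)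
  moreover have "\<xi> \<in> reps (abs_gen \<xi>)" using assms(6) by (simp add: reps_def)
  ultimately show "\<exists>w\<in>gfourier (embed_schwartz \<Omega> V). \<exists>\<eta>\<in>reps (abs_gen \<xi>).
      abs_gen (\<lambda>\<epsilon>. fourier (v \<epsilon>) (\<xi> \<epsilon>)) = abs_gen (\<lambda>\<epsilon>. w \<epsilon> (\<eta> \<epsilon>))"
    by (intro bexI[of _ "\<lambda>\<epsilon>. fourier (v \<epsilon>)"] bexI[of _ \<xi>] refl)
next
  fix c assume "\<exists>w\<in>gfourier (embed_schwartz \<Omega> V). \<exists>\<eta>\<in>reps (abs_gen \<xi>). c = abs_gen (\<lambda>\<epsilon>. w \<epsilon> (\<eta> \<epsilon>))"
  then obtain f \<eta> where f: "f \<in> gfourier (embed_schwartz \<Omega> V)" and \<eta>: "\<eta> \<in> reps (abs_gen \<xi>)"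
    and c: "c = abs_gen (\<lambda>\<epsilon>. f \<epsilon> (\<eta> \<epsilon>))" by (elim bexE)
  obtain w where w: "w \<in> embed_schwartz \<Omega> V" "((\<lambda>\<epsilon>. fourier (w \<epsilon>)), f) \<in> schwartz_rel"
    using f unfolding gfourier_def by auto
  obtain v' L where v': "v' \<in> V" "(v', w) \<in> schwartz_rel" and L: "compact L" "L \<subseteq> \<Omega>"
    and v'L: "\<forall>\<epsilon>\<in>{0<..1}. \<forall>x. x \<notin> L \<longrightarrow> v' \<epsilon> x = 0"
    using w(1) unfolding embed_schwartz_def by auto
  have \<eta>m: "gmoderate \<eta>" and \<eta>\<xi>: "gnegligible (\<lambda>\<epsilon>. \<eta> \<epsilon> - \<xi> \<epsilon>)"
    using \<eta> assms(6) by (simp_all add: reps_abs_gen)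
  have 1: "gnegligible (\<lambda>\<epsilon>. fourier (w \<epsilon>) (\<eta> \<epsilon>) - f \<epsilon> (\<eta> \<epsilon>))"
    unfolding gnegligible_iff
  proof
    fix n
    have "(\<lambda>\<epsilon> x. fourier (w \<epsilon>) x - f \<epsilon> x) \<in> null_schwartz" using w(2) by (simp add: schwartz_rel_def)
    from null_schwartz_null_on[OF this, of "\<lambda>_. 0"]
    have "null_on UNIV (\<lambda>\<epsilon> x. fourier (w \<epsilon>) x - f \<epsilon> x)" by simp
    then have "\<forall>\<^sub>F \<epsilon> in at_right 0. \<forall>x\<in>UNIV. norm (fourier (w \<epsilon>) x - f \<epsilon> x) \<le> \<epsilon> ^ n"
      unfolding null_on_iff ..
    then show "\<forall>\<^sub>F \<epsilon> in at_right 0. norm (fourier (w \<epsilon>) (\<eta> \<epsilon>) - f \<epsilon> (\<eta> \<epsilon>)) \<le> \<epsilon> ^ n"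
      by eventually_elim blast
  qed
  have v'w: "v' \<in> moderate_schwartz" "w \<in> moderate_schwartz" "(\<lambda>\<epsilon> x. v' \<epsilon> x - w \<epsilon> x) \<in> null_schwartz"
    using v'(2) by (simp_all add: schwartz_rel_def)
  have ms_int: "integrable lborel (g \<epsilon>)" if "g \<in> moderate_schwartz" "\<epsilon> \<in> {0<..1}" for g :: "real \<Rightarrow> real^'a \<Rightarrow> complex" and \<epsilon>
    using that unfolding moderate_schwartz_def by (intro schwartz_integrable) blast
  have 2: "gnegligible (\<lambda>\<epsilon>. fourier (v' \<epsilon>) (\<eta> \<epsilon>) - fourier (w \<epsilon>) (\<eta> \<epsilon>))"
    by (rule fourier_value_null_diff) (use null_schwartz_fourier[OF v'w(3)] ms_int v'w(1,2) in auto)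
  have 3: "gnegligible (\<lambda>\<epsilon>. fourier (v \<epsilon>) (\<eta> \<epsilon>) - fourier (v' \<epsilon>) (\<eta> \<epsilon>))"
  proof (rule fourier_value_null_diff)
    fix n
    have "(v, v') \<in> net_rel \<Omega>" using colombeau_elim(2)[OF assms(1-3)] v'(1) by blast
    then have "(\<lambda>\<epsilon> x. v \<epsilon> x - v' \<epsilon> x) \<in> null_nets \<Omega>" by (simp add: net_rel_iff)
    moreover have KL: "compact (K \<union> L)" "K \<union> L \<subseteq> \<Omega>" using L compact_netD(1)[OF assms(4)] assms(5) by auto
    ultimately have "null_on (K \<union> L) (\<lambda>\<epsilon> x. v \<epsilon> x - v' \<epsilon> x)"
      using null_nets_null_on[of _ \<Omega> "K \<union> L" "[]"] by simp
    then show "\<forall>\<^sub>F \<epsilon> in at_right 0. \<forall>\<xi>. norm (fourier (\<lambda>x. v \<epsilon> x - v' \<epsilon> x) \<xi>) \<le> \<epsilon> ^ n"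
      by (rule null_fourier[OF KL(1), rotated]) (use compact_netD(3)[OF assms(4)] v'L in auto)
  qed (use compact_net_integrable[OF assms(4)] ms_int v'w(1) in auto)
  have 4: "gnegligible (\<lambda>\<epsilon>. fourier (v \<epsilon>) (\<xi> \<epsilon>) - fourier (v \<epsilon>) (\<eta> \<epsilon>))"
    by (rule compact_net_fourier_value_diff[OF assms(4) gnegligible_minus[OF \<eta>\<xi>]])
  have "gnegligible (\<lambda>\<epsilon>. fourier (v \<epsilon>) (\<xi> \<epsilon>) - f \<epsilon> (\<eta> \<epsilon>))"
    by (rule gnegligible_trans[OF 4 gnegligible_trans[OF 3 gnegligible_trans[OF 2 1]]])
  then have neg: "gnegligible (\<lambda>\<epsilon>. f \<epsilon> (\<eta> \<epsilon>) - fourier (v \<epsilon>) (\<xi> \<epsilon>))" by (rule gnegligible_minus)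
  have m: "gmoderate (\<lambda>\<epsilon>. fourier (v \<epsilon>) (\<xi> \<epsilon>))" by (rule compact_net_fourier_value[OF assms(4)])
  show "c = abs_gen (\<lambda>\<epsilon>. fourier (v \<epsilon>) (\<xi> \<epsilon>))"
    unfolding c by (subst abs_gen_eq_iff[OF gmoderate_near[OF m neg] m]) (rule neg)
qed

lemma schwartz_point_value_eq_0_iff:
  assumes "open \<Omega>" "V \<in> colombeau \<Omega>" "v \<in> V" "compact_net K v" "K \<subseteq> \<Omega>" "gmoderate \<xi>"
  shows "schwartz_point_value (gfourier (embed_schwartz \<Omega> V)) (abs_gen \<xi>) = 0 \<longleftrightarrow>
    gnegligible (\<lambda>\<epsilon>. fourier (v \<epsilon>) (\<xi> \<epsilon>))"
  unfolding schwartz_point_value_gfourier[OF assms] zero_gen.abs_eq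
  using abs_gen_eq_iff[OF compact_net_fourier_value[OF assms(4)] gmoderate_const, of \<xi> 0] by simp

text \<open>Multiply any representative by a cutoff that equals \<open>1\<close> near the support.
  The difference vanishes near the support, and locally off the support the representative is a null
  net.\<close>

lemma colombeau_c_compact_representative:
  assumes "open \<Omega>" "V \<in> colombeau_c \<Omega>"
  obtains v K where "v \<in> V" "compact_net K v" "K \<subseteq> \<Omega>"
proof -
  have V: "V \<in> colombeau \<Omega>" and S: "compact (colombeau_supp \<Omega> V)"
    using assms(2) by (auto simp: colombeau_c_def)
  have SO: "colombeau_supp \<Omega> V \<subseteq> \<Omega>" by (auto simp: colombeau_supp_def)
  obtain cut W where cut: "test_function \<Omega> cut" "open W" "colombeau_supp \<Omega> V \<subseteq> W" "\<And>x. x \<in> W \<Longrightarrow> cut x = 1"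
    using exists_cutoff[OF S assms(1) SO] by blast
  obtain K where K: "compact K" "K \<subseteq> \<Omega>" "\<And>x. x \<notin> K \<Longrightarrow> cut x = 0"
    using cut(1) by (rule test_functionE) blast
  obtain v0 where v0: "v0 \<in> V" using colombeau_nonempty[OF assms(1) V] by blast
  have v0m: "v0 \<in> moderate_nets \<Omega>" by (rule colombeau_elim(1)[OF assms(1) V v0])
  define v where "v \<epsilon> x = cut x * v0 \<epsilon> x" for \<epsilon> x
  have c: "compact_net K v" unfolding v_def[abs_def] using assms(1) cut(1) v0m K by (rule compact_net_cutoff)
  \<comment> \<open>Locally either the cutoff equals \<open>1\<close> or the representative itself
    is null.\<close>
  have "(\<lambda>\<epsilon> x. v0 \<epsilon> x - v \<epsilon> x) \<in> null_nets \<Omega>"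
  proof (rule null_nets_open_cover)
    fix x assume x: "x \<in> \<Omega>"
    show "\<exists>W. open W \<and> x \<in> W \<and> (\<lambda>\<epsilon> x. v0 \<epsilon> x - v \<epsilon> x) \<in> null_nets W"
    proof (cases "x \<in> colombeau_supp \<Omega> V")
      case True
      have "(\<lambda>\<epsilon> x. v0 \<epsilon> x - v \<epsilon> x) \<in> null_nets W"
        by (rule null_nets_eq_0[OF cut(2)]) (simp add: v_def cut(4))
      then show ?thesis using True cut(2,3) by blast
    next
      case False
      then obtain W' where W': "open W'" "W' \<subseteq> \<Omega>" "V \<subseteq> null_nets W'" "x \<in> W'"
        using x by (auto simp: colombeau_supp_def)
      have "(\<lambda>\<epsilon> x. v0 \<epsilon> x * (1 - cut x)) \<in> null_nets W'"
        using v0 W'(1,3) by (intro null_nets_mult moderate_nets_const smooth_on_diff smooth_on_const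
            test_function_smooth[OF cut(1)]) auto
      also have "(\<lambda>\<epsilon> x. v0 \<epsilon> x * (1 - cut x)) = (\<lambda>\<epsilon> x. v0 \<epsilon> x - v \<epsilon> x)"
        by (simp add: v_def algebra_simps fun_eq_iff)
      finally show ?thesis using W'(1,4) by blast
    qed
  qed
  then have "(v0, v) \<in> net_rel \<Omega>"
    unfolding net_rel_iff using v0m moderate_nets_subset[OF compact_netD(2)[OF c]] by auto
  then have "v \<in> V" using colombeau_elim(2)[OF assms(1) V v0] by blast
  then show ?thesis using c K(2) by (rule that)
qed

lemma compact_net_class:
  assumes "open \<Omega>" "compact_net K v" "K \<subseteq> \<Omega>"
  shows "net_rel \<Omega> `` {v} \<in> colombeau_c \<Omega>" "v \<in> net_rel \<Omega> `` {v}"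
proof -
  have vm: "v \<in> moderate_nets \<Omega>" using moderate_nets_subset[OF compact_netD(2)[OF assms(2)]] by auto
  then show v: "v \<in> net_rel \<Omega> `` {v}"
    using equiv_net_rel[OF assms(1)] by (intro equiv_class_self)
  have cl: "net_rel \<Omega> `` {v} \<in> colombeau \<Omega>" unfolding colombeau_def by (rule quotientI[OF vm])
  let ?W = "{W. open W \<and> W \<subseteq> \<Omega> \<and> net_rel \<Omega> `` {v} \<subseteq> null_nets W}"
  have oW: "open (\<Omega> - K)" using assms(1) compact_netD(1)[OF assms(2)] by (simp add: compact_imp_closed open_Diff)
  have "net_rel \<Omega> `` {v} \<subseteq> null_nets (\<Omega> - K)"
  proof
    fix w assume "w \<in> net_rel \<Omega> `` {v}"
    then have "(\<lambda>\<epsilon> x. v \<epsilon> x - w \<epsilon> x) \<in> null_nets \<Omega>" by (simp add: net_rel_iff)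
    then have "(\<lambda>\<epsilon> x. w \<epsilon> x - v \<epsilon> x) \<in> null_nets (\<Omega> - K)"
      using null_nets_diff_commute[OF assms(1)] null_nets_subset by blast
    moreover have "v \<in> null_nets (\<Omega> - K)"
      using compact_netD(3)[OF assms(2)] by (intro null_nets_eq_0[OF oW]) auto
    ultimately show "w \<in> null_nets (\<Omega> - K)" using null_nets_add[OF oW, of "\<lambda>\<epsilon> x. w \<epsilon> x - v \<epsilon> x" v] by simp
  qed
  then have "\<Omega> - K \<in> ?W" using oW by simp
  then have "\<Omega> - K \<subseteq> \<Union> ?W" by (rule Union_upper)
  then have "colombeau_supp \<Omega> (net_rel \<Omega> `` {v}) = K - \<Union> ?W"
    unfolding colombeau_supp_def using assms(3) by blast
  moreover have "compact (K - \<Union> ?W)" by (intro compact_diff compact_netD(1)[OF assms(2)] open_Union) auto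
  ultimately show "net_rel \<Omega> `` {v} \<in> colombeau_c \<Omega>" using cl by (simp add: colombeau_c_def)
qed

section \<open>From classical to generalized microlocal regularity\<close>

lemma eventually_powr_le:
  assumes "a > 0" "c > 0" shows "\<forall>\<^sub>F \<epsilon> in at_right (0::real). \<epsilon> powr a \<le> c"
  using absorb_const_powr[OF assms(1), of "1 / c" 0] eventually_pos
proof eventually_elim
  case (elim \<epsilon>)
  then show ?case using assms(2) by (simp add: field_simps)
qed

lemma in_compact_repsI:
  assumes "gmoderate y" "compact K" "K \<subseteq> \<Omega>" "\<forall>\<^sub>F \<epsilon> in at_right 0. y \<epsilon> \<in> K"
  shows "y \<in> in_compact_reps \<Omega> (abs_gen y)"
  using assms unfolding in_compact_reps_def reps_def by blast

lemma normalize_diff: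
  fixes h \<eta> :: "'a::real_normed_vector"
  assumes "h \<noteq> 0" "\<eta> \<noteq> 0"
  shows "norm (inverse (norm \<eta>) *\<^sub>R \<eta> - inverse (norm h) *\<^sub>R h) \<le> 2 * norm (\<eta> - h) / norm h"
proof -
  have "inverse (norm \<eta>) *\<^sub>R \<eta> - inverse (norm h) *\<^sub>R h =
      inverse (norm h) *\<^sub>R (\<eta> - h) + (inverse (norm \<eta>) - inverse (norm h)) *\<^sub>R \<eta>"
    by (simp add: algebra_simps)
  also have "norm \<dots> \<le> inverse (norm h) * norm (\<eta> - h) + \<bar>inverse (norm \<eta>) - inverse (norm h)\<bar> * norm \<eta>"
    by (rule order_trans[OF norm_triangle_ineq]) simp
  also have "\<bar>inverse (norm \<eta>) - inverse (norm h)\<bar> * norm \<eta> = \<bar>(inverse (norm \<eta>) - inverse (norm h)) * norm \<eta>\<bar>"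
    by (simp add: abs_mult)
  also have "(inverse (norm \<eta>) - inverse (norm h)) * norm \<eta> = inverse (norm h) * (norm h - norm \<eta>)"
    using assms by (simp add: field_simps)
  also have "\<bar>inverse (norm h) * (norm h - norm \<eta>)\<bar> \<le> inverse (norm h) * norm (\<eta> - h)"
    unfolding abs_mult using norm_triangle_ineq3[of h \<eta>]
    by (simp add: norm_minus_commute mult_left_mono)
  finally show ?thesis by (simp add: divide_inverse mult.commute)
qed

lemma near_norm:
  fixes h \<eta> :: "'a::real_normed_vector"
  assumes "norm (\<eta> - h) \<le> t * norm h"
  shows "(1 - t) * norm h \<le> norm \<eta>" "norm \<eta> \<le> (1 + t) * norm h"
  using assms norm_triangle_ineq2[of h \<eta>] norm_triangle_ineq2[of \<eta> h]
  by (auto simp: norm_minus_commute algebra_simps)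

text \<open>The asymptotic form of the localization estimate. With cutoff width
  \<open>\<epsilon>\<^sup>p\<close> and radius \<open>R = \<epsilon>\<^sup>q |h|\<close> the product
  of width and radius is at least \<open>\<epsilon>\<^sup>-\<^sup>d\<close> with \<open>d = b - p -
  q > 0\<close>, so the remote frequencies contribute less than any power of
  \<open>\<epsilon>\<close>, even though they are only known to be moderate.\<close>

lemma fourier_localization_negligible:
  fixes \<theta> :: "real^'n \<Rightarrow> complex" and h c :: "real \<Rightarrow> real^'n"
  assumes \<theta>: "smooth_on UNIV \<theta>" "compact K" "\<And>x. x \<notin> K \<Longrightarrow> \<theta> x = 0"
    and g: "compact_net L g"
    and s: "\<forall>\<^sub>F \<epsilon> in at_right 0. \<epsilon> powr p \<le> s \<epsilon>"
    and h: "\<forall>\<^sub>F \<epsilon> in at_right 0. \<epsilon> powr (- b) \<le> norm (h \<epsilon>)"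
    and pqb: "p + q < b"
    and small: "\<And>\<eta>. (\<And>\<epsilon>. norm (\<eta> \<epsilon> - h \<epsilon>) \<le> \<epsilon> powr q * norm (h \<epsilon>)) \<Longrightarrow> gnegligible (\<lambda>\<epsilon>. fourier (g \<epsilon>) (\<eta> \<epsilon>))"
  shows "gnegligible (\<lambda>\<epsilon>. fourier (\<lambda>x. \<theta> (inverse (s \<epsilon>) *\<^sub>R (x - c \<epsilon>)) * g \<epsilon> x) (h \<epsilon>))"
proof (rule gnegligible_eventually_bound)
  fix n :: nat
  obtain M where M: "\<forall>\<^sub>F \<epsilon> in at_right 0. \<forall>\<xi>. norm (fourier (g \<epsilon>) \<xi>) \<le> inverse \<epsilon> ^ M"
    using compact_net_fourier_bounded[OF g] ..
  define d where "d = b - p - q"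
  have d: "d > 0" using pqb by (simp add: d_def)
  obtain k :: nat where "real (n + M) / d \<le> real k" using real_arch_simple by blast
  \<comment> \<open>The remote part is then at most
    \<open>\<epsilon>\<^sup>d\<^sup>k\<^sup>-\<^sup>M \<le> \<epsilon>\<^sup>n\<close>.\<close>
  then have k: "real (n + M) \<le> d * real k" using d by (simp add: field_simps)
  have B1: "\<forall>\<^sub>F \<epsilon> in at_right 0. \<forall>\<eta>\<in>{\<eta>. norm (\<eta> - h \<epsilon>) \<le> \<epsilon> powr q * norm (h \<epsilon>)}. norm (fourier (g \<epsilon>) \<eta>) \<le> \<epsilon> ^ n"
  proof (rule uniform_negligible)
    show "{\<eta>. norm (\<eta> - h \<epsilon>) \<le> \<epsilon> powr q * norm (h \<epsilon>)} \<noteq> {}" for \<epsilon>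
      by (auto intro!: exI[of _ "h \<epsilon>"])
  qed (use small in simp)
  show "\<exists>C. \<forall>\<^sub>F \<epsilon> in at_right 0.
      norm (fourier (\<lambda>x. \<theta> (inverse (s \<epsilon>) *\<^sub>R (x - c \<epsilon>)) * g \<epsilon> x) (h \<epsilon>)) \<le> C * \<epsilon> ^ n"
  proof (rule fourier_localization[OF \<theta>, of k])
    fix T :: real
    assume T: "T \<ge> 0" and bound: "\<And>s c g L \<xi> R B1 B2. s > 0 \<Longrightarrow> R > 0 \<Longrightarrow> continuous_on UNIV g \<Longrightarrow> compact L \<Longrightarrow>
      (\<And>x. x \<notin> L \<Longrightarrow> g x = 0) \<Longrightarrow>
      (\<And>\<eta>. norm (\<eta> - \<xi>) \<le> R \<Longrightarrow> norm (fourier g \<eta>) \<le> B1) \<Longrightarrow> (\<And>\<eta>. norm (fourier g \<eta>) \<le> B2) \<Longrightarrow>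
      norm (fourier (\<lambda>x. \<theta> (inverse s *\<^sub>R (x - c)) * g x) \<xi>) \<le> T * (B1 + B2 / (s * R) ^ k)"
    from M s h B1 eventually_unit
    have "\<forall>\<^sub>F \<epsilon> in at_right 0.
        norm (fourier (\<lambda>x. \<theta> (inverse (s \<epsilon>) *\<^sub>R (x - c \<epsilon>)) * g \<epsilon> x) (h \<epsilon>)) \<le> (2 * T) * \<epsilon> ^ n"
    proof eventually_elim
      case (elim \<epsilon>)
      have e: "0 < \<epsilon>" "\<epsilon> \<le> 1" using elim(5) by auto
      have "0 < \<epsilon> powr p" using e by simp
      then have sp: "0 < s \<epsilon>" using elim(2) by linarith
      have "0 < \<epsilon> powr (- b)" using e by simp
      then have hp: "0 < norm (h \<epsilon>)" using elim(3) by linarith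
      define R where "R = \<epsilon> powr q * norm (h \<epsilon>)"
      have R: "R > 0" unfolding R_def using e hp by (intro mult_pos_pos) auto
      have "norm (fourier (\<lambda>x. \<theta> (inverse (s \<epsilon>) *\<^sub>R (x - c \<epsilon>)) * g \<epsilon> x) (h \<epsilon>)) \<le>
          T * (\<epsilon> ^ n + inverse \<epsilon> ^ M / (s \<epsilon> * R) ^ k)"
      proof (rule bound[OF sp R])
        show "continuous_on UNIV (g \<epsilon>)" by (rule compact_netD(6)[OF g elim(5)])
        show "compact L" by (rule compact_netD(1)[OF g])
        show "g \<epsilon> x = 0" if "x \<notin> L" for x by (rule compact_netD(3)[OF g elim(5) that])
        show "norm (fourier (g \<epsilon>) \<eta>) \<le> \<epsilon> ^ n" if "norm (\<eta> - h \<epsilon>) \<le> R" for \<eta>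
          using elim(4) that unfolding R_def by simp
        show "norm (fourier (g \<epsilon>) \<eta>) \<le> inverse \<epsilon> ^ M" for \<eta> using elim(1) by simp
      qed
      also have "inverse \<epsilon> ^ M / (s \<epsilon> * R) ^ k \<le> \<epsilon> ^ n"
      proof -
        have "\<epsilon> powr (- d) = \<epsilon> powr p * (\<epsilon> powr q * \<epsilon> powr (- b))"
        proof -
          have "- d = p + (q + - b)" by (simp add: d_def)
          then show ?thesis by (simp only: powr_add)
        qed
        also have "\<dots> \<le> s \<epsilon> * R"
          unfolding R_def using elim(2,3) sp by (intro mult_mono) auto
        finally have "(\<epsilon> powr (- d)) ^ k \<le> (s \<epsilon> * R) ^ k" by (intro power_mono) auto
        moreover have "(\<epsilon> powr (- d)) ^ k = \<epsilon> powr (- (d * real k))"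
          using e by (simp add: powr_powr flip: powr_realpow)
        moreover have "\<epsilon> powr (- real (n + M)) \<le> \<epsilon> powr (- (d * real k))"
          using e k by (intro powr_mono') auto
        moreover have "\<epsilon> powr (- real (n + M)) = inverse (\<epsilon> ^ (n + M))"
          using e by (simp only: powr_minus powr_realpow)
        ultimately have "inverse (\<epsilon> ^ (n + M)) \<le> (s \<epsilon> * R) ^ k" by linarith
        then have "inverse \<epsilon> ^ M / (s \<epsilon> * R) ^ k \<le> inverse \<epsilon> ^ M / inverse (\<epsilon> ^ (n + M))"
          using e by (intro divide_left_mono) (auto intro!: mult_pos_pos zero_less_power sp R)
        also have "\<dots> = \<epsilon> ^ n" using e by (simp add: power_add power_inverse field_simps)
        finally show ?thesis .
      qed
      then have "T * (\<epsilon> ^ n + inverse \<epsilon> ^ M / (s \<epsilon> * R) ^ k) \<le> T * (\<epsilon> ^ n + \<epsilon> ^ n)"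
        using T by (intro mult_left_mono add_left_mono)
      finally show ?case by (simp add: algebra_simps)
    qed
    then show ?thesis ..
  qed
qed

text \<open>The net \<open>\<phi> u\<close> has negligible Fourier transform at fast-scale
  frequencies in \<open>\<Gamma>\<close>: since the exponent \<open>N\<close> is the same for all
  \<open>m\<close>, it is at most \<open>\<epsilon>\<^sup>-\<^sup>N |\<xi>|\<^sup>-\<^sup>m\<close>
  with \<open>|\<xi>| \<ge> \<epsilon>\<^sup>-\<^sup>b\<close>. Dividing by \<open>\<phi>\<close>,
  which does not vanish near \<open>x0\<close>, one passes to a cutoff that equals \<open>1\<close>
  there, and the localization estimate keeps the transform negligible in directions near
  \<open>\<xi>0\<close>. The resulting \<open>V\<close> serves all points and directions at
  once.\<close>

lemma regular_imp_gen_regular: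
  fixes \<Omega> :: "(real^'n) set"
  assumes \<Omega>: "open \<Omega>" and U: "U \<in> colombeau \<Omega>"
    and reg: "microlocally_regular \<Omega> U x0 \<xi>0"
  shows "\<exists>r>0. \<forall>x. gnorm (x - gconst x0) \<le> gconst r \<longrightarrow>
      x \<in> compact_points \<Omega> \<and>
      (\<forall>\<xi>\<in>gsphere. gnorm (\<xi> - gconst \<xi>0) \<le> gconst r \<longrightarrow>
        gen_microlocally_regular \<Omega> U x \<xi>)"
proof -
  obtain u \<phi> \<Gamma> and N :: nat where u: "u \<in> U" and \<phi>: "test_function \<Omega> \<phi>" "\<phi> x0 = 1" and \<Gamma>: "conic_nbhd \<Gamma> \<xi>0"
    and dec: "\<forall>m::nat. \<forall>\<^sub>F \<epsilon> in at_right 0. \<forall>\<xi>\<in>\<Gamma>.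
      sqrt (1 + (norm \<xi>)\<^sup>2) ^ m * norm (fourier (\<lambda>x. \<phi> x * u \<epsilon> x) \<xi>) \<le> inverse \<epsilon> ^ N"
    using reg unfolding microlocally_regular_def by (elim bexE exE conjE)
  obtain K where K: "compact K" "K \<subseteq> \<Omega>" "\<And>x. x \<notin> K \<Longrightarrow> \<phi> x = 0"
    using \<phi>(1) by (rule test_functionE) blast
  have um: "u \<in> moderate_nets \<Omega>" by (rule colombeau_elim(1)[OF \<Omega> U u])
  define g where "g \<epsilon> x = \<phi> x * u \<epsilon> x" for \<epsilon> x
  have g: "compact_net K g" unfolding g_def[abs_def] using \<Omega> \<phi>(1) um K by (rule compact_net_cutoff)
  define O1 where "O1 = {x. \<phi> x \<noteq> 0}"
  have \<phi>c: "continuous_on UNIV \<phi>" by (rule smooth_on_continuous_on[OF test_function_smooth[OF \<phi>(1)]])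
  have O1: "open O1" unfolding O1_def by (intro open_Collect_neq \<phi>c continuous_on_const)
  have O1\<Omega>: "O1 \<subseteq> \<Omega>" unfolding O1_def using K(2,3) by blast
  have "x0 \<in> O1" by (simp add: O1_def \<phi>(2))
  then obtain e1 where e1: "e1 > 0" "cball x0 e1 \<subseteq> O1" using O1 open_contains_cball by blast
  have "\<xi>0 \<in> interior \<Gamma>" using \<Gamma> by (simp add: conic_nbhd_def)
  then obtain e2 where e2: "e2 > 0" "ball \<xi>0 e2 \<subseteq> \<Gamma>" unfolding mem_interior by blast
  have cone: "t *\<^sub>R \<xi> \<in> \<Gamma>" if "\<xi> \<in> \<Gamma>" "t > 0" for \<xi> t using \<Gamma> that by (simp add: conic_nbhd_def)
  \<comment> \<open>Room for the cutoff, which lives on the ball of radius \<open>3 r\<close>, and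
    for directions at distance less than \<open>4 r\<close> from \<open>\<xi>0\<close>.\<close>
  define r where "r = min (e1 / 4) (e2 / 4)"
  have r: "r > 0" "3 * r \<le> e1" "4 * r \<le> e2" using e1(1) e2(1) by (auto simp: r_def)
  \<comment> \<open>The quotient by which \<open>\<phi> u\<close> has to be multiplied to give the
    bump times \<open>u\<close>.\<close>
  define \<psi> where "\<psi> x = bump x0 (2 * r) (3 * r) x * inverse (\<phi> x)" for x
  have b3: "cball x0 (3 * r) \<subseteq> O1" using e1(2) r(2) by (auto simp: subset_eq)
  have \<psi>: "test_function O1 \<psi>"
    unfolding \<psi>_def[abs_def]
    by (intro test_function_mult_smooth[OF O1] test_function_bump smooth_on_inverse[OF O1] test_function_smooth[OF \<phi>(1)])
      (use r(1) b3 in \<open>auto simp: O1_def\<close>)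
  have \<psi>0: "\<psi> x = 0" if "x \<notin> cball x0 (3 * r)" for x
    unfolding \<psi>_def using that r(1) by (simp add: bump_eq_0 dist_commute)
  define v where "v \<epsilon> x = bump x0 (2 * r) (3 * r) x * u \<epsilon> x" for \<epsilon> x
  have b3\<Omega>: "cball x0 (3 * r) \<subseteq> \<Omega>" using b3 O1\<Omega> by blast
  have v: "compact_net (cball x0 (3 * r)) v"
    unfolding v_def[abs_def]
    by (rule compact_net_cutoff[OF \<Omega> test_function_bump um compact_cball b3\<Omega>])
      (use r(1) b3\<Omega> in \<open>auto simp: dist_commute intro: bump_eq_0\<close>)
  have v\<psi>: "v \<epsilon> x = \<psi> x * g \<epsilon> x" for \<epsilon> x
  proof (cases "\<phi> x = 0")
    case True
    then have "x \<notin> cball x0 (3 * r)" using b3 by (auto simp: O1_def)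
    then have "bump x0 (2 * r) (3 * r) x = 0" using r(1) by (simp add: bump_eq_0 dist_commute)
    then show ?thesis by (simp add: v_def \<psi>_def)
  qed (simp add: v_def \<psi>_def g_def)
  define V where "V = net_rel \<Omega> `` {v}"
  have V: "V \<in> colombeau_c \<Omega>" "v \<in> V" unfolding V_def by (rule compact_net_class[OF \<Omega> v b3\<Omega>])+
  then have V': "V \<in> colombeau \<Omega>" by (simp add: colombeau_c_def)
  show ?thesis
  proof (intro exI[of _ r] conjI allI impI ballI)
    show "r > 0" by (rule r(1))
    fix x assume xr: "gnorm (x - gconst x0) \<le> gconst r"
    obtain y where y: "gmoderate y" "x = abs_gen y" by (rule gen_cases)
    have ye: "\<forall>\<^sub>F \<epsilon> in at_right 0. norm (y \<epsilon> - x0) \<le> 3 / 2 * r"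
      by (rule gballD[OF xr[unfolded y(2)] y(1)]) (use r(1) in simp)
    have b2\<Omega>: "cball x0 (2 * r) \<subseteq> \<Omega>" using b3\<Omega> r(1) by (auto simp: subset_eq)
    show "x \<in> compact_points \<Omega>"
    proof -
      have "\<forall>\<^sub>F \<epsilon> in at_right 0. y \<epsilon> \<in> cball x0 (2 * r)"
        using ye by eventually_elim (use r(1) in \<open>simp add: dist_norm norm_minus_commute\<close>)
      then have "y \<in> in_compact_reps \<Omega> x"
        unfolding y(2) by (rule in_compact_repsI[OF y(1) compact_cball b2\<Omega>])
      then show ?thesis by (auto simp: compact_points_def)
    qed
    fix \<xi> :: "(real^'n) gen" assume \<xi>: "\<xi> \<in> gsphere" "gnorm (\<xi> - gconst \<xi>0) \<le> gconst r"
    show "gen_microlocally_regular \<Omega> U x \<xi>"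
      unfolding gen_microlocally_regular_def
    proof (intro bexI[OF _ V(1)] conjI allI impI ballI)
      fix z assume zx: "z \<approx>\<^sub>f x"
      obtain w where w: "gmoderate w" "z = abs_gen w" by (rule gen_cases)
      obtain a where a: "a > 0" "\<forall>\<^sub>F \<epsilon> in at_right 0. norm (w \<epsilon> - y \<epsilon>) \<le> \<epsilon> powr a"
        using zx unfolding w(2) y(2) fast_near_iff[OF w(1) y(1)] by blast
      have "0 < r / 2" using r(1) by simp
      from a(2) ye eventually_powr_le[OF a(1) this]
      have we: "\<forall>\<^sub>F \<epsilon> in at_right 0. w \<epsilon> \<in> cball x0 (2 * r)"
      proof eventually_elim
        case (elim \<epsilon>)
        have "norm (w \<epsilon> - x0) \<le> norm (w \<epsilon> - y \<epsilon>) + norm (y \<epsilon> - x0)"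
          by (rule norm_diff_triangle_le[OF order_refl order_refl])
        then show ?case using elim by (simp add: dist_norm norm_minus_commute)
      qed
      have wr: "w \<in> in_compact_reps \<Omega> z"
        unfolding w(2) by (rule in_compact_repsI[OF w(1) compact_cball b2\<Omega> we])
      have "gnegligible (\<lambda>\<epsilon>. u \<epsilon> (w \<epsilon>) - v \<epsilon> (w \<epsilon>))"
        unfolding gnegligible_iff
      proof
        fix n
        from we eventually_pos show "\<forall>\<^sub>F \<epsilon> in at_right 0. norm (u \<epsilon> (w \<epsilon>) - v \<epsilon> (w \<epsilon>)) \<le> \<epsilon> ^ n"
        proof eventually_elim
          case (elim \<epsilon>)
          have "bump x0 (2 * r) (3 * r) (w \<epsilon>) = 1"
            by (rule bump_eq_1) (use r(1) elim(1) in \<open>auto simp: dist_commute\<close>)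
          then show ?case using elim(2) by (simp add: v_def)
        qed
      qed
      then show "point_value \<Omega> U z = point_value \<Omega> V z"
        using point_value_eq_iff[OF \<Omega> U u V' V(2) wr] by simp
    next
      fix \<eta> assume \<eta>: "\<eta> \<in> fast_large \<inter> fast_cone \<xi>"
      obtain h where h: "gmoderate h" "\<eta> = abs_gen h" by (rule gen_cases)
      obtain k where k: "gmoderate k" "\<xi> = abs_gen k" by (rule gen_cases)
      obtain b where b: "b > 0" "\<forall>\<^sub>F \<epsilon> in at_right 0. \<epsilon> powr (- b) \<le> norm (h \<epsilon>)"
        using \<eta> unfolding h(2) by (auto simp: fast_large_iff[OF h(1)])
      have "abs_gen h \<in> fast_cone (abs_gen k)" using \<eta> unfolding h(2) k(2) by simp
      then obtain a where a: "a > 0" "\<forall>\<^sub>F \<epsilon> in at_right 0. h \<epsilon> \<noteq> 0 \<and> norm (inverse (norm (h \<epsilon>)) *\<^sub>R h \<epsilon> - k \<epsilon>) \<le> \<epsilon> powr a"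
        by (rule fast_coneD[OF _ h(1) k(1)])
      have ke: "\<forall>\<^sub>F \<epsilon> in at_right 0. norm (k \<epsilon> - \<xi>0) \<le> 2 * r"
        by (rule gballD[OF \<xi>(2)[unfolded k(2)] k(1)]) (use r(1) in simp)
      have "gnegligible (\<lambda>\<epsilon>. fourier (\<lambda>x. \<psi> (inverse 1 *\<^sub>R (x - 0)) * g \<epsilon> x) (h \<epsilon>))"
      proof (rule fourier_localization_negligible[where p = 0 and q = "b / 2" and s = "\<lambda>_. 1" and c = "\<lambda>_. 0",
            OF test_function_smooth[OF \<psi>] compact_cball _ g _ b(2)])
        show "\<psi> x = 0" if "x \<notin> cball x0 (3 * r)" for x by (rule \<psi>0[OF that])
        show "\<forall>\<^sub>F \<epsilon> in at_right 0. \<epsilon> powr 0 \<le> (1::real)" by (intro always_eventually allI) simp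
        show "0 + b / 2 < b" using b(1) by simp
        fix \<zeta> :: "real \<Rightarrow> real^'n" assume \<zeta>: "\<And>\<epsilon>. norm (\<zeta> \<epsilon> - h \<epsilon>) \<le> \<epsilon> powr (b / 2) * norm (h \<epsilon>)"
        show "gnegligible (\<lambda>\<epsilon>. fourier (g \<epsilon>) (\<zeta> \<epsilon>))"
        proof (rule gnegligible_eventually_bound)
          fix n :: nat
          obtain m :: nat where "real (n + N) / b \<le> real m" using real_arch_simple by blast
          then have m: "real (n + N) \<le> b * real m" using b(1) by (simp add: field_simps)
          have c: "b / 2 > 0" "min (1/2) (r / 8) > 0" "r / 2 > 0" using b(1) r(1) by auto
          from spec[OF dec, of m] b(2) a(2) ke eventually_powr_le[OF c(1,2)] eventually_powr_le[OF a(1) c(3)] eventually_unit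
          have "\<forall>\<^sub>F \<epsilon> in at_right 0. norm (fourier (g \<epsilon>) (\<zeta> \<epsilon>)) \<le> 2 ^ m * \<epsilon> ^ n"
          proof eventually_elim
            case (elim \<epsilon>)
            have e: "0 < \<epsilon>" "\<epsilon> \<le> 1" using elim(7) by auto
            define t where "t = \<epsilon> powr (b / 2)"
            have t: "t \<le> 1/2" "t \<le> r / 8" using elim(5) by (auto simp: t_def)
            have hn: "norm (h \<epsilon>) > 0" using elim(3) by simp
            have near: "norm (\<zeta> \<epsilon> - h \<epsilon>) \<le> t * norm (h \<epsilon>)" using \<zeta> by (simp add: t_def)
            have "(1/2) * norm (h \<epsilon>) \<le> (1 - t) * norm (h \<epsilon>)" using t hn by (intro mult_right_mono) auto
            then have \<zeta>h: "norm (h \<epsilon>) / 2 \<le> norm (\<zeta> \<epsilon>)" using near_norm(1)[OF near] by simp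
            then have \<zeta>n: "norm (\<zeta> \<epsilon>) > 0" using hn by linarith
            let ?n = "\<lambda>x::real^'n. inverse (norm x) *\<^sub>R x"
            have "norm (?n (\<zeta> \<epsilon>) - ?n (h \<epsilon>)) \<le> 2 * norm (\<zeta> \<epsilon> - h \<epsilon>) / norm (h \<epsilon>)"
              using hn \<zeta>n by (intro normalize_diff) auto
            also have "\<dots> \<le> 2 * (t * norm (h \<epsilon>)) / norm (h \<epsilon>)"
              using near hn by (intro divide_right_mono mult_left_mono) auto
            also have "\<dots> = 2 * t" using hn by simp
            finally have n1: "norm (?n (\<zeta> \<epsilon>) - ?n (h \<epsilon>)) \<le> r / 4" using t by simp
            have n2: "norm (?n (h \<epsilon>) - k \<epsilon>) \<le> r / 2" using elim(3,6) by linarith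
            have "norm (?n (\<zeta> \<epsilon>) - \<xi>0) \<le> r / 4 + (r / 2 + 2 * r)"
              by (intro norm_diff_triangle_le[OF n1] norm_diff_triangle_le[OF n2 elim(4)])
            then have "?n (\<zeta> \<epsilon>) \<in> ball \<xi>0 e2" using r(1,3) by (simp add: dist_norm norm_minus_commute)
            then have "?n (\<zeta> \<epsilon>) \<in> \<Gamma>" using e2(2) by blast
            then have "norm (\<zeta> \<epsilon>) *\<^sub>R ?n (\<zeta> \<epsilon>) \<in> \<Gamma>" using \<zeta>n by (rule cone)
            then have \<zeta>\<Gamma>: "\<zeta> \<epsilon> \<in> \<Gamma>" using \<zeta>n by simp
            have F: "sqrt (1 + (norm (\<zeta> \<epsilon>))\<^sup>2) ^ m * norm (fourier (g \<epsilon>) (\<zeta> \<epsilon>)) \<le> inverse \<epsilon> ^ N"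
              using bspec[OF elim(1) \<zeta>\<Gamma>] by (simp add: g_def[abs_def])
            have "\<epsilon> powr (- b) / 2 \<le> norm (\<zeta> \<epsilon>)" using \<zeta>h elim(2) by linarith
            also have "\<dots> \<le> sqrt (1 + (norm (\<zeta> \<epsilon>))\<^sup>2)" by (rule real_le_rsqrt) simp
            finally have "(\<epsilon> powr (- b) / 2) ^ m \<le> sqrt (1 + (norm (\<zeta> \<epsilon>))\<^sup>2) ^ m"
              by (intro power_mono) auto
            then have "(\<epsilon> powr (- b) / 2) ^ m * norm (fourier (g \<epsilon>) (\<zeta> \<epsilon>)) \<le> inverse \<epsilon> ^ N"
              using F by (meson mult_right_mono norm_ge_zero order_trans)
            moreover have "(\<epsilon> powr (- b) / 2) ^ m = \<epsilon> powr (- (b * real m)) / 2 ^ m"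
              using e by (simp add: power_divide powr_powr flip: powr_realpow)
            moreover have "\<epsilon> powr (- real (n + N)) \<le> \<epsilon> powr (- (b * real m))"
              using e m by (intro powr_mono') auto
            moreover have "\<epsilon> powr (- real (n + N)) = inverse (\<epsilon> ^ (n + N))"
              using e by (simp only: powr_minus powr_realpow)
            ultimately have "inverse (\<epsilon> ^ (n + N)) / 2 ^ m * norm (fourier (g \<epsilon>) (\<zeta> \<epsilon>)) \<le> inverse \<epsilon> ^ N"
              by (smt (verit) divide_right_mono mult_right_mono norm_ge_zero zero_le_power)
            then have "norm (fourier (g \<epsilon>) (\<zeta> \<epsilon>)) \<le> inverse \<epsilon> ^ N * (2 ^ m * \<epsilon> ^ (n + N))"
              using e by (simp add: field_simps)
            also have "\<dots> = 2 ^ m * \<epsilon> ^ n" using e by (simp add: power_add power_inverse field_simps)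
            finally show ?case .
          qed
          then show "\<exists>C. \<forall>\<^sub>F \<epsilon> in at_right 0. norm (fourier (g \<epsilon>) (\<zeta> \<epsilon>)) \<le> C * \<epsilon> ^ n" ..
        qed
      qed
      then have "gnegligible (\<lambda>\<epsilon>. fourier (v \<epsilon>) (h \<epsilon>))" by (simp add: v\<psi>[abs_def])
      then show "schwartz_point_value (gfourier (embed_schwartz \<Omega> V)) \<eta> = 0"
        unfolding h(2) using schwartz_point_value_eq_0_iff[OF \<Omega> V' V(2) v b3\<Omega> h(1)] by simp
    qed
  qed
qed

section \<open>From generalized to classical microlocal regularity\<close>

text \<open>As a function of the position of the cutoff, the value of the transform at
  \<open>\<xi>\<close> is a correlation; its integral is the transform of that correlation at
  \<open>0\<close>.\<close>

lemma fourier_average: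
  fixes g \<theta> :: "real^'n \<Rightarrow> complex"
  assumes g: "continuous_on UNIV g" "compact L" "\<And>x. x \<notin> L \<Longrightarrow> g x = 0"
    and \<theta>: "continuous_on UNIV \<theta>" "compact K" "\<And>x. x \<notin> K \<Longrightarrow> \<theta> x = 0" and s: "s > 0"
  shows "(LINT x|lborel. fourier (\<lambda>z. \<theta> (inverse s *\<^sub>R (z - x)) * g z) \<xi>) =
    of_real (s ^ CARD('n)) * fourier \<theta> 0 * fourier g \<xi>"
proof -
  define G where "G z = wave z \<xi> * g z" for z
  define T where "T y = \<theta> (inverse s *\<^sub>R (y - 0))" for y
  have G: "continuous_on UNIV G" "\<And>x. x \<notin> L \<Longrightarrow> G x = 0"
    unfolding G_def by (intro continuous_intros g(1)) (simp add: g(3))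
  have T: "continuous_on UNIV T"
    unfolding T_def by (rule continuous_on_compose2[OF \<theta>(1)]) (auto intro!: continuous_intros)
  have TK: "compact ((*\<^sub>R) s ` K)" by (rule compact_scaling[OF \<theta>(2)])
  have T0: "T y = 0" if "y \<notin> (*\<^sub>R) s ` K" for y
  proof -
    have "y = s *\<^sub>R (inverse s *\<^sub>R y)" using s by simp
    then have "inverse s *\<^sub>R y \<notin> K" using that by (metis imageI)
    then show ?thesis by (simp add: T_def \<theta>(3))
  qed
  have "fourier (\<lambda>z. \<theta> (inverse s *\<^sub>R (z - x)) * g z) \<xi> = correlation G T x" for x
    by (simp add: fourier_wave correlation_def G_def T_def mult_ac)
  then have "(LINT x|lborel. fourier (\<lambda>z. \<theta> (inverse s *\<^sub>R (z - x)) * g z) \<xi>) = fourier (correlation G T) 0"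
    by (simp add: fourier_wave)
  also have "\<dots> = fourier G 0 * fourier T (- 0)"
    using G(1) g(2) G(2) T TK T0 by (rule fourier_correlation)
  also have "fourier G 0 = fourier g \<xi>" by (simp add: fourier_wave G_def)
  also have "fourier T (- 0) = of_real (s ^ CARD('n)) * fourier \<theta> 0"
    unfolding T_def[abs_def] using fourier_scale[OF borel_measurable_continuous_onI[OF \<theta>(1)] s, of 0 0] by simp
  finally show ?thesis by simp
qed

text \<open>Uniform control over small cutoffs controls the whole function, at the price of the
  volume factor \<open>s\<^sup>d\<close>.\<close>

lemma fourier_average_bound:
  fixes g \<theta> :: "real^'n \<Rightarrow> complex"
  assumes g: "continuous_on UNIV g" "\<And>x. x \<notin> cball x0 \<rho> \<Longrightarrow> g x = 0"
    and \<theta>: "continuous_on UNIV \<theta>" "\<And>x. x \<notin> cball 0 1 \<Longrightarrow> \<theta> x = 0" and s: "0 < s" "\<rho> + s \<le> R"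
    and B: "\<And>x. x \<in> cball x0 R \<Longrightarrow> norm (fourier (\<lambda>z. \<theta> (inverse s *\<^sub>R (z - x)) * g z) \<xi>) \<le> B"
  shows "s ^ CARD('n) * norm (fourier \<theta> 0) * norm (fourier g \<xi>) \<le> B * measure lborel (cball x0 R)"
proof -
  have "norm (LINT x|lborel. fourier (\<lambda>z. \<theta> (inverse s *\<^sub>R (z - x)) * g z) \<xi>) \<le> B * measure lborel (cball x0 R)"
  proof (rule norm_integral_le_compact[OF compact_cball])
    fix x assume x: "x \<notin> cball x0 R"
    have "\<theta> (inverse s *\<^sub>R (z - x)) * g z = 0" for z
    proof (cases "z \<in> cball x0 \<rho>")
      case True
      have "dist x0 x \<le> dist x0 z + dist z x" by (rule dist_triangle)
      then have "s < norm (z - x)" using x True s(2) by (simp add: dist_norm)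
      then have "1 < inverse s * norm (z - x)" using s(1) by (simp add: field_simps)
      then have "inverse s *\<^sub>R (z - x) \<notin> cball 0 1" using s(1) by simp
      then show ?thesis using \<theta>(2) by simp
    qed (simp add: g(2))
    then have "(\<lambda>z. \<theta> (inverse s *\<^sub>R (z - x)) * g z) = (\<lambda>_. 0)" by (rule ext)
    then show "fourier (\<lambda>z. \<theta> (inverse s *\<^sub>R (z - x)) * g z) \<xi> = 0"
      by (simp only:) (simp add: fourier_wave)
  qed (rule B)
  also have "(LINT x|lborel. fourier (\<lambda>z. \<theta> (inverse s *\<^sub>R (z - x)) * g z) \<xi>) =
      of_real (s ^ CARD('n)) * fourier \<theta> 0 * fourier g \<xi>"
    using g(1) compact_cball g(2) \<theta>(1) compact_cball \<theta>(2) s(1) by (rule fourier_average)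
  finally show ?thesis using s(1) by (simp add: norm_mult norm_power)
qed

text \<open>The net \<open>v\<close> provided by regularity at the point and the direction of
  \<open>h\<close> agrees with \<open>u\<close> up to a negligible error on a ball of radius
  \<open>\<epsilon>\<^sup>b\<^sup>/\<^sup>4\<close>, on which the cutoff lives, and its transform is
  negligible at all frequencies whose distance from \<open>h\<close> is at most a multiple of
  \<open>\<epsilon>\<^sup>b\<^sup>/\<^sup>4 |h|\<close>, since those still belong to the fast cone.
  Two applications of the localization estimate, first with \<open>\<phi>\<close> and then with the
  small cutoff, carry this over to the product.\<close>

lemma gen_regular_local_negligible:
  fixes \<Omega> :: "(real^'n) set" and x h :: "real \<Rightarrow> real^'n"
  assumes \<Omega>: "open \<Omega>" and U: "U \<in> colombeau \<Omega>" "u \<in> U"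
    and \<phi>: "test_function \<Omega> \<phi>" and K\<phi>: "compact K\<phi>" "K\<phi> \<subseteq> \<Omega>" "\<And>x. x \<notin> K\<phi> \<Longrightarrow> \<phi> x = 0"
    and \<theta>: "smooth_on UNIV \<theta>" "\<And>x. x \<notin> cball 0 1 \<Longrightarrow> \<theta> x = 0"
    and x: "gmoderate x" "compact B" "B \<subseteq> \<Omega>" "\<forall>\<^sub>F \<epsilon> in at_right 0. x \<epsilon> \<in> B"
    and h: "gmoderate h" and b: "b > 0" "\<forall>\<^sub>F \<epsilon> in at_right 0. \<epsilon> powr (- b) \<le> norm (h \<epsilon>)"
    and reg: "gen_microlocally_regular \<Omega> U (abs_gen x) (abs_gen (\<lambda>\<epsilon>. inverse (norm (h \<epsilon>)) *\<^sub>R h \<epsilon>))"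
  shows "gnegligible (\<lambda>\<epsilon>. fourier (\<lambda>z. \<theta> (inverse (\<epsilon> powr (b / 4)) *\<^sub>R (z - x \<epsilon>)) * (\<phi> z * u \<epsilon> z)) (h \<epsilon>))"
proof -
  define k where "k \<epsilon> = inverse (norm (h \<epsilon>)) *\<^sub>R h \<epsilon>" for \<epsilon>
  have km: "gmoderate k"
  proof (rule gmoderate_eventually_bound)
    show "\<forall>\<^sub>F \<epsilon> in at_right 0. norm (k \<epsilon>) \<le> 1 * inverse \<epsilon> ^ 0"
    proof (intro always_eventually allI)
      show "norm (k \<epsilon>) \<le> 1 * inverse \<epsilon> ^ 0" for \<epsilon> by (cases "h \<epsilon> = 0") (simp_all add: k_def)
    qed
  qed
  obtain V where V: "V \<in> colombeau_c \<Omega>"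
    and eq: "\<And>z. z \<approx>\<^sub>f abs_gen x \<Longrightarrow> point_value \<Omega> U z = point_value \<Omega> V z"
    and zero: "\<And>\<eta>. \<eta> \<in> fast_large \<inter> fast_cone (abs_gen k) \<Longrightarrow>
      schwartz_point_value (gfourier (embed_schwartz \<Omega> V)) \<eta> = 0"
    using reg unfolding gen_microlocally_regular_def k_def[abs_def, symmetric] by (elim bexE conjE) simp
  obtain v K where v: "v \<in> V" "compact_net K v" "K \<subseteq> \<Omega>"
    by (rule colombeau_c_compact_representative[OF \<Omega> V])
  have V': "V \<in> colombeau \<Omega>" using V by (simp add: colombeau_c_def)
  have um: "u \<in> moderate_nets \<Omega>" by (rule colombeau_elim(1)[OF \<Omega> U])
  let ?s = "\<lambda>\<epsilon>::real. \<epsilon> powr (b / 4)"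
  have diff: "\<forall>\<^sub>F \<epsilon> in at_right 0. \<forall>y\<in>cball (x \<epsilon>) (?s \<epsilon>). norm (u \<epsilon> y - v \<epsilon> y) \<le> \<epsilon> ^ n" for n
  proof (rule uniform_negligible)
    show "cball (x \<epsilon>) (?s \<epsilon>) \<noteq> {}" for \<epsilon> by simp
    fix z assume "\<And>\<epsilon>. z \<epsilon> \<in> cball (x \<epsilon>) (?s \<epsilon>)"
    then have z: "norm (z \<epsilon> - x \<epsilon>) \<le> ?s \<epsilon>" for \<epsilon> by (simp add: dist_norm norm_minus_commute)
    have "gmoderate (\<lambda>\<epsilon>. z \<epsilon> - x \<epsilon>)"
    proof (rule gmoderate_eventually_bound)
      have "b / 4 > 0" using b(1) by simp
      from eventually_powr_le[OF this zero_less_one]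
      show "\<forall>\<^sub>F \<epsilon> in at_right 0. norm (z \<epsilon> - x \<epsilon>) \<le> 1 * inverse \<epsilon> ^ 0"
        by eventually_elim (use z order_trans in fastforce)
    qed
    then have zm: "gmoderate z" using gmoderate_add[OF _ x(1), of "\<lambda>\<epsilon>. z \<epsilon> - x \<epsilon>"] by simp
    have "\<forall>\<^sub>F \<epsilon> in at_right 0. norm (z \<epsilon> - x \<epsilon>) \<le> \<epsilon> powr (b / 4)" using z by simp
    then have "abs_gen z \<approx>\<^sub>f abs_gen x"
      unfolding fast_near_iff[OF zm x(1)] using b(1) by (intro exI[of _ "b / 4"]) simp
    then have pv: "point_value \<Omega> U (abs_gen z) = point_value \<Omega> V (abs_gen z)" by (rule eq)
    obtain L e where L: "e > 0" "compact L" "L \<subseteq> \<Omega>" "\<forall>x\<in>B. cball x e \<subseteq> L"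
      by (rule compact_thicken[OF x(2) \<Omega> x(3)])
    have "b / 4 > 0" using b(1) by simp
    from eventually_powr_le[OF this L(1)] x(4)
    have "\<forall>\<^sub>F \<epsilon> in at_right 0. z \<epsilon> \<in> L"
    proof eventually_elim
      case (elim \<epsilon>)
      have "z \<epsilon> \<in> cball (x \<epsilon>) e" using z[of \<epsilon>] elim(1) by (simp add: dist_norm norm_minus_commute)
      then show ?case using L(4) elim(2) by blast
    qed
    then have "z \<in> in_compact_reps \<Omega> (abs_gen z)" by (rule in_compact_repsI[OF zm L(2,3)])
    then show "gnegligible (\<lambda>\<epsilon>. u \<epsilon> (z \<epsilon>) - v \<epsilon> (z \<epsilon>))"
      using pv point_value_eq_iff[OF \<Omega> U V' v(1)] by blast
  qed
  \<comment> \<open>The factor \<open>3\<close> leaves room for two successive perturbations of the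
    frequency, one for each use of the localization estimate.\<close>
  have Fv: "gnegligible (\<lambda>\<epsilon>. fourier (v \<epsilon>) (\<zeta> \<epsilon>))"
    if \<zeta>: "\<forall>\<^sub>F \<epsilon> in at_right 0. norm (\<zeta> \<epsilon> - h \<epsilon>) \<le> 3 * \<epsilon> powr (b / 4) * norm (h \<epsilon>)"
    for \<zeta> :: "real \<Rightarrow> real^'n"
  proof -
    have c: "b / 4 > 0" "b / 8 > 0" "b / 2 > 0" using b(1) by auto
    have c6: "(1/6::real) > 0" "(1/2::real) > 0" by auto
    from eventually_powr_le[OF c(1) c6(1)] absorb_const_powr[OF c(2), of 6 "b / 8"]
      eventually_powr_le[OF c(3) c6(2)] \<zeta> b(2) eventually_unit
    have all: "\<forall>\<^sub>F \<epsilon> in at_right 0. norm (\<zeta> \<epsilon>) \<le> 2 * norm (h \<epsilon>) \<and> \<epsilon> powr (- (b / 2)) \<le> norm (\<zeta> \<epsilon>) \<and>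
        1 \<le> norm (\<zeta> \<epsilon>) \<and> norm (inverse (norm (\<zeta> \<epsilon>)) *\<^sub>R \<zeta> \<epsilon> - k \<epsilon>) \<le> \<epsilon> powr (b / 8)"
    proof eventually_elim
      case (elim \<epsilon>)
      have e: "0 < \<epsilon>" "\<epsilon> \<le> 1" using elim(6) by auto
      define t where "t = 3 * \<epsilon> powr (b / 4)"
      have t: "t \<le> 1/2" "t \<ge> 0" using elim(1) by (auto simp: t_def)
      have near: "norm (\<zeta> \<epsilon> - h \<epsilon>) \<le> t * norm (h \<epsilon>)" using elim(4) by (simp add: t_def)
      have "0 < \<epsilon> powr (- b)" using e by simp
      then have hp: "0 < norm (h \<epsilon>)" using elim(5) by linarith
      have "(1/2) * norm (h \<epsilon>) \<le> (1 - t) * norm (h \<epsilon>)" using t hp by (intro mult_right_mono) auto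
      then have l: "norm (h \<epsilon>) / 2 \<le> norm (\<zeta> \<epsilon>)" using near_norm(1)[OF near] by simp
      have "(1 + t) * norm (h \<epsilon>) \<le> 2 * norm (h \<epsilon>)" using t hp by (intro mult_right_mono) auto
      then have u: "norm (\<zeta> \<epsilon>) \<le> 2 * norm (h \<epsilon>)" using near_norm(2)[OF near] by simp
      have "\<epsilon> powr (- (b / 2)) = \<epsilon> powr (b / 2) * \<epsilon> powr (- b)" by (simp flip: powr_add)
      also have "\<dots> \<le> 1/2 * norm (h \<epsilon>)" using elim(3,5) by (intro mult_mono) auto
      also have "\<dots> \<le> norm (\<zeta> \<epsilon>)" using l by simp
      finally have lo: "\<epsilon> powr (- (b / 2)) \<le> norm (\<zeta> \<epsilon>)" .
      have "\<epsilon> powr 0 \<le> \<epsilon> powr (- (b / 2))" using e b(1) by (intro powr_mono') auto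
      then have one: "1 \<le> norm (\<zeta> \<epsilon>)" using lo e by simp
      have "norm (inverse (norm (\<zeta> \<epsilon>)) *\<^sub>R \<zeta> \<epsilon> - k \<epsilon>) \<le> 2 * norm (\<zeta> \<epsilon> - h \<epsilon>) / norm (h \<epsilon>)"
        unfolding k_def using hp one by (intro normalize_diff) auto
      also have "\<dots> \<le> 2 * (t * norm (h \<epsilon>)) / norm (h \<epsilon>)"
        using near hp by (intro divide_right_mono mult_left_mono) auto
      also have "\<dots> = 6 * \<epsilon> powr (b / 4)" using hp by (simp add: t_def)
      also have "\<dots> = 6 * \<epsilon> powr (b / 8 + b / 8)" by simp
      also have "\<dots> \<le> \<epsilon> powr (b / 8)" by (rule elim(2))
      finally show ?case using u lo one by simp
    qed
    obtain N where "\<forall>\<^sub>F \<epsilon> in at_right 0. norm (h \<epsilon>) \<le> inverse \<epsilon> ^ N" using h unfolding gmoderate_iff ..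
    with all have "\<forall>\<^sub>F \<epsilon> in at_right 0. norm (\<zeta> \<epsilon>) \<le> 2 * inverse \<epsilon> ^ N" by eventually_elim simp
    then have \<zeta>m: "gmoderate \<zeta>" by (rule gmoderate_eventually_bound)
    have "abs_gen \<zeta> \<in> fast_large"
      unfolding fast_large_iff[OF \<zeta>m] using c(3) by (intro exI[of _ "b / 2"] conjI) (auto intro: eventually_mono[OF all])
    moreover have "abs_gen \<zeta> \<in> fast_cone (abs_gen k)"
      by (rule fast_coneI[OF \<zeta>m km c(2)]) (auto intro: eventually_mono[OF all])
    ultimately have "schwartz_point_value (gfourier (embed_schwartz \<Omega> V)) (abs_gen \<zeta>) = 0"
      by (intro zero) simp
    then show ?thesis using schwartz_point_value_eq_0_iff[OF \<Omega> V' v(1-3) \<zeta>m] by simp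
  qed
  have c\<phi>v: "compact_net K (\<lambda>\<epsilon> x. \<phi> x * v \<epsilon> x)" by (rule compact_net_mult[OF v(2) test_function_smooth[OF \<phi>]])
  have F\<phi>v: "gnegligible (\<lambda>\<epsilon>. fourier (\<lambda>x. \<phi> x * v \<epsilon> x) (\<eta> \<epsilon>))"
    if \<eta>: "\<And>\<epsilon>. norm (\<eta> \<epsilon> - h \<epsilon>) \<le> \<epsilon> powr (b / 4) * norm (h \<epsilon>)" for \<eta> :: "real \<Rightarrow> real^'n"
  proof -
    have c: "b / 4 > 0" "b / 2 > 0" "(1/2::real) > 0" using b(1) by auto
    have "gnegligible (\<lambda>\<epsilon>. fourier (\<lambda>x. \<phi> (inverse 1 *\<^sub>R (x - 0)) * v \<epsilon> x) (\<eta> \<epsilon>))"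
    proof (rule fourier_localization_negligible[where p = 0 and q = "b / 4" and s = "\<lambda>_. 1" and c = "\<lambda>_. 0" and b = "b / 2",
          OF test_function_smooth[OF \<phi>] K\<phi>(1) _ v(2)])
      show "\<phi> x = 0" if "x \<notin> K\<phi>" for x by (rule K\<phi>(3)[OF that])
      show "\<forall>\<^sub>F \<epsilon> in at_right 0. \<epsilon> powr 0 \<le> (1::real)" by (intro always_eventually allI) simp
      show "0 + b / 4 < b / 2" using b(1) by simp
      from eventually_powr_le[OF c(1,3)] eventually_powr_le[OF c(2,3)] b(2)
      show "\<forall>\<^sub>F \<epsilon> in at_right 0. \<epsilon> powr (- (b / 2)) \<le> norm (\<eta> \<epsilon>)"
      proof eventually_elim
        case (elim \<epsilon>)
        have "(1/2) * norm (h \<epsilon>) \<le> (1 - \<epsilon> powr (b / 4)) * norm (h \<epsilon>)"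
          using elim(1) by (intro mult_right_mono) auto
        also have "\<dots> \<le> norm (\<eta> \<epsilon>)" by (rule near_norm(1)[OF \<eta>])
        finally have l: "1/2 * norm (h \<epsilon>) \<le> norm (\<eta> \<epsilon>)" .
        have "\<epsilon> powr (- (b / 2)) = \<epsilon> powr (b / 2) * \<epsilon> powr (- b)" by (simp flip: powr_add)
        also have "\<dots> \<le> 1/2 * norm (h \<epsilon>)" using elim(2,3) by (intro mult_mono) auto
        finally show ?case using l by simp
      qed
      fix \<zeta> :: "real \<Rightarrow> real^'n" assume \<zeta>: "\<And>\<epsilon>. norm (\<zeta> \<epsilon> - \<eta> \<epsilon>) \<le> \<epsilon> powr (b / 4) * norm (\<eta> \<epsilon>)"
      show "gnegligible (\<lambda>\<epsilon>. fourier (v \<epsilon>) (\<zeta> \<epsilon>))"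
      proof (rule Fv)
        from eventually_powr_le[OF c(1) zero_less_one]
        show "\<forall>\<^sub>F \<epsilon> in at_right 0. norm (\<zeta> \<epsilon> - h \<epsilon>) \<le> 3 * \<epsilon> powr (b / 4) * norm (h \<epsilon>)"
        proof eventually_elim
          case (elim \<epsilon>)
          have "(1 + \<epsilon> powr (b / 4)) * norm (h \<epsilon>) \<le> 2 * norm (h \<epsilon>)" using elim by (intro mult_right_mono) auto
          then have "norm (\<eta> \<epsilon>) \<le> 2 * norm (h \<epsilon>)" using near_norm(2)[OF \<eta>, of \<epsilon>] by linarith
          then have "\<epsilon> powr (b / 4) * norm (\<eta> \<epsilon>) \<le> \<epsilon> powr (b / 4) * (2 * norm (h \<epsilon>))"
            by (intro mult_left_mono) auto
          then have "norm (\<zeta> \<epsilon> - \<eta> \<epsilon>) \<le> 2 * \<epsilon> powr (b / 4) * norm (h \<epsilon>)" using \<zeta>[of \<epsilon>] by simp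
          then have "norm (\<zeta> \<epsilon> - h \<epsilon>) \<le> 2 * \<epsilon> powr (b / 4) * norm (h \<epsilon>) + \<epsilon> powr (b / 4) * norm (h \<epsilon>)"
            by (rule norm_diff_triangle_le[OF _ \<eta>])
          then show ?case by (simp add: algebra_simps)
        qed
      qed
    qed
    then show ?thesis by simp
  qed
  have F\<theta>\<phi>v: "gnegligible (\<lambda>\<epsilon>. fourier (\<lambda>z. \<theta> (inverse (?s \<epsilon>) *\<^sub>R (z - x \<epsilon>)) * (\<phi> z * v \<epsilon> z)) (h \<epsilon>))"
  proof (rule fourier_localization_negligible[where p = "b / 4" and q = "b / 4" and s = ?s and b = b and c = x,
        OF \<theta>(1) compact_cball _ c\<phi>v])
    show "\<theta> x = 0" if "x \<notin> cball 0 1" for x by (rule \<theta>(2)[OF that])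
    show "\<forall>\<^sub>F \<epsilon> in at_right 0. \<epsilon> powr (b / 4) \<le> ?s \<epsilon>" by simp
    show "b / 4 + b / 4 < b" using b(1) by simp
  qed (use b(2) F\<phi>v in auto)
  have "gnegligible (\<lambda>\<epsilon>. fourier (\<lambda>z. \<theta> (inverse (?s \<epsilon>) *\<^sub>R (z - x \<epsilon>)) * (\<phi> z * u \<epsilon> z)) (h \<epsilon>) -
      fourier (\<lambda>z. \<theta> (inverse (?s \<epsilon>) *\<^sub>R (z - x \<epsilon>)) * (\<phi> z * v \<epsilon> z)) (h \<epsilon>))"
  proof (rule gnegligible_eventually_bound)
    fix n :: nat
    obtain B1 where B1: "B1 \<ge> 0" "\<And>y. y \<in> cball 0 1 \<Longrightarrow> norm (\<theta> y) \<le> B1"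
      using compact_norm_bound[OF compact_cball smooth_on_continuous_on[OF smooth_on_UNIV[OF \<theta>(1)]]] by blast
    obtain B2 where B2: "B2 \<ge> 0" "\<And>y. y \<in> K\<phi> \<Longrightarrow> norm (\<phi> y) \<le> B2"
      using compact_norm_bound[OF K\<phi>(1) smooth_on_continuous_on[OF test_function_smooth[OF \<phi>]]] by blast
    from diff[of n] eventually_unit
    have "\<forall>\<^sub>F \<epsilon> in at_right 0. norm (fourier (\<lambda>z. \<theta> (inverse (?s \<epsilon>) *\<^sub>R (z - x \<epsilon>)) * (\<phi> z * u \<epsilon> z)) (h \<epsilon>) -
      fourier (\<lambda>z. \<theta> (inverse (?s \<epsilon>) *\<^sub>R (z - x \<epsilon>)) * (\<phi> z * v \<epsilon> z)) (h \<epsilon>)) \<le> (B1 * B2 * measure lborel K\<phi>) * \<epsilon> ^ n"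
    proof eventually_elim
      case (elim \<epsilon>)
      have e: "0 < \<epsilon>" "\<epsilon> \<le> 1" using elim(2) by auto
      have sp: "0 < ?s \<epsilon>" using e by simp
      let ?\<theta> = "\<lambda>z. \<theta> (inverse (?s \<epsilon>) *\<^sub>R (z - x \<epsilon>))"
      have \<theta>c: "continuous_on UNIV ?\<theta>"
        by (rule continuous_on_compose2[OF smooth_on_continuous_on[OF \<theta>(1)]]) (auto intro!: continuous_intros)
      have int: "integrable lborel (\<lambda>z. ?\<theta> z * (\<phi> z * w z))" if "smooth_on \<Omega> w" for w
      proof (rule integrable_continuous_compact[OF _ K\<phi>(1)])
        have "continuous_on UNIV (\<lambda>z. \<phi> z * w z)"
          by (rule smooth_on_continuous_on[OF test_function_smooth[OF test_function_mult_smooth[OF \<Omega> \<phi> that]]])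
        then show "continuous_on UNIV (\<lambda>z. ?\<theta> z * (\<phi> z * w z))" by (rule continuous_on_mult[OF \<theta>c])
      qed (simp add: K\<phi>(3))
      have su: "smooth_on \<Omega> (u \<epsilon>)" by (rule moderate_nets_smooth_on[OF um elim(2)])
      have sv: "smooth_on \<Omega> (v \<epsilon>)" by (rule smooth_on_UNIV[OF compact_netD(4)[OF v(2) elim(2)]])
      have "norm (fourier (\<lambda>z. ?\<theta> z * (\<phi> z * u \<epsilon> z) - ?\<theta> z * (\<phi> z * v \<epsilon> z)) (h \<epsilon>)) \<le> (B1 * B2 * \<epsilon> ^ n) * measure lborel K\<phi>"
      proof (rule norm_fourier_le_compact[OF K\<phi>(1)])
        fix z assume z: "z \<in> K\<phi>"
        have eq: "?\<theta> z * (\<phi> z * u \<epsilon> z) - ?\<theta> z * (\<phi> z * v \<epsilon> z) = ?\<theta> z * \<phi> z * (u \<epsilon> z - v \<epsilon> z)" by (simp add: algebra_simps)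
        show "norm (?\<theta> z * (\<phi> z * u \<epsilon> z) - ?\<theta> z * (\<phi> z * v \<epsilon> z)) \<le> B1 * B2 * \<epsilon> ^ n"
        proof (cases "inverse (?s \<epsilon>) *\<^sub>R (z - x \<epsilon>) \<in> cball 0 1")
          case True
          then have "inverse (?s \<epsilon>) * norm (z - x \<epsilon>) \<le> 1" using sp by simp
          then have "norm (z - x \<epsilon>) \<le> ?s \<epsilon>" using sp by (simp add: field_simps)
          then have "norm (u \<epsilon> z - v \<epsilon> z) \<le> \<epsilon> ^ n" using elim(1) by (simp add: dist_norm norm_minus_commute)
          then show ?thesis
            unfolding eq norm_mult using B1 B2 True z e by (intro mult_mono) auto
        next
          case False
          then show ?thesis unfolding eq using \<theta>(2) B1 B2 e by simp
        qed
      qed (simp add: K\<phi>(3))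
      then show ?case
        unfolding fourier_diff[OF int[OF su] int[OF sv]] by (simp only: mult_ac)
    qed
    then show "\<exists>C. \<forall>\<^sub>F \<epsilon> in at_right 0. norm (fourier (\<lambda>z. \<theta> (inverse (?s \<epsilon>) *\<^sub>R (z - x \<epsilon>)) * (\<phi> z * u \<epsilon> z)) (h \<epsilon>) -
      fourier (\<lambda>z. \<theta> (inverse (?s \<epsilon>) *\<^sub>R (z - x \<epsilon>)) * (\<phi> z * v \<epsilon> z)) (h \<epsilon>)) \<le> C * \<epsilon> ^ n" ..
  qed
  from gnegligible_add[OF this F\<theta>\<phi>v] show ?thesis by simp
qed


text \<open>Three ranges of \<open>|\<xi>|\<close>. Below \<open>\<epsilon>\<^sup>-\<^sup>b\<close>
  with \<open>b \<le> 1/m\<close> the weight costs at most one power of \<open>1/\<epsilon>\<close>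
  besides a constant, so the crude bound with exponent \<open>M\<close> suffices; it is here that
  \<open>N\<close> becomes independent of \<open>m\<close>. Between
  \<open>\<epsilon>\<^sup>-\<^sup>b\<close> and \<open>\<epsilon>\<^sup>-\<^sup>P\<close> the
  transform is smaller than any power of \<open>\<epsilon>\<close>. Above that, its rapid decrease
  wins over the moderate constant.\<close>

lemma uniform_exponent:
  fixes g :: "real \<Rightarrow> real^'n \<Rightarrow> complex"
  assumes g: "compact_net K g"
    and small: "\<And>b P n. 0 < b \<Longrightarrow> b \<le> 1 \<Longrightarrow> 1 \<le> P \<Longrightarrow> \<forall>\<^sub>F \<epsilon> in at_right 0. \<forall>\<xi>\<in>\<Gamma>.
      \<epsilon> powr (- b) \<le> norm \<xi> \<and> norm \<xi> \<le> inverse \<epsilon> ^ P \<longrightarrow> norm (fourier (g \<epsilon>) \<xi>) \<le> \<epsilon> ^ n"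
  shows "\<exists>N::nat. \<forall>m::nat. \<forall>\<^sub>F \<epsilon> in at_right 0. \<forall>\<xi>\<in>\<Gamma>.
    sqrt (1 + (norm \<xi>)\<^sup>2) ^ m * norm (fourier (g \<epsilon>) \<xi>) \<le> inverse \<epsilon> ^ N"
proof -
  obtain M where M: "\<forall>\<^sub>F \<epsilon> in at_right 0. \<forall>\<xi>. norm (fourier (g \<epsilon>) \<xi>) \<le> inverse \<epsilon> ^ M"
    using compact_net_fourier_bounded[OF g] ..
  show ?thesis
  proof (intro exI[of _ "M + 2"] allI)
    fix m :: nat
    obtain Q where Q: "\<forall>\<^sub>F \<epsilon> in at_right 0. \<forall>\<xi>. (1 + norm \<xi>) ^ Suc m * norm (fourier (g \<epsilon>) \<xi>) \<le> inverse \<epsilon> ^ Q"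
      using compact_net_fourier_decay[OF g, of "Suc m"] ..
    define P where "P = max Q 1"
    \<comment> \<open>So that \<open>\<epsilon>\<^sup>-\<^sup>b\<^sup>m \<le> 1/\<epsilon>\<close>,
      also for \<open>m = 0\<close>.\<close>
    define b where "b = 1 / real (Suc m)"
    have b: "0 < b" "b \<le> 1" "b * real m \<le> 1" by (auto simp: b_def divide_simps)
    have P1: "1 \<le> P" by (simp add: P_def)
    from M Q small[OF b(1,2) P1, of "P * m"] absorb_const_inverse[of "2 ^ m" 0]
      eventually_small[OF zero_less_one]
    show "\<forall>\<^sub>F \<epsilon> in at_right 0. \<forall>\<xi>\<in>\<Gamma>. sqrt (1 + (norm \<xi>)\<^sup>2) ^ m * norm (fourier (g \<epsilon>) \<xi>) \<le> inverse \<epsilon> ^ (M + 2)"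
    proof eventually_elim
      case (elim \<epsilon>)
      have e: "0 < \<epsilon>" "\<epsilon> \<le> 1" "1 \<le> inverse \<epsilon>" using elim(5) by (auto simp: one_le_inverse)
      have two: "2 ^ m \<le> inverse \<epsilon>" using elim(4) by simp
      have inv_mono: "inverse \<epsilon> ^ i \<le> inverse \<epsilon> ^ j" if "i \<le> j" for i j
        using e(3) that by (rule power_increasing[rotated])
      show ?case
      proof
        fix \<xi> assume \<xi>: "\<xi> \<in> \<Gamma>"
        let ?F = "norm (fourier (g \<epsilon>) \<xi>)"
        have "sqrt (1 + (norm \<xi>)\<^sup>2) \<le> 1 + norm \<xi>"
          by (rule real_le_lsqrt) (simp_all add: power2_eq_square algebra_simps)
        then have "sqrt (1 + (norm \<xi>)\<^sup>2) ^ m * ?F \<le> (1 + norm \<xi>) ^ m * ?F"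
          by (intro mult_right_mono power_mono) auto
        also have "(1 + norm \<xi>) ^ m * ?F \<le> inverse \<epsilon> ^ (M + 2)"
        proof -
          consider "norm \<xi> < \<epsilon> powr (- b)" | "\<epsilon> powr (- b) \<le> norm \<xi>" "norm \<xi> \<le> inverse \<epsilon> ^ P"
            | "inverse \<epsilon> ^ P < norm \<xi>" by linarith
          then show ?thesis
          proof cases
            case 1
            have "\<epsilon> powr 0 \<le> \<epsilon> powr (- b)" using e b(1) by (intro powr_mono') auto
            then have "1 + norm \<xi> \<le> 2 * \<epsilon> powr (- b)" using 1 e by simp
            then have "(1 + norm \<xi>) ^ m \<le> (2 * \<epsilon> powr (- b)) ^ m" by (intro power_mono) auto
            also have "\<dots> = 2 ^ m * \<epsilon> powr (- (b * real m))"
              using e by (simp add: power_mult_distrib powr_powr flip: powr_realpow)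
            also have "\<epsilon> powr (- (b * real m)) \<le> \<epsilon> powr (- 1)" using e b(3) by (intro powr_mono') auto
            also have "\<epsilon> powr (- 1) = inverse \<epsilon>" using e by (simp add: powr_minus)
            finally have "(1 + norm \<xi>) ^ m \<le> 2 ^ m * inverse \<epsilon>" by simp
            also have "\<dots> \<le> inverse \<epsilon> * inverse \<epsilon>" using two e by (intro mult_right_mono) auto
            finally have "(1 + norm \<xi>) ^ m * ?F \<le> (inverse \<epsilon> * inverse \<epsilon>) * inverse \<epsilon> ^ M"
              using elim(1) e by (intro mult_mono) auto
            then show ?thesis by (simp add: power_add power2_eq_square mult_ac)
          next
            case 2
            have F: "?F \<le> \<epsilon> ^ (P * m)" using elim(3) \<xi> 2 by blast
            have "1 + norm \<xi> \<le> 2 * inverse \<epsilon> ^ P" using 2(2) inv_mono[of 0 P] by simp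
            then have "(1 + norm \<xi>) ^ m \<le> (2 * inverse \<epsilon> ^ P) ^ m" by (intro power_mono) auto
            also have "\<dots> = 2 ^ m * inverse \<epsilon> ^ (P * m)" by (simp add: power_mult_distrib power_mult)
            finally have "(1 + norm \<xi>) ^ m * ?F \<le> (2 ^ m * inverse \<epsilon> ^ (P * m)) * \<epsilon> ^ (P * m)"
              using F e by (intro mult_mono) auto
            also have "\<dots> = 2 ^ m" using e by (simp add: power_inverse)
            also have "\<dots> \<le> inverse \<epsilon> ^ 1" using two by simp
            also have "\<dots> \<le> inverse \<epsilon> ^ (M + 2)" by (rule inv_mono) simp
            finally show ?thesis .
          next
            case 3
            have "inverse \<epsilon> ^ Q \<le> inverse \<epsilon> ^ P" by (rule inv_mono) (simp add: P_def)
            then have "inverse \<epsilon> ^ Q \<le> 1 + norm \<xi>" using 3 by linarith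
            moreover have "(1 + norm \<xi>) * ((1 + norm \<xi>) ^ m * ?F) \<le> inverse \<epsilon> ^ Q"
              using elim(2) by (simp add: mult.assoc)
            ultimately have "(1 + norm \<xi>) * ((1 + norm \<xi>) ^ m * ?F) \<le> (1 + norm \<xi>) * 1"
              by (simp only: mult_1_right)
            then have "(1 + norm \<xi>) ^ m * ?F \<le> 1" by (rule mult_left_le_imp_le) (simp add: add_pos_nonneg)
            also have "\<dots> \<le> inverse \<epsilon> ^ (M + 2)" using inv_mono[of 0 "M + 2"] by simp
            finally show ?thesis .
          qed
        qed
        finally show "sqrt (1 + (norm \<xi>)\<^sup>2) ^ m * ?F \<le> inverse \<epsilon> ^ (M + 2)" .
      qed
    qed
  qed
qed

lemma conic_nbhd_directions:
  fixes \<xi>0 :: "real^'n"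
  assumes "norm \<xi>0 = 1" "\<rho> > 0"
  shows "conic_nbhd {\<xi>. \<xi> \<noteq> 0 \<and> norm (inverse (norm \<xi>) *\<^sub>R \<xi> - \<xi>0) \<le> \<rho>} \<xi>0" (is "conic_nbhd ?\<Gamma> \<xi>0")
  unfolding conic_nbhd_def
proof (intro conjI ballI allI impI)
  have "ball \<xi>0 (min (1/2) (\<rho> / 2)) \<subseteq> ?\<Gamma>"
  proof
    fix \<xi> assume "\<xi> \<in> ball \<xi>0 (min (1/2) (\<rho> / 2))"
    then have d: "norm (\<xi> - \<xi>0) < 1/2" "norm (\<xi> - \<xi>0) < \<rho> / 2" by (auto simp: dist_norm norm_minus_commute)
    have nz: "\<xi> \<noteq> 0" using d(1) assms(1) by auto
    have "\<xi>0 \<noteq> 0" using assms(1) by auto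
    from normalize_diff[OF this nz] assms(1)
    have "norm (inverse (norm \<xi>) *\<^sub>R \<xi> - \<xi>0) \<le> 2 * norm (\<xi> - \<xi>0)" by simp
    then show "\<xi> \<in> ?\<Gamma>" using nz d(2) by simp
  qed
  moreover have "\<xi>0 \<in> ball \<xi>0 (min (1/2) (\<rho> / 2))" using assms(2) by simp
  ultimately show "\<xi>0 \<in> interior ?\<Gamma>" by (intro interiorI[OF open_ball])
next
  fix \<xi> and t :: real assume \<xi>: "\<xi> \<in> ?\<Gamma>" and t: "t > 0"
  have "inverse (norm (t *\<^sub>R \<xi>)) *\<^sub>R (t *\<^sub>R \<xi>) = (inverse (t * norm \<xi>) * t) *\<^sub>R \<xi>" using t by simp
  also have "inverse (t * norm \<xi>) * t = inverse (norm \<xi>)" using t by (simp add: field_simps)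
  finally have "norm (inverse (norm (t *\<^sub>R \<xi>)) *\<^sub>R (t *\<^sub>R \<xi>) - \<xi>0) \<le> \<rho>" using \<xi> by (simp only: mem_Collect_eq)
  moreover have "t *\<^sub>R \<xi> \<noteq> 0" using \<xi> t by simp
  ultimately show "t *\<^sub>R \<xi> \<in> ?\<Gamma>" by blast
qed

text \<open>Regularity along all generalized points and directions makes the transforms of
  \<open>\<phi> u\<close> times small cutoffs negligible uniformly in the classical position of the
  cutoff and in the classical frequency. Averaging over the position removes the small
  cutoff.\<close>

lemma gen_regular_imp_regular:
  fixes \<Omega> :: "(real^'n) set"
  assumes \<Omega>: "open \<Omega>" and U: "U \<in> colombeau \<Omega>" and x0: "x0 \<in> \<Omega>" and \<xi>0: "norm \<xi>0 = 1"
    and r: "r > 0"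
    and reg: "\<And>x \<xi>. gnorm (x - gconst x0) \<le> gconst r \<Longrightarrow> \<xi> \<in> gsphere \<Longrightarrow> gnorm (\<xi> - gconst \<xi>0) \<le> gconst r \<Longrightarrow>
      gen_microlocally_regular \<Omega> U x \<xi>"
  shows "microlocally_regular \<Omega> U x0 \<xi>0"
proof -
  obtain u where u: "u \<in> U" using colombeau_nonempty[OF \<Omega> U] by blast
  have um: "u \<in> moderate_nets \<Omega>" by (rule colombeau_elim(1)[OF \<Omega> U u])
  obtain e where e: "e > 0" "cball x0 e \<subseteq> \<Omega>" using \<Omega> x0 open_contains_cball by blast
  define \<rho> where "\<rho> = min r e"
  have \<rho>: "\<rho> > 0" "\<rho> \<le> r" "\<rho> \<le> e" using r e(1) by (auto simp: \<rho>_def)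
  have B\<Omega>: "cball x0 \<rho> \<subseteq> \<Omega>" using e(2) \<rho>(3) by (auto simp: subset_eq)
  define \<phi> where "\<phi> = bump x0 (\<rho> / 4) (\<rho> / 2)"
  define \<theta> where "\<theta> = bump (0::real^'n) (1/2) 1"
  define \<Gamma> where "\<Gamma> = {\<xi>. \<xi> \<noteq> 0 \<and> norm (inverse (norm \<xi>) *\<^sub>R \<xi> - \<xi>0) \<le> \<rho>}"
  have K\<phi>: "cball x0 (\<rho> / 2) \<subseteq> \<Omega>" using B\<Omega> \<rho>(1) by (auto simp: subset_eq)
  have \<phi>: "test_function \<Omega> \<phi>" unfolding \<phi>_def by (rule test_function_bump[OF _ _ K\<phi>]) (use \<rho>(1) in auto)
  have \<phi>1: "\<phi> x0 = 1" unfolding \<phi>_def by (rule bump_eq_1) (use \<rho>(1) in auto)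
  have \<phi>0: "\<phi> x = 0" if "x \<notin> cball x0 (\<rho> / 2)" for x
    unfolding \<phi>_def using that \<rho>(1) by (intro bump_eq_0) (auto simp: dist_commute)
  have \<theta>: "smooth_on UNIV \<theta>" unfolding \<theta>_def by (rule smooth_on_bump) auto
  have \<theta>0: "\<theta> x = 0" if "x \<notin> cball 0 1" for x
    unfolding \<theta>_def using that by (intro bump_eq_0) (auto simp: dist_commute)
  define I where "I = norm (fourier \<theta> 0)"
  have I: "I > 0" using fourier_bump_0_neq_0[of "1/2" 1, where 'n = 'n] by (simp add: I_def \<theta>_def)
  define g where "g \<epsilon> x = \<phi> x * u \<epsilon> x" for \<epsilon> x
  have g: "compact_net (cball x0 (\<rho> / 2)) g" unfolding g_def[abs_def]
    using \<Omega> \<phi> um compact_cball K\<phi> \<phi>0 by (rule compact_net_cutoff)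
  have small: "\<forall>\<^sub>F \<epsilon> in at_right 0. \<forall>\<xi>\<in>\<Gamma>. \<epsilon> powr (- b) \<le> norm \<xi> \<and> norm \<xi> \<le> inverse \<epsilon> ^ P \<longrightarrow>
      norm (fourier (g \<epsilon>) \<xi>) \<le> \<epsilon> ^ n"
    if b: "0 < b" "b \<le> 1" and P: "1 \<le> P" for b and P n :: nat
  proof -
    let ?s = "\<lambda>\<epsilon>::real. \<epsilon> powr (b / 4)"
    define Z where "Z \<epsilon> = {(x, h). x \<in> cball x0 \<rho> \<and> h \<in> \<Gamma> \<and> \<epsilon> powr (- b) \<le> norm h \<and> norm h \<le> inverse \<epsilon> ^ P}" for \<epsilon>
    \<comment> \<open>For \<open>\<epsilon>\<close> outside \<open>(0, 1]\<close> the set \<open>Z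
      \<epsilon>\<close> may be empty, while a net has to choose a parameter for every
      \<open>\<epsilon>\<close>; for \<open>\<epsilon>\<close> in that interval the substitute
      belongs to \<open>Z \<epsilon>\<close>.\<close>
    define A where "A \<epsilon> = (if Z \<epsilon> = {} then {(x0, inverse \<epsilon> *\<^sub>R \<xi>0)} else Z \<epsilon>)" for \<epsilon>
    have ZI: "p \<in> Z \<epsilon>" if "p \<in> A \<epsilon>" "0 < \<epsilon>" "\<epsilon> \<le> 1" for p \<epsilon>
    proof (cases "Z \<epsilon> = {}")
      case True
      have "inverse \<epsilon> *\<^sub>R \<xi>0 \<in> \<Gamma>" using that(2) \<xi>0 \<rho>(1) by (auto simp: \<Gamma>_def)
      moreover have "\<epsilon> powr (- b) \<le> inverse \<epsilon>"
      proof -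
        have "\<epsilon> powr (- b) \<le> \<epsilon> powr (- 1)" using that(2,3) b(2) by (intro powr_mono') auto
        then show ?thesis using that(2) by (simp add: powr_minus)
      qed
      moreover have "inverse \<epsilon> ^ 1 \<le> inverse \<epsilon> ^ P"
        using P that(2,3) by (intro power_increasing) (auto simp: one_le_inverse)
      ultimately have "(x0, inverse \<epsilon> *\<^sub>R \<xi>0) \<in> Z \<epsilon>"
        unfolding Z_def using \<rho>(1) that(2) \<xi>0 by simp
      with True show ?thesis by simp
    next
      case False
      then show ?thesis using that(1) by (simp add: A_def)
    qed
    have loc: "\<forall>\<^sub>F \<epsilon> in at_right 0. \<forall>p\<in>A \<epsilon>.
        norm (fourier (\<lambda>z. \<theta> (inverse (?s \<epsilon>) *\<^sub>R (z - fst p)) * g \<epsilon> z) (snd p)) \<le> \<epsilon> ^ n" for n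
    proof (rule uniform_negligible)
      show "A \<epsilon> \<noteq> {}" for \<epsilon> by (simp add: A_def)
      fix p assume p: "\<And>\<epsilon>. p \<epsilon> \<in> A \<epsilon>"
      define x where "x \<epsilon> = fst (p \<epsilon>)" for \<epsilon>
      define h where "h \<epsilon> = snd (p \<epsilon>)" for \<epsilon>
      define k where "k \<epsilon> = inverse (norm (h \<epsilon>)) *\<^sub>R h \<epsilon>" for \<epsilon>
      have ev: "\<forall>\<^sub>F \<epsilon> in at_right 0. x \<epsilon> \<in> cball x0 \<rho> \<and> h \<epsilon> \<in> \<Gamma> \<and> \<epsilon> powr (- b) \<le> norm (h \<epsilon>) \<and> norm (h \<epsilon>) \<le> inverse \<epsilon> ^ P"
        using eventually_unit
      proof eventually_elim
        case (elim \<epsilon>)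
        then have "p \<epsilon> \<in> Z \<epsilon>" using ZI[OF p] by simp
        then show ?case by (simp add: Z_def x_def h_def case_prod_unfold)
      qed
      have xB: "\<forall>\<^sub>F \<epsilon> in at_right 0. x \<epsilon> \<in> cball x0 \<rho>" using ev by eventually_elim blast
      have hb: "\<forall>\<^sub>F \<epsilon> in at_right 0. \<epsilon> powr (- b) \<le> norm (h \<epsilon>)" using ev by eventually_elim blast
      have xm: "gmoderate x"
      proof (rule gmoderate_eventually_bound)
        show "\<forall>\<^sub>F \<epsilon> in at_right 0. norm (x \<epsilon>) \<le> (norm x0 + \<rho>) * inverse \<epsilon> ^ 0"
          using xB
        proof eventually_elim
          case (elim \<epsilon>)
          have "norm (x \<epsilon>) \<le> norm x0 + norm (x \<epsilon> - x0)" using norm_triangle_sub[of "x \<epsilon>" x0] by simp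
          then show ?case using elim by (simp add: dist_norm norm_minus_commute)
        qed
      qed
      have "\<forall>\<^sub>F \<epsilon> in at_right 0. norm (h \<epsilon>) \<le> inverse \<epsilon> ^ P" using ev by eventually_elim blast
      then have hm: "gmoderate h" unfolding gmoderate_iff by (rule exI)
      have k1: "\<forall>\<^sub>F \<epsilon> in at_right 0. norm (k \<epsilon>) = 1 \<and> norm (k \<epsilon> - \<xi>0) \<le> r"
        using ev
      proof eventually_elim
        case (elim \<epsilon>)
        then have "h \<epsilon> \<noteq> 0" "norm (k \<epsilon> - \<xi>0) \<le> \<rho>" by (auto simp: \<Gamma>_def k_def)
        then show ?case using \<rho>(2) by (simp add: k_def)
      qed
      have km: "gmoderate k"
      proof (rule gmoderate_eventually_bound)
        show "\<forall>\<^sub>F \<epsilon> in at_right 0. norm (k \<epsilon>) \<le> 1 * inverse \<epsilon> ^ 0" using k1 by eventually_elim simp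
      qed
      have "gen_microlocally_regular \<Omega> U (abs_gen x) (abs_gen k)"
      proof (rule reg)
        show "gnorm (abs_gen x - gconst x0) \<le> gconst r"
        proof (rule gballI[OF xm])
          show "\<forall>\<^sub>F \<epsilon> in at_right 0. norm (x \<epsilon> - x0) \<le> r"
            using xB by eventually_elim (use \<rho>(2) in \<open>simp add: dist_norm norm_minus_commute\<close>)
        qed
        show "abs_gen k \<in> gsphere"
          unfolding gsphere_iff[OF km] gnegligible_iff
        proof
          fix n
          show "\<forall>\<^sub>F \<epsilon> in at_right 0. norm (norm (k \<epsilon>) - 1) \<le> \<epsilon> ^ n"
            using k1 eventually_pos by eventually_elim simp
        qed
        show "gnorm (abs_gen k - gconst \<xi>0) \<le> gconst r"
          by (rule gballI[OF km]) (use k1 in \<open>auto elim: eventually_mono\<close>)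
      qed
      then have "gnegligible (\<lambda>\<epsilon>. fourier (\<lambda>z. \<theta> (inverse (?s \<epsilon>) *\<^sub>R (z - x \<epsilon>)) * (\<phi> z * u \<epsilon> z)) (h \<epsilon>))"
        unfolding k_def[abs_def]
        using \<Omega> U u \<phi> compact_cball K\<phi> \<phi>0 \<theta> \<theta>0 xm compact_cball B\<Omega> xB hm b(1) hb
        by (intro gen_regular_local_negligible)
      then show "gnegligible (\<lambda>\<epsilon>. fourier (\<lambda>z. \<theta> (inverse (?s \<epsilon>) *\<^sub>R (z - fst (p \<epsilon>))) * g \<epsilon> z) (snd (p \<epsilon>)))"
        by (simp add: x_def h_def g_def)
    qed
    let ?d = "CARD('n)"
    define C where "C = measure lborel (cball x0 \<rho>) / I"
    have b4: "b / 4 > 0" "\<rho> / 2 > 0" using b(1) \<rho>(1) by auto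
    \<comment> \<open>One power of \<open>\<epsilon>\<close> is spent on the constant and
      \<open>d\<close> powers on the volume factor \<open>\<epsilon>\<^sup>b\<^sup>d\<^sup>/\<^sup>4
      \<ge> \<epsilon>\<^sup>d\<close>.\<close>
    from loc[of "Suc n + ?d"] absorb_const_power[of C n] eventually_powr_le[OF b4] eventually_unit
    show ?thesis
    proof eventually_elim
      case (elim \<epsilon>)
      have e: "0 < \<epsilon>" "\<epsilon> \<le> 1" using elim(4) by auto
      have sp: "0 < ?s \<epsilon>" using e by simp
      show ?case
      proof (intro ballI impI)
        fix \<xi> assume \<xi>: "\<xi> \<in> \<Gamma>" "\<epsilon> powr (- b) \<le> norm \<xi> \<and> norm \<xi> \<le> inverse \<epsilon> ^ P"
        have avg: "?s \<epsilon> ^ ?d * norm (fourier \<theta> 0) * norm (fourier (g \<epsilon>) \<xi>) \<le>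
            \<epsilon> ^ (Suc n + ?d) * measure lborel (cball x0 \<rho>)"
        proof (rule fourier_average_bound[of _ _ "\<rho> / 2"])
          show "continuous_on UNIV (g \<epsilon>)" by (rule compact_netD(6)[OF g elim(4)])
          show "g \<epsilon> x = 0" if "x \<notin> cball x0 (\<rho> / 2)" for x by (rule compact_netD(3)[OF g elim(4) that])
          show "continuous_on UNIV \<theta>" by (rule smooth_on_continuous_on[OF \<theta>])
          show "\<theta> x = 0" if "x \<notin> cball 0 1" for x by (rule \<theta>0[OF that])
          show "0 < ?s \<epsilon>" by (rule sp)
          show "\<rho> / 2 + ?s \<epsilon> \<le> \<rho>" using elim(3) by simp
          fix x assume "x \<in> cball x0 \<rho>"
          then have "(x, \<xi>) \<in> Z \<epsilon>" using \<xi> by (simp add: Z_def)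
          then have "(x, \<xi>) \<in> A \<epsilon>" by (auto simp: A_def)
          from bspec[OF elim(1) this]
          show "norm (fourier (\<lambda>z. \<theta> (inverse (?s \<epsilon>) *\<^sub>R (z - x)) * g \<epsilon> z) \<xi>) \<le> \<epsilon> ^ (Suc n + ?d)" by simp
        qed
        have "\<epsilon> powr 1 \<le> ?s \<epsilon>" using e b(2) by (intro powr_mono') auto
        then have "\<epsilon> ^ ?d \<le> ?s \<epsilon> ^ ?d" using e by (intro power_mono) auto
        then have "\<epsilon> ^ ?d * (I * norm (fourier (g \<epsilon>) \<xi>)) \<le> ?s \<epsilon> ^ ?d * (I * norm (fourier (g \<epsilon>) \<xi>))"
          using I by (intro mult_right_mono) auto
        also have "\<dots> \<le> \<epsilon> ^ (Suc n + ?d) * measure lborel (cball x0 \<rho>)" using avg by (simp add: I_def mult.assoc)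
        also have "\<dots> = \<epsilon> ^ ?d * (\<epsilon> ^ Suc n * measure lborel (cball x0 \<rho>))" by (simp add: power_add mult_ac)
        finally have "I * norm (fourier (g \<epsilon>) \<xi>) \<le> \<epsilon> ^ Suc n * measure lborel (cball x0 \<rho>)"
          by (rule mult_left_le_imp_le) (use e in simp)
        then have "norm (fourier (g \<epsilon>) \<xi>) \<le> C * \<epsilon> ^ Suc n" using I by (simp add: C_def field_simps)
        also have "\<dots> \<le> \<epsilon> ^ n" by (rule elim(2))
        finally show "norm (fourier (g \<epsilon>) \<xi>) \<le> \<epsilon> ^ n" .
      qed
    qed
  qed
  have "\<exists>N::nat. \<forall>m::nat. \<forall>\<^sub>F \<epsilon> in at_right 0. \<forall>\<xi>\<in>\<Gamma>.
      sqrt (1 + (norm \<xi>)\<^sup>2) ^ m * norm (fourier (g \<epsilon>) \<xi>) \<le> inverse \<epsilon> ^ N"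
    by (rule uniform_exponent[OF g small])
  then obtain N :: nat where "\<forall>m::nat. \<forall>\<^sub>F \<epsilon> in at_right 0. \<forall>\<xi>\<in>\<Gamma>.
      sqrt (1 + (norm \<xi>)\<^sup>2) ^ m * norm (fourier (\<lambda>x. \<phi> x * u \<epsilon> x) \<xi>) \<le> inverse \<epsilon> ^ N"
    unfolding g_def[abs_def] ..
  moreover have "conic_nbhd \<Gamma> \<xi>0" unfolding \<Gamma>_def by (rule conic_nbhd_directions[OF \<xi>0 \<rho>(1)])
  ultimately show ?thesis
    unfolding microlocally_regular_def
    using u \<phi> \<phi>1 by (intro bexI[of _ u] exI[of _ \<phi>] exI[of _ \<Gamma>] exI[of _ N] conjI)
qed

theorem theorem5p3:
  fixes \<Omega> :: "(real^'n) set" and U :: "(real \<Rightarrow> real^'n \<Rightarrow> complex) set"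
    and x0 \<xi>0 :: "real^'n"
  assumes "open \<Omega>" and "U \<in> colombeau \<Omega>" and "x0 \<in> \<Omega>" and "\<xi>0 \<in> sphere 0 1"
  shows "microlocally_regular \<Omega> U x0 \<xi>0 \<longleftrightarrow>
    (\<exists>r>0. \<forall>x. gnorm (x - gconst x0) \<le> gconst r \<longrightarrow>
      x \<in> compact_points \<Omega> \<and>
      (\<forall>\<xi>\<in>gsphere. gnorm (\<xi> - gconst \<xi>0) \<le> gconst r \<longrightarrow>
        gen_microlocally_regular \<Omega> U x \<xi>))" (is "_ \<longleftrightarrow> ?rhs")
proof
  assume "microlocally_regular \<Omega> U x0 \<xi>0"
  then show ?rhs by (rule regular_imp_gen_regular[OF assms(1,2)])
next
  assume ?rhs
  then obtain r where "r > 0" and "\<forall>x. gnorm (x - gconst x0) \<le> gconst r \<longrightarrow>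
      x \<in> compact_points \<Omega> \<and>
      (\<forall>\<xi>\<in>gsphere. gnorm (\<xi> - gconst \<xi>0) \<le> gconst r \<longrightarrow> gen_microlocally_regular \<Omega> U x \<xi>)"
    by blast
  then show "microlocally_regular \<Omega> U x0 \<xi>0"
    using assms(4) by (intro gen_regular_imp_regular[OF assms(1-3)]) auto
qed

end
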